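(* Let $\omega$ be a non-quasianalytic subadditive weight function, $h\in\mathcal{S}_\omega(\mathbb R^d)\setminus\{0\}$ with $\operatorname{supp}\hat h\subseteq[A_1,B_1]\times\cdots\times[A_d,B_d]$, $\beta>0$ and $\{\alpha_m\}_{m\in\mathbb Z^d}\subset(0,\infty)$ with $1/\alpha_m\ge\max_{1\le j\le d}(B_j-A_j)$ for all $m$. Set $h_m(t)=e^{i\beta m\cdot t}h(t)$ and $h_{m,n}(t)=h_m(t-\alpha_m n)$, and assume $$\inf_{\xi\in\mathbb R^d}\sum_{m\in\mathbb Z^d}\alpha_m^{-d}|\hat h(\xi-\beta m)|^2>0,\qquad\sup_{\xi\in\mathbb R^d}\sum_{m\in\mathbb Z^d}\alpha_m^{-d}|\hat h(\xi-\beta m)|^2<+\infty.$$ Then for every $u\in\mathcal{S}'_\omega(\mathbb R^d)$, $$\mathrm{WF}'_\omega(u)=\mathrm{WF}^G_\omega(u)=\mathrm{WF}^{\{h_{m,n}\}}_\omega(u).$$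
   Context: A non-quasianalytic subadditive weight function is a continuous increasing function $\omega:[0,+\infty)\to[0,+\infty)$ such that: ($\alpha$) $\omega(t_1+t_2)\le\omega(t_1)+\omega(t_2)$ for all $t_1,t_2\ge0$; ($\beta$) $\int_1^{+\infty}\omega(t)t^{-2}\,dt<+\infty$; ($\gamma$) there exist $a\in\mathbb R$, $b>0$ with $\omega(t)\ge a+b\log(1+t)$ for all $t\ge0$; ($\delta$) $\varphi(t):=\omega(e^t)$ is convex. $\omega(\zeta):=\omega(|\zeta|)$. $\hat f(\xi)=\int f(x)e^{-ix\cdot\xi}dx$. $\mathcal{S}_\omega(\mathbb R^d)$ is the set of Schwartz functions $f$ with $\sup_x|D^\alpha f(x)|e^{\lambda\omega(x)}<\infty$ and $\sup_\xi|D^\alpha\hat f(\xi)|e^{\lambda\omega(\xi)}<\infty$ for all $\lambda>0$, $\alpha\in\mathbb N_0^d$; $\mathcal{S}'_\omega$ is its strong dual, duality conjugate-linear in the second slot. $\Pi(x,\xi)f(t)=e^{it\cdot\xi}f(t-x)$, $V_\psi u(z)=\langle u,\Pi(z)\psi\rangle$. $\mathrm{WF}'_\omega(u)$: fix $\psi\in\mathcal{S}_\omega\setminus\{0\}$; $z_0\ne0$ is not in $\mathrm{WF}'_\omega(u)$ iff there is an open conic $\Gamma\subseteq\mathbb R^{2d}\setminus\{0\}$ containing $z_0$ with $\sup_{z\in\Gamma}e^{\lambda\omega(z)}|V_\psi u(z)|<\infty$ for all $\lambda>0$. $\mathrm{WF}^G_\omega(u)$: fix $\varphi\in\mathcal{S}_\omega\setminus\{0\}$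 and a lattice $\Lambda=a\mathbb Z^d\times b\mathbb Z^d$ such that $\{\Pi(\sigma)\varphi\}_{\sigma\in\Lambda}$ is a frame in $L^2$; $z_0\ne0$ is not in $\mathrm{WF}^G_\omega(u)$ iff there is an open conic $\Gamma\ni z_0$ with $\sup_{\sigma\in\Lambda\cap\Gamma}e^{\lambda\omega(\sigma)}|\langle u,\Pi(\sigma)\varphi\rangle|<\infty$ for all $\lambda>0$. $\mathrm{WF}^{\{h_{m,n}\}}_\omega(u)$: $z_0\ne0$ is not in it iff there is an open conic $\Gamma\ni z_0$ with $\sup\{e^{\lambda\omega(\alpha_m n,\beta m)}|\langle u,h_{m,n}\rangle|: m,n\in\mathbb Z^d,(\alpha_m n,\beta m)\in\Gamma\}<\infty$ for all $\lambda>0$. *)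

theory Defs
  imports "HOL-Analysis.Analysis"
begin

definition weight_function :: "(real \<Rightarrow> real) \<Rightarrow> bool" where
  "weight_function \<omega> \<longleftrightarrow>
     continuous_on {0..} \<omega> \<and> mono_on {0..} \<omega> \<and> (\<forall>t\<ge>0. \<omega> t \<ge> 0) \<and>
     (\<forall>t1\<ge>0. \<forall>t2\<ge>0. \<omega> (t1 + t2) \<le> \<omega> t1 + \<omega> t2) \<and>
     (\<lambda>t. \<omega> t / t ^ 2) integrable_on {1..} \<and>
     (\<exists>a b. b > 0 \<and> (\<forall>t\<ge>0. \<omega> t \<ge> a + b * ln (1 + t))) \<and>
     convex_on UNIV (\<lambda>t. \<omega> (exp t))"

type_synonym 'n fn = "real ^ 'n \<Rightarrow> complex"

definition pderiv_dir :: "'n::finite \<Rightarrow> 'n fn \<Rightarrow> 'n fn" where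
  "pderiv_dir j f = (\<lambda>x. frechet_derivative f (at x) (axis j 1))"

text \<open>Iterated partial derivative along a list of coordinate directions;
  for smooth functions this is D^alpha, alpha the multiplicity multi-index.\<close>
fun Dlist :: "'n::finite list \<Rightarrow> 'n fn \<Rightarrow> 'n fn" where
  "Dlist [] f = f"
| "Dlist (j # js) f = pderiv_dir j (Dlist js f)"

definition smooth_fn :: "('n::finite) fn \<Rightarrow> bool" where
  "smooth_fn f \<longleftrightarrow> (\<forall>js x. Dlist js f differentiable (at x))"

definition fourier :: "('n::finite) fn \<Rightarrow> 'n fn" where
  "fourier f = (\<lambda>\<xi>. integral UNIV (\<lambda>x. f x * cis (- (x \<bullet> \<xi>))))"

definition tfshift :: "(real ^ 'n) \<times> (real ^ 'n) \<Rightarrow> ('n::finite) fn \<Rightarrow> 'n fn" where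
  "tfshift z f = (\<lambda>t. cis (t \<bullet> snd z) * f (t - fst z))"

definition schwartz :: "('n::finite) fn \<Rightarrow> bool" where
  "schwartz f \<longleftrightarrow> smooth_fn f \<and>
     (\<forall>js::'n list. \<forall>k::nat. \<exists>C. \<forall>x. (1 + norm x) ^ k * norm (Dlist js f x) \<le> C)"

definition S_omega :: "(real \<Rightarrow> real) \<Rightarrow> ('n::finite) fn set" where
  "S_omega \<omega> = {f. schwartz f \<and> smooth_fn (fourier f) \<and>
     (\<forall>lam>0. \<forall>js. \<exists>C. \<forall>x. norm (Dlist js f x) * exp (lam * \<omega> (norm x)) \<le> C) \<and>
     (\<forall>lam>0. \<forall>js. \<exists>C. \<forall>\<xi>. norm (Dlist js (fourier f) \<xi>) * exp (lam * \<omega> (norm \<xi>)) \<le> C)}"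

definition S_seminorm :: "(real \<Rightarrow> real) \<Rightarrow> real \<Rightarrow> nat \<Rightarrow> ('n::finite) fn \<Rightarrow> real" where
  "S_seminorm \<omega> lam N f =
     Sup {norm (Dlist js f x) * exp (lam * \<omega> (norm x)) | js x. length js \<le> N} +
     Sup {norm (Dlist js (fourier f) \<xi>) * exp (lam * \<omega> (norm \<xi>)) | js \<xi>. length js \<le> N}"

text \<open>An element u of S'_omega is represented by its pairing phi |-> <u, phi>,
  which is conjugate-linear and continuous on S_omega.\<close>
definition S'_omega :: "(real \<Rightarrow> real) \<Rightarrow> (('n::finite) fn \<Rightarrow> complex) set" where
  "S'_omega \<omega> = {u.
     (\<forall>f\<in>S_omega \<omega>. \<forall>g\<in>S_omega \<omega>. u (\<lambda>t. f t + g t) = u f + u g) \<and>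
     (\<forall>f\<in>S_omega \<omega>. \<forall>c. u (\<lambda>t. c * f t) = cnj c * u f) \<and>
     (\<exists>C lam N. \<forall>f\<in>S_omega \<omega>. norm (u f) \<le> C * S_seminorm \<omega> lam N f)}"

definition open_conic :: "((real ^ 'n) \<times> (real ^ 'n)) set \<Rightarrow> bool" where
  "open_conic \<Gamma> \<longleftrightarrow> open \<Gamma> \<and> 0 \<notin> \<Gamma> \<and> (\<forall>z\<in>\<Gamma>. \<forall>t>0. t *\<^sub>R z \<in> \<Gamma>)"

definition WF' :: "(real \<Rightarrow> real) \<Rightarrow> ('n::finite) fn \<Rightarrow> ('n fn \<Rightarrow> complex)
                   \<Rightarrow> ((real ^ 'n) \<times> (real ^ 'n)) set" where
  "WF' \<omega> \<psi> u = {z0. z0 \<noteq> 0 \<and> \<not> (\<exists>\<Gamma>. open_conic \<Gamma> \<and> z0 \<in> \<Gamma> \<and>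
      (\<forall>lam>0. \<exists>C. \<forall>z\<in>\<Gamma>. exp (lam * \<omega> (norm z)) * norm (u (tfshift z \<psi>)) \<le> C))}"

definition ivec :: "('n::finite \<Rightarrow> int) \<Rightarrow> real ^ 'n" where
  "ivec k = (\<chi> j. of_int (k j))"

definition gabor_lattice :: "real \<Rightarrow> real \<Rightarrow> ((real ^ 'n::finite) \<times> (real ^ 'n)) set" where
  "gabor_lattice a b = {(a *\<^sub>R ivec k, b *\<^sub>R ivec l) | k l. True}"

definition L2 :: "('n::finite) fn set" where
  "L2 = {f. f \<in> borel_measurable lborel \<and> integrable lborel (\<lambda>x. (norm (f x))\<^sup>2)}"

definition L2_inner :: "('n::finite) fn \<Rightarrow> 'n fn \<Rightarrow> complex" where
  "L2_inner f g = (LINT x|lborel. f x * cnj (g x))"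

definition L2_normsq :: "('n::finite) fn \<Rightarrow> real" where
  "L2_normsq f = (LINT x|lborel. (norm (f x))\<^sup>2)"

definition gabor_frame :: "('n::finite) fn \<Rightarrow> real \<Rightarrow> real \<Rightarrow> bool" where
  "gabor_frame \<phi> a b \<longleftrightarrow> (\<exists>A B. A > 0 \<and> B > 0 \<and> (\<forall>f\<in>L2.
      (\<lambda>\<sigma>. (norm (L2_inner f (tfshift \<sigma> \<phi>)))\<^sup>2) summable_on gabor_lattice a b \<and>
      A * L2_normsq f \<le> (\<Sum>\<^sub>\<infinity>\<sigma>\<in>gabor_lattice a b. (norm (L2_inner f (tfshift \<sigma> \<phi>)))\<^sup>2) \<and>
      (\<Sum>\<^sub>\<infinity>\<sigma>\<in>gabor_lattice a b. (norm (L2_inner f (tfshift \<sigma> \<phi>)))\<^sup>2) \<le> B * L2_normsq f))"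

definition WF_G :: "(real \<Rightarrow> real) \<Rightarrow> ('n::finite) fn \<Rightarrow> real \<Rightarrow> real \<Rightarrow> ('n fn \<Rightarrow> complex)
                   \<Rightarrow> ((real ^ 'n) \<times> (real ^ 'n)) set" where
  "WF_G \<omega> \<phi> a b u = {z0. z0 \<noteq> 0 \<and> \<not> (\<exists>\<Gamma>. open_conic \<Gamma> \<and> z0 \<in> \<Gamma> \<and>
      (\<forall>lam>0. \<exists>C. \<forall>\<sigma>\<in>gabor_lattice a b \<inter> \<Gamma>.
          exp (lam * \<omega> (norm \<sigma>)) * norm (u (tfshift \<sigma> \<phi>)) \<le> C))}"

definition hmn :: "('n::finite) fn \<Rightarrow> (('n \<Rightarrow> int) \<Rightarrow> real) \<Rightarrow> real
                   \<Rightarrow> ('n \<Rightarrow> int) \<Rightarrow> ('n \<Rightarrow> int) \<Rightarrow> 'n fn" where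
  "hmn h \<alpha> \<beta> m n = (\<lambda>t. cis (\<beta> * (ivec m \<bullet> (t - \<alpha> m *\<^sub>R ivec n))) * h (t - \<alpha> m *\<^sub>R ivec n))"

definition WF_h :: "(real \<Rightarrow> real) \<Rightarrow> ('n::finite) fn \<Rightarrow> (('n \<Rightarrow> int) \<Rightarrow> real) \<Rightarrow> real
                   \<Rightarrow> ('n fn \<Rightarrow> complex) \<Rightarrow> ((real ^ 'n) \<times> (real ^ 'n)) set" where
  "WF_h \<omega> h \<alpha> \<beta> u = {z0. z0 \<noteq> 0 \<and> \<not> (\<exists>\<Gamma>. open_conic \<Gamma> \<and> z0 \<in> \<Gamma> \<and>
      (\<forall>lam>0. \<exists>C. \<forall>m n. (\<alpha> m *\<^sub>R ivec n, \<beta> *\<^sub>R ivec m) \<in> \<Gamma> \<longrightarrow>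
          exp (lam * \<omega> (norm (\<alpha> m *\<^sub>R ivec n, \<beta> *\<^sub>R ivec m))) * norm (u (hmn h \<alpha> \<beta> m n)) \<le> C))}"

end

theory Submission
  imports Defs
begin

text \<open>
  Everything reduces to one statement: if \<open>g\<close> is a test function and the time-frequency shifts of \<open>g\<close> along a separated family
  of points \<open>z i\<close> form a frame, then every \<open>\<Pi>(w)\<theta>\<close> with \<open>\<theta>\<close> a test function is a series \<open>\<Sum>i. c w i \<cdot> \<Pi>(z i) g\<close> with
  \<open>\<bar>c w i\<bar> \<le> C exp (- lam \<omega>(z i - w))\<close> for every \<open>lam\<close>. Applying \<open>u\<close> and splitting the series according to whether \<open>z i\<close> lies
  in the given cone moves decay of \<open>u\<close> along the frame to decay of the short-time Fourier transform for an arbitrary window.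
  The coefficients come from the Neumann series of the frame operator. Its terms decay geometrically because of the
  frame bounds; conjugated by the exponential of a slowly varying regularisation of \<open>lam \<omega>\<close> they grow at an arbitrarily
  small geometric rate, because the Gram matrix is then perturbed by a Schur-small matrix (a Combes-Thomas argument that
  replaces Wiener's lemma). The geometric mean of both estimates gives the decay of \<open>c\<close>.

  Two families besides the given Gabor frame are needed: the \<open>h\<^sub>m\<^sub>,\<^sub>n\<close> form a painless frame, and every nonzero test function
  generates a Gabor frame on some fine lattice (Walnut), which makes the wave front set independent of the window. Both
  follow from the Poisson summation formula applied to autocorrelations; the same formula yields Fourier inversion.
\<close>

section \<open>Weight functions\<close>

text \<open>For large \<open>lam\<close> the function \<open>lam * \<omega>\<close> varies strongly,
  so conjugating the frame operator by its exponential is not by itself a small perturbation.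
  Condition (\<beta>) rescues the argument: it forces \<open>\<omega> t = o(t)\<close>, so for every
  \<delta> > 0 the weight \<open>lam * \<omega>\<close> differs by a bounded amount from a function
  of slope at most \<delta>. The size of \<open>lam\<close> is paid for in constants only, and the
  growth rate \<eta> of the weighted energy is chosen from the frame constants alone, so that
  \<open>\<kappa> * (1 + \<eta>) < 1\<close> for the contraction factor
  \<open>\<kappa> = 1 - A / B\<close> of the unweighted energy. A distribution can be applied
  termwise only to series that converge in all seminorms of the test space, whereas frame bounds
  live in L2. Hence all coefficient sequences are kept rapidly decreasing, and an expansion is
  verified by testing the difference of two test functions against the frame: if all coefficients
  vanish, the lower bound and continuity make it zero. Separation of the points of the h_{m,n}
  system is extracted from the upper bound on the sum of squares, which keeps
  \<open>\<alpha> m\<close> away from 0.\<close>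

locale weight_fun =
  fixes \<omega> :: "real \<Rightarrow> real"
  assumes weight: "weight_function \<omega>"
begin

lemma w_nonneg: "t \<ge> 0 \<Longrightarrow> \<omega> t \<ge> 0"
  using weight by (auto simp: weight_function_def)

lemma w_mono: "0 \<le> s \<Longrightarrow> s \<le> t \<Longrightarrow> \<omega> s \<le> \<omega> t"
  using weight by (auto simp: weight_function_def intro: mono_onD)

lemma w_add: "0 \<le> s \<Longrightarrow> 0 \<le> t \<Longrightarrow> \<omega> (s + t) \<le> \<omega> s + \<omega> t"
  using weight by (auto simp: weight_function_def)

lemma w_triangle: "\<omega> (norm (x + y)) \<le> \<omega> (norm x) + \<omega> (norm y)"
  by (rule order_trans[OF w_mono w_add]) (auto intro: norm_triangle_ineq)

lemma w_diff: "\<omega> (norm x) \<le> \<omega> (norm y) + \<omega> (norm (x - y))"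
  using w_triangle[of y "x - y"] by simp

text \<open>The weight need not vanish at 0; the summand \<open>\<omega> 0\<close> serves the base
  case n = 0.\<close>

lemma w_scale: "t \<ge> 0 \<Longrightarrow> \<omega> (real n * t) \<le> real n * \<omega> t + \<omega> 0"
proof (induction n)
  case (Suc n)
  have "\<omega> (real (Suc n) * t) \<le> \<omega> (real n * t) + \<omega> t"
    using w_add[of "real n * t" t] Suc.prems by (simp add: algebra_simps)
  then show ?case using Suc by (simp add: algebra_simps)
qed simp

text \<open>Turns a comparison of norms up to a factor, such as the one between a cone and the
  complement of a larger cone, into a comparison of weights. The additive \<open>\<omega> 0\<close>
  is absorbed by raising the integer factor by one.\<close>

lemma w_scale_le:
  obtains k :: real where "k > 0" "\<And>s t. 0 \<le> s \<Longrightarrow> 0 \<le> t \<Longrightarrow> s \<le> K * t \<Longrightarrow> \<omega> s \<le> k * \<omega> t"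
proof -
  obtain n :: nat where n: "K \<le> real n" using real_arch_simple by blast
  have "\<omega> s \<le> (real n + 1) * \<omega> t" if "0 \<le> s" "0 \<le> t" "s \<le> K * t" for s t
  proof -
    have "s \<le> real n * t" using that n mult_right_mono[of K "real n" t] by linarith
    then have "\<omega> s \<le> \<omega> (real n * t)" using that by (intro w_mono)
    also have "\<dots> \<le> real n * \<omega> t + \<omega> 0" using that by (intro w_scale)
    also have "\<omega> 0 \<le> \<omega> t" using that by (intro w_mono) auto
    finally show ?thesis by (simp add: algebra_simps)
  qed
  then show ?thesis by (intro that[of "real n + 1"]) auto
qed

text \<open>This is the use of condition (\<beta>). If \<open>\<omega> t > \<epsilon> * t\<close>
  held on all of [1, \<infinity>), the integral of \<open>\<omega> t / t^2\<close> would dominate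
  \<epsilon> times the divergent integral of 1/t. So one good T exists, and subadditivity carries
  its slope to every t = n T + rest.\<close>

lemma w_sublinear:
  assumes "\<epsilon> > 0"
  shows "\<exists>C\<ge>0. \<forall>t\<ge>0. \<omega> t \<le> \<epsilon> * t + C"
proof -
  have ex: "\<exists>T\<ge>1. \<omega> T \<le> \<epsilon> * T"
  proof (rule ccontr)
    assume "\<not> ?thesis"
    then have big: "\<And>t. t \<ge> 1 \<Longrightarrow> \<epsilon> * t < \<omega> t" by force
    have int: "(\<lambda>t. \<omega> t / t ^ 2) integrable_on {1..}"
      using weight by (auto simp: weight_function_def)
    let ?I = "integral {1..} (\<lambda>t. \<omega> t / t ^ 2)"
    have "\<epsilon> * ln T \<le> ?I" if "T \<ge> 1" for T
    proof -
      have "((\<lambda>t. \<epsilon> / t) has_integral (\<epsilon> * ln T - \<epsilon> * ln 1)) {1..T}"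
        using that by (intro fundamental_theorem_of_calculus)
           (auto intro!: derivative_eq_intros simp: has_real_derivative_iff_has_vector_derivative[symmetric])
      then have h: "((\<lambda>t. \<epsilon> / t) has_integral (\<epsilon> * ln T)) {1..T}" by simp
      have s: "(\<lambda>t. \<omega> t / t ^ 2) integrable_on {1..T}"
        by (rule integrable_on_subinterval[OF int]) auto
      have "\<epsilon> * ln T \<le> integral {1..T} (\<lambda>t. \<omega> t / t ^ 2)"
      proof (rule has_integral_le[OF h integrable_integral[OF s]])
        fix t assume "t \<in> {1..T}"
        then show "\<epsilon> / t \<le> \<omega> t / t\<^sup>2"
          using big[of t] by (auto simp: field_simps power2_eq_square)
      qed
      also have "\<dots> \<le> ?I"
        by (rule integral_subset_le[OF _ s int]) (auto simp: w_nonneg)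
      finally show ?thesis .
    qed
    \<comment> \<open>At this T the left side \<open>\<epsilon> * ln T\<close> equals
      \<open>\<bar>?I\<bar> + 1\<close>, which exceeds the integral.\<close>
    from this[of "exp ((\<bar>?I\<bar> + 1) / \<epsilon>)"] show False using assms by auto
  qed
  then obtain T where T: "T \<ge> 1" "\<omega> T \<le> \<epsilon> * T" by auto
  have "\<omega> t \<le> \<epsilon> * t + (\<omega> T + \<omega> 0)" if "t \<ge> 0" for t
  proof -
    define n where "n = nat \<lfloor>t / T\<rfloor>"
    have "t / T \<ge> 0" using that T by simp
    then have n: "real n \<le> t / T" "t / T < real n + 1"
      unfolding n_def by (simp_all add: floor_le_iff)
    then have n': "real n * T \<le> t" "t - real n * T \<le> T" using T by (auto simp: field_simps)
    have "\<omega> t \<le> \<omega> (real n * T) + \<omega> (t - real n * T)"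
      using w_add[of "real n * T" "t - real n * T"] n' T by auto
    also have "\<omega> (real n * T) \<le> real n * \<omega> T + \<omega> 0" using T by (intro w_scale) auto
    also have "real n * \<omega> T \<le> real n * (\<epsilon> * T)" using T by (intro mult_left_mono) auto
    also have "real n * (\<epsilon> * T) \<le> \<epsilon> * t" using n'(1) assms by (simp add: algebra_simps)
    also have "\<omega> (t - real n * T) \<le> \<omega> T" using n' by (intro w_mono) auto
    finally show ?thesis by simp
  qed
  moreover have "\<omega> T + \<omega> 0 \<ge> 0" using T by (intro add_nonneg_nonneg w_nonneg) auto
  ultimately show ?thesis by blast
qed

lemma w_power_bound: "\<exists>\<mu>>0. \<exists>C>0. \<forall>t\<ge>0. (1 + t) ^ k \<le> C * exp (\<mu> * \<omega> t)"
proof -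
  obtain a b where b: "b > 0" and ab: "\<And>t. t \<ge> 0 \<Longrightarrow> \<omega> t \<ge> a + b * ln (1 + t)"
    using weight by (auto simp: weight_function_def)
  \<comment> \<open>Matches the slope b of condition (\<gamma>): \<open>\<mu> * b\<close> is k + 1.
    The additional 1 keeps \<mu> positive when k = 0.\<close>
  define \<mu> where "\<mu> = (real k + 1) / b"
  have mu: "\<mu> > 0" using b by (simp add: \<mu>_def)
  have "(1 + t) ^ k \<le> exp (- \<mu> * a) * exp (\<mu> * \<omega> t)" if t: "t \<ge> 0" for t
  proof -
    have "(1 + t) ^ k \<le> (1 + t) ^ (k + 1)" using t by (intro power_increasing) auto
    also have "\<dots> = exp (real (k + 1) * ln (1 + t))"
      using t exp_of_nat_mult[of "k + 1" "ln (1 + t)"] by simp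
    also have "real (k + 1) * ln (1 + t) = \<mu> * (b * ln (1 + t))" using b by (simp add: \<mu>_def)
    also have "exp \<dots> \<le> exp (- \<mu> * a + \<mu> * \<omega> t)"
      using mult_left_mono[OF ab[OF t], of \<mu>] mu by (simp add: algebra_simps)
    finally show ?thesis by (simp add: exp_add[symmetric])
  qed
  then show ?thesis using mu by (meson exp_gt_zero)
qed

lemma w_exp_decay: "\<exists>\<mu>>0. \<exists>C>0. \<forall>t\<ge>0. exp (- (\<mu> * \<omega> t)) \<le> C / (1 + t) ^ k"
proof -
  obtain \<mu> C where *: "\<mu> > 0" "C > 0" "\<And>t. t \<ge> 0 \<Longrightarrow> (1 + t) ^ k \<le> C * exp (\<mu> * \<omega> t)"
    using w_power_bound[of k] by auto
  have "exp (- (\<mu> * \<omega> t)) \<le> C / (1 + t) ^ k" if "t \<ge> 0" for t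
    using *(3)[OF that] that by (simp add: exp_minus field_simps)
  then show ?thesis using * by blast
qed

end

section \<open>Lattice sums and tilings\<close>

lemma int_inverse_square_sum:
  "\<exists>C>0. \<forall>F. finite F \<longrightarrow> (\<Sum>n\<in>F. 1 / (1 + \<bar>real_of_int n\<bar>)\<^sup>2) \<le> C"
proof -
  let ?f = "\<lambda>n::int. 1 / (1 + \<bar>real_of_int n\<bar>)\<^sup>2"
  let ?g = "\<lambda>k::nat. 1 / (1 + real k)\<^sup>2"
  have s: "summable ?g"
    using summable_Suc_iff[of "\<lambda>n. inverse ((real n)\<^sup>2)"] inverse_power_summable[of 2, where 'a=real]
    by (simp add: divide_inverse)
  have "(\<Sum>n\<in>F. ?f n) \<le> 2 * suminf ?g" if F: "finite F" for F
  proof -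
    define N where "N = Suc (Max (insert 0 ((\<lambda>n. nat \<bar>n\<bar>) ` F)))"
    have N: "nat \<bar>n\<bar> < N" if "n \<in> F" for n
      unfolding N_def using that F by (intro le_imp_less_Suc Max_ge) auto
    let ?A = "int ` {..<N}" let ?B = "(\<lambda>k. - int k) ` {..<N}"
    have "F \<subseteq> ?A \<union> ?B"
    proof
      fix n assume "n \<in> F"
      then have *: "nat \<bar>n\<bar> < N" by (rule N)
      show "n \<in> ?A \<union> ?B"
      proof (cases "n \<ge> 0")
        case True
        with * have "n = int (nat \<bar>n\<bar>)" "nat \<bar>n\<bar> \<in> {..<N}" by auto
        then show ?thesis by blast
      next
        case False
        with * have "n = - int (nat \<bar>n\<bar>)" "nat \<bar>n\<bar> \<in> {..<N}" by auto
        then show ?thesis by blast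
      qed
    qed
    then have "(\<Sum>n\<in>F. ?f n) \<le> (\<Sum>n\<in>?A \<union> ?B. ?f n)" by (intro sum_mono2) auto
    also have "\<dots> \<le> (\<Sum>n\<in>?A. ?f n) + (\<Sum>n\<in>?B. ?f n)"
      by (subst sum.union_inter[symmetric]) (auto intro: sum_nonneg)
    also have "(\<Sum>n\<in>?A. ?f n) = (\<Sum>k<N. ?g k)"
      by (subst sum.reindex) (auto simp: inj_on_def)
    also have "(\<Sum>n\<in>?B. ?f n) = (\<Sum>k<N. ?g k)"
      by (subst sum.reindex) (auto simp: inj_on_def)
    also have "(\<Sum>k<N. ?g k) \<le> suminf ?g" by (intro sum_le_suminf s) auto
    finally show ?thesis by simp
  qed
  moreover have "suminf ?g > 0" using s by (intro suminf_pos) auto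
  ultimately show ?thesis by (intro exI[of _ "2 * suminf ?g"]) auto
qed

text \<open>Uniformity in the offset s and in every spacing L \<ge> L0 is the point: in the h_{m,n}
  system the spacing changes with the frequency index and is only bounded from below.\<close>

lemma real_lattice_sum_bound:
  assumes "L0 > 0"
  shows "\<exists>C>0. \<forall>L\<ge>L0. \<forall>s. \<forall>F. finite F \<longrightarrow> (\<Sum>n\<in>F. 1 / (1 + \<bar>s - L * real_of_int n\<bar>)\<^sup>2) \<le> C"
proof -
  obtain C where C: "C > 0" "\<And>F. finite F \<Longrightarrow> (\<Sum>n\<in>F. 1 / (1 + \<bar>real_of_int n\<bar>)\<^sup>2) \<le> C"
    using int_inverse_square_sum by auto
  \<comment> \<open>With k the distance from n to the cell n0 of s: for k \<le> 1 the claim uses c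
    \<le> 1/2, for k \<ge> 2 it uses 3c \<le> L0 together with 3(k - 1) \<ge> k + 1.\<close>
  define c where "c = min (1/2) (L0 / 3)"
  have c: "c > 0" "c \<le> 1/2" "3 * c \<le> L0" using assms by (auto simp: c_def)
  have "(\<Sum>n\<in>F. 1 / (1 + \<bar>s - L * real_of_int n\<bar>)\<^sup>2) \<le> C / c\<^sup>2"
    if L: "L \<ge> L0" and F: "finite F" for L s F
  proof -
    define n0 where "n0 = \<lfloor>s / L\<rfloor>"
    have L0: "L > 0" using L assms by simp
    have le: "c * (1 + \<bar>real_of_int (n - n0)\<bar>) \<le> 1 + \<bar>s - L * real_of_int n\<bar>" for n
    proof -
      define k where "k = \<bar>real_of_int (n - n0)\<bar>"
      have "\<bar>s / L - n\<bar> \<ge> k - 1" unfolding k_def n0_def by linarith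
      then have "L * \<bar>s / L - n\<bar> \<ge> L * (k - 1)" using L0 by simp
      also have "L * \<bar>s / L - n\<bar> = \<bar>L * (s / L - n)\<bar>" using L0 by (simp add: abs_mult)
      also have "L * (s / L - n) = s - L * n" using L0 by (simp add: field_simps)
      finally have 1: "\<bar>s - L * n\<bar> \<ge> L * (k - 1)" .
      show ?thesis
      proof (cases "\<bar>n - n0\<bar> \<le> 1")
        case True
        then have "k \<le> 1" unfolding k_def by linarith
        then have "c * (1 + k) \<le> (1/2) * 2" using c by (intro mult_mono) (auto simp: k_def)
        then show ?thesis unfolding k_def by linarith
      next
        case False
        then have "k \<ge> 2" unfolding k_def by linarith
        then have "L * (k - 1) \<ge> (3 * c) * (k - 1)" using c L by (intro mult_right_mono) auto
        moreover have "(3 * c) * (k - 1) \<ge> c * (1 + k)" using \<open>k \<ge> 2\<close> c by (simp add: field_simps)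
        ultimately show ?thesis using 1 unfolding k_def by linarith
      qed
    qed
    have "(\<Sum>n\<in>F. 1 / (1 + \<bar>s - L * real_of_int n\<bar>)\<^sup>2)
        \<le> (\<Sum>n\<in>F. 1 / (c * (1 + \<bar>real_of_int (n - n0)\<bar>))\<^sup>2)"
    proof (intro sum_mono divide_left_mono power_mono le)
      fix n
      have "1 + \<bar>s - L * real_of_int n\<bar> > 0" "c * (1 + \<bar>real_of_int (n - n0)\<bar>) > 0"
        using c by (auto intro!: mult_pos_pos add_pos_nonneg)
      then show "0 < (1 + \<bar>s - L * real_of_int n\<bar>)\<^sup>2 * (c * (1 + \<bar>real_of_int (n - n0)\<bar>))\<^sup>2"
        using c by (intro mult_pos_pos zero_less_power) auto
    qed (use c in auto)
    also have "\<dots> = (\<Sum>n\<in>F. 1 / (1 + \<bar>real_of_int (n - n0)\<bar>)\<^sup>2) / c\<^sup>2"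
      by (simp add: power_mult_distrib sum_divide_distrib mult.commute)
    also have "(\<Sum>n\<in>F. 1 / (1 + \<bar>real_of_int (n - n0)\<bar>)\<^sup>2)
       = (\<Sum>n\<in>(\<lambda>n. n - n0) ` F. 1 / (1 + \<bar>real_of_int n\<bar>)\<^sup>2)"
      by (subst sum.reindex) (auto simp: inj_on_def)
    also have "\<dots> / c\<^sup>2 \<le> C / c\<^sup>2" by (intro divide_right_mono C) (use F in auto)
    finally show ?thesis .
  qed
  moreover have "C / c\<^sup>2 > 0" using C c by simp
  ultimately show ?thesis by blast
qed

text \<open>The universal majorant. Its exponent is twice the dimension, so that it is dominated by
  a product of inverse squares over the coordinates and is therefore summable over lattices and
  integrable.\<close>

definition decay :: "real ^ 'n::finite \<Rightarrow> real" where
  "decay x = 1 / (1 + norm x) ^ (2 * CARD('n))"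

lemma decay_pos [simp]: "decay x > 0"
  by (simp add: decay_def add_pos_nonneg)

lemma decay_nonneg [simp]: "decay x \<ge> 0"
  by (rule less_imp_le) simp

lemma continuous_decay [continuous_intros]:
  "continuous_on A g \<Longrightarrow> continuous_on A (\<lambda>x. decay (g x))"
  unfolding decay_def by (intro continuous_intros) (auto simp: add_nonneg_eq_0_iff)

text \<open>Peetre's inequality: polynomial weights are submultiplicative, so decay survives
  translations and passes to correlations.\<close>

lemma peetre: "1 + norm (x :: 'a::real_normed_vector) \<le> (1 + norm y) * (1 + norm (x - y))"
proof -
  have "norm x \<le> norm y + norm (x - y)" using norm_triangle_ineq[of y "x - y"] by simp
  moreover have "norm y * norm (x - y) \<ge> 0" by simp
  ultimately have "1 + norm x \<le> 1 + norm y + norm (x - y) + norm y * norm (x - y)" by linarith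
  then show ?thesis by (simp only: algebra_simps mult_1_left)
qed

lemma decay_peetre: "decay y \<le> (1 + norm (x - y)) ^ (2 * CARD('n)) * decay (x :: real ^ 'n::finite)"
proof -
  have "(1 + norm x) ^ (2 * CARD('n)) \<le> ((1 + norm y) * (1 + norm (x - y))) ^ (2 * CARD('n))"
    by (intro power_mono peetre) auto
  then have "(1 + norm x) ^ (2 * CARD('n)) \<le> (1 + norm y) ^ (2 * CARD('n)) * (1 + norm (x - y)) ^ (2 * CARD('n))"
    by (simp add: power_mult_distrib)
  then show ?thesis
    using zero_less_power[of "1 + norm x" "2 * CARD('n)"] zero_less_power[of "1 + norm y" "2 * CARD('n)"]
    by (simp add: decay_def add_pos_nonneg field_simps del: zero_less_power)
qed

text \<open>\<open>decay\<close> is at most a product of one-dimensional inverse squares. Enlarging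
  F to a box turns the sum of products into a product of sums, and each factor falls under the
  one-dimensional bound with the same uniformity in L and x.\<close>

lemma lattice_sum_bound:
  assumes "L0 > 0"
  shows "\<exists>C>0. \<forall>L\<ge>L0. \<forall>x :: real ^ 'n::finite. \<forall>F. finite F \<longrightarrow> (\<Sum>n\<in>F. decay (x - L *\<^sub>R ivec n)) \<le> C"
proof -
  obtain C where C: "C > 0" "\<And>L s F. L \<ge> L0 \<Longrightarrow> finite F \<Longrightarrow> (\<Sum>n\<in>F. 1 / (1 + \<bar>s - L * real_of_int n\<bar>)\<^sup>2) \<le> C"
    using real_lattice_sum_bound[OF assms] by auto
  have "(\<Sum>n\<in>F. decay (x - L *\<^sub>R ivec n)) \<le> C ^ CARD('n)"
    if L: "L \<ge> L0" and F: "finite F" for L and x :: "real ^ 'n" and F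
  proof -
    define B where "B = (\<Union>j. (\<lambda>n. n j) ` F)"
    have B: "finite B" using F by (auto simp: B_def)
    let ?h = "\<lambda>j k. 1 / (1 + \<bar>x $ j - L * real_of_int k\<bar>)\<^sup>2"
    have h0: "0 \<le> ?h j k" for j k by simp
    have "decay (x - L *\<^sub>R ivec n) \<le> (\<Prod>j\<in>UNIV. ?h j (n j))" for n
    proof -
      let ?v = "x - L *\<^sub>R ivec n"
      have "(\<Prod>j\<in>(UNIV::'n set). (1 + \<bar>?v $ j\<bar>)\<^sup>2) \<le> (\<Prod>j\<in>(UNIV::'n set). (1 + norm ?v)\<^sup>2)"
        by (intro prod_mono conjI power_mono add_left_mono component_le_norm_cart) auto
      also have "\<dots> = (1 + norm ?v) ^ (2 * CARD('n))" by (simp add: power_mult)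
      finally have "decay ?v \<le> 1 / (\<Prod>j\<in>(UNIV::'n set). (1 + \<bar>?v $ j\<bar>)\<^sup>2)"
        unfolding decay_def
        by (intro divide_left_mono mult_pos_pos prod_pos zero_less_power) (auto intro: add_pos_nonneg)
      then show ?thesis by (simp add: prod_dividef ivec_def)
    qed
    then have "(\<Sum>n\<in>F. decay (x - L *\<^sub>R ivec n)) \<le> (\<Sum>n\<in>F. \<Prod>j\<in>UNIV. ?h j (n j))"
      by (intro sum_mono)
    also have "\<dots> \<le> (\<Sum>n\<in>PiE UNIV (\<lambda>_. B). \<Prod>j\<in>UNIV. ?h j (n j))"
    proof (intro sum_mono2)
      show "finite (PiE (UNIV::'n set) (\<lambda>_. B))" by (intro finite_PiE B) auto
      show "F \<subseteq> PiE UNIV (\<lambda>_. B)" by (auto simp: B_def)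
    qed (auto intro: prod_nonneg)
    also have "\<dots> = (\<Prod>j\<in>UNIV. \<Sum>k\<in>B. ?h j k)"
      by (rule prod_sum_PiE[symmetric]) (use B in auto)
    also have "\<dots> \<le> (\<Prod>j\<in>(UNIV::'n set). C)"
      by (intro prod_mono conjI sum_nonneg C L B) auto
    finally show ?thesis by simp
  qed
  moreover have "C ^ CARD('n) > 0" using C by simp
  ultimately show ?thesis by blast
qed

lemma nonneg_summable_onI:
  fixes f :: "'i \<Rightarrow> real"
  assumes "\<And>i. i \<in> A \<Longrightarrow> f i \<ge> 0" "\<And>F. finite F \<Longrightarrow> F \<subseteq> A \<Longrightarrow> sum f F \<le> C"
  shows "f summable_on A" "infsum f A \<le> C"
proof -
  show s: "f summable_on A"
    by (rule nonneg_bdd_above_summable_on) (auto simp: assms bdd_above_def intro!: exI[of _ C])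
  show "infsum f A \<le> C"
    by (rule infsum_le_finite_sums[OF s]) (rule assms)
qed

text \<open>Interchange of an unordered sum with the integral under absolute summability. The index
  set is transported to the natural numbers along \<open>to_nat\<close> and padded with zero
  functions, which reduces the claim to the interchange for series.\<close>

lemma has_sum_integral:
  fixes f :: "'i::countable \<Rightarrow> 'a \<Rightarrow> 'b::{banach, second_countable_topology}"
  assumes int: "\<And>i. integrable M (f i)"
    and pt: "\<And>x. x \<in> space M \<Longrightarrow> (\<lambda>i. norm (f i x)) summable_on UNIV"
    and sm: "(\<lambda>i. \<integral>x. norm (f i x) \<partial>M) summable_on UNIV"
  shows "((\<lambda>i. \<integral>x. f i x \<partial>M) has_sum (\<integral>x. (\<Sum>\<^sub>\<infinity>i. f i x) \<partial>M)) UNIV"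
    and "integrable M (\<lambda>x. \<Sum>\<^sub>\<infinity>i. f i x)"
proof -
  let ?R = "range (to_nat :: 'i \<Rightarrow> nat)"
  define g where "g n = (if n \<in> ?R then f (from_nat n) else (\<lambda>_. 0))" for n
  have g: "g (to_nat i) = f i" for i by (simp add: g_def)
  \<comment> \<open>Stated for any F that kills the zero function, because it is applied to point
    evaluations, to their norms and to integrals.\<close>
  have tr: "((\<lambda>i. F (f i)) has_sum s) UNIV \<longleftrightarrow> ((\<lambda>n. F (g n)) has_sum s) UNIV"
    if "F (\<lambda>_. 0) = 0" for F :: "('a \<Rightarrow> 'b) \<Rightarrow> 'c::{comm_monoid_add,topological_space}" and s
  proof -
    have "((\<lambda>n. F (g n)) has_sum s) UNIV \<longleftrightarrow> ((\<lambda>n. F (g n)) has_sum s) ?R"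
      by (rule has_sum_cong_neutral) (auto simp: g_def that)
    also have "\<dots> \<longleftrightarrow> (((\<lambda>n. F (g n)) \<circ> to_nat) has_sum s) (UNIV :: 'i set)"
      by (rule has_sum_reindex) (rule inj_to_nat)
    finally show ?thesis by (simp add: o_def g)
  qed
  have trs: "(\<lambda>i. F (f i)) summable_on UNIV \<longleftrightarrow> (\<lambda>n. F (g n)) summable_on UNIV"
    if "F (\<lambda>_. 0) = 0" for F :: "('a \<Rightarrow> 'b) \<Rightarrow> real"
    unfolding summable_on_def using tr[of F] that by blast
  have pt': "(\<lambda>n. norm (g n x)) summable_on UNIV" if "x \<in> space M" for x
    using pt[OF that] trs[of "\<lambda>h. norm (h x)"] by simp
  have sm': "(\<lambda>n. \<integral>x. norm (g n x) \<partial>M) summable_on UNIV"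
    using sm trs[of "\<lambda>h. \<integral>x. norm (h x) \<partial>M"] by simp
  have int': "integrable M (g n)" for n using int by (auto simp: g_def)
  have AE: "AE x in M. summable (\<lambda>n. norm (g n x))"
    by (intro AE_I2 summable_on_imp_summable pt')
  have S: "summable (\<lambda>n. \<integral>x. norm (g n x) \<partial>M)"
    by (intro summable_on_imp_summable sm')
  have eq: "(\<Sum>\<^sub>\<infinity>i. f i x) = (\<Sum>n. g n x)" if x: "x \<in> space M" for x
  proof -
    have "((\<lambda>n. g n x) has_sum (\<Sum>n. g n x)) UNIV"
      using pt'[OF x] by (metis norm_summable_imp_has_sum summable_norm_cancel summable_on_imp_summable summable_sums)
    then have "((\<lambda>i. f i x) has_sum (\<Sum>n. g n x)) UNIV" using tr[of "\<lambda>h. h x"] by simp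
    then show ?thesis by (rule infsumI)
  qed
  have inteq: "(\<integral>x. (\<Sum>\<^sub>\<infinity>i. f i x) \<partial>M) = (\<integral>x. (\<Sum>n. g n x) \<partial>M)"
    by (intro Bochner_Integration.integral_cong) (auto simp: eq)
  have "integrable M (\<lambda>x. \<Sum>n. g n x)" by (rule integrable_suminf[OF int' AE S])
  then show "integrable M (\<lambda>x. \<Sum>\<^sub>\<infinity>i. f i x)"
    by (subst Bochner_Integration.integrable_cong[OF refl eq]) auto
  have n: "summable (\<lambda>n. norm (\<integral>x. g n x \<partial>M))"
    by (rule summable_comparison_test'[OF S, of 0]) (auto intro: integral_norm_bound)
  have "((\<lambda>n. \<integral>x. g n x \<partial>M) has_sum (\<integral>x. (\<Sum>n. g n x) \<partial>M)) UNIV"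
    by (rule norm_summable_imp_has_sum[OF n sums_integral[OF int' AE S]])
  then show "((\<lambda>i. \<integral>x. f i x \<partial>M) has_sum (\<integral>x. (\<Sum>\<^sub>\<infinity>i. f i x) \<partial>M)) UNIV"
    unfolding inteq using tr[of "\<lambda>h. \<integral>x. h x \<partial>M"] by simp
qed

section \<open>Tilings of space by half-open cubes\<close>

definition cube :: "real \<Rightarrow> (real ^ 'n::finite) set" where
  "cube L = {x. \<forall>j. - L/2 \<le> x $ j \<and> x $ j < L/2}"

definition cell :: "real \<Rightarrow> real ^ 'n::finite \<Rightarrow> ('n \<Rightarrow> int)" where
  "cell L x = (\<lambda>j. \<lfloor>x $ j / L + 1/2\<rfloor>)"

text \<open>The cubes are half-open so that their lattice translates partition space exactly: each x
  lies in the single translate named by \<open>cell L x\<close>, and no exceptional null set has to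
  be carried along.\<close>

lemma in_cube_iff_cell:
  assumes "L > 0"
  shows "x - L *\<^sub>R ivec l \<in> cube L \<longleftrightarrow> l = cell L x"
proof -
  have "x - L *\<^sub>R ivec l \<in> cube L \<longleftrightarrow> (\<forall>j. l j = \<lfloor>x $ j / L + 1/2\<rfloor>)"
    unfolding cube_def ivec_def mem_Collect_eq
    using assms by (intro all_cong1) (auto simp: field_simps eq_commute[of "l _"] floor_eq_iff)
  then show ?thesis by (auto simp: cell_def)
qed

lemma measurable_cube [measurable]: "cube L \<in> sets borel"
proof -
  have "cube L = (\<Inter>j. {x. - L/2 \<le> x $ j} \<inter> {x. x $ j < L/2})" by (auto simp: cube_def)
  also have "\<dots> \<in> sets borel"
    by (intro sets.countable_INT'' sets.Int borel_closed borel_open closed_halfspace_component_ge_cart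
        open_halfspace_component_lt_cart) (auto simp: )
  finally show ?thesis .
qed

lemma cube_subset_cbox: "cube L \<subseteq> cbox (\<chi> j. - L/2) (\<chi> j. L/2)"
  by (auto simp: cube_def mem_box_cart less_imp_le)

lemma box_subset_cube: "box (\<chi> j. - L/2) (\<chi> j. L/2) \<subseteq> cube L"
  by (auto simp: cube_def mem_box_cart less_imp_le)

lemma emeasure_cube:
  assumes "L > 0"
  shows "emeasure lborel (cube L :: (real ^ 'n::finite) set) = ennreal (L ^ CARD('n))"
proof (rule antisym)
  have P: "(\<Prod>b\<in>(Basis :: (real^'n) set). ((\<chi> j. L/2) - (\<chi> j. - L/2)) \<bullet> b) = L ^ CARD('n)"
  proof -
    have "(\<Prod>b\<in>(Basis :: (real^'n) set). ((\<chi> j. L/2) - (\<chi> j. - L/2)) \<bullet> b) = (\<Prod>b\<in>(Basis :: (real^'n) set). L)"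
      by (intro prod.cong) (auto simp: Basis_vec_def inner_axis)
    then show ?thesis by simp
  qed
  have le: "\<And>b. b \<in> (Basis :: (real^'n) set) \<Longrightarrow> (\<chi> j. - L/2) \<bullet> b \<le> (\<chi> j. L/2) \<bullet> b"
    using assms by (auto simp: Basis_vec_def inner_axis)
  have "emeasure lborel (cube L :: (real ^ 'n) set) \<le> emeasure lborel (cbox (\<chi> j. - L/2) (\<chi> j. L/2) :: (real^'n) set)"
    by (intro emeasure_mono cube_subset_cbox) auto
  also have "\<dots> = ennreal (L ^ CARD('n))" using emeasure_lborel_cbox[OF le] P by simp
  finally show "emeasure lborel (cube L :: (real ^ 'n) set) \<le> ennreal (L ^ CARD('n))" .
  have "ennreal (L ^ CARD('n)) = emeasure lborel (box (\<chi> j. - L/2) (\<chi> j. L/2) :: (real^'n) set)"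
    using emeasure_lborel_box[OF le] P by simp
  also have "\<dots> \<le> emeasure lborel (cube L :: (real ^ 'n) set)"
    by (intro emeasure_mono box_subset_cube) auto
  finally show "ennreal (L ^ CARD('n)) \<le> emeasure lborel (cube L :: (real ^ 'n) set)" .
qed

lemma cube_norm_le:
  assumes "x \<in> cube L"
  shows "norm (x :: real ^ 'n::finite) \<le> real CARD('n) * (L / 2)"
proof -
  have "norm x \<le> (\<Sum>j\<in>UNIV. \<bar>x $ j\<bar>)" by (rule norm_le_l1_cart)
  also have "\<dots> \<le> (\<Sum>j\<in>(UNIV::'n set). L / 2)"
  proof (intro sum_mono)
    fix j show "\<bar>x $ j\<bar> \<le> L / 2"
      using assms[unfolded cube_def mem_Collect_eq, rule_format, of j] by linarith
  qed
  finally show ?thesis by simp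
qed

lemma integrable_translate:
  fixes f :: "'a::euclidean_space \<Rightarrow> 'b::{banach, second_countable_topology}"
  assumes "integrable lborel f"
  shows "integrable lborel (\<lambda>x. f (x + c))"
proof -
  have "integrable (distr lborel borel ((+) c)) f" using assms by (simp add: lborel_distr_plus)
  then have "integrable lborel (\<lambda>x. f (c + x))" by (rule integrable_distr[rotated]) simp
  then show ?thesis by (simp add: add.commute)
qed

lemma integral_translate:
  fixes f :: "'a::euclidean_space \<Rightarrow> 'b::{banach, second_countable_topology}"
  shows "(\<integral>x. f (x + c) \<partial>lborel) = (\<integral>x. f x \<partial>lborel)"
proof (cases "integrable lborel f")
  case True
  have "(\<integral>x. f x \<partial>lborel) = (\<integral>x. f x \<partial>(distr lborel borel ((+) c)))" by (simp add: lborel_distr_plus)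
  also have "\<dots> = (\<integral>x. f (c + x) \<partial>lborel)"
    using True by (intro integral_distr) auto
  finally show ?thesis by (simp add: add.commute)
next
  case False
  moreover have "\<not> integrable lborel (\<lambda>x. f (x + c))"
    using False integrable_translate[of "\<lambda>x. f (x + c)" "- c"] by auto
  ultimately show ?thesis by (simp add: not_integrable_integral_eq)
qed

lemma integrable_indicator_cube:
  fixes f :: "real ^ 'n::finite \<Rightarrow> 'b::{banach, second_countable_topology}"
  assumes "integrable lborel f"
  shows "integrable lborel (\<lambda>x. indicator (cube L) (x - c) *\<^sub>R f x)"
proof -
  have "(\<lambda>x. x - c) -` cube L \<inter> space lborel \<in> sets lborel"
    by (rule measurable_sets[where A=borel]) auto
  then have "integrable lborel (\<lambda>x. indicator ((\<lambda>x. x - c) -` cube L) x *\<^sub>R f x)"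
    using assms by (intro integrable_mult_indicator) auto
  then show ?thesis by (simp add: indicator_def)
qed

lemma sum_indicator_cube_le:
  assumes "L > 0" "finite F"
  shows "(\<Sum>l\<in>F. indicator (cube L) (x - L *\<^sub>R ivec l) :: real) \<le> 1"
proof -
  have "(\<Sum>l\<in>F. indicator (cube L) (x - L *\<^sub>R ivec l) :: real) = (\<Sum>l\<in>F. if cell L x = l then 1 else 0)"
    by (intro sum.cong) (auto simp: indicator_def in_cube_iff_cell[OF assms(1)])
  also have "\<dots> \<le> 1" using assms(2) by (simp add: sum.delta)
  finally show ?thesis .
qed

lemma has_sum_indicator_cube:
  fixes v :: "'b::real_normed_vector"
  assumes "L > 0"
  shows "((\<lambda>l. indicator (cube L) (x - L *\<^sub>R ivec l) *\<^sub>R v) has_sum v) UNIV"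
proof -
  let ?f = "\<lambda>l. indicator (cube L) (x - L *\<^sub>R ivec l) *\<^sub>R v"
  have "(?f has_sum sum ?f {cell L x}) {cell L x}" by (rule has_sum_finite) simp
  also have "sum ?f {cell L x} = v" by (simp add: in_cube_iff_cell[OF assms])
  also have "(?f has_sum v) {cell L x} \<longleftrightarrow> (?f has_sum v) UNIV"
    by (rule has_sum_cong_neutral) (auto simp: in_cube_iff_cell[OF assms] indicator_def)
  finally show ?thesis .
qed

lemma summable_cube_integrals:
  fixes f :: "real ^ 'n::finite \<Rightarrow> 'b::{banach, second_countable_topology}"
  assumes L: "L > 0" and f: "integrable lborel f"
  shows "(\<lambda>l. \<integral>x. norm (indicator (cube L) (x - L *\<^sub>R ivec l) *\<^sub>R f x) \<partial>lborel) summable_on UNIV"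
proof (rule nonneg_summable_onI(1)[where C="\<integral>x. norm (f x) \<partial>lborel"])
  fix F :: "('n \<Rightarrow> int) set" assume F: "finite F"
  have "(\<Sum>l\<in>F. \<integral>x. norm (indicator (cube L) (x - L *\<^sub>R ivec l) *\<^sub>R f x) \<partial>lborel)
     = (\<integral>x. (\<Sum>l\<in>F. norm (indicator (cube L) (x - L *\<^sub>R ivec l) *\<^sub>R f x)) \<partial>lborel)"
    by (rule Bochner_Integration.integral_sum[symmetric])
       (intro integrable_norm integrable_indicator_cube f)
  also have "\<dots> \<le> (\<integral>x. norm (f x) \<partial>lborel)"
  proof (rule integral_mono)
    fix x
    have "(\<Sum>l\<in>F. norm (indicator (cube L) (x - L *\<^sub>R ivec l) *\<^sub>R f x))
       = (\<Sum>l\<in>F. indicator (cube L) (x - L *\<^sub>R ivec l)) * norm (f x)"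
      by (simp add: sum_distrib_right)
    also have "\<dots> \<le> 1 * norm (f x)" by (intro mult_right_mono sum_indicator_cube_le L F) auto
    finally show "(\<Sum>l\<in>F. norm (indicator (cube L) (x - L *\<^sub>R ivec l) *\<^sub>R f x)) \<le> norm (f x)" by simp
  qed (intro Bochner_Integration.integrable_sum integrable_norm integrable_indicator_cube f)+
  finally show "(\<Sum>l\<in>F. \<integral>x. norm (indicator (cube L) (x - L *\<^sub>R ivec l) *\<^sub>R f x) \<partial>lborel) \<le> (\<integral>x. norm (f x) \<partial>lborel)" .
qed auto

lemma shift_cube_integral:
  fixes f :: "real ^ 'n::finite \<Rightarrow> 'b::{banach, second_countable_topology}"
  shows "(\<integral>x. indicator (cube L) x *\<^sub>R f (x + c) \<partial>lborel) = (\<integral>x. indicator (cube L) (x - c) *\<^sub>R f x \<partial>lborel)"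
  using integral_translate[of "\<lambda>x. indicator (cube L) (x - c) *\<^sub>R f x" c] by simp

text \<open>Inserting the partition of unity formed by the indicators of the cubes splits an
  integral over the whole space into integrals over one cube.\<close>

lemma tiling:
  fixes f :: "real ^ 'n::finite \<Rightarrow> 'b::{banach, second_countable_topology}"
  assumes L: "L > 0" and f: "integrable lborel f"
  shows "((\<lambda>l. \<integral>x. indicator (cube L) x *\<^sub>R f (x + L *\<^sub>R ivec l) \<partial>lborel) has_sum (\<integral>x. f x \<partial>lborel)) UNIV"
proof -
  have "((\<lambda>l. \<integral>x. indicator (cube L) (x - L *\<^sub>R ivec l) *\<^sub>R f x \<partial>lborel) has_sum
     (\<integral>x. (\<Sum>\<^sub>\<infinity>l. indicator (cube L) (x - L *\<^sub>R ivec l) *\<^sub>R f x) \<partial>lborel)) UNIV"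
  proof (rule has_sum_integral(1))
    fix x
    show "(\<lambda>l. norm (indicator (cube L) (x - L *\<^sub>R ivec l) *\<^sub>R f x)) summable_on UNIV"
      using has_sum_indicator_cube[OF L, of x "norm (f x)"] by (auto simp: summable_on_def)
  qed (intro integrable_indicator_cube f summable_cube_integrals L)+
  also have "(\<lambda>x. \<Sum>\<^sub>\<infinity>l. indicator (cube L) (x - L *\<^sub>R ivec l) *\<^sub>R f x) = f"
    by (intro ext infsumI has_sum_indicator_cube L)
  finally show ?thesis by (simp add: shift_cube_integral)
qed

text \<open>Unfolding: an integral over a fundamental cube of a periodised function is an integral
  over all of space. Fourier coefficients of periodisations are computed with it.\<close>

lemma tiling_periodization:
  fixes f :: "real ^ 'n::finite \<Rightarrow> 'b::{banach, second_countable_topology}"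
  assumes L: "L > 0" and f: "integrable lborel f"
    and pt: "\<And>x. (\<lambda>l. norm (f (x + L *\<^sub>R ivec l))) summable_on UNIV"
  shows "(\<integral>x. indicator (cube L) x *\<^sub>R (\<Sum>\<^sub>\<infinity>l. f (x + L *\<^sub>R ivec l)) \<partial>lborel) = (\<integral>x. f x \<partial>lborel)"
proof -
  have "((\<lambda>l. \<integral>x. indicator (cube L) x *\<^sub>R f (x + L *\<^sub>R ivec l) \<partial>lborel) has_sum
     (\<integral>x. (\<Sum>\<^sub>\<infinity>l. indicator (cube L) x *\<^sub>R f (x + L *\<^sub>R ivec l)) \<partial>lborel)) UNIV"
  proof (rule has_sum_integral(1))
    fix x show "(\<lambda>l. norm (indicator (cube L) x *\<^sub>R f (x + L *\<^sub>R ivec l))) summable_on UNIV"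
      using pt[of x] by (simp add: summable_on_cmult_right)
  next
    fix l show "integrable lborel (\<lambda>x. indicator (cube L) x *\<^sub>R f (x + L *\<^sub>R ivec l))"
      using integrable_indicator_cube[OF integrable_translate[OF f], of L 0] by simp
  next
    have "(\<integral>x. norm (indicator (cube L) x *\<^sub>R f (x + L *\<^sub>R ivec l)) \<partial>lborel)
       = (\<integral>x. norm (indicator (cube L) (x - L *\<^sub>R ivec l) *\<^sub>R f x) \<partial>lborel)" for l
      using shift_cube_integral[of L "\<lambda>x. norm (f x)" "L *\<^sub>R ivec l"] by simp
    then show "(\<lambda>l. \<integral>x. norm (indicator (cube L) x *\<^sub>R f (x + L *\<^sub>R ivec l)) \<partial>lborel) summable_on UNIV"
      using summable_cube_integrals[OF L f] by simp
  qed
  from infsumI[OF this] infsumI[OF tiling[OF L f]] show ?thesis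
    by (simp add: infsum_scaleR_right)
qed

text \<open>On the unit cube around a lattice point l the function is at most a constant times its
  value at l, by Peetre's inequality, so the integral is controlled by the lattice sum.\<close>

lemma integrable_decay: "integrable lborel (decay :: real ^ 'n::finite \<Rightarrow> real)"
proof -
  \<comment> \<open>The base bounds 1 + norm on the cube of side 1, as in
    \<open>cube_norm_le\<close>.\<close>
  let ?K = "(1 + real CARD('n) * (1 / 2)) ^ (2 * CARD('n))"
  let ?f = "\<lambda>l (x :: real^'n). indicator (cube 1) (x - 1 *\<^sub>R ivec l) *\<^sub>R decay x :: real"
  let ?g = "\<lambda>l (x :: real^'n). indicator (cube 1) (x - 1 *\<^sub>R ivec l) *\<^sub>R (?K * decay (ivec l :: real^'n)) :: real"
  obtain C where C: "\<And>x :: real^'n. \<And>F. finite F \<Longrightarrow> (\<Sum>n\<in>F. decay (x - 1 *\<^sub>R ivec n)) \<le> C"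
    using lattice_sum_bound[of 1, where 'n='n] by (metis zero_less_one order_refl)
  have dm: "decay (- y) = decay y" for y :: "real^'n" by (simp add: decay_def)
  have le: "?f l x \<le> ?g l x" for l and x :: "real^'n"
  proof (cases "x - 1 *\<^sub>R ivec l \<in> cube 1")
    case True
    have "decay x \<le> (1 + norm (ivec l - x)) ^ (2 * CARD('n)) * decay (ivec l)" by (rule decay_peetre)
    also have "\<dots> \<le> ?K * decay (ivec l)"
      using cube_norm_le[OF True] by (intro mult_right_mono power_mono) (auto simp: norm_minus_commute)
    finally show ?thesis using True by simp
  qed auto
  have meas: "(\<lambda>x :: real^'n. x - 1 *\<^sub>R ivec l) -` cube 1 \<in> sets lborel" for l
    using measurable_sets[of "\<lambda>x :: real^'n. x - 1 *\<^sub>R ivec l" lborel borel "cube 1"] by simp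
  have ind: "integrable lborel (\<lambda>x :: real^'n. indicator (cube 1) (x - 1 *\<^sub>R ivec l) :: real)"
    "(\<integral>x. indicator (cube 1) (x - 1 *\<^sub>R ivec l :: real^'n) \<partial>lborel) = (1::real)" for l
  proof -
    have "integrable lborel (indicator (cube 1) :: real^'n \<Rightarrow> real)"
      using emeasure_cube[of 1, where 'n='n] by (intro integrable_real_indicator) auto
    moreover have "(\<integral>x. indicator (cube 1) (x :: real^'n) \<partial>lborel) = (1::real)"
      using emeasure_cube[of 1, where 'n='n] by (simp add: measure_def)
    ultimately show "integrable lborel (\<lambda>x :: real^'n. indicator (cube 1) (x - 1 *\<^sub>R ivec l) :: real)"
      "(\<integral>x. indicator (cube 1) (x - 1 *\<^sub>R ivec l :: real^'n) \<partial>lborel) = (1::real)"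
      using integrable_translate[of "indicator (cube 1) :: real^'n \<Rightarrow> real" "- ivec l"]
        integral_translate[of "indicator (cube 1) :: real^'n \<Rightarrow> real" "- ivec l"] by simp_all
  qed
  have intg: "integrable lborel (?g l)" for l using ind(1)[of l] by simp
  have "(decay :: real^'n \<Rightarrow> real) \<in> borel_measurable borel"
    by (intro borel_measurable_continuous_onI continuous_intros)
  then have cont: "(decay :: real^'n \<Rightarrow> real) \<in> borel_measurable lborel" by simp
  have i: "integrable lborel (?f l)" for l
  proof (rule Bochner_Integration.integrable_bound[OF intg[of l]])
    have "(\<lambda>x::real^'n. indicator ((\<lambda>x :: real^'n. x - 1 *\<^sub>R ivec l) -` cube 1) x *\<^sub>R decay x) \<in> borel_measurable lborel"
      using meas[of l] cont by (intro borel_measurable_scaleR borel_measurable_indicator)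
    then show "?f l \<in> borel_measurable lborel" by (simp add: indicator_def)
  qed (use le in \<open>auto simp: indicator_def\<close>)
  have "integrable lborel (\<lambda>x :: real^'n. \<Sum>\<^sub>\<infinity>l. ?f l x)"
  proof (rule has_sum_integral(2))
    show "integrable lborel (?f l)" for l by (rule i)
  next
    fix x :: "real^'n" show "(\<lambda>l. norm (?f l x)) summable_on UNIV"
      using has_sum_indicator_cube[of 1 x "decay x"] by (auto simp: summable_on_def)
  next
    show "(\<lambda>l. \<integral>x. norm (?f l x) \<partial>lborel) summable_on UNIV"
    proof (rule nonneg_summable_onI(1)[where C="?K * C"])
      fix F :: "('n \<Rightarrow> int) set" assume F: "finite F"
      have "(\<Sum>l\<in>F. \<integral>x. norm (?f l x) \<partial>lborel) \<le> (\<Sum>l\<in>F. \<integral>x. ?g l x \<partial>lborel)"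
        by (intro sum_mono integral_mono integrable_norm i intg) (use le in auto)
      also have "\<dots> = (\<Sum>l\<in>F. ?K * decay (ivec l :: real^'n))"
        using ind(2) by simp
      also have "\<dots> = ?K * (\<Sum>l\<in>F. decay (0 - 1 *\<^sub>R ivec l :: real^'n))"
        by (simp add: sum_distrib_left dm)
      also have "\<dots> \<le> ?K * C" by (intro mult_left_mono C F) auto
      finally show "(\<Sum>l\<in>F. \<integral>x. norm (?f l x) \<partial>lborel) \<le> ?K * C" .
    qed auto
  qed
  also have "(\<lambda>x :: real^'n. \<Sum>\<^sub>\<infinity>l. ?f l x) = decay"
    by (intro ext infsumI has_sum_indicator_cube) simp
  finally show ?thesis .
qed

section \<open>Rapidly decreasing functions and Fourier coefficients\<close>

text \<open>A class without derivatives on which the Fourier analysis is done. It is closed under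
  products, translations, modulations and autocorrelation, and contains every test function together
  with its Fourier transform.\<close>

definition rapid :: "('n::finite) fn \<Rightarrow> bool" where
  "rapid f \<longleftrightarrow> continuous_on UNIV f \<and> (\<forall>k. \<exists>C. \<forall>x. (1 + norm x) ^ k * norm (f x) \<le> C)"

lemma rapid_cont: "rapid f \<Longrightarrow> continuous_on UNIV f"
  by (simp add: rapid_def)

lemma one_plus_norm_pos [simp]: "0 < 1 + norm x" "0 \<le> 1 + norm x" "1 + norm x \<noteq> 0"
  by (simp_all add: add_pos_nonneg add_nonneg_eq_0_iff)

lemma rapid_bound:
  assumes "rapid f"
  shows "\<exists>C>0. \<forall>x. (1 + norm x) ^ k * norm (f x) \<le> C"
proof -
  obtain C where "\<And>x. (1 + norm x) ^ k * norm (f x) \<le> C" using assms by (auto simp: rapid_def)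
  then show ?thesis by (intro exI[of _ "max C 1"]) (auto simp: le_max_iff_disj)
qed

lemma rapid_decay_bound:
  assumes "rapid (f :: ('n::finite) fn)"
  shows "\<exists>C>0. \<forall>x. (1 + norm x) ^ k * norm (f x) \<le> C * decay x"
proof -
  obtain C where C: "C > 0" "\<And>x. (1 + norm x) ^ (2 * CARD('n) + k) * norm (f x) \<le> C"
    using rapid_bound[OF assms] by blast
  have "(1 + norm x) ^ k * norm (f x) \<le> C * decay x" for x
    using C(2)[of x] unfolding decay_def power_add by (simp add: field_simps)
  then show ?thesis using C(1) by blast
qed

lemma rapid_le_decay:
  assumes "rapid (f :: ('n::finite) fn)"
  shows "\<exists>C>0. \<forall>x. norm (f x) \<le> C * decay x"
  using rapid_decay_bound[OF assms, of 0] by simp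

lemma borel_measurable_cont_lborel:
  "continuous_on UNIV f \<Longrightarrow> f \<in> borel_measurable lborel"
  using borel_measurable_continuous_onI by simp

lemma integrable_le_decay:
  fixes f :: "real ^ 'n::finite \<Rightarrow> 'b::{banach, second_countable_topology}"
  assumes "continuous_on UNIV f" "\<And>x. norm (f x) \<le> C * decay x"
  shows "integrable lborel f"
proof (rule Bochner_Integration.integrable_bound)
  show "integrable lborel (\<lambda>x :: real^'n. C * decay x)" by (intro integrable_mult_right integrable_decay)
  show "f \<in> borel_measurable lborel" by (intro borel_measurable_cont_lborel assms)
  show "AE x in lborel. norm (f x) \<le> norm (C * decay x)"
    using assms(2) by (auto intro!: AE_I2 order_trans[OF _ abs_ge_self])
qed

lemma rapid_integrable: "rapid f \<Longrightarrow> integrable lborel f"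
  using rapid_le_decay[of f] integrable_le_decay rapid_cont by metis

lemma decay_minus [simp]: "decay (- x) = decay x"
  by (simp add: decay_def)

lemma summable_decay:
  assumes "L > 0"
  shows "(\<lambda>l. decay (x + L *\<^sub>R ivec l)) summable_on UNIV"
proof -
  obtain C where C: "\<And>x :: real^'a. \<And>F. finite F \<Longrightarrow> (\<Sum>n\<in>F. decay (x - L *\<^sub>R ivec n)) \<le> C"
    using lattice_sum_bound[OF assms, where 'n='a] by (meson order_refl)
  have "decay (x + L *\<^sub>R ivec l) = decay (- x - L *\<^sub>R ivec l)" for l
    using decay_minus[of "x + L *\<^sub>R ivec l"] by simp
  then show ?thesis
    by (intro nonneg_summable_onI(1)[where C=C]) (auto intro: C)
qed

lemma summable_le_decay:
  assumes "L > 0" "\<And>x. norm (f x) \<le> C * decay x"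
  shows "(\<lambda>l. norm (f (x + L *\<^sub>R ivec l))) summable_on UNIV"
  by (rule summable_on_comparison_test[OF summable_on_cmult_right[OF summable_decay[OF assms(1)]]])
     (use assms(2) in auto)

lemma rapid_summable:
  "rapid f \<Longrightarrow> L > 0 \<Longrightarrow> (\<lambda>l. norm (f (x + L *\<^sub>R ivec l))) summable_on UNIV"
  using rapid_le_decay[of f] summable_le_decay by metis

lemma rapid_mult:
  assumes f: "rapid f" and g: "continuous_on UNIV g" "\<And>x. norm (g x) \<le> K * (1 + norm x) ^ m"
  shows "rapid (\<lambda>x. f x * g x)"
  unfolding rapid_def
proof (intro conjI allI)
  show "continuous_on UNIV (\<lambda>x. f x * g x)" using rapid_cont[OF f] g(1) by (intro continuous_intros)
  fix k
  obtain C where C: "C > 0" "\<And>x. (1 + norm x) ^ (k + m) * norm (f x) \<le> C"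
    using rapid_bound[OF f] by blast
  have "(1 + norm x) ^ k * norm (f x * g x) \<le> C * \<bar>K\<bar>" for x
  proof -
    have "(1 + norm x) ^ k * norm (f x * g x) \<le> (1 + norm x) ^ k * norm (f x) * (\<bar>K\<bar> * (1 + norm x) ^ m)"
      unfolding norm_mult mult.assoc
      using order_trans[OF g(2) mult_right_mono[OF abs_ge_self]] by (intro mult_left_mono) auto
    also have "\<dots> = (1 + norm x) ^ (k + m) * norm (f x) * \<bar>K\<bar>" by (simp add: power_add)
    also have "\<dots> \<le> C * \<bar>K\<bar>" by (intro mult_right_mono C) auto
    finally show ?thesis .
  qed
  then show "\<exists>C. \<forall>x. (1 + norm x) ^ k * norm (f x * g x) \<le> C" by blast
qed

lemma rapid_bounded_mult:
  assumes f: "rapid f" and g: "continuous_on UNIV g" "\<And>x. norm (g x) \<le> K"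
  shows "rapid (\<lambda>x. f x * g x)"
  by (rule rapid_mult[OF f g(1), of K 0]) (use g in auto)

lemma rapid_cis: "rapid f \<Longrightarrow> continuous_on UNIV p \<Longrightarrow> rapid (\<lambda>x. f x * cis (p x))"
  by (rule rapid_bounded_mult[where K=1]) (auto intro!: continuous_intros)

lemma rapid_cnj: "rapid f \<Longrightarrow> rapid (\<lambda>x. cnj (f x))"
  unfolding rapid_def by (auto intro!: continuous_intros)

lemma rapid_shift:
  assumes "rapid f" shows "rapid (\<lambda>x. f (x + c))"
  unfolding rapid_def
proof (intro conjI allI)
  show "continuous_on UNIV (\<lambda>x. f (x + c))"
    by (rule continuous_on_compose2[OF rapid_cont[OF assms]]) (auto intro!: continuous_intros)
  fix k
  obtain C where C: "C > 0" "\<And>x. (1 + norm x) ^ k * norm (f x) \<le> C"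
    using rapid_bound[OF assms] by blast
  have "(1 + norm x) ^ k * norm (f (x + c)) \<le> (1 + norm c) ^ k * C" for x
  proof -
    have "(1 + norm x) ^ k \<le> ((1 + norm (x + c)) * (1 + norm c)) ^ k"
      using peetre[of x "x + c"] by (intro power_mono) auto
    then have "(1 + norm x) ^ k * norm (f (x + c)) \<le> ((1 + norm (x + c)) * (1 + norm c)) ^ k * norm (f (x + c))"
      by (intro mult_right_mono) auto
    also have "\<dots> = (1 + norm c) ^ k * ((1 + norm (x + c)) ^ k * norm (f (x + c)))"
      by (simp add: power_mult_distrib)
    also have "\<dots> \<le> (1 + norm c) ^ k * C" by (intro mult_left_mono C) auto
    finally show ?thesis .
  qed
  then show "\<exists>C. \<forall>x. (1 + norm x) ^ k * norm (f (x + c)) \<le> C" by blast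
qed

lemma rapid_prod: "rapid f \<Longrightarrow> rapid g \<Longrightarrow> rapid (\<lambda>x. f x * g x)"
  using rapid_bound[of g 0] by (auto intro: rapid_bounded_mult rapid_cont)

text \<open>The definition uses the gauge integral; integrability turns it into a Lebesgue integral,
  to which Fubini and translation invariance apply.\<close>

lemma fourier_lebesgue:
  assumes "rapid f"
  shows "fourier f \<xi> = (\<integral>x. f x * cis (- (x \<bullet> \<xi>)) \<partial>lborel)"
  unfolding fourier_def
  by (rule integral_lborel) (intro rapid_integrable rapid_cis assms continuous_intros)

section \<open>Characters of the torus of period L and uniqueness of Fourier coefficients\<close>

definition char :: "real \<Rightarrow> ('n::finite \<Rightarrow> int) \<Rightarrow> real ^ 'n \<Rightarrow> complex" where
  "char L l x = cis ((2 * pi / L) * (ivec l \<bullet> x))"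

lemma ivec_inner: "ivec l \<bullet> (ivec r :: real ^ 'n::finite) = of_int (\<Sum>j\<in>UNIV. l j * r j)"
  by (simp add: inner_vec_def ivec_def)

lemma norm_char [simp]: "norm (char L l x) = 1"
  by (simp add: char_def)

lemma char_0 [simp]: "char L (\<lambda>_. 0) x = 1"
  by (simp add: char_def ivec_def inner_vec_def)

lemma char_add: "char L (\<lambda>j. l j + m j) x = char L l x * char L m x"
proof -
  have "ivec (\<lambda>j. l j + m j) = (ivec l + ivec m :: real ^ 'a)" by (vector ivec_def)
  then show ?thesis by (simp add: char_def cis_mult inner_add_left algebra_simps add_divide_distrib)
qed

lemma char_periodic: "L > 0 \<Longrightarrow> char L l (x + L *\<^sub>R ivec r) = char L l x"
proof -
  assume "L > 0"
  then have "char L l (x + L *\<^sub>R ivec r) = cis ((2 * pi / L) * (ivec l \<bullet> x) + 2 * pi * (ivec l \<bullet> (ivec r :: real^'a)))"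
    by (simp add: char_def inner_add_right inner_scaleR_right algebra_simps)
  also have "\<dots> = cis ((2 * pi / L) * (ivec l \<bullet> x)) * cis (2 * pi * (ivec l \<bullet> (ivec r :: real^'a)))"
    by (simp add: cis_mult)
  also have "cis (2 * pi * (ivec l \<bullet> (ivec r :: real^'a))) = 1"
    unfolding ivec_inner by (rule cis_multiple_2pi) auto
  finally show ?thesis by (simp add: char_def)
qed

lemma continuous_char [continuous_intros]:
  "continuous_on A g \<Longrightarrow> continuous_on A (\<lambda>x. char L l (g x))"
  unfolding char_def by (intro continuous_intros)

lemma has_sum_uminus_index:
  "((\<lambda>l::'n \<Rightarrow> int. f (\<lambda>j. - l j)) has_sum s) UNIV \<longleftrightarrow> (f has_sum s) UNIV"
proof -
  have "bij_betw (\<lambda>l::'n \<Rightarrow> int. \<lambda>j. - l j) UNIV UNIV"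
    by (rule bij_betwI[where g="\<lambda>l j. - l j"]) auto
  then show ?thesis by (rule has_sum_reindex_bij_betw)
qed

lemma ivec_uminus: "ivec (\<lambda>j. - l j) = - (ivec l :: real ^ 'n::finite)"
  by (vector ivec_def)

lemma ivec_0 [simp]: "ivec (\<lambda>_. 0) = (0 :: real ^ 'n::finite)"
  by (vector ivec_def)

lemma integrable_cube_cont:
  fixes f :: "real ^ 'n::finite \<Rightarrow> 'b::{banach, second_countable_topology}"
  assumes "continuous_on UNIV f"
  shows "integrable lborel (\<lambda>x. indicator (cube L) x *\<^sub>R f x)"
proof (rule Bochner_Integration.integrable_bound)
  let ?B = "cbox (\<chi> j. - L/2) (\<chi> j. L/2) :: (real^'n) set"
  have "integrable lborel (\<lambda>x. indicator ?B x *\<^sub>R norm (f x))"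
    by (rule borel_integrable_compact) (auto intro!: continuous_intros continuous_on_subset[OF assms])
  then show "integrable lborel (\<lambda>x. indicator ?B x *\<^sub>R norm (f x))" .
  show "(\<lambda>x. indicator (cube L) x *\<^sub>R f x) \<in> borel_measurable lborel"
    using borel_measurable_cont_lborel[OF assms] by measurable
  show "AE x in lborel. norm (indicator (cube L) x *\<^sub>R f x) \<le> norm (indicator ?B x *\<^sub>R norm (f x))"
    using cube_subset_cbox[of L] by (intro AE_I2) (auto simp: indicator_def)
qed

lemma indicator_cube_integral:
  assumes "L > 0"
  shows "integrable lborel (indicator (cube L) :: real ^ 'n::finite \<Rightarrow> real)"
    and "(\<integral>x. indicator (cube L) (x :: real^'n) \<partial>lborel) = L ^ CARD('n)"
proof -
  have e: "emeasure lborel (cube L :: (real^'n) set) = ennreal (L ^ CARD('n))" by (rule emeasure_cube[OF assms])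
  show "integrable lborel (indicator (cube L) :: real ^ 'n::finite \<Rightarrow> real)"
    using e by (intro integrable_real_indicator) auto
  have "measure lborel (cube L :: (real^'n) set) = L ^ CARD('n)"
    using assms unfolding measure_def e by simp
  then show "(\<integral>x. indicator (cube L) (x :: real^'n) \<partial>lborel) = L ^ CARD('n)" by simp
qed

text \<open>For l \<noteq> 0 a translation by half a period in a coordinate with l j \<noteq> 0
  changes the sign of the character, while the integral of a periodic function over a translated
  cube stays the same. Hence the integral equals its own negative.\<close>

lemma integral_char:
  fixes l :: "'n::finite \<Rightarrow> int"
  assumes L: "L > 0"
  shows "(\<integral>x. indicator (cube L) x *\<^sub>R char L l x \<partial>lborel) = (if l = (\<lambda>_. 0) then of_real (L ^ CARD('n)) else 0)"
proof (cases "l = (\<lambda>_. 0)")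
  case True
  have "(\<integral>x. indicator (cube L) (x :: real^'n) *\<^sub>R (1::complex) \<partial>lborel) = (L ^ CARD('n)) *\<^sub>R 1"
    by (subst integral_scaleR_left) (auto simp only: indicator_cube_integral[OF L])
  then show ?thesis using True by (simp add: scaleR_conv_of_real)
next
  case False
  then obtain j where j: "l j \<noteq> 0" by auto
  define s :: "real ^ 'n" where "s = (L / (2 * of_int (l j))) *\<^sub>R axis j 1"
  \<comment> \<open>The character restricted to the cube moved by s. Its periodisation is the full
    character again, so unfolding compares the moved cube with the original one.\<close>
  define f where "f x = indicator (cube L) (x - s) *\<^sub>R char L l x" for x
  let ?I = "\<integral>x. indicator (cube L) x *\<^sub>R char L l x \<partial>lborel"
  have s: "char L l (x + s) = - char L l x" for x
  proof -
    have "(2 * pi / L) * (ivec l \<bullet> s) = pi"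
      using j L by (simp add: s_def inner_axis ivec_def)
    then have "(2 * pi / L) * (ivec l \<bullet> (x + s)) = (2 * pi / L) * (ivec l \<bullet> x) + pi"
      by (simp add: inner_add_right distrib_left)
    then show ?thesis unfolding char_def by (simp only: cis_mult[symmetric]) simp
  qed
  have fI: "(\<integral>x. f x \<partial>lborel) = - ?I"
    using shift_cube_integral[of L "char L l" s] by (simp add: f_def s)
  have hs: "((\<lambda>r. f (x + L *\<^sub>R ivec r)) has_sum char L l x) UNIV" for x
  proof -
    have "((\<lambda>r. indicator (cube L) ((x - s) - L *\<^sub>R ivec r) *\<^sub>R char L l x) has_sum char L l x) UNIV"
      by (rule has_sum_indicator_cube[OF L])
    then show ?thesis
      by (subst has_sum_uminus_index[symmetric])
         (simp add: f_def char_periodic[OF L] ivec_uminus char_periodic[OF L, of l x "\<lambda>j. - _ j", unfolded ivec_uminus, simplified] algebra_simps)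
  qed
  have nhs: "(\<lambda>r. norm (f (x + L *\<^sub>R ivec r))) summable_on UNIV" for x
  proof -
    have "((\<lambda>r. indicator (cube L) ((x - s) - L *\<^sub>R ivec r) *\<^sub>R (1::real)) has_sum 1) UNIV"
      by (rule has_sum_indicator_cube[OF L])
    then have "((\<lambda>r. norm (f (x + L *\<^sub>R ivec r))) has_sum 1) UNIV"
      by (subst has_sum_uminus_index[symmetric]) (simp add: f_def ivec_uminus algebra_simps)
    then show ?thesis by (auto simp: summable_on_def)
  qed
  have intf: "integrable lborel f"
    using integrable_translate[OF integrable_cube_cont[of "\<lambda>x. char L l (x + s)" L], of "- s"]
    unfolding f_def by (simp add: continuous_intros)
  have "?I = (\<integral>x. indicator (cube L) x *\<^sub>R (\<Sum>\<^sub>\<infinity>r. f (x + L *\<^sub>R ivec r)) \<partial>lborel)"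
    using infsumI[OF hs] by simp
  also have "\<dots> = (\<integral>x. f x \<partial>lborel)" by (rule tiling_periodization[OF L intf nhs])
  finally have "?I = - ?I" using fI by simp
  then show ?thesis using False by simp
qed

text \<open>The kernel is a trigonometric polynomial whose powers concentrate at the centre of the cube.\<close>

definition peak :: "real \<Rightarrow> real ^ 'n::finite \<Rightarrow> real" where
  "peak L x = (\<Prod>j\<in>UNIV. (1 + cos (2 * pi / L * x $ j)) / 2)"

lemma continuous_peak: "continuous_on UNIV (peak L)"
  unfolding peak_def by (intro continuous_intros) auto

lemma half_one_plus_cos_nonneg: "0 \<le> (1 + cos (t::real)) / 2"
  by (smt (verit) cos_ge_minus_one divide_nonneg_pos)

lemma peak_nonneg: "0 \<le> peak L x"
  unfolding peak_def
proof (intro prod_nonneg ballI)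
  fix j show "0 \<le> (1 + cos (2 * pi / L * x $ j)) / 2"
    by (rule half_one_plus_cos_nonneg)
qed

lemma peak_0 [simp]: "peak L 0 = 1"
  by (simp add: peak_def)

lemma peak_less_1:
  assumes L: "L > 0" and x: "x \<in> cbox (\<chi> j. - L/2) (\<chi> j. L/2)" "x \<noteq> 0"
  shows "peak L x < 1"
proof -
  obtain j where j: "x $ j \<noteq> 0" using x(2) by (metis vec_eq_iff zero_index)
  define t where "t = 2 * pi / L * x $ j"
  have xj: "\<bar>x $ j\<bar> \<le> L / 2"
    using x(1)[unfolded mem_box_cart, rule_format, of j] by (simp, linarith)
  have "\<bar>t\<bar> = 2 * pi / L * \<bar>x $ j\<bar>" using L by (simp add: t_def abs_mult)
  also have "\<dots> \<le> 2 * pi / L * (L / 2)" using L xj by (intro mult_left_mono) auto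
  finally have t: "\<bar>t\<bar> \<le> pi" using L by simp
  have t0: "t \<noteq> 0" using j L by (simp add: t_def)
  have "cos \<bar>t\<bar> < cos 0" by (rule cos_monotone_0_pi) (use t t0 in auto)
  then have c: "cos t < 1" by simp
  have "peak L x = (1 + cos t) / 2 * (\<Prod>j\<in>UNIV - {j}. (1 + cos (2 * pi / L * x $ j)) / 2)"
    unfolding peak_def t_def by (subst prod.remove[of _ j]) auto
  also have "\<dots> \<le> (1 + cos t) / 2 * 1"
  proof (intro mult_left_mono prod_le_1 conjI)
    fix j show "0 \<le> (1 + cos (2 * pi / L * x $ j)) / 2"
      by (rule half_one_plus_cos_nonneg)
  qed (use half_one_plus_cos_nonneg[of t] in auto)
  also have "\<dots> < 1" using c by simp
  finally show ?thesis .
qed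

text \<open>Each factor of \<open>peak\<close> is 1/2 plus a quarter of two opposite characters, so
  multiplication by it only combines coefficients of shifted index. The property that all
  coefficients vanish is thus kept by every factor, hence by every power.\<close>

lemma vanishing_coefficients_mult_peak:
  fixes P :: "real ^ 'n::finite \<Rightarrow> complex"
  assumes P: "continuous_on UNIV P"
    and 0: "\<And>l. (\<integral>x. indicator (cube L) x *\<^sub>R (P x * char L l x) \<partial>lborel) = 0"
  shows "(\<integral>x. indicator (cube L) x *\<^sub>R (P x * of_real (peak L x ^ N) * char L l x) \<partial>lborel) = 0"
proof -
  define Z where "Z p \<longleftrightarrow> continuous_on UNIV p \<and> (\<forall>l. (\<integral>x. indicator (cube L) x *\<^sub>R (p x * char L l x) \<partial>lborel) = 0)"
    for p :: "real ^ 'n \<Rightarrow> complex"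
  let ?k = "\<lambda>j (x :: real^'n). (1 + cos (2 * pi / L * x $ j)) / 2"
  have step: "Z (\<lambda>x. p x * of_real (?k j x))" if "Z p" for p j
  proof -
    define e where "e = (\<lambda>i. if i = j then 1 else 0 :: int)"
    have c: "continuous_on UNIV p" and z: "\<And>l. (\<integral>x. indicator (cube L) x *\<^sub>R (p x * char L l x) \<partial>lborel) = 0"
      using that by (auto simp: Z_def)
    have ie: "ivec e \<bullet> x = x $ j" for x :: "real ^ 'n"
    proof -
      have "ivec e \<bullet> x = (\<Sum>i\<in>UNIV. if i = j then x $ i else 0)"
        unfolding inner_vec_def by (intro sum.cong) (auto simp: ivec_def e_def)
      then show ?thesis by simp
    qed
    have k: "of_real (?k j x) = 1 / 2 + (1/4) * char L e x + (1/4) * char L (\<lambda>i. - e i) x" for x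
      by (simp add: char_def ivec_uminus ie complex_eq_iff)
    have i: "integrable lborel (\<lambda>x. indicator (cube L) x *\<^sub>R (p x * char L l x))" for l
      using c by (intro integrable_cube_cont continuous_intros)
    have "(\<integral>x. indicator (cube L) x *\<^sub>R (p x * of_real (?k j x) * char L l x) \<partial>lborel) = 0" for l
    proof -
      define Y where "Y l x = indicator (cube L) x *\<^sub>R (p x * char L l x)" for l x
      have Y: "integrable lborel (Y l)" "(\<integral>x. Y l x \<partial>lborel) = 0" for l
        using i[of l] z[of l] by (simp_all add: Y_def[abs_def])
      have "indicator (cube L) x *\<^sub>R (p x * of_real (?k j x) * char L l x) =
          (1/2) * Y l x + (1/4) * Y (\<lambda>i. e i + l i) x + (1/4) * Y (\<lambda>i. - e i + l i) x" for x
        unfolding k char_add Y_def by (simp add: algebra_simps scaleR_conv_of_real)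
      then show ?thesis using Y by simp
    qed
    moreover have "continuous_on UNIV (\<lambda>x. p x * of_real (?k j x))" using c by (intro continuous_intros) auto
    ultimately show ?thesis by (auto simp: Z_def)
  qed
  have prd: "Z (\<lambda>x. p x * of_real (\<Prod>j\<in>J. ?k j x))" if "finite J" "Z p" for p J
    using that
  proof (induction J)
    case (insert j J)
    have "Z (\<lambda>x. p x * of_real (\<Prod>j\<in>J. ?k j x) * of_real (?k j x))"
      by (rule step) (use insert in auto)
    then show ?case using insert by (simp add: mult_ac)
  qed simp
  have "Z (\<lambda>x. P x * of_real (peak L x ^ N))"
  proof (induction N)
    case 0 then show ?case using assms by (simp add: Z_def)
  next
    case (Suc N)
    show ?case using prd[OF _ Suc, of UNIV] by (simp add: peak_def mult_ac)
  qed
  then show ?thesis by (auto simp: Z_def)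
qed

text \<open>If P 0 were nonzero, the integrals against the powers of \<open>peak\<close> would be
  dominated by a neighbourhood of 0, where the kernel is at least q', since away from 0 it is at
  most q < q'. But these integrals all vanish.\<close>

lemma vanishing_coefficients_0:
  fixes P :: "real ^ 'n::finite \<Rightarrow> complex"
  assumes L: "L > 0" and P: "continuous_on UNIV P"
    and 0: "\<And>l. (\<integral>x. indicator (cube L) x *\<^sub>R (P x * char L l x) \<partial>lborel) = 0"
  shows "P 0 = 0"
proof (rule ccontr)
  assume nz: "P 0 \<noteq> 0"
  \<comment> \<open>Normalised to be real with value 1 at the origin, so that positivity near 0
    makes sense.\<close>
  define F where "F x = Re (P x / P 0)" for x
  have F0: "F 0 = 1" using nz by (simp add: F_def)
  have Fc: "continuous_on UNIV F" unfolding F_def by (intro continuous_intros P) (use nz in simp)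
  let ?B = "cbox (\<chi> j. - L/2) (\<chi> j. L/2) :: (real^'n) set"
  have I0: "(\<integral>x. indicator (cube L) x *\<^sub>R (F x * peak L x ^ N) \<partial>lborel) = 0" for N
  proof -
    have i: "integrable lborel (\<lambda>x. indicator (cube L) x *\<^sub>R (P x / P 0 * of_real (peak L x ^ N)))"
      by (intro integrable_cube_cont continuous_intros P continuous_peak) (use nz in simp)
    have "(\<integral>x. indicator (cube L) x *\<^sub>R (P x / P 0 * of_real (peak L x ^ N)) \<partial>lborel)
       = (\<integral>x. indicator (cube L) x *\<^sub>R (P x * of_real (peak L x ^ N) * char L (\<lambda>_. 0) x) / P 0 \<partial>lborel)"
      by (intro Bochner_Integration.integral_cong) (auto simp: scaleR_conv_of_real)
    also have "\<dots> = 0"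
      using vanishing_coefficients_mult_peak[OF P 0, of N "\<lambda>_. 0"] by simp
    finally have "Re (\<integral>x. indicator (cube L) x *\<^sub>R (P x / P 0 * of_real (peak L x ^ N)) \<partial>lborel) = 0" by simp
    moreover have "Re (c *\<^sub>R (z * of_real y)) = c *\<^sub>R (Re z * y)" for c y z by simp
    ultimately show ?thesis unfolding integral_Re[OF i, symmetric] F_def by (simp only:)
  qed
  obtain \<delta> where d: "\<delta> > 0" "\<And>x. norm x < \<delta> \<Longrightarrow> F x \<ge> 1/2"
  proof -
    have "isCont F 0" using Fc by (simp add: continuous_on_eq_continuous_at)
    then obtain \<delta> where "\<delta> > 0" "\<And>x. dist x 0 < \<delta> \<Longrightarrow> dist (F x) (F 0) < 1/2"
      unfolding continuous_at_eps_delta by (metis half_gt_zero zero_less_one)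
    moreover have "1/2 \<le> F x" if "dist (F x) (F 0) < 1/2" for x
      using that F0 unfolding dist_real_def by linarith
    ultimately show ?thesis by (intro that[of \<delta>]) auto
  qed
  obtain q where q: "0 \<le> q" "q < 1" "\<And>x. x \<in> ?B \<Longrightarrow> norm x \<ge> \<delta> \<Longrightarrow> peak L x \<le> q"
  proof (cases "?B - ball 0 \<delta> = {}")
    case True
    then show ?thesis by (intro that[of 0]) (auto simp: dist_norm)
  next
    case False
    have "compact (?B - ball 0 \<delta>)" by (intro compact_diff) auto
    then obtain x where x: "x \<in> ?B - ball 0 \<delta>" "\<And>y. y \<in> ?B - ball 0 \<delta> \<Longrightarrow> peak L y \<le> peak L x"
      using continuous_attains_sup[of "?B - ball 0 \<delta>" "peak L"] False continuous_on_subset[OF continuous_peak] by blast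
    show ?thesis
      using x d(1) by (intro that[of "peak L x"] peak_less_1 L peak_nonneg) auto
  qed
  \<comment> \<open>Midway between q, the bound for the kernel at distance at least \<delta>, and
    its maximum 1: the kernel still exceeds q' near 0, and the ratio of the two powers tends to
    0.\<close>
  define q' where "q' = (1 + q) / 2"
  have q': "q < q'" "q' < 1" "q' > 0" using q by (auto simp: q'_def)
  obtain \<delta>1 where d1: "\<delta>1 > 0" "\<And>x :: real^'n. norm x < \<delta>1 \<Longrightarrow> peak L x \<ge> q'"
  proof -
    have "continuous_on UNIV (peak L :: real^'n \<Rightarrow> real)" by (rule continuous_peak)
    then have "isCont (peak L) (0 :: real^'n)" by (simp add: continuous_on_eq_continuous_at)
    then obtain \<delta> where *: "\<delta> > 0" "\<And>x :: real^'n. dist x 0 < \<delta> \<Longrightarrow> dist (peak L x) (peak L 0) < 1 - q'"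
      using q' unfolding continuous_at_eps_delta by (elim allE[of _ "1 - q'"]) auto
    show ?thesis
    proof (rule that[OF *(1)])
      fix x :: "real^'n" assume "norm x < \<delta>"
      then have "dist (peak L x) (peak L 0) < 1 - q'" using *(2)[of x] by simp
      then show "q' \<le> peak L x" unfolding dist_real_def peak_0 by linarith
    qed
  qed
  \<comment> \<open>Inside this ball F \<ge> 1/2, the kernel is at least q', and the ball lies in
    the cube.\<close>
  define r where "r = min \<delta> (min \<delta>1 (L/2))"
  have r: "r > 0" "r \<le> \<delta>" "r \<le> \<delta>1" "r \<le> L/2" using d d1 L by (auto simp: r_def)
  define V where "V = measure lborel (ball 0 r :: (real^'n) set)"
  have V: "V > 0" using content_ball_pos[OF r(1), of "0 :: real^'n"] by (simp add: V_def measure_completion)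
  have bV: "ball 0 r \<subseteq> (cube L :: (real^'n) set)"
  proof
    fix x :: "real^'n" assume "x \<in> ball 0 r"
    then have "norm x < L/2" using r by simp
    then have "- L/2 \<le> x $ j \<and> x $ j < L/2" for j using component_le_norm_cart[of x j] by linarith
    then show "x \<in> cube L" by (simp add: cube_def)
  qed
  obtain M where M: "M > 0" "\<And>x. x \<in> ?B \<Longrightarrow> \<bar>F x\<bar> \<le> M"
  proof -
    have "compact (F ` ?B)" by (intro compact_continuous_image continuous_on_subset[OF Fc]) auto
    then have "bounded (F ` ?B)" by (rule compact_imp_bounded)
    then obtain M where M: "\<forall>y\<in>F ` ?B. norm y \<le> M" unfolding bounded_iff by blast
    show ?thesis
    proof (rule that[of "max M 1"])
      fix x assume "x \<in> ?B"
      then have "norm (F x) \<le> M" using M by blast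
      then show "\<bar>F x\<bar> \<le> max M 1" by simp
    qed simp
  qed
  define D where "D = L ^ CARD('n)"
  have D: "D > 0" "integrable lborel (indicator (cube L) :: real^'n \<Rightarrow> real)"
    "(\<integral>x. indicator (cube L) (x :: real^'n) \<partial>lborel) = D"
    using L indicator_cube_integral[OF L, where 'n='n] by (auto simp: D_def)
  have Vi: "integrable lborel (indicator (ball 0 r) :: real^'n \<Rightarrow> real)"
    "(\<integral>x. indicator (ball 0 r) (x :: real^'n) \<partial>lborel) = V"
    using emeasure_lborel_ball_finite[of "0 :: real^'n" r] by (auto simp: V_def intro!: integrable_real_indicator)
  \<comment> \<open>The integrand is bounded below on three zones: by the positive term on the small
    ball, by 0 up to radius \<delta>, where F is still positive, and by \<open>- M * q ^ N\<close>
    on the rest of the cube.\<close>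
  have key: "(1/2) * q' ^ N * V \<le> M * q ^ N * D" for N
  proof -
    have "(1/2) * q' ^ N * V - M * q ^ N * D
       = (\<integral>x. (1/2) * q' ^ N * indicator (ball 0 r) x - M * q ^ N * indicator (cube L) (x :: real^'n) \<partial>lborel)"
      using D Vi by simp
    also have "\<dots> \<le> (\<integral>x. indicator (cube L) x *\<^sub>R (F x * peak L x ^ N) \<partial>lborel)"
    proof (rule integral_mono)
      show "integrable lborel (\<lambda>x. (1/2) * q' ^ N * indicator (ball 0 r) x - M * q ^ N * indicator (cube L) (x :: real^'n))"
        using D Vi by simp
      show "integrable lborel (\<lambda>x. indicator (cube L) x *\<^sub>R (F x * peak L x ^ N))"
        by (intro integrable_cube_cont continuous_intros Fc continuous_peak)
      fix x :: "real^'n"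
      show "(1/2) * q' ^ N * indicator (ball 0 r) x - M * q ^ N * indicator (cube L) x
          \<le> indicator (cube L) x *\<^sub>R (F x * peak L x ^ N)"
      proof (cases "x \<in> cube L")
        case False
        then have "x \<notin> ball 0 r" using bV by blast
        with False show ?thesis by simp
      next
        case True
        then have xB: "x \<in> ?B" using cube_subset_cbox by blast
        have Mq: "0 \<le> M * q ^ N" using M q by simp
        consider "norm x < r" | "r \<le> norm x" "norm x < \<delta>" | "norm x \<ge> \<delta>" by linarith
        then show ?thesis
        proof cases
          case 1
          have "(1/2) * q' ^ N \<le> F x * peak L x ^ N"
            using 1 r d(2)[of x] d1(2)[of x] q' by (intro mult_mono power_mono) auto
          moreover have "x \<in> ball 0 r" using 1 by simp
          ultimately show ?thesis using True Mq by simp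
        next
          case 2
          have "0 \<le> F x * peak L x ^ N"
            using d(2)[OF 2(2)] peak_nonneg[of L x] by simp
          moreover have "x \<notin> ball 0 r" using 2 by simp
          ultimately show ?thesis using True Mq by simp
        next
          case 3
          have "\<bar>F x * peak L x ^ N\<bar> \<le> M * q ^ N"
          proof -
            have "\<bar>peak L x ^ N\<bar> = peak L x ^ N" by (simp add: peak_nonneg)
            also have "\<dots> \<le> q ^ N" by (intro power_mono q(3)[OF xB 3] peak_nonneg)
            finally show ?thesis unfolding abs_mult using M(1)
              by (intro mult_mono M(2)[OF xB]) auto
          qed
          then have "- (M * q ^ N) \<le> F x * peak L x ^ N" by linarith
          moreover have "x \<notin> ball 0 r" using 3 r by simp
          ultimately show ?thesis using True by simp
        qed
      qed
    qed
    finally show ?thesis using I0 by simp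
  qed
  have "(\<lambda>N. (q / q') ^ N) \<longlonglongrightarrow> 0" using q q' by (intro LIMSEQ_realpow_zero) auto
  then have "\<forall>\<^sub>F N in sequentially. (q / q') ^ N < V / (2 * M * D)"
    using V M D by (intro order_tendstoD) auto
  then obtain N where "(q / q') ^ N < V / (2 * M * D)" by (auto simp: eventually_sequentially)
  then have "M * q ^ N * D < (1/2) * q' ^ N * V"
  proof -
    assume *: "(q / q') ^ N < V / (2 * M * D)"
    have p: "q' ^ N > 0" using q' by simp
    have "q ^ N = (q / q') ^ N * q' ^ N" using q'(3) by (simp add: power_divide)
    also have "\<dots> < V / (2 * M * D) * q' ^ N" by (rule mult_strict_right_mono[OF * p])
    finally have "M * D * q ^ N < M * D * (V / (2 * M * D) * q' ^ N)"
      using M D by (intro mult_strict_left_mono) auto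
    also have "\<dots> = (1/2) * q' ^ N * V" using M D by simp
    finally show ?thesis by (simp add: mult_ac)
  qed
  with key[of N] show False by simp
qed

section \<open>Poisson summation, Fourier inversion and Parseval\<close>

text \<open>The Weierstrass test on balls. The majorant may depend on the ball, because lattice sums
  of translates converge only locally uniformly.\<close>

lemma continuous_on_infsum:
  fixes f :: "'i \<Rightarrow> 'a::euclidean_space \<Rightarrow> 'b::banach"
  assumes c: "\<And>i. continuous_on UNIV (f i)"
    and b: "\<And>R. R > 0 \<Longrightarrow> \<exists>M. M summable_on UNIV \<and> (\<forall>i. \<forall>x\<in>ball 0 R. norm (f i x) \<le> M i)"
  shows "continuous_on UNIV (\<lambda>x. \<Sum>\<^sub>\<infinity>i. f i x)"
proof -
  have "continuous (at x) (\<lambda>x. \<Sum>\<^sub>\<infinity>i. f i x)" for x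
  proof -
    define R where "R = norm x + 1"
    have R: "R > 0" "x \<in> ball 0 R" by (auto simp: R_def add_nonneg_pos)
    obtain M where M: "M summable_on UNIV" "\<And>i x. x \<in> ball 0 R \<Longrightarrow> norm (f i x) \<le> M i"
      using b[OF R(1)] by auto
    have "uniform_limit (ball 0 R) (\<lambda>X y. \<Sum>i\<in>X. f i y) (\<lambda>y. \<Sum>\<^sub>\<infinity>i. f i y) (finite_subsets_at_top UNIV)"
      by (rule Weierstrass_m_test_general[OF M(2) M(1)])
    then have "continuous_on (ball 0 R) (\<lambda>y. \<Sum>\<^sub>\<infinity>i. f i y)"
      by (rule uniform_limit_theorem[rotated])
         (auto intro!: always_eventually continuous_intros continuous_on_subset[OF c])
    then show ?thesis using R by (simp add: continuous_on_eq_continuous_at)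
  qed
  then show ?thesis by (simp add: continuous_on_eq_continuous_at)
qed

lemma rapid_periodization_continuous:
  assumes f: "rapid (f :: ('n::finite) fn)" and L: "L > 0"
  shows "continuous_on UNIV (\<lambda>x. \<Sum>\<^sub>\<infinity>l. f (x + L *\<^sub>R ivec l))"
proof (rule continuous_on_infsum)
  fix l show "continuous_on UNIV (\<lambda>x. f (x + L *\<^sub>R ivec l))"
    by (intro rapid_cont rapid_shift f)
next
  fix R :: real assume R: "R > 0"
  obtain C where C: "C > 0" "\<And>x. norm (f x) \<le> C * decay x" using rapid_le_decay[OF f] by auto
  let ?M = "\<lambda>l. C * (1 + R) ^ (2 * CARD('n)) * decay (0 + L *\<^sub>R ivec l :: real^'n)"
  have "?M summable_on UNIV" by (intro summable_on_cmult_right summable_decay L)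
  moreover have "norm (f (x + L *\<^sub>R ivec l)) \<le> ?M l" if x: "x \<in> ball 0 R" for x l
  proof -
    have "norm (f (x + L *\<^sub>R ivec l)) \<le> C * decay (x + L *\<^sub>R ivec l)" by (rule C)
    also have "decay (x + L *\<^sub>R ivec l) \<le> (1 + norm (L *\<^sub>R ivec l - (x + L *\<^sub>R ivec l))) ^ (2 * CARD('n)) * decay (L *\<^sub>R ivec l :: real^'n)"
      by (rule decay_peetre)
    also have "\<dots> \<le> (1 + R) ^ (2 * CARD('n)) * decay (L *\<^sub>R ivec l :: real^'n)"
      using x by (intro mult_right_mono power_mono) auto
    finally show ?thesis using C(1) by (simp add: mult.assoc)
  qed
  ultimately show "\<exists>M. M summable_on UNIV \<and> (\<forall>l. \<forall>x\<in>ball 0 R. norm (f (x + L *\<^sub>R ivec l)) \<le> M l)" by blast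
qed

lemma has_sum_single:
  fixes f :: "'i \<Rightarrow> 'a::{topological_comm_monoid_add, t2_space}"
  assumes "\<And>i. i \<noteq> i0 \<Longrightarrow> f i = 0"
  shows "(f has_sum f i0) UNIV"
proof -
  have "(f has_sum sum f {i0}) {i0}" by (rule has_sum_finite) simp
  also have "(f has_sum sum f {i0}) {i0} \<longleftrightarrow> (f has_sum f i0) UNIV"
    by (subst has_sum_cong_neutral[of UNIV "{i0}" f f]) (auto simp: assms)
  finally show ?thesis .
qed

text \<open>The periodisation P1 and the Fourier series P2 are both continuous, and
  \<open>D * P1\<close> has the same coefficients as P2. Uniqueness of coefficients at the origin
  gives the identity, so no pointwise convergence theory of Fourier series is used.\<close>

lemma poisson_summation:
  fixes G :: "('n::finite) fn"
  assumes L: "L > 0" and G: "rapid G"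
    and sm: "(\<lambda>l. norm (fourier G ((2 * pi / L) *\<^sub>R ivec l))) summable_on UNIV"
  shows "of_real (L ^ CARD('n)) * (\<Sum>\<^sub>\<infinity>r. G (L *\<^sub>R ivec r)) = (\<Sum>\<^sub>\<infinity>l. fourier G ((2 * pi / L) *\<^sub>R ivec l))"
proof -
  define D :: complex where "D = of_real (L ^ CARD('n))"
  have D: "D \<noteq> 0" using L by (simp add: D_def)
  define c where "c l = fourier G ((2 * pi / L) *\<^sub>R ivec l)" for l
  define P1 where "P1 x = (\<Sum>\<^sub>\<infinity>r. G (x + L *\<^sub>R ivec r))" for x
  define P2 where "P2 x = (\<Sum>\<^sub>\<infinity>l. c l * char L l x)" for x
  have c1: "continuous_on UNIV P1" unfolding P1_def by (rule rapid_periodization_continuous[OF G L])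
  have csm: "(\<lambda>l. norm (c l)) summable_on UNIV" using sm by (simp add: c_def)
  have c2: "continuous_on UNIV P2" unfolding P2_def
  proof (rule continuous_on_infsum)
    show "\<exists>M. M summable_on UNIV \<and> (\<forall>l. \<forall>x\<in>ball 0 R. norm (c l * char L l x) \<le> M l)" for R :: real
      using csm by (intro exI[of _ "\<lambda>l. norm (c l)"]) (auto simp: norm_mult)
  qed (intro continuous_intros)
  \<comment> \<open>The pairing with the character is taken without conjugation, which is why the
    index changes sign.\<close>
  have coef1: "(\<integral>x. indicator (cube L) x *\<^sub>R (P1 x * char L m x) \<partial>lborel) = c (\<lambda>j. - m j)" for m
  proof -
    define g where "g x = G x * char L m x" for x
    have g: "rapid g" unfolding g_def char_def by (intro rapid_cis G continuous_intros)
    have "P1 x * char L m x = (\<Sum>\<^sub>\<infinity>r. g (x + L *\<^sub>R ivec r))" for x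
      unfolding P1_def g_def by (simp add: char_periodic[OF L] infsum_cmult_left')
    then have "(\<integral>x. indicator (cube L) x *\<^sub>R (P1 x * char L m x) \<partial>lborel) = (\<integral>x. g x \<partial>lborel)"
      using tiling_periodization[OF L rapid_integrable[OF g] rapid_summable[OF g L]] by simp
    also have "\<dots> = c (\<lambda>j. - m j)"
      unfolding c_def fourier_lebesgue[OF G] g_def char_def
      by (simp add: ivec_uminus inner_commute)
    finally show ?thesis .
  qed
  have coef2: "(\<integral>x. indicator (cube L) x *\<^sub>R (P2 x * char L m x) \<partial>lborel) = c (\<lambda>j. - m j) * D" for m
  proof -
    let ?h = "\<lambda>l x. indicator (cube L) x *\<^sub>R (c l * char L l x * char L m x)"
    have i: "integrable lborel (?h l)" for l by (intro integrable_cube_cont continuous_intros)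
    have nI: "(\<integral>x. norm (?h l x) \<partial>lborel) = L ^ CARD('n) * norm (c l)" for l
      using indicator_cube_integral[OF L, where 'n='n] by (simp add: norm_mult)
    have "((\<lambda>l. \<integral>x. ?h l x \<partial>lborel) has_sum (\<integral>x. (\<Sum>\<^sub>\<infinity>l. ?h l x) \<partial>lborel)) UNIV"
    proof (rule has_sum_integral(1)[OF i])
      show "(\<lambda>l. norm (?h l x)) summable_on UNIV" for x
        using csm by (simp add: norm_mult summable_on_cmult_right)
      show "(\<lambda>l. \<integral>x. norm (?h l x) \<partial>lborel) summable_on UNIV"
        unfolding nI by (intro summable_on_cmult_right csm)
    qed
    also have "(\<lambda>x. \<Sum>\<^sub>\<infinity>l. ?h l x) = (\<lambda>x. indicator (cube L) x *\<^sub>R (P2 x * char L m x))"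
      unfolding P2_def by (simp add: infsum_scaleR_right infsum_cmult_left')
    also have "(\<lambda>l. \<integral>x. ?h l x \<partial>lborel) = (\<lambda>l. if l = (\<lambda>j. - m j) then c l * D else 0)"
    proof
      fix l
      have "(\<integral>x. ?h l x \<partial>lborel) = (\<integral>x. c l * (indicator (cube L) x *\<^sub>R char L (\<lambda>j. l j + m j) x) \<partial>lborel)"
        by (simp add: char_add mult.assoc)
      also have "\<dots> = c l * (if (\<lambda>j. l j + m j) = (\<lambda>_. 0) then D else 0)"
        by (subst Bochner_Integration.integral_mult_right_zero) (simp only: integral_char[OF L] D_def)
      also have "(\<lambda>j. l j + m j) = (\<lambda>_. 0) \<longleftrightarrow> l = (\<lambda>j. - m j)"
        by (auto simp: fun_eq_iff eq_neg_iff_add_eq_0)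
      finally show "(\<integral>x. ?h l x \<partial>lborel) = (if l = (\<lambda>j. - m j) then c l * D else 0)" by simp
    qed
    finally have A: "((\<lambda>l. if l = (\<lambda>j. - m j) then c l * D else 0) has_sum
       (\<integral>x. indicator (cube L) x *\<^sub>R (P2 x * char L m x) \<partial>lborel)) UNIV" .
    have "((\<lambda>l. if l = (\<lambda>j. - m j) then c l * D else 0) has_sum c (\<lambda>j. - m j) * D) UNIV"
      using has_sum_single[of "\<lambda>j. - m j" "\<lambda>l. if l = (\<lambda>j. - m j) then c l * D else 0"] by simp
    with A show ?thesis by (rule has_sum_unique)
  qed
  have "D * P1 0 - P2 0 = 0"
  proof (rule vanishing_coefficients_0[OF L])
    show "continuous_on UNIV (\<lambda>x. D * P1 x - P2 x)" by (intro continuous_intros c1 c2)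
    fix m
    have i: "integrable lborel (\<lambda>x. indicator (cube L) x *\<^sub>R (P1 x * char L m x))"
      "integrable lborel (\<lambda>x. indicator (cube L) x *\<^sub>R (P2 x * char L m x))"
      by (intro integrable_cube_cont continuous_intros c1 c2)+
    have "(\<integral>x. indicator (cube L) x *\<^sub>R ((D * P1 x - P2 x) * char L m x) \<partial>lborel)
      = (\<integral>x. D * (indicator (cube L) x *\<^sub>R (P1 x * char L m x)) - indicator (cube L) x *\<^sub>R (P2 x * char L m x) \<partial>lborel)"
      by (intro Bochner_Integration.integral_cong) (auto simp: algebra_simps)
    also have "\<dots> = D * (\<integral>x. indicator (cube L) x *\<^sub>R (P1 x * char L m x) \<partial>lborel) - (\<integral>x. indicator (cube L) x *\<^sub>R (P2 x * char L m x) \<partial>lborel)"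
      by (subst Bochner_Integration.integral_diff)
         (intro Bochner_Integration.integrable_mult_right i, rule i, simp only: Bochner_Integration.integral_mult_right_zero)
    also have "\<dots> = 0" unfolding coef1 coef2 by simp
    finally show "(\<integral>x. indicator (cube L) x *\<^sub>R ((D * P1 x - P2 x) * char L m x) \<partial>lborel) = 0" .
  qed
  then show ?thesis by (simp add: P1_def P2_def D_def c_def char_def)
qed

lemma fourier_modulated_shift:
  assumes f: "rapid f"
  shows "fourier (\<lambda>t. f (t + x) * cis (- (t \<bullet> \<theta>))) \<eta> = cis (x \<bullet> (\<theta> + \<eta>)) * fourier f (\<theta> + \<eta>)"
proof -
  have r: "rapid (\<lambda>t. f (t + x) * cis (- (t \<bullet> \<theta>)))"
    by (intro rapid_cis rapid_shift f continuous_intros)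
  have "fourier (\<lambda>t. f (t + x) * cis (- (t \<bullet> \<theta>))) \<eta>
     = (\<integral>t. f (t + x) * cis (- (t \<bullet> \<theta>)) * cis (- (t \<bullet> \<eta>)) \<partial>lborel)"
    by (rule fourier_lebesgue[OF r])
  also have "\<dots> = (\<integral>t. cis (x \<bullet> (\<theta> + \<eta>)) * (f (t + x) * cis (- ((t + x) \<bullet> (\<theta> + \<eta>)))) \<partial>lborel)"
  proof (intro Bochner_Integration.integral_cong refl)
    fix t
    have "cis (- (t \<bullet> \<theta>)) * cis (- (t \<bullet> \<eta>)) = cis (x \<bullet> (\<theta> + \<eta>)) * cis (- ((t + x) \<bullet> (\<theta> + \<eta>)))"
      by (simp add: cis_mult algebra_simps)
    then show "f (t + x) * cis (- (t \<bullet> \<theta>)) * cis (- (t \<bullet> \<eta>)) = cis (x \<bullet> (\<theta> + \<eta>)) * (f (t + x) * cis (- ((t + x) \<bullet> (\<theta> + \<eta>))))"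
      by (simp add: mult.assoc mult.left_commute)
  qed
  also have "\<dots> = cis (x \<bullet> (\<theta> + \<eta>)) * (\<integral>t. f (t + x) * cis (- ((t + x) \<bullet> (\<theta> + \<eta>))) \<partial>lborel)"
    by (rule Bochner_Integration.integral_mult_right_zero)
  also have "(\<integral>t. f (t + x) * cis (- ((t + x) \<bullet> (\<theta> + \<eta>))) \<partial>lborel) = fourier f (\<theta> + \<eta>)"
    unfolding fourier_lebesgue[OF f]
    by (rule integral_translate[of "\<lambda>t. f t * cis (- (t \<bullet> (\<theta> + \<eta>)))" x])
  finally show ?thesis .
qed

text \<open>Poisson summation for all modulations of a translate of \<^term>\<open>f\<close>, integrated over the modulation parameter, tiles the
  frequency space and leaves a single term on the other side.\<close>

lemma fourier_inversion:
  fixes f :: "('n::finite) fn"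
  assumes f: "rapid f" and ff: "rapid (fourier f)"
  shows "of_real ((2 * pi) ^ CARD('n)) * f x = (\<integral>\<xi>. fourier f \<xi> * cis (x \<bullet> \<xi>) \<partial>lborel)"
proof -
  define H where "H \<xi> = fourier f \<xi> * cis (x \<bullet> \<xi>)" for \<xi>
  have H: "rapid H" unfolding H_def by (intro rapid_cis ff continuous_intros)
  let ?L = "2 * pi"
  have pi2: "?L > 0" by simp
  \<comment> \<open>Summation over the integer lattice has the dual lattice of step 2 pi. So
    \<theta> ranging over a cube of side 2 pi unfolds the right side to the inversion integral,
    while on the left the characters with r \<noteq> 0 integrate to 0.\<close>
  have P: "(\<Sum>\<^sub>\<infinity>r. f (ivec r + x) * cis (- (ivec r \<bullet> \<theta>))) = (\<Sum>\<^sub>\<infinity>l. H (\<theta> + ?L *\<^sub>R ivec l))" for \<theta>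
  proof -
    let ?G = "\<lambda>t. f (t + x) * cis (- (t \<bullet> \<theta>))"
    have r: "rapid ?G" by (intro rapid_cis rapid_shift f continuous_intros)
    have eq: "fourier ?G ((2 * pi / 1) *\<^sub>R ivec l) = H (\<theta> + ?L *\<^sub>R ivec l)" for l
      unfolding fourier_modulated_shift[OF f] H_def by simp
    have "of_real (1 ^ CARD('n)) * (\<Sum>\<^sub>\<infinity>r. ?G (1 *\<^sub>R ivec r)) = (\<Sum>\<^sub>\<infinity>l. fourier ?G ((2 * pi / 1) *\<^sub>R ivec l))"
      by (rule poisson_summation[OF _ r]) (simp only: eq zero_less_one rapid_summable[OF H pi2] | simp only: zero_less_one)+
    then show ?thesis unfolding eq by simp
  qed
  have "(\<integral>\<theta>. indicator (cube ?L) \<theta> *\<^sub>R (\<Sum>\<^sub>\<infinity>l. H (\<theta> + ?L *\<^sub>R ivec l)) \<partial>lborel) = (\<integral>\<xi>. H \<xi> \<partial>lborel)"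
    using pi_gt_zero by (intro tiling_periodization rapid_integrable rapid_summable H) linarith+
  then have E: "(\<integral>\<theta>. (\<Sum>\<^sub>\<infinity>r. indicator (cube ?L) \<theta> *\<^sub>R (f (ivec r + x) * cis (- (ivec r \<bullet> \<theta>)))) \<partial>lborel) = (\<integral>\<xi>. H \<xi> \<partial>lborel)"
    unfolding P[symmetric] by (simp add: infsum_scaleR_right)
  let ?h = "\<lambda>r \<theta>. indicator (cube ?L) \<theta> *\<^sub>R (f (ivec r + x) * cis (- (ivec r \<bullet> (\<theta> :: real^'n))))"
  have sf: "(\<lambda>r. norm (f (ivec r + x))) summable_on UNIV"
    using rapid_summable[OF f zero_less_one, of x] by (simp add: add.commute)
  have "((\<lambda>r. \<integral>\<theta>. ?h r \<theta> \<partial>lborel) has_sum (\<integral>\<theta>. (\<Sum>\<^sub>\<infinity>r. ?h r \<theta>) \<partial>lborel)) UNIV"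
  proof (rule has_sum_integral(1))
    show "integrable lborel (?h r)" for r by (intro integrable_cube_cont continuous_intros)
    show "(\<lambda>r. norm (?h r \<theta>)) summable_on UNIV" for \<theta>
      using sf by (simp add: norm_mult summable_on_cmult_right)
    have "(\<integral>\<theta>. norm (?h r \<theta>) \<partial>lborel) = ?L ^ CARD('n) * norm (f (ivec r + x))" for r
      using indicator_cube_integral[of ?L, where 'n='n] by (simp add: norm_mult)
    then show "(\<lambda>r. \<integral>\<theta>. norm (?h r \<theta>) \<partial>lborel) summable_on UNIV"
      using sf by (simp only: summable_on_cmult_right)
  qed
  also have "(\<lambda>r. \<integral>\<theta>. ?h r \<theta> \<partial>lborel) = (\<lambda>r. if r = (\<lambda>_. 0) then of_real (?L ^ CARD('n)) * f x else 0)"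
  proof
    fix r :: "'n \<Rightarrow> int"
    have "(\<integral>\<theta>. ?h r \<theta> \<partial>lborel) = (\<integral>\<theta>. f (ivec r + x) * (indicator (cube ?L) \<theta> *\<^sub>R char ?L (\<lambda>j. - r j) \<theta>) \<partial>lborel)"
      by (intro Bochner_Integration.integral_cong) (auto simp: char_def ivec_uminus)
    also have "\<dots> = f (ivec r + x) * (if (\<lambda>j. - r j) = (\<lambda>_. 0) then of_real (?L ^ CARD('n)) else 0)"
      by (subst Bochner_Integration.integral_mult_right_zero) (simp only: integral_char[OF pi2])
    also have "(\<lambda>j. - r j) = (\<lambda>_. 0) \<longleftrightarrow> r = (\<lambda>_. 0)" by (auto simp: fun_eq_iff)
    finally show "(\<integral>\<theta>. ?h r \<theta> \<partial>lborel) = (if r = (\<lambda>_. 0) then of_real (?L ^ CARD('n)) * f x else 0)" by auto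
  qed
  finally have A: "((\<lambda>r::'n \<Rightarrow> int. if r = (\<lambda>_. 0) then of_real (?L ^ CARD('n)) * f x else 0) has_sum (\<integral>\<xi>. H \<xi> \<partial>lborel)) UNIV"
    unfolding E .
  have B: "((\<lambda>r::'n \<Rightarrow> int. if r = (\<lambda>_. 0) then of_real (?L ^ CARD('n)) * f x else 0) has_sum of_real (?L ^ CARD('n)) * f x) UNIV"
    using has_sum_single[of "\<lambda>_. 0" "\<lambda>r::'n \<Rightarrow> int. if r = (\<lambda>_. 0) then of_real (?L ^ CARD('n)) * f x else 0"] by simp
  from has_sum_unique[OF B A] show ?thesis by (simp add: H_def)
qed

lemma fubini_decay:
  fixes k :: "real ^ 'n::finite \<Rightarrow> real ^ 'm::finite \<Rightarrow> complex"
  assumes c: "continuous_on UNIV (\<lambda>p. k (fst p) (snd p))"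
    and b: "\<And>x y. norm (k x y) \<le> C * decay x * decay y"
  shows "(\<integral>y. (\<integral>x. k x y \<partial>lborel) \<partial>lborel) = (\<integral>x. (\<integral>y. k x y \<partial>lborel) \<partial>lborel)"
proof (rule lborel_pair.Fubini_integral)
  have m: "(\<lambda>p. k (fst p) (snd p)) \<in> borel_measurable (lborel \<Otimes>\<^sub>M lborel)"
    unfolding lborel_prod by (rule borel_measurable_cont_lborel[OF c])
  have cy: "continuous_on UNIV (k x)" for x
    using continuous_on_compose2[OF c, of UNIV "\<lambda>y. (x, y)"] continuous_on_Pair[OF continuous_on_const continuous_on_id, of UNIV x]
    by simp
  have iy: "integrable lborel (k x)" for x
    by (rule integrable_le_decay[OF cy, where C="C * decay x"]) (use b in \<open>auto simp: mult.assoc\<close>)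
  have "integrable (lborel \<Otimes>\<^sub>M lborel) (\<lambda>p. k (fst p) (snd p))"
  proof (rule lborel_pair.Fubini_integrable[OF m])
    have mm: "(\<lambda>x. \<integral>y. norm (k x y) \<partial>lborel) \<in> borel_measurable lborel"
      using m by measurable
    have "integrable lborel (\<lambda>x :: real^'n. \<bar>C\<bar> * (\<integral>y. decay (y :: real^'m) \<partial>lborel) * decay x)"
      by (intro integrable_mult_right integrable_decay)
    then show "integrable lborel (\<lambda>x. \<integral>y. norm (k (fst (x, y)) (snd (x, y))) \<partial>lborel)"
      unfolding fst_conv snd_conv
    proof (rule Bochner_Integration.integrable_bound[OF _ mm], intro AE_I2)
      fix x
      have "(\<integral>y. norm (k x y) \<partial>lborel) \<le> (\<integral>y. \<bar>C\<bar> * decay x * decay (y :: real^'m) \<partial>lborel)"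
      proof (rule integral_mono)
        fix y show "norm (k x y) \<le> \<bar>C\<bar> * decay x * decay y"
          using b[of x y] by (rule order_trans) (intro mult_right_mono, auto)
      qed (intro integrable_norm iy integrable_mult_right integrable_decay)+
      then show "norm (\<integral>y. norm (k x y) \<partial>lborel) \<le> norm (\<bar>C\<bar> * (\<integral>y. decay (y :: real^'m) \<partial>lborel) * decay x)"
        by (simp add: integral_nonneg_AE mult_ac abs_mult)
    qed
    show "AE x in lborel. integrable lborel (\<lambda>y. k (fst (x, y)) (snd (x, y)))" using iy by simp
  qed
  then show "integrable (lborel \<Otimes>\<^sub>M lborel) (\<lambda>(x, y). k x y)" by (simp add: case_prod_beta')
qed

text \<open>Inversion is inserted for f alone and the two integrals are exchanged, so decay of the
  Fourier transform is required of one factor only.\<close>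

lemma parseval:
  fixes f g :: "('n::finite) fn"
  assumes f: "rapid f" and ff: "rapid (fourier f)" and g: "rapid g"
  shows "of_real ((2 * pi) ^ CARD('n)) * (\<integral>t. f t * cnj (g t) \<partial>lborel) = (\<integral>\<xi>. fourier f \<xi> * cnj (fourier g \<xi>) \<partial>lborel)"
proof -
  obtain C1 where C1: "C1 > 0" "\<And>x. norm (fourier f x) \<le> C1 * decay x" using rapid_le_decay[OF ff] by auto
  obtain C2 where C2: "C2 > 0" "\<And>x. norm (g x) \<le> C2 * decay x" using rapid_le_decay[OF g] by auto
  let ?k = "\<lambda>\<xi> t. fourier f \<xi> * cis (t \<bullet> \<xi>) * cnj (g t)"
  have "of_real ((2 * pi) ^ CARD('n)) * (\<integral>t. f t * cnj (g t) \<partial>lborel)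
     = (\<integral>t. of_real ((2 * pi) ^ CARD('n)) * f t * cnj (g t) \<partial>lborel)"
    by (simp add: mult.assoc)
  also have "\<dots> = (\<integral>t. (\<integral>\<xi>. ?k \<xi> t \<partial>lborel) \<partial>lborel)"
    unfolding fourier_inversion[OF f ff] by (simp only: Bochner_Integration.integral_mult_left_zero)
  also have "\<dots> = (\<integral>\<xi>. (\<integral>t. ?k \<xi> t \<partial>lborel) \<partial>lborel)"
  proof (rule fubini_decay[where C="C1 * C2"])
    show "continuous_on UNIV (\<lambda>p. fourier f (fst p) * cis (snd p \<bullet> fst p) * cnj (g (snd p)))"
      by (intro continuous_intros continuous_on_compose2[OF rapid_cont[OF ff]] continuous_on_compose2[OF rapid_cont[OF g]]) auto
    fix \<xi> t
    have "norm (?k \<xi> t) = norm (fourier f \<xi>) * norm (g t)" by (simp add: norm_mult)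
    also have "\<dots> \<le> (C1 * decay \<xi>) * (C2 * decay t)" by (intro mult_mono C1 C2) (use C1 in auto)
    finally show "norm (?k \<xi> t) \<le> C1 * C2 * decay \<xi> * decay t" by (simp add: mult_ac)
  qed
  also have "\<dots> = (\<integral>\<xi>. fourier f \<xi> * cnj (fourier g \<xi>) \<partial>lborel)"
  proof (intro Bochner_Integration.integral_cong refl)
    fix \<xi>
    have "(\<integral>t. ?k \<xi> t \<partial>lborel) = fourier f \<xi> * (\<integral>t. cnj (g t * cis (- (t \<bullet> \<xi>))) \<partial>lborel)"
      by (simp add: mult_ac cis_cnj flip: Bochner_Integration.integral_mult_right_zero)
    also have "\<dots> = fourier f \<xi> * cnj (\<integral>t. g t * cis (- (t \<bullet> \<xi>)) \<partial>lborel)"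
      by (simp only: Bochner_Integration.integral_cnj)
    finally show "(\<integral>t. ?k \<xi> t \<partial>lborel) = fourier f \<xi> * cnj (fourier g \<xi>)"
      unfolding fourier_lebesgue[OF g] .
  qed
  finally show ?thesis .
qed

section \<open>Autocorrelations and sums of squared Fourier samples\<close>

definition autocorr :: "('n::finite) fn \<Rightarrow> 'n fn" where
  "autocorr G y = (\<integral>x. G (x + y) * cnj (G x) \<partial>lborel)"

text \<open>By Peetre's inequality a polynomial weight at y is shared between the two factors G (x +
  y) and G x, one of which also supplies the integrable majorant. Continuity is dominated
  convergence.\<close>

lemma rapid_autocorr:
  assumes G: "rapid (G :: ('n::finite) fn)"
  shows "rapid (autocorr G)"
  unfolding rapid_def
proof (intro conjI allI)
  obtain C0 where C0: "C0 > 0" "\<And>x. norm (G x) \<le> C0" using rapid_bound[OF G, of 0] by auto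
  have i: "integrable lborel (\<lambda>x. G (x + y) * cnj (G x))" for y
    by (intro rapid_integrable rapid_prod rapid_shift rapid_cnj G)
  show "continuous_on UNIV (autocorr G)"
  proof (rule continuous_on_sequentiallyI)
    fix u :: "nat \<Rightarrow> real^'n" and y assume u: "u \<longlonglongrightarrow> y"
    show "(\<lambda>n. autocorr G (u n)) \<longlonglongrightarrow> autocorr G y"
      unfolding autocorr_def
    proof (rule integral_dominated_convergence)
      show "integrable lborel (\<lambda>x. C0 * norm (G x))" by (intro integrable_mult_right integrable_norm rapid_integrable G)
      show "AE x in lborel. (\<lambda>n. G (x + u n) * cnj (G x)) \<longlonglongrightarrow> G (x + y) * cnj (G x)"
      proof (intro AE_I2 tendsto_intros)
        fix x
        have "isCont G (x + y)" using rapid_cont[OF G] by (simp add: continuous_on_eq_continuous_at)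
        then show "(\<lambda>n. G (x + u n)) \<longlonglongrightarrow> G (x + y)"
          by (rule isCont_tendsto_compose) (intro tendsto_intros u)
      qed
      show "AE x in lborel. norm (G (x + u n) * cnj (G x)) \<le> C0 * norm (G x)" for n
        using C0 by (intro AE_I2) (auto simp: norm_mult intro!: mult_right_mono)
    qed (use i in auto)
  qed
  fix k
  obtain C1 where C1: "C1 > 0" "\<And>x. (1 + norm x) ^ k * norm (G x) \<le> C1" using rapid_bound[OF G] by blast
  obtain C2 where C2: "C2 > 0" "\<And>x. (1 + norm x) ^ k * norm (G x) \<le> C2 * decay x" using rapid_decay_bound[OF G] by blast
  have "(1 + norm y) ^ k * norm (autocorr G y) \<le> C1 * C2 * (\<integral>x. decay (x :: real^'n) \<partial>lborel)" for y
  proof -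
    have "(1 + norm y) ^ k * norm (autocorr G y) \<le> (1 + norm y) ^ k * (\<integral>x. norm (G (x + y) * cnj (G x)) \<partial>lborel)"
      unfolding autocorr_def by (intro mult_left_mono integral_norm_bound) auto
    also have "\<dots> = (\<integral>x. (1 + norm y) ^ k * norm (G (x + y) * cnj (G x)) \<partial>lborel)" by simp
    also have "\<dots> \<le> (\<integral>x. C1 * C2 * decay (x :: real^'n) \<partial>lborel)"
    proof (rule integral_mono)
      fix x
      have "(1 + norm y) ^ k \<le> ((1 + norm (x + y)) * (1 + norm x)) ^ k"
        using peetre[of y "x + y"] by (intro power_mono) auto
      then have "(1 + norm y) ^ k * norm (G (x + y) * cnj (G x)) \<le> ((1 + norm (x + y)) * (1 + norm x)) ^ k * norm (G (x + y) * cnj (G x))"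
        by (intro mult_right_mono) auto
      also have "\<dots> = ((1 + norm (x + y)) ^ k * norm (G (x + y))) * ((1 + norm x) ^ k * norm (G x))"
        by (simp add: power_mult_distrib norm_mult mult_ac)
      also have "\<dots> \<le> C1 * (C2 * decay x)" by (intro mult_mono C1 C2) (use C1 in auto)
      finally show "(1 + norm y) ^ k * norm (G (x + y) * cnj (G x)) \<le> C1 * C2 * decay x" by (simp add: mult_ac)
    qed (intro integrable_mult_right integrable_norm i integrable_decay)+
    finally show ?thesis by simp
  qed
  then show "\<exists>C. \<forall>y. (1 + norm y) ^ k * norm (autocorr G y) \<le> C" by blast
qed

lemma fourier_autocorr:
  assumes G: "rapid (G :: ('n::finite) fn)"
  shows "fourier (autocorr G) \<xi> = of_real ((norm (fourier G \<xi>))\<^sup>2)"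
proof -
  obtain C1 where C1: "C1 > 0" "\<And>x. norm (G x) \<le> C1 * decay x" using rapid_le_decay[OF G] by auto
  obtain C2 where C2: "C2 > 0" "\<And>x. (1 + norm x) ^ (2 * CARD('n)) * norm (G x) \<le> C2 * decay x" using rapid_decay_bound[OF G] by blast
  let ?k = "\<lambda>x y. G (x + y) * cnj (G x) * cis (- (y \<bullet> \<xi>))"
  have "fourier (autocorr G) \<xi> = (\<integral>y. autocorr G y * cis (- (y \<bullet> \<xi>)) \<partial>lborel)"
    by (rule fourier_lebesgue[OF rapid_autocorr[OF G]])
  also have "\<dots> = (\<integral>y. (\<integral>x. ?k x y \<partial>lborel) \<partial>lborel)"
    unfolding autocorr_def by (simp only: Bochner_Integration.integral_mult_left_zero)
  also have "\<dots> = (\<integral>x. (\<integral>y. ?k x y \<partial>lborel) \<partial>lborel)"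
  proof (rule fubini_decay[where C="C1 * C2"])
    show "continuous_on UNIV (\<lambda>p. G (fst p + snd p) * cnj (G (fst p)) * cis (- (snd p \<bullet> \<xi>)))"
      by (intro continuous_intros continuous_on_compose2[OF rapid_cont[OF G]]) auto
    fix x y
    have "norm (?k x y) \<le> (C1 * decay (x + y)) * norm (G x)"
      by (simp add: norm_mult mult_right_mono C1)
    also have "decay (x + y) \<le> (1 + norm (y - (x + y))) ^ (2 * CARD('n)) * decay y" by (rule decay_peetre)
    also have "C1 * ((1 + norm (y - (x + y))) ^ (2 * CARD('n)) * decay y) * norm (G x) = C1 * decay y * ((1 + norm x) ^ (2 * CARD('n)) * norm (G x))"
      by simp
    also have "\<dots> \<le> C1 * decay y * (C2 * decay x)" by (intro mult_left_mono C2) (use C1 in auto)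
    finally show "norm (?k x y) \<le> C1 * C2 * decay x * decay y" using C1 by (simp add: mult_ac mult_right_mono mult_left_mono)
  qed
  also have "\<dots> = (\<integral>x. cnj (G x * cis (- (x \<bullet> \<xi>))) * fourier G \<xi> \<partial>lborel)"
  proof (intro Bochner_Integration.integral_cong refl)
    fix x
    have "(\<integral>y. ?k x y \<partial>lborel) = (\<integral>y. cnj (G x * cis (- (x \<bullet> \<xi>))) * (G (y + x) * cis (- ((y + x) \<bullet> \<xi>))) \<partial>lborel)"
    proof (intro Bochner_Integration.integral_cong refl)
      fix y
      have "cis (- (y \<bullet> \<xi>)) = cis (x \<bullet> \<xi>) * cis (- ((y + x) \<bullet> \<xi>))" by (simp add: cis_mult algebra_simps)
      then show "?k x y = cnj (G x * cis (- (x \<bullet> \<xi>))) * (G (y + x) * cis (- ((y + x) \<bullet> \<xi>)))"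
        by (simp add: cis_cnj mult_ac add.commute)
    qed
    also have "\<dots> = cnj (G x * cis (- (x \<bullet> \<xi>))) * (\<integral>y. G (y + x) * cis (- ((y + x) \<bullet> \<xi>)) \<partial>lborel)"
      by (rule Bochner_Integration.integral_mult_right_zero)
    also have "(\<integral>y. G (y + x) * cis (- ((y + x) \<bullet> \<xi>)) \<partial>lborel) = fourier G \<xi>"
      unfolding fourier_lebesgue[OF G] by (rule integral_translate[of "\<lambda>t. G t * cis (- (t \<bullet> \<xi>))" x])
    finally show "(\<integral>y. ?k x y \<partial>lborel) = cnj (G x * cis (- (x \<bullet> \<xi>))) * fourier G \<xi>" .
  qed
  also have "\<dots> = cnj (\<integral>x. G x * cis (- (x \<bullet> \<xi>)) \<partial>lborel) * fourier G \<xi>"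
    by (subst Bochner_Integration.integral_mult_left_zero) (simp only: Bochner_Integration.integral_cnj)
  also have "(\<integral>x. G x * cis (- (x \<bullet> \<xi>)) \<partial>lborel) = fourier G \<xi>"
    by (rule fourier_lebesgue[OF G, symmetric])
  finally show ?thesis by (simp only: complex_norm_square mult.commute)
qed

text \<open>Converts a sum of squared moduli of Fourier samples into a lattice sum of
  autocorrelations. The term at 0 is the L2 norm, and everything else is an error to be shown zero
  (disjoint supports) or small (fine lattice).\<close>

lemma autocorr_poisson:
  fixes G :: "('n::finite) fn"
  assumes L: "L > 0" and G: "rapid G"
    and sm: "(\<lambda>l. (norm (fourier G ((2 * pi / L) *\<^sub>R ivec l)))\<^sup>2) summable_on UNIV"
  shows "of_real (\<Sum>\<^sub>\<infinity>l. (norm (fourier G ((2 * pi / L) *\<^sub>R ivec l)))\<^sup>2)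
       = of_real (L ^ CARD('n)) * (\<Sum>\<^sub>\<infinity>r. autocorr G (L *\<^sub>R ivec r))"
proof -
  let ?N = "\<lambda>l. (norm (fourier G ((2 * pi / L) *\<^sub>R ivec l)))\<^sup>2"
  have "of_real (L ^ CARD('n)) * (\<Sum>\<^sub>\<infinity>r. autocorr G (L *\<^sub>R ivec r))
      = (\<Sum>\<^sub>\<infinity>l. fourier (autocorr G) ((2 * pi / L) *\<^sub>R ivec l))"
    by (rule poisson_summation[OF L rapid_autocorr[OF G]])
       (use sm in \<open>simp add: fourier_autocorr[OF G] norm_power del: of_real_power\<close>)
  also have "\<dots> = (\<Sum>\<^sub>\<infinity>l. of_real (?N l))" by (simp only: fourier_autocorr[OF G])
  also have "\<dots> = of_real (\<Sum>\<^sub>\<infinity>l. ?N l)"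
    by (intro infsumI has_sum_of_real has_sum_infsum sm)
  finally show ?thesis by simp
qed

section \<open>The space of test functions\<close>

text \<open>Recovers the total derivative from the directional ones, so that the derivative rules
  for total derivatives can be used inside inductions over \<open>Dlist\<close>.\<close>

lemma has_derivative_pderiv_dir:
  fixes g :: "('n::finite) fn"
  assumes "g differentiable at x"
  shows "(g has_derivative (\<lambda>h. \<Sum>j\<in>UNIV. (h $ j) *\<^sub>R pderiv_dir j g x)) (at x)"
proof -
  let ?D = "frechet_derivative g (at x)"
  have d: "(g has_derivative ?D) (at x)" using assms by (simp add: frechet_derivative_works)
  then interpret bounded_linear ?D by (rule has_derivative_bounded_linear)
  have "?D h = (\<Sum>j\<in>UNIV. (h $ j) *\<^sub>R pderiv_dir j g x)" for h
  proof -
    have "h = (\<Sum>j\<in>UNIV. (h $ j) *\<^sub>R axis j 1)"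
      using basis_expansion[of h] by (simp add: scalar_mult_eq_scaleR)
    then have "?D h = ?D (\<Sum>j\<in>UNIV. (h $ j) *\<^sub>R axis j 1)" by simp
    also have "\<dots> = (\<Sum>j\<in>UNIV. (h $ j) *\<^sub>R ?D (axis j 1))" by (simp add: sum scaleR)
    finally show ?thesis by (simp add: pderiv_dir_def)
  qed
  then have "?D = (\<lambda>h. \<Sum>j\<in>UNIV. (h $ j) *\<^sub>R pderiv_dir j g x)" by blast
  with d show ?thesis by simp
qed

lemma pderiv_dir_eq:
  assumes "(g has_derivative g') (at x)"
  shows "pderiv_dir j g x = g' (axis j 1)"
  using frechet_derivative_at[OF assms] by (simp add: pderiv_dir_def)

lemma smooth_differentiable: "smooth_fn f \<Longrightarrow> Dlist js f differentiable at x"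
  by (simp add: smooth_fn_def)

lemma smooth_continuous: "smooth_fn f \<Longrightarrow> continuous_on UNIV (Dlist js f)"
  by (meson smooth_differentiable continuous_at_imp_continuous_on differentiable_imp_continuous_within)

lemma axis_sum:
  "(\<Sum>i\<in>UNIV. (axis j (1::real) $ i) *\<^sub>R v i) = (v j :: 'b::real_vector)"
proof -
  have "(\<Sum>i\<in>UNIV. (axis j (1::real) $ i) *\<^sub>R v i) = (\<Sum>i\<in>UNIV. if i = j then v i else 0)"
    by (intro sum.cong) (auto simp: axis_def)
  then show ?thesis by simp
qed

lemma norm_sums_le:
  fixes f :: "nat \<Rightarrow> 'a::banach"
  assumes "f sums s" "\<And>i. norm (f i) \<le> g i" "summable g"
  shows "norm s \<le> suminf g"
  using norm_suminf_le[OF assms(2,3)] assms(1) by (simp add: sums_iff)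

text \<open>Termwise differentiation, by induction on the list of directions. A summable majorant
  for every list makes the differentiated series converge uniformly; the limit supplied by the
  theorem on differentiated series is identified by uniqueness of sums.\<close>

lemma Dlist_series:
  fixes f :: "nat \<Rightarrow> ('n::finite) fn"
  assumes sm: "\<And>i. smooth_fn (f i)"
    and M: "\<And>js. summable (M js)" "\<And>js i x. norm (Dlist js (f i) x) \<le> M js i"
  shows "smooth_fn (\<lambda>x. \<Sum>i. f i x)"
    and "(\<lambda>i. Dlist js (f i) x) sums Dlist js (\<lambda>x. \<Sum>i. f i x) x"
proof -
  let ?F = "\<lambda>x. \<Sum>i. f i x"
  have S: "summable (\<lambda>i. Dlist js (f i) x)" for js x
    by (rule summable_norm_cancel, rule summable_comparison_test'[OF M(1)[of js], of 0]) (use M(2) in auto)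
  have step: "(\<forall>x. (\<lambda>i. Dlist js (f i) x) sums Dlist js ?F x) \<Longrightarrow>
     (Dlist js ?F has_derivative (\<lambda>h. \<Sum>j\<in>UNIV. (h $ j) *\<^sub>R (\<Sum>i. Dlist (j # js) (f i) x))) (at x)" for js x
  proof -
    assume IH: "\<forall>x. (\<lambda>i. Dlist js (f i) x) sums Dlist js ?F x"
    let ?f' = "\<lambda>i x h. \<Sum>j\<in>UNIV. (h $ j) *\<^sub>R Dlist (j # js) (f i) x"
    let ?g' = "\<lambda>x h. \<Sum>j\<in>UNIV. (h $ j) *\<^sub>R (\<Sum>i. Dlist (j # js) (f i) x)"
    have "\<exists>g. \<forall>x\<in>UNIV. (\<lambda>n. Dlist js (f n) x) sums g x \<and> (g has_derivative ?g' x) (at x within UNIV)"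
    proof (rule has_derivative_series[where f'="?f'" and x=x])
      show "(Dlist js (f n) has_derivative ?f' n x) (at x within UNIV)" for n x
        using has_derivative_pderiv_dir[OF smooth_differentiable[OF sm]] by simp
      fix e :: real assume e: "e > 0"
      \<comment> \<open>The tail of the majorants added over all directions; it bounds the operator
        norm of the error of the n-th partial derivative sum at every point simultaneously.\<close>
      define T where "T n = (\<Sum>j\<in>UNIV. \<Sum>i. M (j # js) (i + n))" for n
      have "T \<longlonglongrightarrow> (\<Sum>j\<in>(UNIV :: 'n set). 0)" unfolding T_def
        by (intro tendsto_sum suminf_exist_split2 M)
      then have "\<forall>\<^sub>F n in sequentially. T n < e" using e by (intro order_tendstoD(2)) auto
      then show "\<forall>\<^sub>F n in sequentially. \<forall>x\<in>UNIV. \<forall>h. norm ((\<Sum>i<n. ?f' i x h) - ?g' x h) \<le> e * norm h"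
      proof (rule eventually_mono, intro ballI allI)
        fix n x and h :: "real^'n" assume T: "T n < e"
        have tail: "norm ((\<Sum>i<n. Dlist (j # js) (f i) x) - (\<Sum>i. Dlist (j # js) (f i) x)) \<le> (\<Sum>i. M (j # js) (i + n))" for j
        proof -
          have "(\<Sum>i. Dlist (j # js) (f i) x) = (\<Sum>i. Dlist (j # js) (f (i + n)) x) + (\<Sum>i<n. Dlist (j # js) (f i) x)"
            by (rule suminf_split_initial_segment[OF S])
          then have "norm ((\<Sum>i<n. Dlist (j # js) (f i) x) - (\<Sum>i. Dlist (j # js) (f i) x)) = norm (\<Sum>i. Dlist (j # js) (f (i + n)) x)"
            by simp
          also have "\<dots> \<le> (\<Sum>i. M (j # js) (i + n))"
            by (rule norm_suminf_le[OF M(2)]) (use M(1)[of "j # js"] in \<open>simp add: summable_iff_shift\<close>)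
          finally show ?thesis .
        qed
        have "(\<Sum>i<n. ?f' i x h) = (\<Sum>j\<in>UNIV. (h $ j) *\<^sub>R (\<Sum>i<n. Dlist (j # js) (f i) x))"
          unfolding scaleR_sum_right by (rule sum.swap)
        then have "(\<Sum>i<n. ?f' i x h) - ?g' x h = (\<Sum>j\<in>UNIV. (h $ j) *\<^sub>R ((\<Sum>i<n. Dlist (j # js) (f i) x) - (\<Sum>i. Dlist (j # js) (f i) x)))"
          by (simp only: scaleR_right_diff_distrib sum_subtractf)
        also have "norm \<dots> \<le> (\<Sum>j\<in>UNIV. norm h * (\<Sum>i. M (j # js) (i + n)))"
          by (intro sum_norm_le) (use tail component_le_norm_cart[of h] in \<open>auto intro!: mult_mono\<close>)
        also have "\<dots> = norm h * T n" by (simp add: T_def sum_distrib_left)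
        also have "\<dots> \<le> e * norm h" unfolding mult.commute[of "norm h"] using T by (intro mult_right_mono) auto
        finally show "norm ((\<Sum>i<n. ?f' i x h) - ?g' x h) \<le> e * norm h" .
      qed
    qed (use IH in auto)
    then obtain g where g: "\<And>x. (\<lambda>n. Dlist js (f n) x) sums g x" "\<And>x. (g has_derivative ?g' x) (at x)" by auto
    have "g = Dlist js ?F" using IH g(1) sums_unique2 by blast
    with g(2) show ?thesis by blast
  qed
  have main: "\<forall>x. (\<lambda>i. Dlist js (f i) x) sums Dlist js ?F x" for js
  proof (induction js)
    case Nil then show ?case using S[of "[]"] by (simp add: summable_sums)
  next
    case (Cons j js)
    show ?case
    proof
      fix x
      have "Dlist (j # js) ?F x = (\<Sum>i. Dlist (j # js) (f i) x)"
        using pderiv_dir_eq[OF step[OF Cons], of j x] by (simp add: axis_sum)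
      then show "(\<lambda>i. Dlist (j # js) (f i) x) sums Dlist (j # js) ?F x"
        using S summable_sums by metis
    qed
  qed
  then show "(\<lambda>i. Dlist js (f i) x) sums Dlist js (\<lambda>x. \<Sum>i. f i x) x" by blast
  show "smooth_fn ?F" unfolding smooth_fn_def
    using step[OF main] by (meson differentiable_def)
qed

lemma Dlist_scale:
  assumes "smooth_fn f"
  shows "Dlist js (\<lambda>t. c * f t) = (\<lambda>t. c * Dlist js f t)"
proof (induction js)
  case (Cons j js)
  have "pderiv_dir j (\<lambda>t. c * Dlist js f t) x = c * pderiv_dir j (Dlist js f) x" for x
  proof -
    have "((\<lambda>t. c * Dlist js f t) has_derivative (\<lambda>h. c * (\<Sum>j\<in>UNIV. (h $ j) *\<^sub>R pderiv_dir j (Dlist js f) x))) (at x)"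
      by (intro has_derivative_mult_right has_derivative_pderiv_dir smooth_differentiable assms)
    from pderiv_dir_eq[OF this] show ?thesis by (simp add: axis_sum)
  qed
  then show ?case using Cons by auto
qed simp

lemma smooth_scale: "smooth_fn f \<Longrightarrow> smooth_fn (\<lambda>t. c * f t)"
  unfolding smooth_fn_def Dlist_scale[unfolded smooth_fn_def]
  by (auto intro!: differentiable_mult simp: Dlist_scale smooth_fn_def)

text \<open>The bookkeeping of the Leibniz rule for iterated derivatives of a product: each
  direction goes either to p, where it hits the modulation, or to q, where it hits the window.
  Repetitions are kept, so binomial coefficients do not appear.\<close>

fun splits :: "'n list \<Rightarrow> ('n list \<times> 'n list) list" where
  "splits [] = [([], [])]"
| "splits (j # js) = map (\<lambda>(p, q). (j # p, q)) (splits js) @ map (\<lambda>(p, q). (p, j # q)) (splits js)"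

lemma length_splits: "length (splits js) = 2 ^ length js"
  by (induction js) auto

lemma splits_length: "(p, q) \<in> set (splits js) \<Longrightarrow> length p \<le> length js \<and> length q \<le> length js"
  by (induction js arbitrary: p q) fastforce+

lemma has_derivative_tfshift:
  assumes "(k has_derivative k') (at (t - fst z))"
  shows "(tfshift z k has_derivative (\<lambda>h. \<i> * of_real (h \<bullet> snd z) * tfshift z k t + cis (t \<bullet> snd z) * k' h)) (at t)"
proof -
  have cis: "cis a = of_real (cos a) + \<i> * of_real (sin a)" for a by (simp add: complex_eq_iff)
  have 1: "((\<lambda>t. cis (t \<bullet> snd z)) has_derivative (\<lambda>h. \<i> * of_real (h \<bullet> snd z) * cis (t \<bullet> snd z))) (at t)"
    unfolding cis by (auto intro!: derivative_eq_intros simp: algebra_simps)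
  have "((\<lambda>t. t - fst z) has_derivative (\<lambda>h. h)) (at t)" by (auto intro!: derivative_eq_intros)
  from has_derivative_compose[OF this assms]
  have 2: "((\<lambda>t. k (t - fst z)) has_derivative k') (at t)" .
  show ?thesis unfolding tfshift_def
    by (rule has_derivative_eq_rhs[OF has_derivative_mult[OF 1 2]]) (auto simp: algebra_simps)
qed

lemma Dlist_tfshift:
  assumes g: "smooth_fn g"
  shows "Dlist js (tfshift z g) t = (\<Sum>(p, q)\<leftarrow>splits js. (\<Prod>j\<leftarrow>p. \<i> * of_real (snd z $ j)) * tfshift z (Dlist q g) t)"
    and "smooth_fn (tfshift z g)"
proof -
  let ?c = "\<lambda>p. (\<Prod>j\<leftarrow>p. \<i> * of_real (snd z $ j))"
  let ?E = "\<lambda>l t. \<Sum>(p, q)\<leftarrow>l. ?c p * tfshift z (Dlist q g) t"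
  have d1: "(tfshift z (Dlist q g) has_derivative
     (\<lambda>h. \<i> * of_real (h \<bullet> snd z) * tfshift z (Dlist q g) t + cis (t \<bullet> snd z) * (\<Sum>j\<in>UNIV. (h $ j) *\<^sub>R pderiv_dir j (Dlist q g) (t - fst z)))) (at t)"
    for q t by (intro has_derivative_tfshift has_derivative_pderiv_dir smooth_differentiable g)
  define D where "D q t h = \<i> * of_real (h \<bullet> snd z) * tfshift z (Dlist q g) t + cis (t \<bullet> snd z) * (\<Sum>j\<in>UNIV. (h $ j) *\<^sub>R pderiv_dir j (Dlist q g) (t - fst z))"
    for q t h
  have d: "(?E l has_derivative (\<lambda>h. \<Sum>(p, q)\<leftarrow>l. ?c p * D q t h)) (at t)" for l t
    by (induction l) (auto intro!: derivative_intros d1[folded D_def] split: prod.splits)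
  have Da: "D q t (axis j 1) = \<i> * of_real (snd z $ j) * tfshift z (Dlist q g) t + tfshift z (Dlist (j # q) g) t" for q t j
    unfolding D_def axis_sum by (simp add: inner_axis' tfshift_def)
  have main: "Dlist js (tfshift z g) = ?E (splits js)" for js
  proof (induction js)
    case (Cons j js)
    have "Dlist (j # js) (tfshift z g) t = ?E (splits (j # js)) t" for t
    proof -
      have "Dlist (j # js) (tfshift z g) t = (\<Sum>(p, q)\<leftarrow>splits js. ?c p * D q t (axis j 1))"
        using pderiv_dir_eq[OF d, of j "splits js" t] Cons by simp
      also have "\<dots> = ?E (splits (j # js)) t"
      proof -
        have "(\<Sum>(p, q)\<leftarrow>l. ?c p * D q t (axis j 1)) =
           ?E (map (\<lambda>(p, q). (j # p, q)) l @ map (\<lambda>(p, q). (p, j # q)) l) t" for l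
          unfolding Da by (induction l) (auto simp: algebra_simps)
        then show ?thesis by simp
      qed
      finally show ?thesis .
    qed
    then show ?case by blast
  qed simp
  then show "Dlist js (tfshift z g) t = ?E (splits js) t" by simp
  show "smooth_fn (tfshift z g)"
    unfolding smooth_fn_def main using d by (auto simp: differentiable_def)
qed

text \<open>The derivatives of a shifted window cost only a polynomial in the frequency shift, and
  such a factor is later absorbed by an exponential of the weight.\<close>

lemma Dlist_tfshift_bound:
  assumes g: "smooth_fn g" and K: "\<And>q. length q \<le> length js \<Longrightarrow> norm (Dlist q g (t - fst z)) \<le> K"
  shows "norm (Dlist js (tfshift z g) t) \<le> 2 ^ length js * (1 + norm (snd z)) ^ length js * K"
proof -
  have K0: "K \<ge> 0" using K[of "[]"] norm_ge_zero[of "g (t - fst z)"] by (simp, linarith)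
  have pr: "norm (\<Prod>j\<leftarrow>p. \<i> * of_real (snd z $ j) :: complex) \<le> (1 + norm (snd z)) ^ length p" for p
  proof (induction p)
    case (Cons j p)
    have "\<bar>snd z $ j\<bar> \<le> 1 + norm (snd z)" using component_le_norm_cart[of "snd z" j] by simp
    with Cons show ?case by (simp add: norm_mult mult_mono)
  qed simp
  have "norm (\<Sum>(p, q)\<leftarrow>l. (\<Prod>j\<leftarrow>p. \<i> * of_real (snd z $ j)) * tfshift z (Dlist q g) t)
     \<le> real (length l) * ((1 + norm (snd z)) ^ length js * K)"
    if "set l \<subseteq> set (splits js)" for l using that
  proof (induction l)
    case (Cons a l)
    obtain p q where a: "a = (p, q)" by (cases a)
    with Cons.prems have len: "length p \<le> length js" "length q \<le> length js" using splits_length[of p q js] by auto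
    have "norm ((\<Prod>j\<leftarrow>p. \<i> * of_real (snd z $ j)) * tfshift z (Dlist q g) t)
        = norm (\<Prod>j\<leftarrow>p. \<i> * of_real (snd z $ j) :: complex) * norm (Dlist q g (t - fst z))"
      by (simp add: norm_mult tfshift_def)
    also have "\<dots> \<le> (1 + norm (snd z)) ^ length p * K"
      by (intro mult_mono pr K len) auto
    also have "\<dots> \<le> (1 + norm (snd z)) ^ length js * K"
      by (intro mult_right_mono power_increasing len K0) auto
    finally have "norm ((\<Prod>j\<leftarrow>p. \<i> * of_real (snd z $ j)) * tfshift z (Dlist q g) t) \<le> (1 + norm (snd z)) ^ length js * K" .
    with Cons show ?case by (auto simp: a algebra_simps intro!: norm_triangle_le)
  qed simp
  from this[of "splits js"] show ?thesis
    by (simp add: Dlist_tfshift(1)[OF g] length_splits mult.assoc)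
qed

lemma rapid_tfshift:
  assumes "rapid g" shows "rapid (tfshift z g)"
proof -
  have "rapid (\<lambda>t. g (t + - fst z) * cis (t \<bullet> snd z))"
    by (intro rapid_cis rapid_shift assms continuous_intros)
  also have "(\<lambda>t. g (t + - fst z) * cis (t \<bullet> snd z)) = tfshift z g"
    by (simp add: tfshift_def mult.commute)
  finally show ?thesis .
qed

lemma fourier_tfshift:
  assumes g: "rapid g"
  shows "fourier (tfshift z g) \<eta> = cis (fst z \<bullet> snd z) * tfshift (snd z, - fst z) (fourier g) \<eta>"
proof -
  have "fourier (tfshift z g) \<eta> = (\<integral>t. tfshift z g t * cis (- (t \<bullet> \<eta>)) \<partial>lborel)"
    by (rule fourier_lebesgue[OF rapid_tfshift[OF g]])
  also have "\<dots> = (\<integral>t. tfshift z g (t + fst z) * cis (- ((t + fst z) \<bullet> \<eta>)) \<partial>lborel)"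
    by (rule integral_translate[symmetric])
  also have "\<dots> = (\<integral>t. cis (fst z \<bullet> snd z) * cis (- (fst z \<bullet> \<eta>)) * (g t * cis (- (t \<bullet> (\<eta> - snd z)))) \<partial>lborel)"
  proof (intro Bochner_Integration.integral_cong refl)
    fix t
    have "cis ((t + fst z) \<bullet> snd z) * cis (- ((t + fst z) \<bullet> \<eta>)) = cis (fst z \<bullet> snd z) * cis (- (fst z \<bullet> \<eta>)) * cis (- (t \<bullet> (\<eta> - snd z)))"
      by (simp add: cis_mult algebra_simps)
    then show "tfshift z g (t + fst z) * cis (- ((t + fst z) \<bullet> \<eta>)) = cis (fst z \<bullet> snd z) * cis (- (fst z \<bullet> \<eta>)) * (g t * cis (- (t \<bullet> (\<eta> - snd z))))"
      by (simp add: tfshift_def mult_ac)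
  qed
  also have "\<dots> = cis (fst z \<bullet> snd z) * cis (- (fst z \<bullet> \<eta>)) * fourier g (\<eta> - snd z)"
    unfolding fourier_lebesgue[OF g] by (rule Bochner_Integration.integral_mult_right_zero)
  finally show ?thesis by (simp add: tfshift_def inner_commute)
qed

section \<open>Weighted seminorms, absolutely convergent series and the dual space\<close>

context weight_fun
begin

abbreviation S :: "('n::finite) fn set" where "S \<equiv> S_omega \<omega>"

lemma rapidI:
  assumes "continuous_on UNIV f" "\<And>lam. lam > 0 \<Longrightarrow> \<exists>C. \<forall>x. norm (f x) * exp (lam * \<omega> (norm x)) \<le> C"
  shows "rapid f"
  unfolding rapid_def
proof (intro conjI allI assms(1))
  fix k
  obtain \<mu> C1 where 1: "\<mu> > 0" "C1 > 0" "\<And>t. t \<ge> 0 \<Longrightarrow> (1 + t) ^ k \<le> C1 * exp (\<mu> * \<omega> t)"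
    using w_power_bound[of k] by auto
  obtain C2 where 2: "\<And>x. norm (f x) * exp (\<mu> * \<omega> (norm x)) \<le> C2" using assms(2)[OF 1(1)] by auto
  have "(1 + norm x) ^ k * norm (f x) \<le> C1 * C2" for x
  proof -
    have "(1 + norm x) ^ k * norm (f x) \<le> C1 * exp (\<mu> * \<omega> (norm x)) * norm (f x)"
      by (intro mult_right_mono 1) auto
    also have "\<dots> = C1 * (norm (f x) * exp (\<mu> * \<omega> (norm x)))" by simp
    also have "\<dots> \<le> C1 * C2" using 1 by (intro mult_left_mono 2) auto
    finally show ?thesis .
  qed
  then show "\<exists>C. \<forall>x. (1 + norm x) ^ k * norm (f x) \<le> C" by blast
qed

lemma S_smooth: "f \<in> S \<Longrightarrow> smooth_fn f" "f \<in> S \<Longrightarrow> smooth_fn (fourier f)"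
  by (auto simp: S_omega_def schwartz_def)

text \<open>Extends the bounds from positive to arbitrary real \<open>lam\<close>, which spares
  later sign distinctions.\<close>

lemma S_exp_bound:
  assumes "f \<in> S"
  shows "\<exists>C. \<forall>x. norm (Dlist js f x) * exp (lam * \<omega> (norm x)) \<le> C"
    and "\<exists>C. \<forall>x. norm (Dlist js (fourier f) x) * exp (lam * \<omega> (norm x)) \<le> C"
proof -
  define l where "l = max lam 1"
  have le: "exp (lam * \<omega> (norm x)) \<le> exp (l * \<omega> (norm x))" for x :: "real^'n"
    by (auto simp: l_def intro!: mult_right_mono w_nonneg)
  have "l > 0" by (simp add: l_def)
  then have "\<exists>C. \<forall>x. norm (Dlist js f x) * exp (l * \<omega> (norm x)) \<le> C" "\<exists>C. \<forall>x. norm (Dlist js (fourier f) x) * exp (l * \<omega> (norm x)) \<le> C"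
    using assms by (auto simp: S_omega_def)
  then show "\<exists>C. \<forall>x. norm (Dlist js f x) * exp (lam * \<omega> (norm x)) \<le> C"
    and "\<exists>C. \<forall>x. norm (Dlist js (fourier f) x) * exp (lam * \<omega> (norm x)) \<le> C"
    by (meson order_trans mult_left_mono[OF le norm_ge_zero])+
qed

lemma S_rapid: assumes "f \<in> S" shows "rapid f" "rapid (fourier f)"
  using S_exp_bound[OF assms, of "[]"] smooth_continuous[OF S_smooth(1)[OF assms], of "[]"] smooth_continuous[OF S_smooth(2)[OF assms], of "[]"]
  by (auto intro!: rapidI)

text \<open>The polynomial Schwartz bounds follow from the weighted ones, since by (\<gamma>)
  exponentials of \<omega> dominate all powers.\<close>

lemma S_I:
  assumes "smooth_fn f" "smooth_fn (fourier f)"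
    and 1: "\<And>js lam. lam > 0 \<Longrightarrow> \<exists>C. \<forall>x. norm (Dlist js f x) * exp (lam * \<omega> (norm x)) \<le> C"
    and 2: "\<And>js lam. lam > 0 \<Longrightarrow> \<exists>C. \<forall>x. norm (Dlist js (fourier f) x) * exp (lam * \<omega> (norm x)) \<le> C"
  shows "f \<in> S"
proof -
  have "rapid (Dlist js f)" for js by (intro rapidI smooth_continuous assms)
  then have "schwartz f" using assms(1) by (auto simp: schwartz_def rapid_def)
  then show ?thesis using assms by (auto simp: S_omega_def)
qed

definition weighted_values :: "real \<Rightarrow> nat \<Rightarrow> ('n::finite) fn \<Rightarrow> real set" where
  "weighted_values lam N f = {norm (Dlist js f x) * exp (lam * \<omega> (norm x)) | js x. length js \<le> N}"

lemma S_seminorm_weighted_values: "S_seminorm \<omega> lam N f = Sup (weighted_values lam N f) + Sup (weighted_values lam N (fourier f))"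
  by (simp add: S_seminorm_def weighted_values_def)

text \<open>The seminorms are suprema of real sets, which carry information only for bounded sets.
  Boundedness holds because there are finitely many lists of length at most N.\<close>

lemma bdd_above_weighted_values:
  fixes f :: "('n::finite) fn"
  assumes "\<And>js. \<exists>C. \<forall>x. norm (Dlist js f x) * exp (lam * \<omega> (norm x)) \<le> C"
  shows "bdd_above (weighted_values lam N f)"
proof -
  obtain C where C: "\<And>js x. norm (Dlist js f x) * exp (lam * \<omega> (norm x)) \<le> C js" using assms by metis
  let ?J = "{js :: 'n list. length js \<le> N}"
  have fin: "finite ?J" using finite_lists_length_le[of "UNIV :: 'n set" N] by simp
  have "y \<le> Max (C ` ?J)" if "y \<in> weighted_values lam N f" for y
  proof -
    from that obtain js x where y: "y = norm (Dlist js f x) * exp (lam * \<omega> (norm x))" "js \<in> ?J" by (auto simp: weighted_values_def)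
    have "y \<le> C js" using C y by simp
    also have "C js \<le> Max (C ` ?J)" using fin y by (intro Max_ge) auto
    finally show ?thesis .
  qed
  then show ?thesis by (auto simp: bdd_above_def)
qed

lemma Sup_weighted_values_ge:
  assumes "\<And>js. \<exists>C. \<forall>x. norm (Dlist js f x) * exp (lam * \<omega> (norm x)) \<le> C" "length js \<le> N"
  shows "norm (Dlist js f x) * exp (lam * \<omega> (norm x)) \<le> Sup (weighted_values lam N f)"
  by (rule cSup_upper[OF _ bdd_above_weighted_values]) (use assms in \<open>auto simp: weighted_values_def\<close>)

lemma Sup_weighted_values_le:
  assumes "\<And>js x. length js \<le> N \<Longrightarrow> norm (Dlist js f x) * exp (lam * \<omega> (norm x)) \<le> M"
  shows "Sup (weighted_values lam N f) \<le> M"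
proof (rule cSup_least)
  show "weighted_values lam N f \<noteq> {}" unfolding weighted_values_def by (auto intro!: exI[of _ "[]"])
qed (use assms in \<open>auto simp: weighted_values_def\<close>)

lemma Sup_weighted_values_nonneg:
  assumes "\<And>js. \<exists>C. \<forall>x. norm (Dlist js f x) * exp (lam * \<omega> (norm x)) \<le> C"
  shows "0 \<le> Sup (weighted_values lam N f)"
  by (rule order_trans[OF _ Sup_weighted_values_ge[OF assms, of "[]" N 0]]) auto

lemma S_seminorm_ge:
  assumes f: "f \<in> S" and js: "length js \<le> N"
  shows "norm (Dlist js f x) * exp (lam * \<omega> (norm x)) \<le> S_seminorm \<omega> lam N f"
    and "norm (Dlist js (fourier f) x) * exp (lam * \<omega> (norm x)) \<le> S_seminorm \<omega> lam N f"
  unfolding S_seminorm_weighted_values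
  using Sup_weighted_values_ge[OF S_exp_bound(1)[OF f] js, where lam=lam and x=x] Sup_weighted_values_ge[OF S_exp_bound(2)[OF f] js, where lam=lam and x=x]
    Sup_weighted_values_nonneg[OF S_exp_bound(1)[OF f], where lam=lam and N=N] Sup_weighted_values_nonneg[OF S_exp_bound(2)[OF f], where lam=lam and N=N]
  by linarith+

lemma S_seminorm_nonneg: "f \<in> S \<Longrightarrow> 0 \<le> S_seminorm \<omega> lam N f"
  by (rule order_trans[OF _ S_seminorm_ge(1)[of _ "[]" N 0]]) auto

lemma S_seminorm_le:
  assumes "\<And>js x. length js \<le> N \<Longrightarrow> norm (Dlist js f x) * exp (lam * \<omega> (norm x)) \<le> M1"
    and "\<And>js x. length js \<le> N \<Longrightarrow> norm (Dlist js (fourier f) x) * exp (lam * \<omega> (norm x)) \<le> M2"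
  shows "S_seminorm \<omega> lam N f \<le> M1 + M2"
  unfolding S_seminorm_weighted_values by (intro add_mono Sup_weighted_values_le assms)

lemma S_seminorm_mono:
  fixes f :: "('n::finite) fn"
  assumes f: "f \<in> S" and "lam \<le> lam'"
  shows "S_seminorm \<omega> lam N f \<le> S_seminorm \<omega> lam' N f"
  unfolding S_seminorm_weighted_values
proof (intro add_mono Sup_weighted_values_le)
  fix js :: "'n list" and x :: "real^'n" assume js: "length js \<le> N"
  have le: "exp (lam * \<omega> (norm x)) \<le> exp (lam' * \<omega> (norm x))"
    using assms by (auto intro!: mult_right_mono w_nonneg)
  show "norm (Dlist js f x) * exp (lam * \<omega> (norm x)) \<le> Sup (weighted_values lam' N f)"
    by (rule order_trans[OF mult_left_mono[OF le] Sup_weighted_values_ge[OF S_exp_bound(1)[OF f] js]]) auto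
  show "norm (Dlist js (fourier f) x) * exp (lam * \<omega> (norm x)) \<le> Sup (weighted_values lam' N (fourier f))"
    by (rule order_trans[OF mult_left_mono[OF le] Sup_weighted_values_ge[OF S_exp_bound(2)[OF f] js]]) auto
qed

lemma norm_le_seminorm:
  assumes f: "f \<in> S" and js: "length js \<le> N"
  shows "norm (Dlist js f x) \<le> S_seminorm \<omega> lam N f * exp (- (lam * \<omega> (norm x)))"
    and "norm (Dlist js (fourier f) x) \<le> S_seminorm \<omega> lam N f * exp (- (lam * \<omega> (norm x)))"
  using S_seminorm_ge[OF f js, of x lam] by (auto simp: exp_minus field_simps)

lemma exp_le_decay: "\<exists>\<mu>>0. \<exists>C>0. \<forall>x :: real^'n::finite. exp (- (\<mu> * \<omega> (norm x))) \<le> C * decay x"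
proof -
  obtain \<mu> C where "\<mu> > 0" "C > 0" "\<And>t. t \<ge> 0 \<Longrightarrow> exp (- (\<mu> * \<omega> t)) \<le> C / (1 + t) ^ (2 * CARD('n))"
    using w_exp_decay[of "2 * CARD('n)"] by blast
  then show ?thesis unfolding decay_def by (intro exI[of _ \<mu>] exI[of _ C] conjI) auto
qed

text \<open>Absolute summability in every seminorm is enough: derivatives pass through the sum on
  both sides of the Fourier transform, and the transform itself passes through it by an integrable
  majorant. The factor 2 arises because the seminorm adds two suprema, each bounded by the whole
  series.\<close>

lemma S_series:
  fixes f :: "nat \<Rightarrow> ('n::finite) fn"
  assumes f: "\<And>i. f i \<in> S" and sm: "\<And>lam N. lam > 0 \<Longrightarrow> summable (\<lambda>i. S_seminorm \<omega> lam N (f i))"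
  shows "(\<lambda>x. \<Sum>i. f i x) \<in> S"
    and "lam > 0 \<Longrightarrow> S_seminorm \<omega> lam N (\<lambda>x. \<Sum>i. f i x) \<le> 2 * (\<Sum>i. S_seminorm \<omega> lam N (f i))"
    and "summable (\<lambda>i. f i x)"
proof -
  let ?F = "\<lambda>x. \<Sum>i. f i x"
  have b: "norm (Dlist js (f i) x) \<le> S_seminorm \<omega> 1 (length js) (f i)"
    "norm (Dlist js (fourier (f i)) x) \<le> S_seminorm \<omega> 1 (length js) (f i)" for js i x
  proof -
    have "S_seminorm \<omega> 1 (length js) (f i) * exp (- (1 * \<omega> (norm x))) \<le> S_seminorm \<omega> 1 (length js) (f i) * 1"
      by (intro mult_left_mono S_seminorm_nonneg f) (simp add: w_nonneg)
    then show "norm (Dlist js (f i) x) \<le> S_seminorm \<omega> 1 (length js) (f i)"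
      "norm (Dlist js (fourier (f i)) x) \<le> S_seminorm \<omega> 1 (length js) (f i)"
      using norm_le_seminorm[OF f order_refl, of js i x 1] by auto
  qed
  have M: "summable (\<lambda>i. S_seminorm \<omega> 1 (length js) (f i))" for js :: "'n list" by (rule sm) simp
  note F = Dlist_series[OF S_smooth(1)[OF f] M b(1)]
  note F' = Dlist_series[OF S_smooth(2)[OF f] M b(2)]
  show "summable (\<lambda>i. f i x)" for x using F(2)[of "[]" x] by (auto simp: sums_iff)
  have ff: "fourier ?F = (\<lambda>\<xi>. \<Sum>i. fourier (f i) \<xi>)"
  proof
    fix \<xi>
    \<comment> \<open>This exponent makes the seminorm of parameter \<mu> control an integrable
      majorant of each term.\<close>
    obtain \<mu> C where mu: "\<mu> > 0" "C > 0" "\<And>x :: real^'n. exp (- (\<mu> * \<omega> (norm x))) \<le> C * decay x"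
      using exp_le_decay by auto
    have fb: "norm (f i x) \<le> S_seminorm \<omega> \<mu> 0 (f i) * (C * decay x)" for i x
      using norm_le_seminorm(1)[OF f, of "[]" 0 i x \<mu>] mult_left_mono[OF mu(3)[of x] S_seminorm_nonneg[OF f], of \<mu> 0 i]
      by simp
    have i: "integrable lborel (\<lambda>x. f i x * cis (- (x \<bullet> \<xi>)))" for i
      by (intro rapid_integrable rapid_cis S_rapid f continuous_intros)
    have A: "AE x in lborel. summable (\<lambda>i. norm (f i x * cis (- (x \<bullet> \<xi>))))"
      by (intro AE_I2, rule summable_comparison_test'[OF M[of "[]"], of 0]) (use b(1)[of "[]"] in \<open>simp add: norm_mult\<close>)
    have B: "summable (\<lambda>i. \<integral>x. norm (f i x * cis (- (x \<bullet> \<xi>))) \<partial>lborel)"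
    proof (rule summable_comparison_test'[of "\<lambda>i. S_seminorm \<omega> \<mu> 0 (f i) * (C * (\<integral>x. decay (x :: real^'n) \<partial>lborel))" 0])
      show "summable (\<lambda>i. S_seminorm \<omega> \<mu> 0 (f i) * (C * (\<integral>x. decay (x :: real^'n) \<partial>lborel)))"
        by (intro summable_mult2 sm mu)
      fix n
      have "(\<integral>x. norm (f n x * cis (- (x \<bullet> \<xi>))) \<partial>lborel) \<le> (\<integral>x. S_seminorm \<omega> \<mu> 0 (f n) * (C * decay (x :: real^'n)) \<partial>lborel)"
        by (intro integral_mono integrable_norm i integrable_mult_right integrable_decay) (use fb in \<open>simp add: norm_mult\<close>)
      also have "\<dots> = S_seminorm \<omega> \<mu> 0 (f n) * (C * (\<integral>x. decay (x :: real^'n) \<partial>lborel))" by simp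
      finally show "norm (\<integral>x. norm (f n x * cis (- (x \<bullet> \<xi>))) \<partial>lborel) \<le> S_seminorm \<omega> \<mu> 0 (f n) * (C * (\<integral>x. decay (x :: real^'n) \<partial>lborel))"
        by (simp add: integral_nonneg_AE)
    qed
    have s: "summable (\<lambda>i. f i x)" for x using F(2)[of "[]" x] by (auto simp: sums_iff)
    have eq: "(\<lambda>x. \<Sum>i. f i x * cis (- (x \<bullet> \<xi>))) = (\<lambda>x. ?F x * cis (- (x \<bullet> \<xi>)))"
      using s by (simp add: suminf_mult2)
    have int: "integrable lborel (\<lambda>x. ?F x * cis (- (x \<bullet> \<xi>)))"
      using integrable_suminf[OF i A B] unfolding eq .
    have "fourier ?F \<xi> = (\<integral>x. ?F x * cis (- (x \<bullet> \<xi>)) \<partial>lborel)"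
      unfolding fourier_def by (rule integral_lborel[OF int])
    also have "\<dots> = (\<Sum>i. \<integral>x. f i x * cis (- (x \<bullet> \<xi>)) \<partial>lborel)"
      using integral_suminf[OF i A B] unfolding eq .
    also have "\<dots> = (\<Sum>i. fourier (f i) \<xi>)" by (simp add: fourier_lebesgue S_rapid f)
    finally show "fourier ?F \<xi> = (\<Sum>i. fourier (f i) \<xi>)" .
  qed
  have B1: "norm (Dlist js ?F x) * exp (lam * \<omega> (norm x)) \<le> (\<Sum>i. S_seminorm \<omega> lam N (f i))"
    if lam: "lam > 0" and N: "length js \<le> N" for js x lam N
  proof -
    have "(\<lambda>i. Dlist js (f i) x * of_real (exp (lam * \<omega> (norm x)))) sums (Dlist js ?F x * of_real (exp (lam * \<omega> (norm x))))"
      by (intro sums_mult2 F(2))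
    then have "norm (Dlist js ?F x * of_real (exp (lam * \<omega> (norm x)))) \<le> (\<Sum>i. S_seminorm \<omega> lam N (f i))"
      by (rule norm_sums_le) (use S_seminorm_ge(1)[OF f N] sm[OF lam] in \<open>auto simp: norm_mult\<close>)
    then show ?thesis by (simp add: norm_mult)
  qed
  have B2: "norm (Dlist js (fourier ?F) x) * exp (lam * \<omega> (norm x)) \<le> (\<Sum>i. S_seminorm \<omega> lam N (f i))"
    if lam: "lam > 0" and N: "length js \<le> N" for js x lam N
  proof -
    have "(\<lambda>i. Dlist js (fourier (f i)) x * of_real (exp (lam * \<omega> (norm x)))) sums (Dlist js (fourier ?F) x * of_real (exp (lam * \<omega> (norm x))))"
      unfolding ff by (intro sums_mult2 F'(2))
    then have "norm (Dlist js (fourier ?F) x * of_real (exp (lam * \<omega> (norm x)))) \<le> (\<Sum>i. S_seminorm \<omega> lam N (f i))"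
      by (rule norm_sums_le) (use S_seminorm_ge(2)[OF f N] sm[OF lam] in \<open>auto simp: norm_mult\<close>)
    then show ?thesis by (simp add: norm_mult)
  qed
  show "?F \<in> S"
  proof (rule S_I)
    show "smooth_fn ?F" by (rule F(1))
    show "smooth_fn (fourier ?F)" unfolding ff by (rule F'(1))
  qed (use B1[OF _ order_refl] B2[OF _ order_refl] in blast)+
  show "S_seminorm \<omega> lam N ?F \<le> 2 * (\<Sum>i. S_seminorm \<omega> lam N (f i))" if "lam > 0"
    using S_seminorm_le[of N ?F lam, OF B1[of lam _ N] B2[of lam _ N]] that by simp
qed

lemma Dlist_zero: "Dlist js (\<lambda>_. 0) = (\<lambda>_. 0)"
proof (induction js)
  case (Cons j js)
  have "pderiv_dir j (\<lambda>_. 0) x = 0" for x :: "real^'a"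
    using pderiv_dir_eq[of "\<lambda>_. 0" "\<lambda>_. 0" x j] by simp
  then show ?case using Cons by auto
qed simp

lemma fourier_zero: "fourier (\<lambda>_. 0) = (\<lambda>_. 0)"
  by (simp add: fourier_def)

lemma S_zero: "(\<lambda>_ :: real^'n::finite. 0) \<in> S" "S_seminorm \<omega> lam N (\<lambda>_ :: real^'n::finite. 0) = 0"
proof -
  have sm: "smooth_fn (\<lambda>_. 0)" by (auto simp: smooth_fn_def Dlist_zero)
  show z: "(\<lambda>_. 0) \<in> (S :: 'n fn set)" by (rule S_I) (auto simp: fourier_zero Dlist_zero sm)
  have "S_seminorm \<omega> lam N (\<lambda>_ :: real^'n. 0) \<le> 0 + 0"
    by (rule S_seminorm_le) (auto simp: fourier_zero Dlist_zero)
  with S_seminorm_nonneg[OF z, of lam N] show "S_seminorm \<omega> lam N (\<lambda>_ :: real^'n. 0) = 0" by simp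
qed

lemma S_add:
  assumes "f \<in> S" "g \<in> S" shows "(\<lambda>t. f t + g t) \<in> S"
proof -
  \<comment> \<open>Closure under addition is obtained as a series with two nonzero terms, which
    reuses the linearity already contained in the series lemma.\<close>
  define F where "F i = (if i = 0 then f else if i = 1 then g else (\<lambda>_. 0))" for i :: nat
  have FS: "F i \<in> S" for i using assms S_zero by (auto simp: F_def)
  have "(\<lambda>t. \<Sum>i. F i t) \<in> S"
    by (rule S_series(1)[OF FS], rule summable_finite[of "{0, 1}"]) (auto simp: F_def S_zero)
  also have "(\<lambda>t. \<Sum>i. F i t) = (\<lambda>t. f t + g t)"
  proof
    fix t
    have "(\<Sum>i. F i t) = (\<Sum>i\<in>{0,1}. F i t)" by (rule suminf_finite) (auto simp: F_def)
    then show "(\<Sum>i. F i t) = f t + g t" by (simp add: F_def)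
  qed
  finally show ?thesis .
qed

lemma fourier_scale:
  assumes "rapid f" shows "fourier (\<lambda>t. c * f t) = (\<lambda>\<xi>. c * fourier f \<xi>)"
proof
  fix \<xi>
  have r: "rapid (\<lambda>t. c * f t)"
    using rapid_bounded_mult[OF assms continuous_on_const, of c "norm c"] by (simp add: mult.commute)
  show "fourier (\<lambda>t. c * f t) \<xi> = c * fourier f \<xi>"
    unfolding fourier_lebesgue[OF r] fourier_lebesgue[OF assms]
    by (simp add: mult.assoc)
qed

lemma S_scale:
  assumes f: "f \<in> S" shows "(\<lambda>t. c * f t) \<in> S" "S_seminorm \<omega> lam N (\<lambda>t. c * f t) \<le> norm c * S_seminorm \<omega> lam N f"
proof -
  have D: "Dlist js (\<lambda>t. c * f t) x = c * Dlist js f x" "Dlist js (fourier (\<lambda>t. c * f t)) x = c * Dlist js (fourier f) x" for js x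
    using f by (simp_all add: fourier_scale S_rapid Dlist_scale S_smooth)
  have ex: "\<exists>C. \<forall>x. norm (c * h x) * e x \<le> C" if "\<exists>C. \<forall>x. norm (h x) * e x \<le> C" for h :: "'a fn" and e
  proof -
    from that obtain C where C: "\<And>x. norm (h x) * e x \<le> C" by auto
    have "norm (c * h x) * e x \<le> norm c * C" for x
      using mult_left_mono[OF C, of "norm c" x] by (simp add: norm_mult mult_ac)
    then show ?thesis by blast
  qed
  show "(\<lambda>t. c * f t) \<in> S"
  proof (rule S_I)
    show "smooth_fn (\<lambda>t. c * f t)" by (intro smooth_scale S_smooth f)
    show "smooth_fn (fourier (\<lambda>t. c * f t))" unfolding fourier_scale[OF S_rapid(1)[OF f]] by (intro smooth_scale S_smooth f)
    fix js lam
    show "\<exists>C. \<forall>x. norm (Dlist js (\<lambda>t. c * f t) x) * exp (lam * \<omega> (norm x)) \<le> C"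
      unfolding D by (rule ex[OF S_exp_bound(1)[OF f]])
    show "\<exists>C. \<forall>x. norm (Dlist js (fourier (\<lambda>t. c * f t)) x) * exp (lam * \<omega> (norm x)) \<le> C"
      unfolding D by (rule ex[OF S_exp_bound(2)[OF f]])
  qed
  have "S_seminorm \<omega> lam N (\<lambda>t. c * f t) \<le> norm c * Sup (weighted_values lam N f) + norm c * Sup (weighted_values lam N (fourier f))"
  proof (rule S_seminorm_le)
    fix js :: "'a list" and x assume js: "length js \<le> N"
    show "norm (Dlist js (\<lambda>t. c * f t) x) * exp (lam * \<omega> (norm x)) \<le> norm c * Sup (weighted_values lam N f)"
      using mult_left_mono[OF Sup_weighted_values_ge[OF S_exp_bound(1)[OF f] js, where lam=lam and x=x], of "norm c"]
      by (simp add: D norm_mult mult_ac)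
    show "norm (Dlist js (fourier (\<lambda>t. c * f t)) x) * exp (lam * \<omega> (norm x)) \<le> norm c * Sup (weighted_values lam N (fourier f))"
      using mult_left_mono[OF Sup_weighted_values_ge[OF S_exp_bound(2)[OF f] js, where lam=lam and x=x], of "norm c"]
      by (simp add: D norm_mult mult_ac)
  qed
  then show "S_seminorm \<omega> lam N (\<lambda>t. c * f t) \<le> norm c * S_seminorm \<omega> lam N f"
    by (simp add: S_seminorm_weighted_values distrib_left)
qed

lemma dual_add: "u \<in> S'_omega \<omega> \<Longrightarrow> f \<in> S \<Longrightarrow> g \<in> S \<Longrightarrow> u (\<lambda>t. f t + g t) = u f + u g"
  by (auto simp: S'_omega_def)

lemma dual_scale: "u \<in> S'_omega \<omega> \<Longrightarrow> f \<in> S \<Longrightarrow> u (\<lambda>t. c * f t) = cnj c * u f"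
  by (auto simp: S'_omega_def)

lemma dual_bound:
  assumes "u \<in> S'_omega \<omega>"
  shows "\<exists>C\<ge>0. \<exists>lam>0. \<exists>N. \<forall>f\<in>S. norm (u f) \<le> C * S_seminorm \<omega> lam N f"
proof -
  obtain C lam N where C: "\<And>f. f \<in> S \<Longrightarrow> norm (u f) \<le> C * S_seminorm \<omega> lam N f"
    using assms unfolding S'_omega_def by blast
  have "norm (u f) \<le> \<bar>C\<bar> * S_seminorm \<omega> (max lam 1) N f" if f: "f \<in> S" for f
  proof -
    have "norm (u f) \<le> C * S_seminorm \<omega> lam N f" by (rule C[OF f])
    also have "\<dots> \<le> \<bar>C\<bar> * S_seminorm \<omega> lam N f" by (intro mult_right_mono S_seminorm_nonneg f) auto
    also have "\<dots> \<le> \<bar>C\<bar> * S_seminorm \<omega> (max lam 1) N f" by (intro mult_left_mono S_seminorm_mono f) auto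
    finally show ?thesis .
  qed
  then show ?thesis by (intro exI[of _ "\<bar>C\<bar>"] exI[of _ "max lam 1"] conjI exI[of _ N]) auto
qed

text \<open>The functional is only known to be finitely additive. Peeling off n terms leaves its
  value on the tail, and continuity bounds that value by a tail of the seminorm series, which tends
  to 0.\<close>

lemma dual_series:
  fixes f :: "nat \<Rightarrow> ('n::finite) fn"
  assumes u: "u \<in> S'_omega \<omega>" and f: "\<And>i. f i \<in> S" and sm: "\<And>lam N. lam > 0 \<Longrightarrow> summable (\<lambda>i. S_seminorm \<omega> lam N (f i))"
  shows "(\<lambda>i. u (f i)) sums u (\<lambda>x. \<Sum>i. f i x)"
proof -
  let ?T = "\<lambda>n x. \<Sum>i. f (i + n) x"
  have sm': "summable (\<lambda>i. S_seminorm \<omega> lam N (f (i + n)))" if "lam > 0" for lam N n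
    using sm[OF that] by (subst summable_iff_shift)
  have TS: "?T n \<in> S" for n by (rule S_series(1)) (use f sm' in auto)
  have split: "u (?T 0) = (\<Sum>i<n. u (f i)) + u (?T n)" for n
  proof (induction n)
    case (Suc n)
    have "?T n = (\<lambda>x. f n x + ?T (Suc n) x)"
    proof
      fix x
      have s: "summable (\<lambda>i. f (i + n) x)" by (rule S_series(3)[where f="\<lambda>i. f (i + n)"]) (use f sm' in auto)
      show "?T n x = f n x + ?T (Suc n) x" using suminf_split_head[OF s] by simp
    qed
    then have "u (?T n) = u (f n) + u (?T (Suc n))" using dual_add[OF u f TS, of n "Suc n"] by simp
    with Suc show ?case by simp
  qed simp
  obtain C lam N where C: "C \<ge> 0" "lam > 0" "\<And>f. f \<in> S \<Longrightarrow> norm (u f) \<le> C * S_seminorm \<omega> lam N f"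
    using dual_bound[OF u] by blast
  have "(\<lambda>n. u (?T n)) \<longlonglongrightarrow> 0"
  proof (rule tendsto_norm_zero_cancel, rule tendsto_sandwich[OF always_eventually always_eventually tendsto_const])
    have "(\<lambda>n. \<Sum>i. S_seminorm \<omega> lam N (f (i + n))) \<longlonglongrightarrow> 0" by (rule suminf_exist_split2[OF sm[OF C(2)]])
    then show "(\<lambda>n. C * (2 * (\<Sum>i. S_seminorm \<omega> lam N (f (i + n))))) \<longlonglongrightarrow> 0"
      by (intro tendsto_mult_right_zero)
    show "\<forall>n. norm (u (?T n)) \<le> C * (2 * (\<Sum>i. S_seminorm \<omega> lam N (f (i + n))))"
    proof
      fix n
      have "norm (u (?T n)) \<le> C * S_seminorm \<omega> lam N (?T n)" by (rule C(3)[OF TS])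
      also have "\<dots> \<le> C * (2 * (\<Sum>i. S_seminorm \<omega> lam N (f (i + n))))"
        by (intro mult_left_mono C S_series(2)) (use f sm' C in auto)
      finally show "norm (u (?T n)) \<le> C * (2 * (\<Sum>i. S_seminorm \<omega> lam N (f (i + n))))" .
    qed
  qed auto
  then have "(\<lambda>n. u (?T 0) - u (?T n)) \<longlonglongrightarrow> u (?T 0) - 0" by (intro tendsto_intros)
  moreover have "u (?T 0) - u (?T n) = (\<Sum>i<n. u (f i))" for n using split[of n] by simp
  ultimately show ?thesis by (simp add: sums_def)
qed

section \<open>Time-frequency shifts and the short-time Fourier transform\<close>
text \<open>Formulated for an arbitrary smooth k with a bound K, because it serves both the window
  and, with the rotated point (snd z, - fst z), its Fourier transform. The constants do not depend
  on k.\<close>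

lemma tfshift_exp_bound:
  assumes lam: "lam > 0"
  obtains \<mu> C where "\<mu> > 0" "C > 0" "\<And>k K js t z. smooth_fn (k :: ('n::finite) fn) \<Longrightarrow> length js \<le> N \<Longrightarrow>
    (\<And>q x. length q \<le> N \<Longrightarrow> norm (Dlist q k x) \<le> K * exp (- (lam * \<omega> (norm x)))) \<Longrightarrow>
    norm (Dlist js (tfshift z k) t) * exp (lam * \<omega> (norm t)) \<le> C * K * exp (\<mu> * \<omega> (norm z))"
proof -
  obtain \<mu> C where C: "\<mu> > 0" "C > 0" "\<And>t. t \<ge> 0 \<Longrightarrow> (1 + t) ^ N \<le> C * exp (\<mu> * \<omega> t)"
    using w_power_bound[of N] by blast
  have main: "norm (Dlist js (tfshift z k) t) * exp (lam * \<omega> (norm t)) \<le> (2 ^ N * C) * K * exp ((\<mu> + lam) * \<omega> (norm z))"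
    if k: "smooth_fn k" and js: "length js \<le> N" and K: "\<And>q x. length q \<le> N \<Longrightarrow> norm (Dlist q k x) \<le> K * exp (- (lam * \<omega> (norm x)))"
    for k :: "'n fn" and K js t z
  proof -
    have K0: "K \<ge> 0"
    proof -
      have "0 \<le> K * exp (- (lam * \<omega> (norm (0::real^'n))))" by (rule order_trans[OF norm_ge_zero K[of "[]" 0]]) simp
      then show ?thesis by (simp add: zero_le_mult_iff)
    qed
    have "norm (Dlist js (tfshift z k) t) \<le> 2 ^ length js * (1 + norm (snd z)) ^ length js * (K * exp (- (lam * \<omega> (norm (t - fst z)))))"
      by (rule Dlist_tfshift_bound[OF k]) (use K js in auto)
    also have "\<dots> \<le> 2 ^ N * (1 + norm z) ^ N * (K * exp (- (lam * \<omega> (norm (t - fst z)))))"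
    proof (intro mult_right_mono mult_mono power_increasing js)
      have "(1 + norm (snd z)) ^ length js \<le> (1 + norm z) ^ length js"
        using norm_snd_le[of "snd z" "fst z"] by (intro power_mono) auto
      also have "\<dots> \<le> (1 + norm z) ^ N" by (intro power_increasing js) auto
      finally show "(1 + norm (snd z)) ^ length js \<le> (1 + norm z) ^ N" .
    qed (use K0 in auto)
    also have "\<dots> \<le> 2 ^ N * (C * exp (\<mu> * \<omega> (norm z))) * (K * exp (- (lam * \<omega> (norm (t - fst z)))))"
      by (intro mult_right_mono mult_left_mono C) (use K0 in auto)
    finally have 1: "norm (Dlist js (tfshift z k) t) * exp (lam * \<omega> (norm t))
       \<le> 2 ^ N * (C * exp (\<mu> * \<omega> (norm z))) * (K * exp (- (lam * \<omega> (norm (t - fst z))))) * exp (lam * \<omega> (norm t))"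
      by (rule mult_right_mono) auto
    \<comment> \<open>Subadditivity moves the weight from t to the centre of the shift; the loss is
      an exponential of the weight of z, added to the one that absorbs the polynomial
      factor.\<close>
    have "\<omega> (norm t) \<le> \<omega> (norm (t - fst z)) + \<omega> (norm (fst z))" using w_triangle[of "t - fst z" "fst z"] by simp
    also have "\<omega> (norm (fst z)) \<le> \<omega> (norm z)" using norm_fst_le[of "fst z" "snd z"] by (intro w_mono) auto
    finally have "lam * \<omega> (norm t) \<le> lam * (\<omega> (norm (t - fst z)) + \<omega> (norm z))" using lam by (intro mult_left_mono) auto
    then have "exp (- (lam * \<omega> (norm (t - fst z)))) * exp (lam * \<omega> (norm t)) \<le> exp (lam * \<omega> (norm z))"
      by (simp add: exp_add[symmetric] algebra_simps)
    then have "2 ^ N * (C * exp (\<mu> * \<omega> (norm z))) * K * (exp (- (lam * \<omega> (norm (t - fst z)))) * exp (lam * \<omega> (norm t)))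
       \<le> 2 ^ N * (C * exp (\<mu> * \<omega> (norm z))) * K * exp (lam * \<omega> (norm z))"
      using C K0 by (intro mult_left_mono) auto
    then have "2 ^ N * (C * exp (\<mu> * \<omega> (norm z))) * (K * exp (- (lam * \<omega> (norm (t - fst z))))) * exp (lam * \<omega> (norm t))
       \<le> 2 ^ N * (C * exp (\<mu> * \<omega> (norm z))) * K * exp (lam * \<omega> (norm z))"
      by (simp only: mult.assoc)
    also have "\<dots> = (2 ^ N * C) * K * exp ((\<mu> + lam) * \<omega> (norm z))"
      by (simp add: mult_ac distrib_right exp_add)
    finally show ?thesis using 1 by linarith
  qed
  have p: "\<mu> + lam > 0" "2 ^ N * C > 0" using C lam by auto
  show ?thesis by (rule that[OF p main])
qed

lemma norm_swap_neg: "norm (snd z, - fst z) = norm (z :: 'a::real_normed_vector \<times> 'a)"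
  by (cases z) (simp add: norm_Pair add.commute)

text \<open>The second claim says that a distribution paired with shifted windows grows at most like
  an exponential of the weight. The decay of expansion coefficients only has to beat this
  growth.\<close>

lemma tfshift_S:
  fixes g :: "('n::finite) fn"
  assumes g: "g \<in> S"
  shows "tfshift z g \<in> S"
    and "lam > 0 \<Longrightarrow> \<exists>C>0. \<exists>\<mu>>0. \<forall>z. S_seminorm \<omega> lam N (tfshift z g) \<le> C * exp (\<mu> * \<omega> (norm z))"
proof -
  have ft: "fourier (tfshift z g) = (\<lambda>\<eta>. cis (fst z \<bullet> snd z) * tfshift (snd z, - fst z) (fourier g) \<eta>)" for z
    by (intro ext fourier_tfshift S_rapid g)
  have sm: "smooth_fn (tfshift z g)" "smooth_fn (tfshift z (fourier g))" for z
    by (intro Dlist_tfshift(2) S_smooth g)+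
  have Df: "norm (Dlist js (fourier (tfshift z g)) x) = norm (Dlist js (tfshift (snd z, - fst z) (fourier g)) x)" for js z x
    unfolding ft by (simp add: Dlist_scale[OF sm(2)] norm_mult)
  have key: "\<exists>C>0. \<exists>\<mu>>0. \<forall>z js x. length js \<le> N \<longrightarrow>
      norm (Dlist js (tfshift z g) x) * exp (lam * \<omega> (norm x)) \<le> C * exp (\<mu> * \<omega> (norm z)) \<and>
      norm (Dlist js (fourier (tfshift z g)) x) * exp (lam * \<omega> (norm x)) \<le> C * exp (\<mu> * \<omega> (norm z))"
    if lam: "lam > 0" for lam N
  proof -
    obtain \<mu> C where C: "\<mu> > 0" "C > 0" "\<And>k K js t z. smooth_fn (k :: 'n fn) \<Longrightarrow> length js \<le> N \<Longrightarrow>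
       (\<And>q x. length q \<le> N \<Longrightarrow> norm (Dlist q k x) \<le> K * exp (- (lam * \<omega> (norm x)))) \<Longrightarrow>
       norm (Dlist js (tfshift z k) t) * exp (lam * \<omega> (norm t)) \<le> C * K * exp (\<mu> * \<omega> (norm z))"
      apply (rule tfshift_exp_bound[OF lam, of N, where 'n='n])
      subgoal premises p for \<mu> C by (rule that[OF p(2) p(3) p(4)])
      done
    define K where "K = S_seminorm \<omega> lam N g + 1"
    have K: "K > 0" using S_seminorm_nonneg[OF g, of lam N] by (simp add: K_def)
    have le: "S_seminorm \<omega> lam N g * exp (- (lam * \<omega> (norm x))) \<le> K * exp (- (lam * \<omega> (norm x)))" for x :: "real^'n"
      by (intro mult_right_mono) (auto simp: K_def)
    have b: "norm (Dlist q g x) \<le> K * exp (- (lam * \<omega> (norm x)))" "norm (Dlist q (fourier g) x) \<le> K * exp (- (lam * \<omega> (norm x)))"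
      if "length q \<le> N" for q x
      using norm_le_seminorm[OF g that] le order_trans by blast+
    have "norm (Dlist js (tfshift z g) x) * exp (lam * \<omega> (norm x)) \<le> C * K * exp (\<mu> * \<omega> (norm z))"
      "norm (Dlist js (fourier (tfshift z g)) x) * exp (lam * \<omega> (norm x)) \<le> C * K * exp (\<mu> * \<omega> (norm z))"
      if js: "length js \<le> N" for z js x
      using C(3)[OF S_smooth(1)[OF g] js b(1), of z x] C(3)[OF S_smooth(2)[OF g] js b(2), of "(snd z, - fst z)" x]
      unfolding Df norm_swap_neg by auto
    then show ?thesis using C K by (intro exI[of _ "C * K"] conjI exI[of _ \<mu>]) auto
  qed
  show "tfshift z g \<in> S"
  proof (rule S_I)
    show "smooth_fn (tfshift z g)" by (rule sm)
    show "smooth_fn (fourier (tfshift z g))" unfolding ft by (intro smooth_scale sm)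
    fix js :: "'n list" and lam :: real assume "lam > 0"
    from key[OF this, of "length js"] obtain C \<mu> where
      C: "\<forall>z js' x. length js' \<le> length js \<longrightarrow>
      norm (Dlist js' (tfshift z g) x) * exp (lam * \<omega> (norm x)) \<le> C * exp (\<mu> * \<omega> (norm z)) \<and>
      norm (Dlist js' (fourier (tfshift z g)) x) * exp (lam * \<omega> (norm x)) \<le> C * exp (\<mu> * \<omega> (norm z))"
      by (elim exE conjE)
    show "\<exists>C. \<forall>x. norm (Dlist js (tfshift z g) x) * exp (lam * \<omega> (norm x)) \<le> C"
      using C[rule_format, of js z] by (intro exI[of _ "C * exp (\<mu> * \<omega> (norm z))"] allI) auto
    show "\<exists>C. \<forall>x. norm (Dlist js (fourier (tfshift z g)) x) * exp (lam * \<omega> (norm x)) \<le> C"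
      using C[rule_format, of js z] by (intro exI[of _ "C * exp (\<mu> * \<omega> (norm z))"] allI) auto
  qed
  show "\<exists>C>0. \<exists>\<mu>>0. \<forall>z. S_seminorm \<omega> lam N (tfshift z g) \<le> C * exp (\<mu> * \<omega> (norm z))" if lam: "lam > 0"
  proof -
    obtain C \<mu> where C: "C > 0" "\<mu> > 0" and *: "\<forall>z js x. length js \<le> N \<longrightarrow>
      norm (Dlist js (tfshift z g) x) * exp (lam * \<omega> (norm x)) \<le> C * exp (\<mu> * \<omega> (norm z)) \<and>
      norm (Dlist js (fourier (tfshift z g)) x) * exp (lam * \<omega> (norm x)) \<le> C * exp (\<mu> * \<omega> (norm z))"
      using key[OF lam, of N] by (elim exE conjE)
    note C3 = *[rule_format, THEN conjunct1] and C4 = *[rule_format, THEN conjunct2]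
    have "S_seminorm \<omega> lam N (tfshift z g) \<le> 2 * C * exp (\<mu> * \<omega> (norm z))" for z
      using S_seminorm_le[of N "tfshift z g" lam, OF C3 C4] by simp
    then show ?thesis using C(1,2) by (intro exI[of _ "2 * C"] conjI exI[of _ \<mu>]) auto
  qed
qed

text \<open>Covariance up to a unimodular factor: the modulus depends on the difference of the two
  points only. Therefore the Gram matrix is dominated by a convolution-type kernel, and estimates
  for a shifted test function are uniform in the shift.\<close>

lemma L2_inner_tfshift:
  "norm (L2_inner (tfshift w f) (tfshift z g)) = norm (L2_inner f (tfshift (z - w) g))"
proof -
  have "L2_inner (tfshift w f) (tfshift z g) = (\<integral>t. tfshift w f (t + fst w) * cnj (tfshift z g (t + fst w)) \<partial>lborel)"
    unfolding L2_inner_def by (rule integral_translate[symmetric])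
  also have "\<dots> = (\<integral>t. cis (fst w \<bullet> (snd w - snd z)) * (f t * cnj (tfshift (z - w) g t)) \<partial>lborel)"
  proof (intro Bochner_Integration.integral_cong refl)
    fix t
    have "cis ((t + fst w) \<bullet> snd w) * cnj (cis ((t + fst w) \<bullet> snd z)) = cis (fst w \<bullet> (snd w - snd z)) * cnj (cis (t \<bullet> (snd z - snd w)))"
      by (simp add: cis_cnj cis_mult algebra_simps)
    moreover have "tfshift w f (t + fst w) * cnj (tfshift z g (t + fst w))
        = (cis ((t + fst w) \<bullet> snd w) * cnj (cis ((t + fst w) \<bullet> snd z))) * (f t * cnj (g (t - fst (z - w))))"
      by (simp add: tfshift_def algebra_simps)
    ultimately show "tfshift w f (t + fst w) * cnj (tfshift z g (t + fst w)) = cis (fst w \<bullet> (snd w - snd z)) * (f t * cnj (tfshift (z - w) g t))"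
      by (simp add: tfshift_def mult_ac)
  qed
  also have "\<dots> = cis (fst w \<bullet> (snd w - snd z)) * L2_inner f (tfshift (z - w) g)"
    unfolding L2_inner_def by (rule Bochner_Integration.integral_mult_right_zero)
  finally show ?thesis by (simp add: norm_mult)
qed

lemma mult_exp_le_imp: "a * exp x \<le> C \<Longrightarrow> a \<le> C * exp (- x)" for a x C :: real
  by (simp add: exp_minus field_simps)

text \<open>Decay of a correlation in the translation x. The integrand enters through a domination
  hypothesis on r, so that the same statement serves the time side and the frequency side, where
  different phase factors occur.\<close>

lemma correlation_bound:
  fixes p q :: "('n::finite) fn"
  assumes p: "continuous_on UNIV p" "\<And>lam. lam > 0 \<Longrightarrow> \<exists>C. \<forall>x. norm (p x) * exp (lam * \<omega> (norm x)) \<le> C"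
    and q: "continuous_on UNIV q" "\<And>lam. lam > 0 \<Longrightarrow> \<exists>C. \<forall>x. norm (q x) * exp (lam * \<omega> (norm x)) \<le> C"
    and lam: "lam > 0"
  obtains C where "C \<ge> 0" "\<And>x r. (\<And>t. norm (r t) \<le> norm (p t) * norm (q (t - x))) \<Longrightarrow> continuous_on UNIV r \<Longrightarrow>
           norm (\<integral>t. r t \<partial>lborel :: complex) \<le> C * exp (- (lam * \<omega> (norm x)))"
proof -
  obtain \<mu> C where mu: "\<mu> > 0" "C > 0" "\<And>x :: real^'n. exp (- (\<mu> * \<omega> (norm x))) \<le> C * decay x"
    using exp_le_decay by auto
  \<comment> \<open>The part \<open>lam\<close> of the exponent is combined with that of q by
    subadditivity into decay in x; the part \<mu> pays for integrability in t.\<close>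
  obtain C1 where C1: "\<And>x. norm (p x) * exp ((lam + \<mu>) * \<omega> (norm x)) \<le> C1" using p(2)[of "lam + \<mu>"] lam mu by auto
  obtain C2 where C2: "\<And>x. norm (q x) * exp (lam * \<omega> (norm x)) \<le> C2" using q(2)[OF lam] by auto
  have C0: "C1 \<ge> 0" "C2 \<ge> 0"
    using C1[of 0] C2[of 0] by (meson order_trans mult_nonneg_nonneg norm_ge_zero exp_ge_zero)+
  let ?I = "\<integral>x. decay (x :: real^'n) \<partial>lborel"
  have main: "norm (\<integral>t. r t \<partial>lborel) \<le> (C1 * C2 * C * ?I) * exp (- (lam * \<omega> (norm x)))"
    if r: "\<And>t. norm (r t) \<le> norm (p t) * norm (q (t - x))" and rc: "continuous_on UNIV r" for x and r :: "real^'n \<Rightarrow> complex"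
  proof -
    have b: "norm (r t) \<le> C1 * C2 * C * exp (- (lam * \<omega> (norm x))) * decay t" for t
    proof -
      have "norm (p t) \<le> C1 * exp (- ((lam + \<mu>) * \<omega> (norm t)))" "norm (q (t - x)) \<le> C2 * exp (- (lam * \<omega> (norm (t - x))))"
        by (intro mult_exp_le_imp C1 C2)+
      then have "norm (p t) * norm (q (t - x)) \<le> (C1 * exp (- ((lam + \<mu>) * \<omega> (norm t)))) * (C2 * exp (- (lam * \<omega> (norm (t - x)))))"
        using C0 by (intro mult_mono) auto
      also have "\<dots> = C1 * C2 * (exp (- (lam * (\<omega> (norm t) + \<omega> (norm (t - x))))) * exp (- (\<mu> * \<omega> (norm t))))"
        by (simp add: exp_add[symmetric] algebra_simps)
      also have "\<dots> \<le> C1 * C2 * (exp (- (lam * \<omega> (norm x))) * (C * decay t))"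
      proof (intro mult_left_mono mult_mono mu)
        have "\<omega> (norm x) \<le> \<omega> (norm t) + \<omega> (norm (x - t))" by (rule w_diff)
        then show "exp (- (lam * (\<omega> (norm t) + \<omega> (norm (t - x))))) \<le> exp (- (lam * \<omega> (norm x)))"
          using lam by (simp add: norm_minus_commute)
      qed (use C0 in auto)
      finally show ?thesis using r[of t] by (simp add: mult_ac)
    qed
    have i: "integrable lborel r" by (rule integrable_le_decay[OF rc b])
    have "norm (\<integral>t. r t \<partial>lborel) \<le> (\<integral>t. norm (r t) \<partial>lborel)" by (rule integral_norm_bound)
    also have "\<dots> \<le> (\<integral>t. C1 * C2 * C * exp (- (lam * \<omega> (norm x))) * decay (t :: real^'n) \<partial>lborel)"
      by (intro integral_mono integrable_norm i integrable_mult_right integrable_decay b)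
    also have "\<dots> = (C1 * C2 * C * ?I) * exp (- (lam * \<omega> (norm x)))" by simp
    finally show ?thesis .
  qed
  have p: "C1 * C2 * C * ?I \<ge> 0" using C0 mu by (intro mult_nonneg_nonneg) (auto intro: integral_nonneg_AE)
  show ?thesis by (rule that[OF p main])
qed

lemma S_cont: "f \<in> S \<Longrightarrow> continuous_on UNIV f" "f \<in> S \<Longrightarrow> continuous_on UNIV (fourier f)"
  by (simp_all add: S_rapid rapid_cont)

lemma continuous_tfshift [continuous_intros]:
  "continuous_on UNIV g \<Longrightarrow> continuous_on UNIV (tfshift z g)"
  unfolding tfshift_def by (intro continuous_intros) (auto intro!: continuous_on_compose2[of UNIV g] continuous_intros)

text \<open>The time side gives decay in the translation, the frequency side, reached by Parseval,
  gives decay in the modulation. Each is taken at rate 2 lam, and their geometric mean decays at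
  rate lam in both, hence in the norm of z by subadditivity.\<close>

lemma stft_decay:
  fixes f g :: "('n::finite) fn"
  assumes f: "f \<in> S" and g: "g \<in> S" and lam: "lam > 0"
  shows "\<exists>C>0. \<forall>z. norm (L2_inner f (tfshift z g)) \<le> C * exp (- (lam * \<omega> (norm z)))"
proof -
  have lam2: "2 * lam > 0" using lam by simp
  note b = S_exp_bound[of _ "[]", simplified]
  obtain C1 where C1: "C1 \<ge> 0" "\<And>x r. (\<And>t. norm (r t) \<le> norm (f t) * norm (g (t - x))) \<Longrightarrow> continuous_on UNIV r \<Longrightarrow>
           norm (\<integral>t. r t \<partial>lborel :: complex) \<le> C1 * exp (- (2 * lam * \<omega> (norm x)))"
    apply (rule correlation_bound[OF S_cont(1)[OF f] b(1)[OF f] S_cont(1)[OF g] b(1)[OF g] lam2])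
    subgoal premises p for C by (rule that[OF p(2) p(3)])
    done
  obtain C2 where C2: "C2 \<ge> 0" "\<And>x r. (\<And>t. norm (r t) \<le> norm (fourier f t) * norm (fourier g (t - x))) \<Longrightarrow> continuous_on UNIV r \<Longrightarrow>
           norm (\<integral>t. r t \<partial>lborel :: complex) \<le> C2 * exp (- (2 * lam * \<omega> (norm x)))"
    apply (rule correlation_bound[OF S_cont(2)[OF f] b(2)[OF f] S_cont(2)[OF g] b(2)[OF g] lam2])
    subgoal premises p for C by (rule that[OF p(2) p(3)])
    done
  let ?P = "(2 * pi) ^ CARD('n)"
  define D where "D = max (max C1 C2) 1"
  have D: "C1 \<le> D" "C2 \<le> D" "D > 0" by (auto simp: D_def)
  have "norm (L2_inner f (tfshift z g)) \<le> D * exp (- (lam * \<omega> (norm z)))" for z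
  proof -
    let ?A = "norm (L2_inner f (tfshift z g))"
    let ?a = "exp (- (lam * \<omega> (norm (fst z))))" let ?b = "exp (- (lam * \<omega> (norm (snd z))))"
    have "?A \<le> C1 * exp (- (2 * lam * \<omega> (norm (fst z))))"
      unfolding L2_inner_def
    proof (rule C1(2))
      show "norm (f t * cnj (tfshift z g t)) \<le> norm (f t) * norm (g (t - fst z))" for t
        by (simp add: tfshift_def norm_mult)
    qed (intro continuous_intros S_cont f g)
    also have "\<dots> \<le> D * ?a\<^sup>2"
      using D by (intro mult_mono) (auto simp: power2_eq_square exp_add[symmetric])
    finally have 1: "?A \<le> D * ?a\<^sup>2" .
    have "of_real ?P * L2_inner f (tfshift z g) = (\<integral>\<xi>. fourier f \<xi> * cnj (fourier (tfshift z g) \<xi>) \<partial>lborel)"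
      unfolding L2_inner_def by (intro parseval S_rapid tfshift_S f g)
    then have "?P * ?A = norm (\<integral>\<xi>. fourier f \<xi> * cnj (fourier (tfshift z g) \<xi>) \<partial>lborel)"
      by (metis norm_mult norm_of_real abs_of_nonneg zero_le_power pi_ge_zero zero_le_mult_iff zero_le_numeral)
    also have "\<dots> \<le> C2 * exp (- (2 * lam * \<omega> (norm (snd z))))"
    proof (rule C2(2))
      show "norm (fourier f t * cnj (fourier (tfshift z g) t)) \<le> norm (fourier f t) * norm (fourier g (t - snd z))" for t
        unfolding fourier_tfshift[OF S_rapid(1)[OF g]] by (simp add: norm_mult tfshift_def)
    qed (intro continuous_intros S_cont tfshift_S f g)
    also have "\<dots> \<le> D * ?b\<^sup>2"
      using D by (intro mult_mono) (auto simp: power2_eq_square exp_add[symmetric])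
    finally have "?P * ?A \<le> D * ?b\<^sup>2" .
    moreover have "1 * ?A \<le> ?P * ?A"
      using pi_ge_two by (intro mult_right_mono one_le_power) auto
    ultimately have 2: "?A \<le> D * ?b\<^sup>2" by simp
    \<comment> \<open>The two estimates are multiplied; the square root of the product is the
      claim.\<close>
    have "?A * ?A \<le> (D * ?a\<^sup>2) * (D * ?b\<^sup>2)" using D by (intro mult_mono 1 2) auto
    also have "\<dots> = (D * ?a * ?b)\<^sup>2" by (simp add: power2_eq_square)
    finally have "?A\<^sup>2 \<le> (D * ?a * ?b)\<^sup>2" by (simp add: power2_eq_square)
    then have 3: "?A \<le> D * ?a * ?b" by (rule power2_le_imp_le) (use D in auto)
    have "?a * ?b \<le> exp (- (lam * \<omega> (norm z)))"
    proof -
      have "norm z \<le> norm (fst z) + norm (snd z)" using norm_Pair_le[of "fst z" "snd z"] by simp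
      then have "\<omega> (norm z) \<le> \<omega> (norm (fst z) + norm (snd z))" by (intro w_mono) auto
      also have "\<dots> \<le> \<omega> (norm (fst z)) + \<omega> (norm (snd z))" by (intro w_add) auto
      finally have "lam * \<omega> (norm z) \<le> lam * (\<omega> (norm (fst z)) + \<omega> (norm (snd z)))" using lam by (intro mult_left_mono) auto
      then show ?thesis by (simp add: exp_add[symmetric] algebra_simps)
    qed
    then have "D * (?a * ?b) \<le> D * exp (- (lam * \<omega> (norm z)))" using D by (intro mult_left_mono) auto
    with 3 show ?thesis by (simp only: mult.assoc)
  qed
  then show ?thesis using D by blast
qed

text \<open>Test functions act as distributions, so the termwise evaluation of series proved for the
  dual space applies to inner products.\<close>

lemma L2_inner_dual:
  assumes f: "f \<in> (S :: ('n::finite) fn set)"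
  shows "L2_inner f \<in> S'_omega \<omega>"
proof -
  have i: "integrable lborel (\<lambda>x. f x * cnj (g x))" if "g \<in> S" for g
    by (intro rapid_integrable rapid_prod rapid_cnj S_rapid f that)
  have "norm (L2_inner f g) \<le> (\<integral>x. norm (f x) \<partial>lborel) * S_seminorm \<omega> 1 0 g" if g: "g \<in> S" for g
  proof -
    have b: "norm (g x) \<le> S_seminorm \<omega> 1 0 g" for x
    proof -
      have "norm (g x) \<le> S_seminorm \<omega> 1 0 g * exp (- (1 * \<omega> (norm x)))" using norm_le_seminorm(1)[OF g, of "[]" 0 x 1] by simp
      also have "\<dots> \<le> S_seminorm \<omega> 1 0 g * 1" by (intro mult_left_mono S_seminorm_nonneg g) (simp add: w_nonneg)
      finally show ?thesis by simp
    qed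
    have "norm (L2_inner f g) \<le> (\<integral>x. norm (f x * cnj (g x)) \<partial>lborel)" unfolding L2_inner_def by (rule integral_norm_bound)
    also have "\<dots> \<le> (\<integral>x. norm (f x) * S_seminorm \<omega> 1 0 g \<partial>lborel)"
      by (intro integral_mono integrable_norm i g integrable_mult_left rapid_integrable S_rapid f)
         (auto simp: norm_mult intro!: mult_left_mono b)
    finally show ?thesis by simp
  qed
  moreover have "L2_inner f (\<lambda>t. g t + h t) = L2_inner f g + L2_inner f h" if "g \<in> S" "h \<in> S" for g h
    using i[OF that(1)] i[OF that(2)] by (simp add: L2_inner_def distrib_left)
  moreover have "L2_inner f (\<lambda>t. c * g t) = cnj c * L2_inner f g" for g c
  proof -
    have "L2_inner f (\<lambda>t. c * g t) = (\<integral>x. cnj c * (f x * cnj (g x)) \<partial>lborel)"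
      unfolding L2_inner_def by (simp add: mult_ac)
    then show ?thesis unfolding L2_inner_def by (simp only: Bochner_Integration.integral_mult_right_zero)
  qed
  ultimately show ?thesis unfolding S'_omega_def by blast
qed

end

lemma L2_inner_cnj: "L2_inner g f = cnj (L2_inner f g)"
proof -
  have "L2_inner g f = (\<integral>x. cnj (f x * cnj (g x)) \<partial>lborel)"
    unfolding L2_inner_def by (simp add: mult.commute)
  also have "\<dots> = cnj (L2_inner f g)" unfolding L2_inner_def by (rule Bochner_Integration.integral_cnj)
  finally show ?thesis .
qed

lemma L2_inner_self:
  assumes "rapid f"
  shows "L2_inner f f = of_real (L2_normsq f)"
proof -
  have "L2_inner f f = (\<integral>x. of_real ((norm (f x))\<^sup>2) \<partial>lborel)"
    unfolding L2_inner_def by (simp only: complex_norm_square)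
  then show ?thesis unfolding L2_normsq_def by (simp only: integral_complex_of_real)
qed

section \<open>Localisation of frames\<close>

text \<open>Cauchy-Schwarz with the square root of the kernel on both factors, carried out on finite
  sections and only then passed to the limit. The matrix enters through the products c i j and their
  row sums, so no operator has to be defined.\<close>

lemma schur_test:
  fixes c :: "nat \<Rightarrow> nat \<Rightarrow> complex" and K :: "nat \<Rightarrow> nat \<Rightarrow> real"
  assumes K0: "\<And>i j. K i j \<ge> 0"
    and row: "\<And>i n. (\<Sum>j<n. K i j) \<le> e" and col: "\<And>j n. (\<Sum>i<n. K i j) \<le> e"
    and c: "\<And>i j. norm (c i j) \<le> K i j * \<beta> j" and r: "\<And>i. (\<lambda>j. c i j) sums r i"
    and b: "summable (\<lambda>j. (\<beta> j)\<^sup>2)"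
  shows "summable (\<lambda>i. (norm (r i))\<^sup>2)" "(\<Sum>i. (norm (r i))\<^sup>2) \<le> e\<^sup>2 * (\<Sum>j. (\<beta> j)\<^sup>2)"
proof -
  have e0: "e \<ge> 0" using row[of 0 0] by simp
  have fin: "(\<Sum>i<n. (norm (\<Sum>j<m. c i j))\<^sup>2) \<le> e\<^sup>2 * (\<Sum>j. (\<beta> j)\<^sup>2)" for n m
  proof -
    have "(norm (\<Sum>j<m. c i j))\<^sup>2 \<le> e * (\<Sum>j<m. K i j * (\<beta> j)\<^sup>2)" for i
    proof -
      have "norm (\<Sum>j<m. c i j) \<le> (\<Sum>j<m. K i j * \<beta> j)" by (intro sum_norm_le c)
      then have "(norm (\<Sum>j<m. c i j))\<^sup>2 \<le> (\<Sum>j<m. K i j * \<beta> j)\<^sup>2" by (intro power_mono) auto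
      also have "(\<Sum>j<m. K i j * \<beta> j) = (\<Sum>j<m. sqrt (K i j) * (sqrt (K i j) * \<beta> j))"
        using K0 by (simp add: mult.assoc[symmetric])
      also have "(\<dots>)\<^sup>2 \<le> (\<Sum>j<m. (sqrt (K i j))\<^sup>2) * (\<Sum>j<m. (sqrt (K i j) * \<beta> j)\<^sup>2)"
        by (rule Cauchy_Schwarz_ineq_sum)
      also have "\<dots> = (\<Sum>j<m. K i j) * (\<Sum>j<m. K i j * (\<beta> j)\<^sup>2)"
        using K0 by (simp add: power_mult_distrib)
      also have "\<dots> \<le> e * (\<Sum>j<m. K i j * (\<beta> j)\<^sup>2)"
        using K0 by (intro mult_right_mono row sum_nonneg) auto
      finally show ?thesis .
    qed
    then have "(\<Sum>i<n. (norm (\<Sum>j<m. c i j))\<^sup>2) \<le> (\<Sum>i<n. e * (\<Sum>j<m. K i j * (\<beta> j)\<^sup>2))" by (rule sum_mono)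
    also have "\<dots> = e * (\<Sum>j<m. (\<Sum>i<n. K i j) * (\<beta> j)\<^sup>2)"
      unfolding sum_distrib_left[symmetric] sum_distrib_right by (subst sum.swap) simp
    also have "\<dots> \<le> e * (\<Sum>j<m. e * (\<beta> j)\<^sup>2)"
      by (intro mult_left_mono sum_mono mult_right_mono col e0) auto
    also have "\<dots> = e\<^sup>2 * (\<Sum>j<m. (\<beta> j)\<^sup>2)" by (simp add: sum_distrib_left power2_eq_square mult.assoc)
    also have "\<dots> \<le> e\<^sup>2 * (\<Sum>j. (\<beta> j)\<^sup>2)" by (intro mult_left_mono sum_le_suminf b) auto
    finally show ?thesis .
  qed
  have part: "(\<Sum>i<n. (norm (r i))\<^sup>2) \<le> e\<^sup>2 * (\<Sum>j. (\<beta> j)\<^sup>2)" for n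
  proof (rule LIMSEQ_le_const2)
    show "(\<lambda>m. \<Sum>i<n. (norm (\<Sum>j<m. c i j))\<^sup>2) \<longlonglongrightarrow> (\<Sum>i<n. (norm (r i))\<^sup>2)"
      using r by (intro tendsto_intros) (auto simp: sums_def)
  qed (use fin in auto)
  show s: "summable (\<lambda>i. (norm (r i))\<^sup>2)" by (rule summableI_nonneg_bounded[OF _ part]) auto
  show "(\<Sum>i. (norm (r i))\<^sup>2) \<le> e\<^sup>2 * (\<Sum>j. (\<beta> j)\<^sup>2)" by (rule suminf_le_const[OF s part])
qed

text \<open>The parameter t shifts the cost of the cross term: a small t leaves the first square
  almost unchanged, and the large factor falls on a term that is made small separately.\<close>

lemma norm_sum_squared_le:
  fixes x y :: "'a::real_normed_vector"
  assumes "t > 0"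
  shows "(norm (x + y))\<^sup>2 \<le> (1 + t) * (norm x)\<^sup>2 + (1 + 1 / t) * (norm y)\<^sup>2"
proof -
  have "(norm (x + y))\<^sup>2 \<le> (norm x + norm y)\<^sup>2" by (intro power_mono norm_triangle_ineq) auto
  also have "\<dots> = (norm x)\<^sup>2 + (norm y)\<^sup>2 + 2 * (sqrt t * norm x) * (norm y / sqrt t)"
    using assms by (simp add: power2_sum)
  also have "2 * (sqrt t * norm x) * (norm y / sqrt t) \<le> (sqrt t * norm x)\<^sup>2 + (norm y / sqrt t)\<^sup>2"
    by (rule sum_squares_bound)
  also have "\<dots> = t * (norm x)\<^sup>2 + (norm y)\<^sup>2 / t" using assms by (simp add: power_mult_distrib power_divide)
  finally show ?thesis by (simp add: algebra_simps)
qed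

lemma integrable_normsq:
  assumes "rapid f" shows "integrable lborel (\<lambda>x. (norm (f x))\<^sup>2)"
proof -
  have "integrable lborel (\<lambda>x. norm (f x * cnj (f x)))" by (intro integrable_norm rapid_integrable rapid_prod rapid_cnj assms)
  then show ?thesis by (simp add: norm_mult power2_eq_square)
qed

lemma continuous_L2_normsq_0:
  fixes f :: "('n::finite) fn"
  assumes f: "rapid f" and 0: "L2_normsq f \<le> 0"
  shows "f = (\<lambda>_. 0)"
proof (rule ccontr)
  assume "f \<noteq> (\<lambda>_. 0)"
  then obtain x0 where x0: "f x0 \<noteq> 0" by auto
  have c: "continuous_on UNIV f" by (rule rapid_cont[OF f])
  then have "isCont f x0" by (simp add: continuous_on_eq_continuous_at)
  then obtain r where r: "r > 0" "\<And>x. dist x x0 < r \<Longrightarrow> dist (f x) (f x0) < norm (f x0) / 2"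
    using x0 unfolding continuous_at_eps_delta by (meson half_gt_zero zero_less_norm_iff)
  define e where "e = (norm (f x0) / 2)\<^sup>2"
  have e: "e > 0" using x0 by (simp add: e_def)
  have b: "e * indicator (ball x0 r) x \<le> (norm (f x))\<^sup>2" for x
  proof (cases "x \<in> ball x0 r")
    case True
    then have "dist (f x) (f x0) < norm (f x0) / 2" using r(2)[of x] by (simp add: dist_commute)
    then have "norm (f x0) / 2 \<le> norm (f x)" using norm_triangle_sub[of "f x0" "f x"] by (simp add: dist_norm norm_minus_commute)
    then have "e \<le> (norm (f x))\<^sup>2" unfolding e_def by (intro power_mono) auto
    then show ?thesis using True by simp
  qed simp
  have i: "integrable lborel (\<lambda>x. (norm (f x))\<^sup>2)" by (rule integrable_normsq[OF f])
  have ib: "integrable lborel (indicator (ball x0 r) :: real^'n \<Rightarrow> real)"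
    using emeasure_lborel_ball_finite[of x0 r] by (intro integrable_real_indicator) auto
  have "e * measure lborel (ball x0 r) = (\<integral>x. e * indicator (ball x0 r) x \<partial>lborel)" by simp
  also have "\<dots> \<le> L2_normsq f" unfolding L2_normsq_def
    by (intro integral_mono integrable_mult_right ib i b)
  finally have "e * measure lborel (ball x0 r) \<le> 0" using 0 by simp
  moreover have "measure lborel (ball x0 r) > 0" using content_ball_pos[OF r(1), of x0] by (simp add: measure_completion)
  ultimately show False using e by (simp add: mult_le_0_iff)
qed

lemma exp_minus_one_bound: "\<bar>exp s - 1\<bar> \<le> \<bar>s\<bar> * exp \<bar>s\<bar>" for s :: real
proof -
  have 1: "exp t - 1 \<le> t * exp t" for t :: real
    using mult_left_mono[OF exp_ge_add_one_self[of "-t"], of "exp t"] by (simp add: exp_minus algebra_simps)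
  show ?thesis
  proof (cases "s \<ge> 0")
    case True then show ?thesis using 1[of s] by simp
  next
    case False
    have "\<bar>exp s - 1\<bar> = 1 - exp s" using False by simp
    also have "\<dots> \<le> - s" using exp_ge_add_one_self[of s] by linarith
    also have "\<dots> \<le> - s * exp (- s)" using False by (simp add: mult_le_cancel_left1)
    finally show ?thesis using False by simp
  qed
qed

context weight_fun
begin

text \<open>The Lipschitz regularisation of \<^term>\<open>\<lambda>v. lam * \<omega> (norm v)\<close>: its slope is as small as we like, it keeps the
  modulus of continuity of the weight, and it stays within a constant of the weight because \<^term>\<open>\<omega>\<close> is sublinear.\<close>

definition regw :: "real \<Rightarrow> real \<Rightarrow> 'a::real_normed_vector \<Rightarrow> real" where
  "regw lam \<delta> v = (INF y. lam * \<omega> (norm y) + \<delta> * norm (v - y))"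

lemma regw_bdd: "lam > 0 \<Longrightarrow> \<delta> > 0 \<Longrightarrow> bdd_below (range (\<lambda>y. lam * \<omega> (norm y) + \<delta> * norm (v - y)))"
  by (rule bdd_belowI[of _ 0]) (auto intro!: add_nonneg_nonneg mult_nonneg_nonneg w_nonneg)

lemma regw_le: "lam > 0 \<Longrightarrow> \<delta> > 0 \<Longrightarrow> regw lam \<delta> v \<le> lam * \<omega> (norm y) + \<delta> * norm (v - y)"
  unfolding regw_def by (rule cINF_lower[OF regw_bdd]) auto

lemma regw_le_weight: "lam > 0 \<Longrightarrow> \<delta> > 0 \<Longrightarrow> regw lam \<delta> v \<le> lam * \<omega> (norm v)"
  using regw_le[of lam \<delta> v v] by simp

lemma regw_lipschitz:
  assumes "lam > 0" "\<delta> > 0"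
  shows "regw lam \<delta> v - regw lam \<delta> v' \<le> \<delta> * norm (v - v')"
proof -
  have "regw lam \<delta> v - \<delta> * norm (v - v') \<le> regw lam \<delta> v'"
    unfolding regw_def[of _ _ v']
  proof (rule cINF_greatest)
    fix y
    have "regw lam \<delta> v \<le> lam * \<omega> (norm y) + \<delta> * norm (v - y)" by (rule regw_le[OF assms])
    also have "\<delta> * norm (v - y) \<le> \<delta> * (norm (v - v') + norm (v' - y))"
      using assms norm_triangle_ineq[of "v - v'" "v' - y"] by (intro mult_left_mono) auto
    finally show "regw lam \<delta> v - \<delta> * norm (v - v') \<le> lam * \<omega> (norm y) + \<delta> * norm (v' - y)"
      by (simp add: algebra_simps)
  qed simp
  then show ?thesis by simp
qed

text \<open>A competitor y for v' is moved to y + (v - v'), which is a competitor for v at the same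
  distance. Subadditivity bounds the change of its weight, so the infimal convolution inherits the
  modulus of continuity of \<omega>.\<close>

lemma regw_modulus:
  assumes "lam > 0" "\<delta> > 0"
  shows "regw lam \<delta> v - regw lam \<delta> v' \<le> lam * \<omega> (norm (v - v'))"
proof -
  have "regw lam \<delta> v - lam * \<omega> (norm (v - v')) \<le> regw lam \<delta> v'"
    unfolding regw_def[of _ _ v']
  proof (rule cINF_greatest)
    fix y
    have "regw lam \<delta> v \<le> lam * \<omega> (norm (y + (v - v'))) + \<delta> * norm (v - (y + (v - v')))" by (rule regw_le[OF assms])
    also have "v - (y + (v - v')) = v' - y" by simp
    also have "lam * \<omega> (norm (y + (v - v'))) \<le> lam * (\<omega> (norm y) + \<omega> (norm (v - v')))"
      using assms by (intro mult_left_mono w_triangle) auto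
    finally show "regw lam \<delta> v - lam * \<omega> (norm (v - v')) \<le> lam * \<omega> (norm y) + \<delta> * norm (v' - y)"
      by (simp add: algebra_simps)
  qed simp
  then show ?thesis by simp
qed

text \<open>Replacing v by a competitor y loses at most the weight of v - y, and sublinearity with
  slope \<delta> / lam bounds this by the penalty plus a constant. This is the only place where the
  price of a small slope appears.\<close>

lemma regw_lower:
  assumes "lam > 0" "\<delta> > 0"
  shows "\<exists>C\<ge>0. \<forall>v :: 'a::real_normed_vector. lam * \<omega> (norm v) \<le> regw lam \<delta> v + C"
proof -
  obtain C where C: "C \<ge> 0" "\<And>t. t \<ge> 0 \<Longrightarrow> \<omega> t \<le> (\<delta> / lam) * t + C"
    using w_sublinear[of "\<delta> / lam"] assms by auto
  have "lam * \<omega> (norm v) - lam * C \<le> regw lam \<delta> v" for v :: 'a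
    unfolding regw_def
  proof (rule cINF_greatest)
    fix y :: 'a
    have "\<omega> (norm v) \<le> \<omega> (norm y) + \<omega> (norm (v - y))" by (rule w_diff)
    also have "\<omega> (norm (v - y)) \<le> (\<delta> / lam) * norm (v - y) + C" by (rule C) simp
    finally have "lam * \<omega> (norm v) \<le> lam * (\<omega> (norm y) + ((\<delta> / lam) * norm (v - y) + C))"
      using assms by (intro mult_left_mono) auto
    also have "\<dots> = lam * \<omega> (norm y) + \<delta> * norm (v - y) + lam * C" using assms by (simp add: field_simps)
    finally show "lam * \<omega> (norm v) - lam * C \<le> lam * \<omega> (norm y) + \<delta> * norm (v - y)" by simp
  qed simp
  then have "\<And>v :: 'a. lam * \<omega> (norm v) \<le> regw lam \<delta> v + lam * C" by (simp add: diff_le_eq)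
  then show ?thesis using assms C by (intro exI[of _ "lam * C"]) auto
qed

lemma L2_inner_linear:
  assumes "f \<in> S" "h \<in> S" "k \<in> S"
  shows "L2_inner (\<lambda>t. f t + c * h t) k = L2_inner f k + c * L2_inner h k"
proof -
  have i: "integrable lborel (\<lambda>x. f x * cnj (k x))" "integrable lborel (\<lambda>x. h x * cnj (k x))"
    by (intro rapid_integrable rapid_prod rapid_cnj S_rapid assms)+
  have "L2_inner (\<lambda>t. f t + c * h t) k = (\<integral>x. f x * cnj (k x) + c * (h x * cnj (k x)) \<partial>lborel)"
    unfolding L2_inner_def by (simp add: algebra_simps)
  also have "\<dots> = L2_inner f k + (\<integral>x. c * (h x * cnj (k x)) \<partial>lborel)"
    unfolding L2_inner_def using i by (intro Bochner_Integration.integral_add) auto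
  also have "(\<integral>x. c * (h x * cnj (k x)) \<partial>lborel) = c * L2_inner h k"
    unfolding L2_inner_def by (rule Bochner_Integration.integral_mult_right_zero)
  finally show ?thesis .
qed

lemma L2_normsq_tfshift: "L2_normsq (tfshift w f) = L2_normsq f"
  using integral_translate[of "\<lambda>x. (norm (f x))\<^sup>2" "- fst w"]
  by (simp add: L2_normsq_def tfshift_def norm_mult)

lemma L2_normsq_nonneg: "0 \<le> L2_normsq f"
  unfolding L2_normsq_def by (rule integral_nonneg_AE) auto

end

text \<open>The frame inequalities are demanded on test functions only, since only these are ever
  expanded. Separation is expressed by a uniform bound on inverse power sums, which covers
  nonuniform point sets and is what the Schur estimates consume.\<close>

locale gabor_type_frame = weight_fun \<omega> for \<omega> +
  fixes g :: "('n::finite) fn" and z :: "nat \<Rightarrow> (real^'n) \<times> (real^'n)" and A B Cs :: real and M :: nat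
  assumes gS: "g \<in> S_omega \<omega>"
    and Apos: "A > 0" and AB: "A \<le> B"
    and sep: "\<And>w n. (\<Sum>i<n. 1 / (1 + norm (w - z i)) ^ M) \<le> Cs"
    and lower: "\<And>f. f \<in> S_omega \<omega> \<Longrightarrow> A * L2_normsq f \<le> (\<Sum>i. (norm (L2_inner f (tfshift (z i) g)))\<^sup>2)"
    and upper: "\<And>f. f \<in> S_omega \<omega> \<Longrightarrow> (\<Sum>i. (norm (L2_inner f (tfshift (z i) g)))\<^sup>2) \<le> B * L2_normsq f"
begin

abbreviation G :: "nat \<Rightarrow> 'n fn" where "G i \<equiv> tfshift (z i) g"

text \<open>The step size of the relaxation iteration: with 1/B the iteration operator lies between
  0 and 1 - A/B in the sense of quadratic forms.\<close>

definition \<rho> :: real where "\<rho> = 1 / B"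

lemma rho: "\<rho> > 0" "\<rho> * B = 1" "B > 0"
  using Apos AB by (auto simp: \<rho>_def)

lemma GS: "G i \<in> S"
  by (rule tfshift_S(1)[OF gS])

lemma sep_exp: "\<exists>\<nu>>0. \<exists>K>0. \<forall>w. summable (\<lambda>i. exp (- (\<nu> * \<omega> (norm (w - z i))))) \<and> (\<Sum>i. exp (- (\<nu> * \<omega> (norm (w - z i))))) \<le> K"
proof -
  obtain \<nu> C where nu: "\<nu> > 0" "C > 0" "\<And>t. t \<ge> 0 \<Longrightarrow> exp (- (\<nu> * \<omega> t)) \<le> C / (1 + t) ^ M"
    using w_exp_decay[of M] by blast
  have Cs: "Cs \<ge> 0" using sep[of 0 0] by simp
  have p: "(\<Sum>i<n. exp (- (\<nu> * \<omega> (norm (w - z i))))) \<le> C * Cs + 1" for n w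
  proof -
    have "(\<Sum>i<n. exp (- (\<nu> * \<omega> (norm (w - z i))))) \<le> (\<Sum>i<n. C * (1 / (1 + norm (w - z i)) ^ M))"
      using nu(3) by (intro sum_mono) auto
    also have "\<dots> = C * (\<Sum>i<n. 1 / (1 + norm (w - z i)) ^ M)" by (simp only: sum_distrib_left)
    also have "\<dots> \<le> C * Cs" using nu(2) by (intro mult_left_mono sep) auto
    finally show ?thesis by simp
  qed
  have "summable (\<lambda>i. exp (- (\<nu> * \<omega> (norm (w - z i)))))" for w
    by (rule summableI_nonneg_bounded[OF _ p]) auto
  moreover from this have "(\<Sum>i. exp (- (\<nu> * \<omega> (norm (w - z i))))) \<le> C * Cs + 1" for w
    using p by (rule suminf_le_const)
  moreover have "C * Cs + 1 > 0" using nu Cs by (simp add: add_nonneg_pos)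
  ultimately show ?thesis using nu(1) by blast
qed

text \<open>The coefficients for which synthesis converges in the test space itself. Mere square
  summability would give convergence in L2, where a distribution cannot be applied.\<close>

definition rapid_seq :: "(nat \<Rightarrow> complex) \<Rightarrow> bool" where
  "rapid_seq b \<longleftrightarrow> (\<forall>lam>0. \<exists>C. \<forall>i. norm (b i) * exp (lam * \<omega> (norm (z i))) \<le> C)"

definition synth :: "(nat \<Rightarrow> complex) \<Rightarrow> 'n fn" where
  "synth b = (\<lambda>t. \<Sum>i. b i * G i t)"

lemma rapid_seq_summable:
  assumes "rapid_seq b"
  shows "summable (\<lambda>i. norm (b i) * exp (lam * \<omega> (norm (z i))))"
proof -
  obtain \<nu> K where nu: "\<nu> > 0" "\<And>w. summable (\<lambda>i. exp (- (\<nu> * \<omega> (norm (w - z i)))))" using sep_exp by blast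
  define l where "l = max (lam + \<nu>) 1"
  obtain C where C: "\<And>i. norm (b i) * exp (l * \<omega> (norm (z i))) \<le> C" using assms unfolding rapid_seq_def l_def by (metis less_max_iff_disj zero_less_one)
  have s: "summable (\<lambda>i. C * exp (- (\<nu> * \<omega> (norm (0 - z i)))))" by (intro summable_mult nu)
  show ?thesis
  proof (rule summable_comparison_test'[OF s, of 0])
    fix i
    have "exp (lam * \<omega> (norm (z i))) = exp ((lam + \<nu>) * \<omega> (norm (z i))) * exp (- (\<nu> * \<omega> (norm (0 - z i))))"
      by (simp add: exp_add[symmetric] algebra_simps)
    also have "\<dots> \<le> exp (l * \<omega> (norm (z i))) * exp (- (\<nu> * \<omega> (norm (0 - z i))))"
      by (intro mult_right_mono) (auto simp: l_def intro!: mult_right_mono w_nonneg)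
    finally have "norm (b i) * exp (lam * \<omega> (norm (z i))) \<le> norm (b i) * (exp (l * \<omega> (norm (z i))) * exp (- (\<nu> * \<omega> (norm (0 - z i)))))"
      by (rule mult_left_mono) auto
    also have "\<dots> \<le> C * exp (- (\<nu> * \<omega> (norm (0 - z i))))"
      using mult_right_mono[OF C[of i], of "exp (- (\<nu> * \<omega> (norm (0 - z i))))"] by (simp add: mult.assoc)
    finally show "norm (norm (b i) * exp (lam * \<omega> (norm (z i)))) \<le> C * exp (- (\<nu> * \<omega> (norm (0 - z i))))" by simp
  qed
qed

lemma rapid_seq_abs_summable: "rapid_seq b \<Longrightarrow> summable (\<lambda>i. norm (b i))"
  using rapid_seq_summable[of b 0] by simp

lemma rapid_seq_square_summable:
  assumes "rapid_seq b" shows "summable (\<lambda>i. (norm (b i))\<^sup>2)"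
proof -
  have s: "summable (\<lambda>i. norm (b i))" by (rule rapid_seq_abs_summable[OF assms])
  obtain C where C: "\<And>i. norm (b i) * exp (1 * \<omega> (norm (z i))) \<le> C" using assms unfolding rapid_seq_def by (metis zero_less_one)
  have "norm (b i) \<le> C" for i
    using mult_left_mono[of 1 "exp (1 * \<omega> (norm (z i)))" "norm (b i)"] C[of i] w_nonneg[of "norm (z i)"] by simp
  then show ?thesis
    by (intro summable_comparison_test'[OF summable_mult[OF s, of C], of 0]) (auto simp: power2_eq_square intro!: mult_right_mono)
qed

text \<open>Multiplication by an exponential weight stays in the class, because every rate is
  available; this makes the conjugated sequences legitimate.\<close>

lemma rapid_seq_mult:
  assumes b: "rapid_seq b" and c: "\<And>i. norm (c i) \<le> K * exp (l * \<omega> (norm (z i)))"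
  shows "rapid_seq (\<lambda>i. c i * b i)"
  unfolding rapid_seq_def
proof (intro allI impI)
  fix lam :: real assume lam: "lam > 0"
  define l' where "l' = \<bar>l\<bar> + lam"
  have "l' > 0" using lam by (simp add: l'_def)
  then obtain C where C: "\<And>i. norm (b i) * exp (l' * \<omega> (norm (z i))) \<le> C" using b unfolding rapid_seq_def by blast
  have "norm (c i * b i) * exp (lam * \<omega> (norm (z i))) \<le> \<bar>K\<bar> * C" for i
  proof -
    have "norm (c i) \<le> \<bar>K\<bar> * exp (l * \<omega> (norm (z i)))" by (rule order_trans[OF c]) (auto intro: mult_right_mono)
    also have "\<dots> \<le> \<bar>K\<bar> * exp (\<bar>l\<bar> * \<omega> (norm (z i)))" by (auto intro!: mult_left_mono mult_right_mono w_nonneg)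
    finally have "norm (c i * b i) * exp (lam * \<omega> (norm (z i))) \<le> (\<bar>K\<bar> * exp (\<bar>l\<bar> * \<omega> (norm (z i)))) * (norm (b i) * exp (lam * \<omega> (norm (z i))))"
      unfolding norm_mult mult.assoc[of "norm (c i)"] by (rule mult_right_mono) auto
    also have "\<dots> = \<bar>K\<bar> * (norm (b i) * exp (l' * \<omega> (norm (z i))))"
      by (simp add: l'_def distrib_right exp_add)
    also have "\<dots> \<le> \<bar>K\<bar> * C" by (intro mult_left_mono C) auto
    finally show ?thesis .
  qed
  then show "\<exists>C. \<forall>i. norm (c i * b i) * exp (lam * \<omega> (norm (z i))) \<le> C" by blast
qed

lemma synth_terms:
  assumes b: "rapid_seq b"
  shows "(\<lambda>t. b i * G i t) \<in> S" "lam > 0 \<Longrightarrow> summable (\<lambda>i. S_seminorm \<omega> lam N (\<lambda>t. b i * G i t))"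
proof -
  show "(\<lambda>t. b i * G i t) \<in> S" for i by (rule S_scale(1)[OF GS])
  assume lam: "lam > 0"
  obtain C \<mu> where C: "C > 0" "\<mu> > 0" "\<And>w. S_seminorm \<omega> lam N (tfshift w g) \<le> C * exp (\<mu> * \<omega> (norm w))"
    using tfshift_S(2)[OF gS lam, of N] by blast
  have s: "summable (\<lambda>i. C * (norm (b i) * exp (\<mu> * \<omega> (norm (z i)))))" by (intro summable_mult rapid_seq_summable b)
  show "summable (\<lambda>i. S_seminorm \<omega> lam N (\<lambda>t. b i * G i t))"
  proof (rule summable_comparison_test'[OF s, of 0])
    fix i
    have "S_seminorm \<omega> lam N (\<lambda>t. b i * G i t) \<le> norm (b i) * S_seminorm \<omega> lam N (G i)" by (rule S_scale(2)[OF GS])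
    also have "\<dots> \<le> norm (b i) * (C * exp (\<mu> * \<omega> (norm (z i))))" by (intro mult_left_mono C) auto
    finally show "norm (S_seminorm \<omega> lam N (\<lambda>t. b i * G i t)) \<le> C * (norm (b i) * exp (\<mu> * \<omega> (norm (z i))))"
      using S_seminorm_nonneg[OF S_scale(1)[OF GS], of lam N "b i" i] by (simp add: mult_ac)
  qed
qed

lemma synth_S: "rapid_seq b \<Longrightarrow> synth b \<in> S"
  unfolding synth_def by (rule S_series(1)) (rule synth_terms; assumption)+

lemma dual_synth:
  assumes "u \<in> S'_omega \<omega>" "rapid_seq b"
  shows "(\<lambda>i. cnj (b i) * u (G i)) sums u (synth b)"
  using dual_series[OF assms(1) synth_terms[OF assms(2)]] dual_scale[OF assms(1) GS] by (simp add: synth_def)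

lemma rapid_seq_coefficients: "f \<in> S \<Longrightarrow> rapid_seq (\<lambda>i. L2_inner f (G i))"
proof -
  assume f: "f \<in> S"
  show ?thesis unfolding rapid_seq_def
  proof (intro allI impI)
    fix lam :: real assume "lam > 0"
    then obtain C where C: "\<And>w. norm (L2_inner f (tfshift w g)) \<le> C * exp (- (lam * \<omega> (norm w)))" using stft_decay[OF f gS] by blast
    have "norm (L2_inner f (G i)) * exp (lam * \<omega> (norm (z i))) \<le> C" for i
      using mult_right_mono[OF C[of "z i"], of "exp (lam * \<omega> (norm (z i)))"] by (simp add: mult.assoc exp_add[symmetric])
    then show "\<exists>C. \<forall>i. norm (L2_inner f (G i)) * exp (lam * \<omega> (norm (z i))) \<le> C" by blast
  qed
qed

lemma inner_synth:
  assumes "f \<in> S" "rapid_seq b"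
  shows "(\<lambda>i. cnj (b i) * L2_inner f (G i)) sums L2_inner f (synth b)"
  by (rule dual_synth[OF L2_inner_dual[OF assms(1)] assms(2)])

lemma synth_inner:
  assumes "rapid_seq b"
  shows "(\<lambda>j. b j * L2_inner (G j) (G i)) sums L2_inner (synth b) (G i)"
  using inner_synth[OF GS assms, of i, THEN sums_cnj[THEN iffD2]] unfolding L2_inner_cnj[of _ "G i"]
  by (simp add: L2_inner_cnj[of _ "G i"])

text \<open>The square of b - \<rho> v is expanded: the cross term is the L2 norm of the synthesised
  function, and the last term is bounded by the upper frame bound, which costs only half of the
  gain. Nonnegativity of the left side then yields the bound for the synthesis operator for
  free.\<close>

lemma energy_synth:
  fixes b v :: "nat \<Rightarrow> complex"
  assumes b: "rapid_seq b"
  defines "v \<equiv> \<lambda>i. L2_inner (synth b) (G i)"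
  shows "(\<Sum>i. (norm (b i - \<rho> * v i))\<^sup>2) \<le> (\<Sum>i. (norm (b i))\<^sup>2) - \<rho> * L2_normsq (synth b)"
    and "summable (\<lambda>i. (norm (b i - \<rho> * v i))\<^sup>2)"
    and "L2_normsq (synth b) \<le> B * (\<Sum>i. (norm (b i))\<^sup>2)"
proof -
  have F: "synth b \<in> S" by (rule synth_S[OF b])
  have 1: "(\<lambda>i. (norm (b i))\<^sup>2) sums (\<Sum>i. (norm (b i))\<^sup>2)" using rapid_seq_square_summable[OF b] by (rule summable_sums)
  have 2: "(\<lambda>i. (norm (v i))\<^sup>2) sums (\<Sum>i. (norm (v i))\<^sup>2)"
    unfolding v_def using rapid_seq_square_summable[OF rapid_seq_coefficients[OF F]] by (rule summable_sums)
  have "(\<lambda>i. cnj (b i) * v i) sums of_real (L2_normsq (synth b))"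
    using inner_synth[OF F b] unfolding v_def L2_inner_self[OF S_rapid(1)[OF F]] .
  then have 3: "(\<lambda>i. Re (cnj (b i) * v i)) sums L2_normsq (synth b)" using sums_Re by fastforce
  have eq: "(norm (b i - \<rho> * v i))\<^sup>2 = (norm (b i))\<^sup>2 - 2 * \<rho> * Re (cnj (b i) * v i) + \<rho>\<^sup>2 * (norm (v i))\<^sup>2" for i
    unfolding cmod_power2 by (simp add: power2_eq_square algebra_simps)
  have s: "(\<lambda>i. (norm (b i - \<rho> * v i))\<^sup>2) sums ((\<Sum>i. (norm (b i))\<^sup>2) - 2 * \<rho> * L2_normsq (synth b) + \<rho>\<^sup>2 * (\<Sum>i. (norm (v i))\<^sup>2))"
    unfolding eq by (intro sums_add sums_diff sums_mult 1 2 3)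
  then show sm: "summable (\<lambda>i. (norm (b i - \<rho> * v i))\<^sup>2)" by (rule sums_summable)
  have "\<rho>\<^sup>2 * (\<Sum>i. (norm (v i))\<^sup>2) \<le> \<rho>\<^sup>2 * (B * L2_normsq (synth b))"
    unfolding v_def by (intro mult_left_mono upper F) auto
  also have "\<dots> = \<rho> * L2_normsq (synth b)" using rho(2) by (simp add: power2_eq_square algebra_simps)
  finally show le: "(\<Sum>i. (norm (b i - \<rho> * v i))\<^sup>2) \<le> (\<Sum>i. (norm (b i))\<^sup>2) - \<rho> * L2_normsq (synth b)"
    using sums_unique[OF s] by linarith
  have "0 \<le> (\<Sum>i. (norm (b i - \<rho> * v i))\<^sup>2)" by (intro suminf_nonneg sm) auto
  with le have "\<rho> * L2_normsq (synth b) \<le> (\<Sum>i. (norm (b i))\<^sup>2)" by linarith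
  then have "B * (\<rho> * L2_normsq (synth b)) \<le> B * (\<Sum>i. (norm (b i))\<^sup>2)" using rho by (intro mult_left_mono) auto
  moreover have "B * (\<rho> * L2_normsq (synth b)) = L2_normsq (synth b)" using rho(2) by (simp add: algebra_simps)
  ultimately show "L2_normsq (synth b) \<le> B * (\<Sum>i. (norm (b i))\<^sup>2)" by simp
qed

text \<open>One step f - \<rho> S f with the frame operator S. Its iterates are the remainders of
  the Neumann series for the inverse of S.\<close>

definition relax :: "'n fn \<Rightarrow> 'n fn" where
  "relax f = (\<lambda>t. f t + of_real (- \<rho>) * synth (\<lambda>i. L2_inner f (G i)) t)"

definition \<kappa> :: real where "\<kappa> = 1 - A / B"

lemma kappa: "0 \<le> \<kappa>" "\<kappa> < 1"
  using Apos AB by (auto simp: \<kappa>_def)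

lemma relax_S: "f \<in> S \<Longrightarrow> relax f \<in> S"
  unfolding relax_def by (intro S_add S_scale synth_S rapid_seq_coefficients)

lemma relax_coef:
  assumes "f \<in> S"
  shows "L2_inner (relax f) (G i) = L2_inner f (G i) - \<rho> * L2_inner (synth (\<lambda>i. L2_inner f (G i))) (G i)"
  unfolding relax_def by (subst L2_inner_linear) (auto intro: assms synth_S rapid_seq_coefficients GS)

text \<open>With E the energy of the coefficients of f and F the frame operator applied to f, the
  inner product of f and F is E and the squared norm of F is at most B E. Hence the squared norm
  drops by at least \<rho> E, and the lower frame bound turns this into the factor \<kappa>.\<close>

lemma relax_norm:
  assumes f: "f \<in> S"
  shows "L2_normsq (relax f) \<le> \<kappa> * L2_normsq f"
proof -
  define a where "a = (\<lambda>i. L2_inner f (G i))"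
  define F where "F = synth a"
  define E where "E = (\<Sum>i. (norm (a i))\<^sup>2)"
  have a: "rapid_seq a" unfolding a_def by (rule rapid_seq_coefficients[OF f])
  have F: "F \<in> S" unfolding F_def by (rule synth_S[OF a])
  have "(\<lambda>i. cnj (a i) * a i) sums L2_inner f F" using inner_synth[OF f a] by (simp add: F_def a_def)
  moreover have "cnj (a i) * a i = of_real ((norm (a i))\<^sup>2)" for i by (simp only: complex_norm_square mult.commute)
  moreover have "(\<lambda>i. of_real ((norm (a i))\<^sup>2) :: complex) sums of_real E"
    unfolding E_def by (intro sums_of_real summable_sums rapid_seq_square_summable a)
  ultimately have fF: "L2_inner f F = of_real E" using sums_unique2 by auto
  have Ff: "L2_inner F f = of_real E" using L2_inner_cnj[of F f] fF by simp
  have lin: "L2_inner (relax f) k = L2_inner f k - \<rho> * L2_inner F k" if "k \<in> S" for k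
    unfolding relax_def a_def[symmetric] F_def[symmetric] by (subst L2_inner_linear) (auto intro: f F that)
  have "of_real (L2_normsq (relax f)) = L2_inner (relax f) (relax f)" by (rule L2_inner_self[symmetric]) (intro S_rapid relax_S f)
  also have "\<dots> = L2_inner f (relax f) - \<rho> * L2_inner F (relax f)" by (rule lin[OF relax_S[OF f]])
  also have "L2_inner f (relax f) = cnj (L2_inner f f - \<rho> * L2_inner F f)"
    unfolding L2_inner_cnj[of f "relax f"] lin[OF f] ..
  also have "L2_inner F (relax f) = cnj (L2_inner f F - \<rho> * L2_inner F F)"
    unfolding L2_inner_cnj[of F "relax f"] lin[OF F] ..
  finally have "complex_of_real (L2_normsq (relax f)) = of_real (L2_normsq f - \<rho> * E - \<rho> * (E - \<rho> * L2_normsq F))"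
    unfolding L2_inner_self[OF S_rapid(1)[OF f]] L2_inner_self[OF S_rapid(1)[OF F]] fF Ff by simp
  then have "L2_normsq (relax f) = L2_normsq f - \<rho> * E - \<rho> * (E - \<rho> * L2_normsq F)" by (simp only: of_real_eq_iff)
  also have "\<dots> = L2_normsq f - 2 * \<rho> * E + \<rho>\<^sup>2 * L2_normsq F" by (simp add: algebra_simps power2_eq_square)
  also have "\<rho>\<^sup>2 * L2_normsq F \<le> \<rho>\<^sup>2 * (B * E)"
    unfolding F_def E_def by (intro mult_left_mono energy_synth a) auto
  also have "\<rho>\<^sup>2 * (B * E) = \<rho> * E" using rho(2) by (simp add: power2_eq_square algebra_simps)
  also have "L2_normsq f - 2 * \<rho> * E + \<rho> * E = L2_normsq f - \<rho> * E" by simp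
  also have "\<dots> \<le> L2_normsq f - \<rho> * (A * L2_normsq f)"
    using lower[OF f] rho unfolding E_def a_def by (intro diff_left_mono mult_left_mono) auto
  also have "\<dots> = \<kappa> * L2_normsq f" by (simp add: \<kappa>_def \<rho>_def algebra_simps)
  finally show ?thesis by simp
qed

definition residual :: "nat \<Rightarrow> 'n fn \<Rightarrow> 'n fn" where "residual k f = (relax ^^ k) f"

lemma residual_simps [simp]: "residual 0 f = f" "residual (Suc k) f = relax (residual k f)"
  by (simp_all add: residual_def)

lemma residual_S: "f \<in> S \<Longrightarrow> residual k f \<in> S"
  by (induction k) (auto intro: relax_S)

lemma residual_norm:
  assumes "f \<in> S"
  shows "L2_normsq (residual k f) \<le> \<kappa> ^ k * L2_normsq f"
proof (induction k)
  case (Suc k)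
  have "L2_normsq (residual (Suc k) f) \<le> \<kappa> * L2_normsq (residual k f)" using relax_norm[OF residual_S[OF assms]] by simp
  also have "\<dots> \<le> \<kappa> * (\<kappa> ^ k * L2_normsq f)" by (intro mult_left_mono Suc kappa)
  finally show ?case by simp
qed simp

lemma residual_coef_bound:
  assumes f: "f \<in> S"
  shows "(norm (L2_inner (residual k f) (G i)))\<^sup>2 \<le> B * \<kappa> ^ k * L2_normsq f"
proof -
  have "(norm (L2_inner (residual k f) (G i)))\<^sup>2 = (\<Sum>j\<in>{i}. (norm (L2_inner (residual k f) (G j)))\<^sup>2)" by simp
  also have "\<dots> \<le> (\<Sum>j. (norm (L2_inner (residual k f) (G j)))\<^sup>2)"
    by (intro sum_le_suminf rapid_seq_square_summable rapid_seq_coefficients residual_S f) auto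
  also have "\<dots> \<le> B * L2_normsq (residual k f)" by (rule upper[OF residual_S[OF f]])
  also have "\<dots> \<le> B * (\<kappa> ^ k * L2_normsq f)" using rho by (intro mult_left_mono residual_norm f) auto
  finally show ?thesis by (simp add: mult.assoc)
qed

end

text \<open>The smaller cone consists of the dilates of a ball of half the radius of a ball inside
  the larger one. At unit scale a point of it keeps the distance d from the complement, and
  homogeneity turns this into a distance proportional to the norm.\<close>

lemma cone_shrink:
  fixes \<Gamma> :: "((real ^ 'n::finite) \<times> (real ^ 'n)) set"
  assumes G: "open_conic \<Gamma>" and z0: "z0 \<in> \<Gamma>"
  shows "\<exists>\<Gamma>' K. open_conic \<Gamma>' \<and> z0 \<in> \<Gamma>' \<and> (\<forall>w\<in>\<Gamma>'. \<forall>v. v \<notin> \<Gamma> \<longrightarrow> norm w \<le> K * norm (v - w))"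
proof -
  have o: "open \<Gamma>" and n0: "0 \<notin> \<Gamma>" and con: "\<And>x t. x \<in> \<Gamma> \<Longrightarrow> t > 0 \<Longrightarrow> t *\<^sub>R x \<in> \<Gamma>"
    using G by (auto simp: open_conic_def)
  obtain e where e: "e > 0" "ball z0 e \<subseteq> \<Gamma>" using o z0 open_contains_ball by blast
  define d where "d = e / 2"
  have d: "d > 0" using e by (simp add: d_def)
  define \<Gamma>' where "\<Gamma>' = (\<Union>t\<in>{0<..}. (\<lambda>x. t *\<^sub>R x) ` ball z0 d)"
  have "open \<Gamma>'" unfolding \<Gamma>'_def by (intro open_UN ballI open_scaling) auto
  moreover
  have sub: "ball z0 d \<subseteq> \<Gamma>" using e d_def by auto
  have "0 \<notin> \<Gamma>'"
  proof
    assume "0 \<in> \<Gamma>'"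
    then obtain t where "t > 0" and "0 \<in> (\<lambda>x. t *\<^sub>R x) ` ball z0 d" unfolding \<Gamma>'_def by blast
    then obtain y where t: "t > 0" "y \<in> ball z0 d" "0 = t *\<^sub>R y" by (elim imageE)
    from t(1,3) have "y = 0" by (metis scaleR_eq_0_iff less_irrefl)
    with t(2) sub n0 show False by blast
  qed
  moreover have "s *\<^sub>R x \<in> \<Gamma>'" if "x \<in> \<Gamma>'" "s > 0" for x s
  proof -
    from that obtain t y where "t > 0" "y \<in> ball z0 d" "x = t *\<^sub>R y" by (auto simp: \<Gamma>'_def)
    then show ?thesis using that(2) unfolding \<Gamma>'_def by (intro UN_I[of "s * t"] image_eqI[of _ _ y]) auto
  qed
  ultimately have "open_conic \<Gamma>'" by (auto simp: open_conic_def)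
  moreover have "z0 \<in> \<Gamma>'" unfolding \<Gamma>'_def using d by (intro UN_I[of 1]) auto
  moreover have "norm w \<le> ((norm z0 + d) / d) * norm (v - w)" if w: "w \<in> \<Gamma>'" and v: "v \<notin> \<Gamma>" for w v
  proof -
    from w obtain t y where t: "t > 0" "y \<in> ball z0 d" "w = t *\<^sub>R y" by (auto simp: \<Gamma>'_def)
    have "inverse t *\<^sub>R v \<notin> ball z0 e"
    proof
      assume "inverse t *\<^sub>R v \<in> ball z0 e"
      then have "inverse t *\<^sub>R v \<in> \<Gamma>" using e(2) by blast
      then have "t *\<^sub>R (inverse t *\<^sub>R v) \<in> \<Gamma>" using t(1) by (rule con)
      then show False using v t by simp
    qed
    then have "e \<le> dist z0 (inverse t *\<^sub>R v)" by simp
    also have "\<dots> \<le> dist z0 y + dist y (inverse t *\<^sub>R v)" by (rule dist_triangle)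
    also have "dist z0 y < d" using t by simp
    finally have "d \<le> norm (inverse t *\<^sub>R v - y)" by (simp add: d_def dist_norm norm_minus_commute)
    then have "t * d \<le> t * norm (inverse t *\<^sub>R v - y)" using t by simp
    also have "\<dots> = norm (t *\<^sub>R (inverse t *\<^sub>R v - y))" using t by simp
    also have "t *\<^sub>R (inverse t *\<^sub>R v - y) = v - w" using t by (simp add: scaleR_right_diff_distrib)
    finally have 1: "t * d \<le> norm (v - w)" .
    have "norm y \<le> norm z0 + d" using t(2) norm_triangle_sub[of y z0] by (simp add: dist_norm norm_minus_commute)
    then have "norm w \<le> t * (norm z0 + d)" using t by simp
    also have "\<dots> = (norm z0 + d) / d * (t * d)" using d by simp
    also have "\<dots> \<le> (norm z0 + d) / d * norm (v - w)" using d 1 by (intro mult_left_mono) auto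
    finally show ?thesis .
  qed
  ultimately show ?thesis by blast
qed

lemma le_geometric_imp_0:
  fixes x C r :: real
  assumes "\<And>K. x \<le> C * r ^ K" "0 \<le> r" "r < 1"
  shows "x \<le> 0"
proof -
  have "(\<lambda>K. C * r ^ K) \<longlonglongrightarrow> C * 0" using assms by (intro tendsto_intros LIMSEQ_realpow_zero) auto
  then show ?thesis using assms(1) by (intro LIMSEQ_le_const[where X="\<lambda>K. C * r ^ K"]) auto
qed

section \<open>Decay of residual coefficients, frame expansions and transfer to the short-time
  Fourier transform\<close>

context gabor_type_frame
begin

lemma gram_bound:
  assumes "lam > 0"
  shows "\<exists>C>0. \<forall>i j. norm (L2_inner (G j) (G i)) \<le> C * exp (- (lam * \<omega> (norm (z i - z j))))"
proof -
  obtain C where "C > 0" "\<And>w. norm (L2_inner g (tfshift w g)) \<le> C * exp (- (lam * \<omega> (norm w)))"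
    using stft_decay[OF gS gS assms] by blast
  then show ?thesis unfolding L2_inner_tfshift by blast
qed

text \<open>Both bounds on s are used in \<open>\<bar>s\<bar> * exp \<bar>s\<bar>\<close>: the
  Lipschitz bound in the factor, where it produces the small \<delta>, and the modulus of the weight
  in the exponent, where Gram decay of a higher rate compensates it. The constant D does not depend
  on \<delta>.\<close>

lemma kernel_bound:
  assumes lam: "lam > 0"
  shows "\<exists>D>0. \<forall>\<delta>>0. \<forall>s i j. \<bar>s\<bar> \<le> \<delta> * norm (z i - z j) \<longrightarrow> \<bar>s\<bar> \<le> lam * \<omega> (norm (z i - z j)) \<longrightarrow>
           \<bar>exp s - 1\<bar> * norm (L2_inner (G j) (G i)) \<le> \<delta> * D * (1 / (1 + norm (z i - z j)) ^ M)"
proof -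
  \<comment> \<open>One power more than M, to absorb the factor norm (z i - z j) coming from the
    Lipschitz bound.\<close>
  obtain l1 C1 where C1: "l1 > 0" "C1 > 0" "\<And>t. t \<ge> 0 \<Longrightarrow> exp (- (l1 * \<omega> t)) \<le> C1 / (1 + t) ^ Suc M"
    using w_exp_decay[of "Suc M"] by blast
  have "lam + l1 > 0" using lam C1 by simp
  then obtain C where C: "C > 0" "\<And>i j. norm (L2_inner (G j) (G i)) \<le> C * exp (- ((lam + l1) * \<omega> (norm (z i - z j))))"
    using gram_bound by blast
  have "\<bar>exp s - 1\<bar> * norm (L2_inner (G j) (G i)) \<le> \<delta> * (C * C1) * (1 / (1 + norm (z i - z j)) ^ M)"
    if d: "\<delta> > 0" and s: "\<bar>s\<bar> \<le> \<delta> * norm (z i - z j)" "\<bar>s\<bar> \<le> lam * \<omega> (norm (z i - z j))" for \<delta> s i j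
  proof -
    let ?t = "norm (z i - z j)"
    have "\<bar>exp s - 1\<bar> \<le> \<bar>s\<bar> * exp \<bar>s\<bar>" by (rule exp_minus_one_bound)
    also have "\<dots> \<le> (\<delta> * ?t) * exp (lam * \<omega> ?t)" using s d by (intro mult_mono) auto
    finally have "\<bar>exp s - 1\<bar> * norm (L2_inner (G j) (G i)) \<le> ((\<delta> * ?t) * exp (lam * \<omega> ?t)) * (C * exp (- ((lam + l1) * \<omega> ?t)))"
      using d by (intro mult_mono C) auto
    also have "\<dots> = \<delta> * C * ?t * exp (- (l1 * \<omega> ?t))"
      by (simp add: exp_add[symmetric] algebra_simps)
    also have "\<dots> \<le> \<delta> * C * ?t * (C1 / (1 + ?t) ^ Suc M)" using d C by (intro mult_left_mono C1) auto
    also have "\<dots> = \<delta> * (C * C1) * (?t / (1 + ?t) * (1 / (1 + ?t) ^ M))" by simp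
    also have "\<dots> \<le> \<delta> * (C * C1) * (1 * (1 / (1 + ?t) ^ M))"
      using d C C1 by (intro mult_left_mono mult_right_mono) (auto simp: divide_le_eq_1 add_pos_nonneg)
    finally show ?thesis by simp
  qed
  then show ?thesis using C C1 by (intro exI[of _ "C * C1"]) auto
qed

text \<open>Conjugating by a slowly varying weight perturbs the Gram operator by a matrix that is small in the Schur sense.\<close>

lemma weighted_step:
  assumes lam: "lam > 0" and eta: "\<eta> > 0"
  shows "\<exists>\<delta>>0. \<forall>W K f. f \<in> S \<longrightarrow> (\<forall>i j. \<bar>W i - W j\<bar> \<le> \<delta> * norm (z i - z j)) \<longrightarrow>
     (\<forall>i j. \<bar>W i - W j\<bar> \<le> lam * \<omega> (norm (z i - z j))) \<longrightarrow> (\<forall>i. exp (W i) \<le> K * exp (lam * \<omega> (norm (z i)))) \<longrightarrow>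
     (\<Sum>i. (exp (W i) * norm (L2_inner (relax f) (G i)))\<^sup>2) \<le> (1 + \<eta>) * (\<Sum>i. (exp (W i) * norm (L2_inner f (G i)))\<^sup>2)"
proof -
  obtain D where D: "D > 0" "\<And>\<delta> s i j. \<delta> > 0 \<Longrightarrow> \<bar>s\<bar> \<le> \<delta> * norm (z i - z j) \<Longrightarrow> \<bar>s\<bar> \<le> lam * \<omega> (norm (z i - z j)) \<Longrightarrow>
           \<bar>exp s - 1\<bar> * norm (L2_inner (G j) (G i)) \<le> \<delta> * D * (1 / (1 + norm (z i - z j)) ^ M)"
    using kernel_bound[OF lam] by blast
  \<comment> \<open>Half of the admissible growth goes to the cross term of the square, the other
    half to the perturbation.\<close>
  define \<tau> where "\<tau> = \<eta> / 2"
  have tau: "\<tau> > 0" using eta by (simp add: \<tau>_def)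
  define Cs' where "Cs' = Cs + 1"
  have Cs: "Cs' > 0" "Cs \<le> Cs'" using sep[of 0 0] by (auto simp: Cs'_def)
  define q where "q = (1 + 1 / \<tau>) * \<rho>\<^sup>2"
  have q: "q > 0" using tau rho by (simp add: q_def add_pos_pos)
  \<comment> \<open>Solves \<open>q * e\<^sup>2 = \<tau>\<close> for the Schur norm e = \<delta> D
    Cs' of the perturbation.\<close>
  define \<delta> where "\<delta> = sqrt (\<tau> / q) / (D * Cs')"
  have delta: "\<delta> > 0" using tau q D Cs by (simp add: \<delta>_def)
  define e where "e = \<delta> * D * Cs'"
  have e: "q * e\<^sup>2 = \<tau>"
  proof -
    have "e = sqrt (\<tau> / q)" using D Cs by (simp add: e_def \<delta>_def)
    then show ?thesis using tau q by simp
  qed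
  have "(\<Sum>i. (exp (W i) * norm (L2_inner (relax f) (G i)))\<^sup>2) \<le> (1 + \<eta>) * (\<Sum>i. (exp (W i) * norm (L2_inner f (G i)))\<^sup>2)"
    if f: "f \<in> S" and W1: "\<And>i j. \<bar>W i - W j\<bar> \<le> \<delta> * norm (z i - z j)"
      and W2: "\<And>i j. \<bar>W i - W j\<bar> \<le> lam * \<omega> (norm (z i - z j))"
      and W3: "\<And>i. exp (W i) \<le> K * exp (lam * \<omega> (norm (z i)))" for W K f
  proof -
    define a where "a = (\<lambda>i. L2_inner f (G i))"
    define b where "b = (\<lambda>i. of_real (exp (W i)) * a i)"
    define v where "v i = L2_inner (synth b) (G i)" for i
    define r where "r = (\<lambda>i. of_real (exp (W i)) * L2_inner (synth a) (G i) - v i)"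
    \<comment> \<open>The conjugated Gram matrix minus the Gram matrix itself, applied to the
      weighted coefficients b.\<close>
    define c where "c = (\<lambda>i j. of_real (exp (W i - W j) - 1) * (b j * L2_inner (G j) (G i)))"
    have a: "rapid_seq a" unfolding a_def by (rule rapid_seq_coefficients[OF f])
    \<comment> \<open>The bound on exp (W i) with the constant K is needed only here, qualitatively;
      K does not enter the resulting estimate.\<close>
    have b: "rapid_seq b" unfolding b_def by (rule rapid_seq_mult[OF a, of _ K lam]) (use W3 in auto)
    have nb: "norm (b i) = exp (W i) * norm (L2_inner f (G i))" for i by (simp add: b_def a_def norm_mult)
    have cs: "(\<lambda>j. c i j) sums r i" for i
    proof -
      have "(\<lambda>j. of_real (exp (W i)) * (a j * L2_inner (G j) (G i)) - b j * L2_inner (G j) (G i)) sums r i"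
        unfolding r_def v_def by (intro sums_diff sums_mult synth_inner a b)
      moreover have "of_real (exp (W i)) * (a j * L2_inner (G j) (G i)) - b j * L2_inner (G j) (G i) = c i j" for j
        unfolding c_def b_def by (simp add: exp_diff field_simps)
      ultimately show ?thesis by simp
    qed
    let ?K = "\<lambda>i j. \<delta> * D * (1 / (1 + norm (z i - z j)) ^ M)"
    have row: "(\<Sum>j<n. ?K i j) \<le> e" for i n
    proof -
      have "(\<Sum>j<n. ?K i j) = \<delta> * D * (\<Sum>j<n. 1 / (1 + norm (z i - z j)) ^ M)" by (simp only: sum_distrib_left)
      also have "\<dots> \<le> \<delta> * D * Cs'" using delta D sep[where w="z i" and n=n] Cs by (intro mult_left_mono) auto
      finally show ?thesis by (simp add: e_def)
    qed
    have col: "(\<Sum>i<n. ?K i j) \<le> e" for j n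
      using row[of j n] by (simp add: norm_minus_commute)
    have cK: "norm (c i j) \<le> ?K i j * norm (b j)" for i j
    proof -
      have "norm (c i j) = (\<bar>exp (W i - W j) - 1\<bar> * norm (L2_inner (G j) (G i))) * norm (b j)"
        unfolding c_def norm_mult norm_of_real by simp
      also have "\<dots> \<le> ?K i j * norm (b j)" by (intro mult_right_mono D delta W1 W2) auto
      finally show ?thesis .
    qed
    have K0: "0 \<le> ?K i j" for i j using delta D by simp
    note schur = schur_test[where \<beta>="\<lambda>j. norm (b j)", OF K0 row col cK cs rapid_seq_square_summable[OF b]]
    note en = energy_synth[OF b, folded v_def]
    have nrm: "(exp (W i) * norm (L2_inner (relax f) (G i)))\<^sup>2 \<le> (1 + \<tau>) * (norm (b i - of_real \<rho> * v i))\<^sup>2 + q * (norm (r i))\<^sup>2" for i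
    proof -
      \<comment> \<open>The first part is the unweighted iteration acting on b, which does not
        increase the energy; the second is the Schur-small error.\<close>
      have eq: "of_real (exp (W i)) * L2_inner (relax f) (G i) = (b i - of_real \<rho> * v i) + (- of_real \<rho> * r i)"
        unfolding relax_coef[OF f] r_def b_def a_def by (simp add: algebra_simps)
      have "(exp (W i) * norm (L2_inner (relax f) (G i)))\<^sup>2 = (norm (of_real (exp (W i)) * L2_inner (relax f) (G i)))\<^sup>2"
        by (simp add: norm_mult)
      also have "\<dots> \<le> (1 + \<tau>) * (norm (b i - of_real \<rho> * v i))\<^sup>2 + (1 + 1 / \<tau>) * (norm (- of_real \<rho> * r i))\<^sup>2"
        unfolding eq by (rule norm_sum_squared_le[OF tau])
      also have "(1 + 1 / \<tau>) * (norm (- of_real \<rho> * r i))\<^sup>2 = q * (norm (r i))\<^sup>2"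
        by (simp add: q_def norm_mult power_mult_distrib)
      finally show ?thesis .
    qed
    have sm: "summable (\<lambda>i. (1 + \<tau>) * (norm (b i - of_real \<rho> * v i))\<^sup>2 + q * (norm (r i))\<^sup>2)"
      by (intro summable_add summable_mult en(2) schur(1))
    have "(\<Sum>i. (exp (W i) * norm (L2_inner (relax f) (G i)))\<^sup>2) \<le> (\<Sum>i. (1 + \<tau>) * (norm (b i - of_real \<rho> * v i))\<^sup>2 + q * (norm (r i))\<^sup>2)"
      by (intro suminf_le nrm sm summable_comparison_test'[OF sm, of 0]) (use nrm in auto)
    also have "\<dots> = (1 + \<tau>) * (\<Sum>i. (norm (b i - of_real \<rho> * v i))\<^sup>2) + q * (\<Sum>i. (norm (r i))\<^sup>2)"
      using en(2) schur(1) by (simp add: suminf_add[symmetric] suminf_mult summable_mult)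
    also have "\<dots> \<le> (1 + \<tau>) * (\<Sum>i. (norm (b i))\<^sup>2) + q * (e\<^sup>2 * (\<Sum>i. (norm (b i))\<^sup>2))"
    proof (intro add_mono mult_left_mono schur)
      have "\<rho> * L2_normsq (synth b) \<ge> 0" by (intro mult_nonneg_nonneg L2_normsq_nonneg) (use rho in auto)
      with en(1) show "(\<Sum>i. (norm (b i - of_real \<rho> * v i))\<^sup>2) \<le> (\<Sum>i. (norm (b i))\<^sup>2)" by linarith
    qed (use tau q in auto)
    also have "\<dots> = (1 + \<tau> + q * e\<^sup>2) * (\<Sum>i. (norm (b i))\<^sup>2)" by (simp add: algebra_simps)
    also have "1 + \<tau> + q * e\<^sup>2 = 1 + \<eta>" unfolding e by (simp add: \<tau>_def)
    finally show ?thesis unfolding nb .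
  qed
  then show ?thesis using delta by blast
qed

text \<open>The order of quantifiers matters: the rate r depends on the frame bounds only, while
  \<open>lam\<close> changes just the constant C. This holds because \<eta> is fixed in terms of
  \<kappa> before the regularised weight is chosen.\<close>

lemma residual_coef_decay:
  assumes chi: "\<theta> \<in> S"
  shows "\<exists>r. 0 < r \<and> r < 1 \<and> (\<forall>lam>0. \<exists>C\<ge>0. \<forall>w k i. norm (L2_inner (residual k (tfshift w \<theta>)) (G i)) \<le> C * r ^ k * exp (- (lam * \<omega> (norm (z i - w)))))"
proof -
  define \<eta> where "\<eta> = (1 - \<kappa>) / 2"
  define r1 where "r1 = (1 + \<kappa>) / 2"
  \<comment> \<open>The fourth power of a coefficient is estimated by the product of its unweighted
    and its weighted square, so the rate is a fourth root of r1, which bounds \<kappa> (1 +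
    \<eta>).\<close>
  define r where "r = sqrt (sqrt r1)"
  have eta: "\<eta> > 0" using kappa by (simp add: \<eta>_def)
  have r1: "0 < r1" "r1 < 1" using kappa by (auto simp: r1_def)
  have kr: "\<kappa> * (1 + \<eta>) \<le> r1"
  proof -
    have "\<kappa> * \<eta> \<le> 1 * \<eta>" using kappa eta by (intro mult_right_mono) auto
    then show ?thesis by (simp add: algebra_simps) (simp add: \<eta>_def r1_def field_simps)
  qed
  have r: "0 < r" "r < 1" "r ^ 4 = r1"
    using r1 power_mult[of r 2 2] by (auto simp: r_def)
  have "\<exists>C\<ge>0. \<forall>w k i. norm (L2_inner (residual k (tfshift w \<theta>)) (G i)) \<le> C * r ^ k * exp (- (lam * \<omega> (norm (z i - w))))"
    if lam: "lam > 0" for lam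
  proof -
    \<comment> \<open>The weight is taken with twice the exponent, because half of it is lost in the
      geometric mean with the unweighted estimate.\<close>
    have lam2: "2 * lam > 0" using lam by simp
    obtain \<delta> where \<delta>: "\<delta> > 0" and step: "\<And>W K f. f \<in> S \<Longrightarrow> (\<And>i j. \<bar>W i - W j\<bar> \<le> \<delta> * norm (z i - z j)) \<Longrightarrow>
     (\<And>i j. \<bar>W i - W j\<bar> \<le> 2 * lam * \<omega> (norm (z i - z j))) \<Longrightarrow> (\<And>i. exp (W i) \<le> K * exp (2 * lam * \<omega> (norm (z i)))) \<Longrightarrow>
     (\<Sum>i. (exp (W i) * norm (L2_inner (relax f) (G i)))\<^sup>2) \<le> (1 + \<eta>) * (\<Sum>i. (exp (W i) * norm (L2_inner f (G i)))\<^sup>2)"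
      using weighted_step[OF lam2 eta] by blast
    obtain C3 where C3: "C3 \<ge> 0" "\<And>v :: (real^'n) \<times> (real^'n). 2 * lam * \<omega> (norm v) \<le> regw (2 * lam) \<delta> v + C3"
      using regw_lower[OF lam2 \<delta>] by blast
    obtain \<nu> Kn where nu: "\<nu> > 0" "Kn > 0" "\<And>w. summable (\<lambda>i. exp (- (\<nu> * \<omega> (norm (w - z i)))))"
      "\<And>w. (\<Sum>i. exp (- (\<nu> * \<omega> (norm (w - z i))))) \<le> Kn" using sep_exp by blast
    \<comment> \<open>The surplus \<nu> makes the weighted energy of the unrelaxed function finite,
      with a bound independent of w.\<close>
    have "2 * lam + \<nu> > 0" using lam nu by simp
    then obtain C4 where C4: "C4 > 0" "\<And>v. norm (L2_inner \<theta> (tfshift v g)) \<le> C4 * exp (- ((2 * lam + \<nu>) * \<omega> (norm v)))"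
      using stft_decay[OF chi gS] by blast
    define E0 where "E0 = C4\<^sup>2 * Kn"
    have E0: "E0 \<ge> 0" using nu by (simp add: E0_def)
    define D' where "D' = B * L2_normsq \<theta> * E0 * exp (2 * C3)"
    \<comment> \<open>Being at least 1, C satisfies D' \<le> C \<le> C ^ 4, so no fourth root of D'
      has to be taken.\<close>
    define C where "C = max 1 D'"
    have C: "C \<ge> 1" "D' \<le> C" by (auto simp: C_def)
    have "norm (L2_inner (residual k (tfshift w \<theta>)) (G i)) \<le> C * r ^ k * exp (- (lam * \<omega> (norm (z i - w))))" for w k i
    proof -
      \<comment> \<open>The weight is centred at w; its slope and modulus do not depend on w, which
        makes all constants uniform in w.\<close>
      define W where "W i = regw (2 * lam) \<delta> (z i - w)" for i
      have f: "tfshift w \<theta> \<in> S" by (rule tfshift_S(1)[OF chi])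
      have W1: "\<bar>W i - W j\<bar> \<le> \<delta> * norm (z i - z j)" for i j
        using regw_lipschitz[OF lam2 \<delta>, of "z i - w" "z j - w"] regw_lipschitz[OF lam2 \<delta>, of "z j - w" "z i - w"]
        unfolding W_def by (simp add: norm_minus_commute abs_le_iff)
      have W2: "\<bar>W i - W j\<bar> \<le> 2 * lam * \<omega> (norm (z i - z j))" for i j
        using regw_modulus[OF lam2 \<delta>, of "z i - w" "z j - w"] regw_modulus[OF lam2 \<delta>, of "z j - w" "z i - w"]
        unfolding W_def by (simp add: norm_minus_commute abs_le_iff)
      have Wup: "W i \<le> 2 * lam * \<omega> (norm (z i - w))" for i unfolding W_def by (rule regw_le_weight[OF lam2 \<delta>])
      have W3: "exp (W i) \<le> exp (2 * lam * \<omega> (norm w)) * exp (2 * lam * \<omega> (norm (z i)))" for i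
      proof -
        have "\<omega> (norm (z i - w)) \<le> \<omega> (norm (z i)) + \<omega> (norm w)" using w_triangle[of "z i" "- w"] by simp
        then have "2 * lam * \<omega> (norm (z i - w)) \<le> 2 * lam * (\<omega> (norm (z i)) + \<omega> (norm w))" using lam by (intro mult_left_mono) auto
        with Wup[of i] show ?thesis by (simp add: exp_add[symmetric] algebra_simps)
      qed
      define E where "E k = (\<Sum>i. (exp (W i) * norm (L2_inner (residual k (tfshift w \<theta>)) (G i)))\<^sup>2)" for k
      have Ek: "E k \<le> (1 + \<eta>) ^ k * E 0" for k
      proof (induction k)
        case (Suc k)
        have "E (Suc k) \<le> (1 + \<eta>) * E k"
          unfolding E_def residual_simps by (rule step[OF residual_S[OF f] W1 W2 W3])
        also have "\<dots> \<le> (1 + \<eta>) * ((1 + \<eta>) ^ k * E 0)" using eta by (intro mult_left_mono Suc) auto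
        finally show ?case by simp
      qed simp
      have t0: "(exp (W i) * norm (L2_inner (tfshift w \<theta>) (G i)))\<^sup>2 \<le> C4\<^sup>2 * exp (- (\<nu> * \<omega> (norm (w - z i))))" for i
      proof -
        have "exp (W i) * norm (L2_inner (tfshift w \<theta>) (G i)) \<le> exp (2 * lam * \<omega> (norm (z i - w))) * (C4 * exp (- ((2 * lam + \<nu>) * \<omega> (norm (z i - w)))))"
          unfolding L2_inner_tfshift using Wup[of i] by (intro mult_mono C4) auto
        also have "\<dots> = C4 * exp (- (\<nu> * \<omega> (norm (w - z i))))"
          by (simp add: exp_add[symmetric] algebra_simps norm_minus_commute)
        finally have "(exp (W i) * norm (L2_inner (tfshift w \<theta>) (G i)))\<^sup>2 \<le> (C4 * exp (- (\<nu> * \<omega> (norm (w - z i)))))\<^sup>2"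
          by (intro power_mono) auto
        also have "\<dots> = C4\<^sup>2 * (exp (- (\<nu> * \<omega> (norm (w - z i)))) * exp (- (\<nu> * \<omega> (norm (w - z i)))))"
          by (simp add: power2_eq_square)
        also have "\<dots> \<le> C4\<^sup>2 * (exp (- (\<nu> * \<omega> (norm (w - z i)))) * 1)"
          using nu(1) w_nonneg[of "norm (w - z i)"] by (intro mult_left_mono) auto
        finally show ?thesis by simp
      qed
      have "E 0 \<le> (\<Sum>i. C4\<^sup>2 * exp (- (\<nu> * \<omega> (norm (w - z i)))))"
        unfolding E_def residual_simps
        by (intro suminf_le t0 summable_mult nu(3) summable_comparison_test'[OF summable_mult[OF nu(3), of "C4\<^sup>2" w], of 0])
           (use t0 in auto)
      also have "\<dots> = C4\<^sup>2 * (\<Sum>i. exp (- (\<nu> * \<omega> (norm (w - z i)))))" by (rule suminf_mult[OF nu(3)])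
      also have "\<dots> \<le> E0" unfolding E0_def by (intro mult_left_mono nu) auto
      finally have E00: "E 0 \<le> E0" .
      let ?a = "norm (L2_inner (residual k (tfshift w \<theta>)) (G i))"
      have rdk: "rapid_seq (\<lambda>i. of_real (exp (W i)) * L2_inner (residual k (tfshift w \<theta>)) (G i))"
        by (rule rapid_seq_mult[OF rapid_seq_coefficients[OF residual_S[OF f]], of _ "exp (2 * lam * \<omega> (norm w))" "2 * lam"]) (use W3 in auto)
      have "(exp (W i) * ?a)\<^sup>2 = (\<Sum>j\<in>{i}. (exp (W j) * norm (L2_inner (residual k (tfshift w \<theta>)) (G j)))\<^sup>2)" by simp
      also have "\<dots> \<le> E k" unfolding E_def
        using rapid_seq_square_summable[OF rdk] by (intro sum_le_suminf) (auto simp: norm_mult)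
      also have "\<dots> \<le> (1 + \<eta>) ^ k * E0" using order_trans[OF Ek[of k] mult_left_mono[OF E00, of "(1 + \<eta>) ^ k"]] eta by simp
      finally have A1: "(exp (W i) * ?a)\<^sup>2 \<le> (1 + \<eta>) ^ k * E0" .
      have A2: "?a\<^sup>2 \<le> B * \<kappa> ^ k * L2_normsq \<theta>" using residual_coef_bound[OF f, of k i] by (simp add: L2_normsq_tfshift)
      have "?a ^ 4 = ?a\<^sup>2 * (exp (W i) * ?a)\<^sup>2 * exp (- 2 * W i)"
      proof -
        have "(exp (W i))\<^sup>2 * exp (- 2 * W i) = 1" by (simp add: power2_eq_square exp_add[symmetric])
        moreover have "?a\<^sup>2 * (exp (W i) * ?a)\<^sup>2 * exp (- 2 * W i) = ?a ^ 4 * ((exp (W i))\<^sup>2 * exp (- 2 * W i))"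
          by (simp only: power2_eq_square power4_eq_xxxx mult_ac)
        ultimately show ?thesis by simp
      qed
      also have "\<dots> \<le> (B * \<kappa> ^ k * L2_normsq \<theta>) * ((1 + \<eta>) ^ k * E0) * exp (2 * C3 - 4 * lam * \<omega> (norm (z i - w)))"
      proof (intro mult_mono A1 A2)
        show "exp (- 2 * W i) \<le> exp (2 * C3 - 4 * lam * \<omega> (norm (z i - w)))" using C3(2)[of "z i - w"] by (simp add: W_def)
      qed (use rho kappa L2_normsq_nonneg[of \<theta>] E0 eta in auto)
      also have "\<dots> = D' * (\<kappa> * (1 + \<eta>)) ^ k * exp (- (4 * lam * \<omega> (norm (z i - w))))"
        by (simp add: D'_def power_mult_distrib exp_diff exp_minus divide_inverse mult_ac)
      also have "\<dots> \<le> C ^ 4 * r1 ^ k * exp (- (4 * lam * \<omega> (norm (z i - w))))"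
      proof (intro mult_right_mono mult_mono power_mono kr)
        have "C \<le> C ^ 4" using C(1) by (intro self_le_power) auto
        then show "D' \<le> C ^ 4" using C by linarith
      qed (use kappa eta C r1 in auto)
      also have "\<dots> = (C * r ^ k * exp (- (lam * \<omega> (norm (z i - w))))) ^ 4"
        unfolding r(3)[symmetric] power_mult_distrib exp_of_nat_mult[symmetric] by (simp add: power_mult[symmetric] mult.commute mult.assoc)
      finally show "?a \<le> C * r ^ k * exp (- (lam * \<omega> (norm (z i - w))))"
        by (rule power_le_imp_le_base[of _ 3, simplified]) (use C r in auto)
    qed
    then show ?thesis using C(1) by (intro exI[of _ C]) auto
  qed
  then show ?thesis using r by blast
qed

text \<open>The coefficients are \<rho> times the sum of the coefficients of all residuals. That
  they reproduce the shifted function is not read off from convergence of the Neumann series in the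
  test space: the difference is a test function with vanishing frame coefficients, hence zero by the
  lower frame bound and continuity.\<close>

lemma frame_expansion:
  assumes chi: "\<theta> \<in> S"
  shows "\<exists>c. (\<forall>lam>0. \<exists>C\<ge>0. \<forall>w i. norm (c w i) \<le> C * exp (- (lam * \<omega> (norm (z i - w))))) \<and>
     (\<forall>w. rapid_seq (c w) \<and> tfshift w \<theta> = synth (c w))"
proof -
  obtain r where r: "0 < r" "r < 1" and dec: "\<And>lam. lam > 0 \<Longrightarrow> \<exists>C\<ge>0. \<forall>w k i. norm (L2_inner (residual k (tfshift w \<theta>)) (G i)) \<le> C * r ^ k * exp (- (lam * \<omega> (norm (z i - w))))"
    using residual_coef_decay[OF chi] by blast
  define a where "a w k i = L2_inner (residual k (tfshift w \<theta>)) (G i)" for w k i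
  define c where "c w i = of_real \<rho> * (\<Sum>k. a w k i)" for w i
  have gs: "summable (\<lambda>k. r ^ k)" using r by (intro summable_geometric) auto
  have asum: "summable (\<lambda>k. a w k i)" for w i
  proof -
    obtain C where "\<And>w k i. norm (a w k i) \<le> C * r ^ k * exp (- (1 * \<omega> (norm (z i - w))))" using dec[of 1] unfolding a_def by auto
    then have "norm (a w k i) \<le> C * exp (- (1 * \<omega> (norm (z i - w)))) * r ^ k" for k by (simp add: mult_ac)
    then show ?thesis by (intro summable_norm_cancel[OF summable_comparison_test'[OF summable_mult[OF gs]], of 0]) auto
  qed
  have cb: "\<exists>C\<ge>0. \<forall>w i. norm (c w i) \<le> C * exp (- (lam * \<omega> (norm (z i - w))))" if lam: "lam > 0" for lam
  proof -
    obtain C where C: "C \<ge> 0" "\<And>w k i. norm (a w k i) \<le> C * r ^ k * exp (- (lam * \<omega> (norm (z i - w))))" using dec[OF lam] unfolding a_def by auto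
    have "norm (c w i) \<le> \<rho> * C * (\<Sum>k. r ^ k) * exp (- (lam * \<omega> (norm (z i - w))))" for w i
    proof -
      have "norm (\<Sum>k. a w k i) \<le> (\<Sum>k. C * exp (- (lam * \<omega> (norm (z i - w)))) * r ^ k)"
        by (intro norm_suminf_le summable_mult gs) (use C(2)[of w _ i] in \<open>simp add: mult_ac\<close>)
      also have "\<dots> = C * exp (- (lam * \<omega> (norm (z i - w)))) * (\<Sum>k. r ^ k)" by (rule suminf_mult[OF gs])
      finally have "\<rho> * norm (\<Sum>k. a w k i) \<le> \<rho> * (C * exp (- (lam * \<omega> (norm (z i - w)))) * (\<Sum>k. r ^ k))" using rho by (intro mult_left_mono) auto
      then show ?thesis using rho by (simp add: c_def norm_mult mult_ac)
    qed
    moreover have "\<rho> * C * (\<Sum>k. r ^ k) \<ge> 0" using rho C r gs by (intro mult_nonneg_nonneg suminf_nonneg) auto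
    ultimately show ?thesis by blast
  qed
  have crd: "rapid_seq (c w)" for w unfolding rapid_seq_def
  proof (intro allI impI)
    fix lam :: real assume lam: "lam > 0"
    obtain C where C: "C \<ge> 0" "\<And>w i. norm (c w i) \<le> C * exp (- (lam * \<omega> (norm (z i - w))))" using cb[OF lam] by blast
    have "norm (c w i) * exp (lam * \<omega> (norm (z i))) \<le> C * exp (lam * \<omega> (norm w))" for i
    proof -
      have "lam * \<omega> (norm (z i)) \<le> lam * (\<omega> (norm w) + \<omega> (norm (z i - w)))" using lam by (intro mult_left_mono w_diff) auto
      then have "norm (c w i) * exp (lam * \<omega> (norm (z i))) \<le> (C * exp (- (lam * \<omega> (norm (z i - w))))) * exp (lam * (\<omega> (norm w) + \<omega> (norm (z i - w))))"
        using C by (intro mult_mono) auto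
      also have "\<dots> = C * exp (lam * \<omega> (norm w))" by (simp add: exp_add[symmetric] algebra_simps)
      finally show ?thesis .
    qed
    then show "\<exists>C. \<forall>i. norm (c w i) * exp (lam * \<omega> (norm (z i))) \<le> C" by blast
  qed
  have "tfshift w \<theta> = synth (c w)" for w
  proof -
    let ?f = "tfshift w \<theta>"
    have f: "?f \<in> S" by (rule tfshift_S(1)[OF chi])
    have ard: "rapid_seq (a w k)" for k unfolding a_def by (rule rapid_seq_coefficients[OF residual_S[OF f]])
    \<comment> \<open>The definition of the relaxation step read as a telescoping identity for the
      frame coefficients.\<close>
    have tel: "of_real \<rho> * L2_inner (synth (a w k)) (G i) = a w k i - a w (Suc k) i" for k i
      unfolding a_def residual_simps relax_coef[OF residual_S[OF f]] by simp
    have eq: "L2_inner (synth (c w)) (G i) = a w 0 i" for i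
    proof -
      let ?g = "\<lambda>j. L2_inner (G j) (G i)"
      obtain C where C: "C \<ge> 0" "\<And>w k i. norm (a w k i) \<le> C * r ^ k * exp (- (1 * \<omega> (norm (z i - w))))"
        using dec[of 1] unfolding a_def by auto
      have C': "norm (a w k j) \<le> C * r ^ k" for k j
      proof -
        have "C * r ^ k * exp (- (1 * \<omega> (norm (z j - w)))) \<le> C * r ^ k * 1"
          using C r by (intro mult_left_mono) (auto intro: w_nonneg)
        with C(2)[of w k j] show ?thesis by linarith
      qed
      have gsum: "summable (\<lambda>j. norm (?g j))"
      proof -
        have "norm (?g j) = norm (L2_inner (G i) (G j))" for j by (subst L2_inner_cnj) simp
        then show ?thesis using rapid_seq_abs_summable[OF rapid_seq_coefficients[OF GS, of i]] by simp
      qed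
      define T where "T = (\<Sum>j. norm (?g j))"
      \<comment> \<open>Cutting the series of c at K leaves a telescoping sum that misses a w 0 i
        only by a w K i. This error and the tail are both of order r ^ K, uniformly in j, and the
        Gram row is absolutely summable.\<close>
      have "norm (L2_inner (synth (c w)) (G i) - a w 0 i) \<le> (\<rho> * C * (1 / (1 - r)) * T + C) * r ^ K" for K
      proof -
        have s1: "(\<lambda>j. c w j * ?g j) sums L2_inner (synth (c w)) (G i)" by (rule synth_inner[OF crd])
        have "(\<lambda>j. \<Sum>k<K. of_real \<rho> * (a w k j * ?g j)) sums (\<Sum>k<K. of_real \<rho> * L2_inner (synth (a w k)) (G i))"
          by (intro sums_sum sums_mult synth_inner ard)
        also have "(\<Sum>k<K. of_real \<rho> * L2_inner (synth (a w k)) (G i)) = a w 0 i - a w K i"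
          unfolding tel by (rule sum_lessThan_telescope')
        finally have s2: "(\<lambda>j. c w j * ?g j - (\<Sum>k<K. of_real \<rho> * (a w k j * ?g j))) sums
           (L2_inner (synth (c w)) (G i) - (a w 0 i - a w K i))" by (intro sums_diff s1)
        have tail: "c w j * ?g j - (\<Sum>k<K. of_real \<rho> * (a w k j * ?g j)) = of_real \<rho> * (\<Sum>k. a w (k + K) j) * ?g j" for j
        proof -
          have "(\<Sum>k. a w k j) = (\<Sum>k. a w (k + K) j) + (\<Sum>k<K. a w k j)" by (rule suminf_split_initial_segment[OF asum])
          then have "c w j = of_real \<rho> * (\<Sum>k. a w (k + K) j) + of_real \<rho> * (\<Sum>k<K. a w k j)" by (simp add: c_def distrib_left)
          then show ?thesis by (simp add: sum_distrib_left sum_distrib_right algebra_simps)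
        qed
        have tb: "norm (of_real \<rho> * (\<Sum>k. a w (k + K) j) * ?g j) \<le> \<rho> * C * (1 / (1 - r)) * r ^ K * norm (?g j)" for j
        proof -
          have "norm (\<Sum>k. a w (k + K) j) \<le> (\<Sum>k. (C * r ^ K) * r ^ k)"
            by (intro norm_suminf_le summable_mult gs) (use C'[of "_ + K" j] in \<open>simp add: power_add mult_ac\<close>)
          also have "\<dots> = (C * r ^ K) * (1 / (1 - r))" using suminf_mult[OF gs, of "C * r ^ K"] suminf_geometric[of r] r by simp
          finally have "\<rho> * norm (\<Sum>k. a w (k + K) j) * norm (?g j) \<le> \<rho> * ((C * r ^ K) * (1 / (1 - r))) * norm (?g j)"
            using rho by (intro mult_right_mono mult_left_mono) auto
          then show ?thesis using rho by (simp add: norm_mult mult_ac)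
        qed
        have "norm (L2_inner (synth (c w)) (G i) - (a w 0 i - a w K i)) \<le> (\<Sum>j. \<rho> * C * (1 / (1 - r)) * r ^ K * norm (?g j))"
          by (rule norm_sums_le[OF s2]) (use tb in \<open>simp add: tail\<close>, intro summable_mult gsum)
        also have "\<dots> = \<rho> * C * (1 / (1 - r)) * r ^ K * T" unfolding T_def by (rule suminf_mult[OF gsum])
        finally have "norm (L2_inner (synth (c w)) (G i) - a w 0 i + a w K i) \<le> \<rho> * C * (1 / (1 - r)) * r ^ K * T" by (simp add: algebra_simps)
        moreover have "norm (L2_inner (synth (c w)) (G i) - a w 0 i) \<le> norm (L2_inner (synth (c w)) (G i) - a w 0 i + a w K i) + norm (a w K i)"
          using norm_triangle_ineq4[of "L2_inner (synth (c w)) (G i) - a w 0 i + a w K i" "a w K i"] by simp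
        ultimately show ?thesis using C'[of K i] by (simp add: algebra_simps)
      qed
      then have "norm (L2_inner (synth (c w)) (G i) - a w 0 i) \<le> 0" by (rule le_geometric_imp_0) (use r in auto)
      then show ?thesis by simp
    qed
    define H where "H = (\<lambda>t. ?f t + (-1) * synth (c w) t)"
    have H: "H \<in> S" unfolding H_def by (intro S_add S_scale synth_S crd f)
    have "L2_inner H (G i) = 0" for i
      unfolding H_def by (subst L2_inner_linear) (auto intro: f synth_S crd GS simp: eq a_def)
    then have "A * L2_normsq H \<le> 0" using lower[OF H] by simp
    then have "L2_normsq H \<le> 0" using Apos by (simp add: mult_le_0_iff)
    then have "H = (\<lambda>_. 0)" by (rule continuous_L2_normsq_0[OF S_rapid(1)[OF H]])
    then show ?thesis by (auto simp: H_def fun_eq_iff)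
  qed
  then show ?thesis using cb crd by (intro exI[of _ c]) blast
qed

text \<open>For w in the smaller cone, terms with z i in the larger cone are small because u decays
  there. For all other terms the distance of z i from w dominates the norm of w, so the coefficient
  decay beats both the factor exp (lam \<omega>(w)) and the growth of u.\<close>

lemma frame_decay_imp_stft_decay:
  assumes u: "u \<in> S'_omega \<omega>" and chi: "\<theta> \<in> S" and Gam: "open_conic \<Gamma>" "z0 \<in> \<Gamma>"
    and dec: "\<And>lam. lam > 0 \<Longrightarrow> \<exists>C. \<forall>i. z i \<in> \<Gamma> \<longrightarrow> exp (lam * \<omega> (norm (z i))) * norm (u (G i)) \<le> C"
  shows "\<exists>\<Gamma>'. open_conic \<Gamma>' \<and> z0 \<in> \<Gamma>' \<and> (\<forall>lam>0. \<exists>C. \<forall>w\<in>\<Gamma>'. exp (lam * \<omega> (norm w)) * norm (u (tfshift w \<theta>)) \<le> C)"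
proof -
  obtain \<Gamma>' K where G': "open_conic \<Gamma>'" "z0 \<in> \<Gamma>'" and K: "\<And>w v. w \<in> \<Gamma>' \<Longrightarrow> v \<notin> \<Gamma> \<Longrightarrow> norm w \<le> K * norm (v - w)"
    using cone_shrink[OF Gam] by blast
  obtain k1 where k1: "k1 > 0" "\<And>s t. 0 \<le> s \<Longrightarrow> 0 \<le> t \<Longrightarrow> s \<le> K * t \<Longrightarrow> \<omega> s \<le> k1 * \<omega> t" using w_scale_le by blast
  obtain C0 l N where C0: "C0 \<ge> 0" "l > 0" "\<And>f. f \<in> S \<Longrightarrow> norm (u f) \<le> C0 * S_seminorm \<omega> l N f" using dual_bound[OF u] by blast
  obtain C0' \<mu> where C0': "C0' > 0" "\<mu> > 0" "\<And>w. S_seminorm \<omega> l N (tfshift w g) \<le> C0' * exp (\<mu> * \<omega> (norm w))"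
    using tfshift_S(2)[OF gS C0(2), of N] by blast
  define C1 where "C1 = C0 * C0'"
  have C1: "C1 \<ge> 0" "norm (u (G i)) \<le> C1 * exp (\<mu> * \<omega> (norm (z i)))" for i
    using C0(1) C0'(1) order_trans[OF C0(3)[OF GS, of i] mult_left_mono[OF C0'(3)[of "z i"] C0(1)]] by (simp_all add: C1_def mult.assoc)
  obtain c where c: "\<And>lam. lam > 0 \<Longrightarrow> \<exists>C\<ge>0. \<forall>w i. norm (c w i) \<le> C * exp (- (lam * \<omega> (norm (z i - w))))"
    "\<And>w. rapid_seq (c w)" "\<And>w. tfshift w \<theta> = synth (c w)" using frame_expansion[OF chi] by blast
  obtain \<nu> Kn where nu: "\<nu> > 0" "Kn > 0" "\<And>w. summable (\<lambda>i. exp (- (\<nu> * \<omega> (norm (w - z i)))))"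
    "\<And>w. (\<Sum>i. exp (- (\<nu> * \<omega> (norm (w - z i))))) \<le> Kn" using sep_exp by blast
  have "\<exists>C. \<forall>w\<in>\<Gamma>'. exp (lam * \<omega> (norm w)) * norm (u (tfshift w \<theta>)) \<le> C" if lam: "lam > 0" for lam
  proof -
    obtain C2 where C2: "\<And>i. z i \<in> \<Gamma> \<Longrightarrow> exp (lam * \<omega> (norm (z i))) * norm (u (G i)) \<le> C2" using dec[OF lam] by blast
    \<comment> \<open>The summand lam serves points inside the cone; lam k1 and \<mu> (k1 + 1) serve
      points outside, for the weight of w and the growth of u; \<nu> makes the sum over i
      converge.\<close>
    define L where "L = lam + lam * k1 + \<mu> * (k1 + 1) + \<nu>"
    have pos: "lam * k1 > 0" "\<mu> * (k1 + 1) > 0" using lam k1 C0' by auto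
    have "L > 0" using lam pos nu by (simp add: L_def)
    then obtain C3 where C3: "C3 \<ge> 0" "\<And>w i. norm (c w i) \<le> C3 * exp (- (L * \<omega> (norm (z i - w))))" using c(1) by blast
    have trm: "exp (lam * \<omega> (norm w)) * (norm (c w i) * norm (u (G i))) \<le> C3 * (C1 + \<bar>C2\<bar>) * exp (- (\<nu> * \<omega> (norm (w - z i))))"
      if w: "w \<in> \<Gamma>'" for w i
    proof -
      define s where "s = \<omega> (norm (z i - w))"
      have s: "s \<ge> 0" "\<omega> (norm (w - z i)) = s" by (auto simp: s_def w_nonneg norm_minus_commute)
      have main: "exp (lam * \<omega> (norm w)) * norm (u (G i)) \<le> (C1 + \<bar>C2\<bar>) * exp ((L - \<nu>) * s)"
      proof (cases "z i \<in> \<Gamma>")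
        case True
        have "\<omega> (norm w) \<le> \<omega> (norm (z i)) + s" using w_diff[of w "z i"] s by simp
        then have "exp (lam * \<omega> (norm w)) \<le> exp (lam * (\<omega> (norm (z i)) + s))" using lam by (simp add: mult_left_mono)
        then have "exp (lam * \<omega> (norm w)) * norm (u (G i)) \<le> exp (lam * (\<omega> (norm (z i)) + s)) * norm (u (G i))" by (rule mult_right_mono) auto
        also have "\<dots> = (exp (lam * \<omega> (norm (z i))) * norm (u (G i))) * exp (lam * s)" by (simp add: exp_add distrib_left)
        also have "\<dots> \<le> (C1 + \<bar>C2\<bar>) * exp ((L - \<nu>) * s)"
        proof (intro mult_mono)
          show "exp (lam * \<omega> (norm (z i))) * norm (u (G i)) \<le> C1 + \<bar>C2\<bar>" using C2[OF True] C1(1) by linarith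
          show "exp (lam * s) \<le> exp ((L - \<nu>) * s)" using s pos by (auto simp: L_def intro!: mult_right_mono)
        qed (use C1 in auto)
        finally show ?thesis .
      next
        case False
        have 1: "\<omega> (norm w) \<le> k1 * s" unfolding s_def by (rule k1(2)) (auto intro: K[OF w False])
        have "\<omega> (norm (z i)) \<le> \<omega> (norm w) + s" unfolding s_def by (rule w_diff)
        with 1 have 2: "\<omega> (norm (z i)) \<le> (k1 + 1) * s" by (simp add: algebra_simps)
        have "exp (lam * \<omega> (norm w)) * norm (u (G i)) \<le> exp (lam * (k1 * s)) * (C1 * exp (\<mu> * ((k1 + 1) * s)))"
        proof (intro mult_mono)
          show "exp (lam * \<omega> (norm w)) \<le> exp (lam * (k1 * s))" using 1 lam by simp
          have "C1 * exp (\<mu> * \<omega> (norm (z i))) \<le> C1 * exp (\<mu> * ((k1 + 1) * s))" using 2 C0'(2) C1(1) by (intro mult_left_mono) auto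
          with C1(2)[of i] show "norm (u (G i)) \<le> C1 * exp (\<mu> * ((k1 + 1) * s))" by linarith
        qed auto
        also have "\<dots> = C1 * exp ((lam * k1 + \<mu> * (k1 + 1)) * s)" by (simp add: exp_add[symmetric] algebra_simps)
        also have "\<dots> \<le> (C1 + \<bar>C2\<bar>) * exp ((L - \<nu>) * s)"
        proof (intro mult_mono)
          show "exp ((lam * k1 + \<mu> * (k1 + 1)) * s) \<le> exp ((L - \<nu>) * s)"
            using s lam by (auto simp: L_def intro!: mult_right_mono)
        qed (use C1 in auto)
        finally show ?thesis .
      qed
      have "exp (lam * \<omega> (norm w)) * (norm (c w i) * norm (u (G i))) = norm (c w i) * (exp (lam * \<omega> (norm w)) * norm (u (G i)))" by simp
      also have "\<dots> \<le> (C3 * exp (- (L * s))) * ((C1 + \<bar>C2\<bar>) * exp ((L - \<nu>) * s))"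
        by (rule mult_mono[OF C3(2)[of w i, folded s_def] main]) (use C3(1) in auto)
      also have "\<dots> = C3 * (C1 + \<bar>C2\<bar>) * exp (- (\<nu> * s))"
      proof -
        have "exp (- (L * s)) * exp ((L - \<nu>) * s) = exp (- (\<nu> * s))" by (simp add: exp_add[symmetric] algebra_simps)
        then show ?thesis by (metis (no_types, lifting) mult.assoc mult.left_commute)
      qed
      finally show ?thesis by (simp add: s)
    qed
    have "exp (lam * \<omega> (norm w)) * norm (u (tfshift w \<theta>)) \<le> C3 * (C1 + \<bar>C2\<bar>) * Kn" if w: "w \<in> \<Gamma>'" for w
    proof -
      have "(\<lambda>i. of_real (exp (lam * \<omega> (norm w))) * (cnj (c w i) * u (G i))) sums (of_real (exp (lam * \<omega> (norm w))) * u (tfshift w \<theta>))"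
        unfolding c(3) by (intro sums_mult dual_synth u c(2))
      then have "norm (of_real (exp (lam * \<omega> (norm w))) * u (tfshift w \<theta>)) \<le> (\<Sum>i. C3 * (C1 + \<bar>C2\<bar>) * exp (- (\<nu> * \<omega> (norm (w - z i)))))"
        by (rule norm_sums_le) (use trm[OF w] in \<open>simp add: norm_mult\<close>, intro summable_mult nu(3))
      also have "\<dots> = C3 * (C1 + \<bar>C2\<bar>) * (\<Sum>i. exp (- (\<nu> * \<omega> (norm (w - z i)))))" by (rule suminf_mult[OF nu(3)])
      also have "\<dots> \<le> C3 * (C1 + \<bar>C2\<bar>) * Kn" using C3 C1 by (intro mult_left_mono nu) auto
      finally show ?thesis by (simp add: norm_mult)
    qed
    then show ?thesis by blast
  qed
  then show ?thesis using G' by blast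
qed

end

section \<open>Painless and fine Gabor frames\<close>

text \<open>The index pair is (m, n) with the frequency first, since the spacing in time depends on
  m. A constant \<alpha> gives a Gabor lattice, so both kinds of systems share one index
  set.\<close>

definition tfpoint :: "(('n::finite \<Rightarrow> int) \<Rightarrow> real) \<Rightarrow> real \<Rightarrow> ('n \<Rightarrow> int) \<times> ('n \<Rightarrow> int) \<Rightarrow> (real ^ 'n) \<times> (real ^ 'n)" where
  "tfpoint \<alpha> \<beta> p = (\<alpha> (fst p) *\<^sub>R ivec (snd p), \<beta> *\<^sub>R ivec (fst p))"

lemma ivec_eq_iff: "ivec k = (ivec l :: real ^ 'n::finite) \<longleftrightarrow> k = l"
  by (auto simp: ivec_def vec_eq_iff fun_eq_iff)

lemma inj_tfpoint:
  assumes "\<And>m. \<alpha> m > 0" "\<beta> > 0" shows "inj (tfpoint \<alpha> \<beta>)"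
proof (rule injI)
  fix p q assume eq: "tfpoint \<alpha> \<beta> p = tfpoint \<alpha> \<beta> q"
  then have f: "fst p = fst q" using assms(2) by (simp add: tfpoint_def ivec_eq_iff)
  with eq have "snd p = snd q" using assms(1)[of "fst q"] by (simp add: tfpoint_def ivec_eq_iff)
  with f show "p = q" by (simp add: prod_eq_iff)
qed

text \<open>The exponent 4d splits into 2d for time and 2d for frequency. For fixed m the sum over n
  is bounded uniformly in m, because all spacings are at least \<alpha>0; the sum over m is then a
  lattice sum.\<close>

lemma tfpoint_separated:
  fixes \<alpha> :: "('n::finite \<Rightarrow> int) \<Rightarrow> real"
  assumes "\<alpha>0 > 0" "\<And>m. \<alpha>0 \<le> \<alpha> m" "\<beta> > 0"
  shows "\<exists>C. \<forall>w. \<forall>F. finite F \<longrightarrow> (\<Sum>p\<in>F. 1 / (1 + norm (w - tfpoint \<alpha> \<beta> p)) ^ (4 * CARD('n))) \<le> C"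
proof -
  obtain C1 where C1: "C1 > 0" "\<And>L (x :: real^'n) F. L \<ge> \<alpha>0 \<Longrightarrow> finite F \<Longrightarrow> (\<Sum>n\<in>F. decay (x - L *\<^sub>R ivec n)) \<le> C1"
    using lattice_sum_bound[OF assms(1), where 'n='n] by blast
  obtain C2 where C2: "C2 > 0" "\<And>L (x :: real^'n) F. L \<ge> \<beta> \<Longrightarrow> finite F \<Longrightarrow> (\<Sum>n\<in>F. decay (x - L *\<^sub>R ivec n)) \<le> C2"
    using lattice_sum_bound[OF assms(3), where 'n='n] by blast
  have "(\<Sum>p\<in>F. 1 / (1 + norm (w - tfpoint \<alpha> \<beta> p)) ^ (4 * CARD('n))) \<le> C2 * C1" if F: "finite F" for w F
  proof -
    have pt: "1 / (1 + norm v) ^ (4 * CARD('n)) \<le> decay (snd v) * decay (fst v)" for v :: "(real^'n) \<times> (real^'n)"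
    proof -
      have "(1 + norm (snd v)) ^ (2 * CARD('n)) * (1 + norm (fst v)) ^ (2 * CARD('n)) \<le> (1 + norm v) ^ (2 * CARD('n)) * (1 + norm v) ^ (2 * CARD('n))"
        using norm_fst_le[of "fst v" "snd v"] norm_snd_le[of "snd v" "fst v"] by (intro mult_mono power_mono) auto
      also have "\<dots> = (1 + norm v) ^ (4 * CARD('n))" by (simp add: power_add[symmetric])
      finally have "1 / (1 + norm v) ^ (4 * CARD('n)) \<le> 1 / ((1 + norm (snd v)) ^ (2 * CARD('n)) * (1 + norm (fst v)) ^ (2 * CARD('n)))"
        by (intro divide_left_mono mult_pos_pos zero_less_power) auto
      then show ?thesis by (simp add: decay_def)
    qed
    let ?A = "fst ` F" let ?B = "snd ` F"
    let ?h = "\<lambda>m n. decay (snd w - \<beta> *\<^sub>R ivec m) * decay (fst w - \<alpha> m *\<^sub>R ivec n)"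
    have "(\<Sum>p\<in>F. 1 / (1 + norm (w - tfpoint \<alpha> \<beta> p)) ^ (4 * CARD('n))) \<le> (\<Sum>p\<in>F. ?h (fst p) (snd p))"
      using pt[of "w - tfpoint \<alpha> \<beta> _"] by (intro sum_mono) (simp add: tfpoint_def)
    also have "\<dots> \<le> (\<Sum>p\<in>?A \<times> ?B. ?h (fst p) (snd p))"
      using F by (intro sum_mono2) force+
    also have "\<dots> = (\<Sum>m\<in>?A. decay (snd w - \<beta> *\<^sub>R ivec m) * (\<Sum>n\<in>?B. decay (fst w - \<alpha> m *\<^sub>R ivec n)))"
      by (simp add: sum.cartesian_product' sum_distrib_left)
    also have "\<dots> \<le> (\<Sum>m\<in>?A. decay (snd w - \<beta> *\<^sub>R ivec m) * C1)"
      using F assms(2) by (intro sum_mono mult_left_mono C1) auto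
    also have "\<dots> = (\<Sum>m\<in>?A. decay (snd w - \<beta> *\<^sub>R ivec m)) * C1" by (simp add: sum_distrib_right)
    also have "\<dots> \<le> C2 * C1" using F C1(1) by (intro mult_right_mono C2) auto
    finally show ?thesis .
  qed
  then show ?thesis by blast
qed

context weight_fun
begin

text \<open>An unordered sum that does not converge has the default value 0, so convergence has to
  be known before the sums in the frame bounds may be enumerated or rearranged.\<close>

lemma family_summable:
  fixes Z :: "'i \<Rightarrow> (real ^ 'n::finite) \<times> (real ^ 'n)"
  assumes g: "g \<in> S" and f: "f \<in> S"
    and sep: "\<exists>C. \<forall>w. \<forall>F. finite F \<longrightarrow> F \<subseteq> I \<longrightarrow> (\<Sum>i\<in>F. 1 / (1 + norm (w - Z i)) ^ M) \<le> C"
  shows "(\<lambda>i. (norm (L2_inner f (tfshift (Z i) g)))\<^sup>2) summable_on I"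
proof -
  obtain Cs where Cs: "\<And>w F. finite F \<Longrightarrow> F \<subseteq> I \<Longrightarrow> (\<Sum>i\<in>F. 1 / (1 + norm (w - Z i)) ^ M) \<le> Cs" using sep by blast
  obtain \<mu> C1 where mu: "\<mu> > 0" "C1 > 0" "\<And>t. t \<ge> 0 \<Longrightarrow> exp (- (\<mu> * \<omega> t)) \<le> C1 / (1 + t) ^ M"
    using w_exp_decay[of M] by blast
  obtain C where C: "C > 0" "\<And>w. norm (L2_inner f (tfshift w g)) \<le> C * exp (- (\<mu> * \<omega> (norm w)))"
    using stft_decay[OF f g mu(1)] by blast
  have t: "(norm (L2_inner f (tfshift (Z i) g)))\<^sup>2 \<le> C\<^sup>2 * C1 * (1 / (1 + norm (0 - Z i)) ^ M)" for i
  proof -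
    let ?e = "exp (- (\<mu> * \<omega> (norm (Z i))))"
    have "(norm (L2_inner f (tfshift (Z i) g)))\<^sup>2 \<le> (C * ?e)\<^sup>2" by (intro power_mono C) auto
    also have "\<dots> = C\<^sup>2 * (?e * ?e)" by (simp add: power2_eq_square)
    also have "\<dots> \<le> C\<^sup>2 * (1 * (C1 / (1 + norm (Z i)) ^ M))"
      using mu(1) w_nonneg[of "norm (Z i)"] by (intro mult_left_mono mult_mono mu) auto
    finally show ?thesis by simp
  qed
  show ?thesis
  proof (rule nonneg_summable_onI(1)[where C="C\<^sup>2 * C1 * Cs"])
    fix F assume F: "finite F" "F \<subseteq> I"
    have "(\<Sum>i\<in>F. (norm (L2_inner f (tfshift (Z i) g)))\<^sup>2) \<le> (\<Sum>i\<in>F. C\<^sup>2 * C1 * (1 / (1 + norm (0 - Z i)) ^ M))" by (intro sum_mono t)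
    also have "\<dots> = C\<^sup>2 * C1 * (\<Sum>i\<in>F. 1 / (1 + norm (0 - Z i)) ^ M)" by (simp only: sum_distrib_left)
    also have "\<dots> \<le> C\<^sup>2 * C1 * Cs" using mu(2) by (intro mult_left_mono Cs F) auto
    finally show "(\<Sum>i\<in>F. (norm (L2_inner f (tfshift (Z i) g)))\<^sup>2) \<le> C\<^sup>2 * C1 * Cs" .
  qed auto
qed

lemma family_decay_imp_stft_decay:
  fixes Z :: "'i \<Rightarrow> (real ^ 'n::finite) \<times> (real ^ 'n)" and u :: "'n fn \<Rightarrow> complex"
  assumes g: "g \<in> S" and I: "countable I" "infinite I"
    and sep: "\<exists>C. \<forall>w. \<forall>F. finite F \<longrightarrow> F \<subseteq> I \<longrightarrow> (\<Sum>i\<in>F. 1 / (1 + norm (w - Z i)) ^ M) \<le> C"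
    and fr: "A > 0" "\<And>f. f \<in> S \<Longrightarrow> A * L2_normsq f \<le> (\<Sum>\<^sub>\<infinity>i\<in>I. (norm (L2_inner f (tfshift (Z i) g)))\<^sup>2)"
      "\<And>f. f \<in> S \<Longrightarrow> (\<Sum>\<^sub>\<infinity>i\<in>I. (norm (L2_inner f (tfshift (Z i) g)))\<^sup>2) \<le> B * L2_normsq f"
    and u: "u \<in> S'_omega \<omega>" and th: "\<theta> \<in> S" and Gam: "open_conic \<Gamma>" "z0 \<in> \<Gamma>"
    and dec: "\<forall>lam>0. \<exists>C. \<forall>i\<in>I. Z i \<in> \<Gamma> \<longrightarrow> exp (lam * \<omega> (norm (Z i))) * norm (u (tfshift (Z i) g)) \<le> C"
  shows "\<exists>\<Gamma>'. open_conic \<Gamma>' \<and> z0 \<in> \<Gamma>' \<and> (\<forall>lam>0. \<exists>C. \<forall>w\<in>\<Gamma>'. exp (lam * \<omega> (norm w)) * norm (u (tfshift w \<theta>)) \<le> C)"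
proof -
  define e where "e = from_nat_into I"
  have e: "bij_betw e UNIV I" unfolding e_def by (rule bij_betw_from_nat_into[OF I])
  then have inj: "inj e" and eI: "\<And>n. e n \<in> I" by (auto simp: bij_betw_def)
  obtain Cs where Cs: "\<And>w F. finite F \<Longrightarrow> F \<subseteq> I \<Longrightarrow> (\<Sum>i\<in>F. 1 / (1 + norm (w - Z i)) ^ M) \<le> Cs" using sep by blast
  have si: "(\<Sum>n. (norm (L2_inner f (tfshift (Z (e n)) g)))\<^sup>2) = (\<Sum>\<^sub>\<infinity>i\<in>I. (norm (L2_inner f (tfshift (Z i) g)))\<^sup>2)" if f: "f \<in> S" for f
  proof -
    let ?h = "\<lambda>i. (norm (L2_inner f (tfshift (Z i) g)))\<^sup>2"
    have "(?h has_sum infsum ?h I) I" by (intro has_sum_infsum family_summable[OF g f sep])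
    then have "((\<lambda>n. ?h (e n)) has_sum infsum ?h I) UNIV" by (rule has_sum_reindex_bij_betw[OF e, THEN iffD2])
    then show ?thesis using has_sum_imp_sums sums_unique by fastforce
  qed
  \<comment> \<open>The upper bound is raised to at least A, which the locale demands; this only
    weakens the inequality.\<close>
  interpret gabor_type_frame \<omega> g "\<lambda>n. Z (e n)" A "max A B" Cs M
  proof
    show "(\<Sum>i<n. 1 / (1 + norm (w - Z (e i))) ^ M) \<le> Cs" for w n
    proof -
      have "(\<Sum>i<n. 1 / (1 + norm (w - Z (e i))) ^ M) = (\<Sum>i\<in>e ` {..<n}. 1 / (1 + norm (w - Z i)) ^ M)"
        by (rule sum.reindex[symmetric, unfolded o_def]) (rule inj_on_subset[OF inj], simp)
      also have "\<dots> \<le> Cs" using eI by (intro Cs) auto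
      finally show ?thesis .
    qed
    fix f :: "'n fn" assume f: "f \<in> S"
    show "A * L2_normsq f \<le> (\<Sum>i. (norm (L2_inner f (tfshift (Z (e i)) g)))\<^sup>2)" unfolding si[OF f] by (rule fr(2)[OF f])
    have "B * L2_normsq f \<le> max A B * L2_normsq f" by (intro mult_right_mono L2_normsq_nonneg) auto
    with fr(3)[OF f] show "(\<Sum>i. (norm (L2_inner f (tfshift (Z (e i)) g)))\<^sup>2) \<le> max A B * L2_normsq f" unfolding si[OF f] by linarith
  qed (use g fr in auto)
  show ?thesis
    by (rule frame_decay_imp_stft_decay[OF u th Gam]) (use dec eI in blast)
qed

text \<open>Both orders of summation are provided: the painless frame sums over translations inside
  each frequency, the fine lattice over modulations inside each translation.\<close>

lemma infsum_pair_rows: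
  fixes h :: "'i \<times> 'j \<Rightarrow> real"
  assumes "h summable_on UNIV"
  shows "infsum h UNIV = (\<Sum>\<^sub>\<infinity>m. \<Sum>\<^sub>\<infinity>n. h (m, n))" "(\<lambda>n. h (m, n)) summable_on UNIV"
    "(\<lambda>m. \<Sum>\<^sub>\<infinity>n. h (m, n)) summable_on UNIV"
    "infsum h UNIV = (\<Sum>\<^sub>\<infinity>n. \<Sum>\<^sub>\<infinity>m. h (m, n))" "(\<lambda>m. h (m, n)) summable_on UNIV"
    "(\<lambda>n. \<Sum>\<^sub>\<infinity>m. h (m, n)) summable_on UNIV"
proof -
  have s: "h summable_on UNIV \<times> UNIV" using assms by simp
  have s2: "(\<lambda>(x, y). h (x, y)) summable_on UNIV \<times> UNIV" using s by simp
  have sw: "(\<lambda>(y, x). h (x, y)) summable_on UNIV \<times> UNIV"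
    using summable_on_swap[of h UNIV UNIV] s by (simp add: case_prod_beta' prod.swap_def o_def)
  show 1: "infsum h UNIV = (\<Sum>\<^sub>\<infinity>m. \<Sum>\<^sub>\<infinity>n. h (m, n))" using infsum_Sigma_banach[OF s] by simp
  show r: "(\<lambda>n. h (m, n)) summable_on UNIV" for m using summable_on_SigmaD1[OF s2, of m] by simp
  show "(\<lambda>m. \<Sum>\<^sub>\<infinity>n. h (m, n)) summable_on UNIV" by (rule summable_on_SigmaD[OF s r])
  show "infsum h UNIV = (\<Sum>\<^sub>\<infinity>n. \<Sum>\<^sub>\<infinity>m. h (m, n))" unfolding 1 by (rule infsum_swap_banach[OF s2])
  show c: "(\<lambda>m. h (m, n)) summable_on UNIV" for n using summable_on_SigmaD1[OF sw, of n] by simp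
  show "(\<lambda>n. \<Sum>\<^sub>\<infinity>m. h (m, n)) summable_on UNIV"
    using summable_on_SigmaD[of "\<lambda>(y, x). h (x, y)" UNIV "\<lambda>_. UNIV"] sw c by simp
qed

lemma plancherel:
  assumes f: "f \<in> (S :: ('n::finite) fn set)"
  shows "L2_normsq (fourier f) = (2 * pi) ^ CARD('n) * L2_normsq f"
proof -
  have "of_real ((2 * pi) ^ CARD('n)) * L2_inner f f = L2_inner (fourier f) (fourier f)"
    unfolding L2_inner_def by (intro parseval S_rapid f)
  then have "complex_of_real ((2 * pi) ^ CARD('n) * L2_normsq f) = of_real (L2_normsq (fourier f))"
    unfolding L2_inner_self[OF S_rapid(1)[OF f]] L2_inner_self[OF S_rapid(2)[OF f]] by simp
  then show ?thesis by (simp only: of_real_eq_iff)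
qed

lemma autocorr_0: "autocorr G 0 = of_real (L2_normsq G)"
proof -
  have "autocorr G 0 = (\<integral>x. of_real ((norm (G x))\<^sup>2) \<partial>lborel)"
    unfolding autocorr_def by (simp only: complex_norm_square add_0_right)
  then show ?thesis unfolding L2_normsq_def by (simp only: integral_complex_of_real)
qed

text \<open>The translates of the support of \<^term>\<open>fourier h\<close> by the dual lattice \<open>2 * pi / \<alpha> m\<close> are disjoint, so only the term
  \<open>r = 0\<close> of the Poisson sum survives.\<close>

lemma painless_row:
  fixes h f :: "('n::finite) fn"
  assumes h: "h \<in> S" and f: "f \<in> S" and al: "\<alpha> > 0"
    and supp: "\<And>\<xi>. fourier h \<xi> \<noteq> 0 \<Longrightarrow> \<xi> \<in> cbox A B" and width: "\<And>j. B $ j - A $ j \<le> 1 / \<alpha>"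
    and sm: "(\<lambda>n. (norm (L2_inner f (tfshift (\<alpha> *\<^sub>R ivec n, \<eta>) h)))\<^sup>2) summable_on UNIV"
  shows "(2 * pi) ^ CARD('n) * (\<Sum>\<^sub>\<infinity>n. (norm (L2_inner f (tfshift (\<alpha> *\<^sub>R ivec n, \<eta>) h)))\<^sup>2)
     = (\<integral>\<xi>. (norm (fourier f \<xi>))\<^sup>2 * ((norm (fourier h (\<xi> - \<eta>)))\<^sup>2 / \<alpha> ^ CARD('n)) \<partial>lborel)"
proof -
  \<comment> \<open>By Parseval the inner products with all translates are, up to phase and the
    factor (2 pi)^d, the samples of the Fourier transform of this single function.\<close>
  define H where "H \<xi> = fourier f \<xi> * cnj (fourier h (\<xi> - \<eta>))" for \<xi>
  have rh: "rapid (\<lambda>\<xi>. fourier h (\<xi> - \<eta>))" using rapid_shift[OF S_rapid(2)[OF h], of "- \<eta>"] by simp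
  have H: "rapid H" unfolding H_def by (intro rapid_prod rapid_cnj rh S_rapid f)
  let ?P = "(2 * pi) ^ CARD('n)"
  have P: "?P > 0" by simp
  define L where "L = 2 * pi / \<alpha>"
  have L: "L > 0" using al by (simp add: L_def)
  have L\<alpha>: "2 * pi / L = \<alpha>" using al by (simp add: L_def)
  have ip: "?P * norm (L2_inner f (tfshift (\<alpha> *\<^sub>R ivec n, \<eta>) h)) = norm (fourier H (\<alpha> *\<^sub>R ivec (\<lambda>j. - n j)))" for n
  proof -
    let ?x = "\<alpha> *\<^sub>R ivec n"
    have "of_real ?P * L2_inner f (tfshift (?x, \<eta>) h) = (\<integral>\<xi>. fourier f \<xi> * cnj (fourier (tfshift (?x, \<eta>) h) \<xi>) \<partial>lborel)"
      unfolding L2_inner_def by (intro parseval S_rapid tfshift_S f h)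
    also have "\<dots> = (\<integral>\<xi>. cnj (cis (?x \<bullet> \<eta>)) * (H \<xi> * cis (- (\<xi> \<bullet> (\<alpha> *\<^sub>R ivec (\<lambda>j. - n j))))) \<partial>lborel)"
      unfolding fourier_tfshift[OF S_rapid(1)[OF h]]
      by (intro Bochner_Integration.integral_cong refl)
         (simp add: tfshift_def H_def ivec_uminus cis_cnj mult_ac)
    also have "\<dots> = cnj (cis (?x \<bullet> \<eta>)) * fourier H (\<alpha> *\<^sub>R ivec (\<lambda>j. - n j))"
      unfolding fourier_lebesgue[OF H] by (rule Bochner_Integration.integral_mult_right_zero)
    finally have "norm (of_real ?P * L2_inner f (tfshift (?x, \<eta>) h)) = norm (fourier H (\<alpha> *\<^sub>R ivec (\<lambda>j. - n j)))"
      by (simp add: norm_mult)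
    moreover have "norm (of_real ?P * L2_inner f (tfshift (?x, \<eta>) h)) = ?P * norm (L2_inner f (tfshift (?x, \<eta>) h))"
      unfolding norm_mult norm_of_real using P by (simp add: abs_of_pos)
    ultimately show ?thesis by simp
  qed
  let ?N = "\<lambda>n. (norm (fourier H (\<alpha> *\<^sub>R ivec n)))\<^sup>2"
  have N: "?N (\<lambda>j. - n j) = ?P\<^sup>2 * (norm (L2_inner f (tfshift (\<alpha> *\<^sub>R ivec n, \<eta>) h)))\<^sup>2" for n
    unfolding ip[symmetric] by (simp add: power_mult_distrib)
  have "((\<lambda>n. ?N (\<lambda>j. - n j)) has_sum ?P\<^sup>2 * (\<Sum>\<^sub>\<infinity>n. (norm (L2_inner f (tfshift (\<alpha> *\<^sub>R ivec n, \<eta>) h)))\<^sup>2)) UNIV"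
    unfolding N by (intro has_sum_cmult_right has_sum_infsum sm)
  then have hs: "(?N has_sum ?P\<^sup>2 * (\<Sum>\<^sub>\<infinity>n. (norm (L2_inner f (tfshift (\<alpha> *\<^sub>R ivec n, \<eta>) h)))\<^sup>2)) UNIV"
    unfolding has_sum_uminus_index[of ?N] .
  have z: "autocorr H (L *\<^sub>R ivec r) = 0" if r: "r \<noteq> (\<lambda>_. 0)" for r
  proof -
    obtain j where j: "r j \<noteq> 0" using r by auto
    have "H (x + L *\<^sub>R ivec r) * cnj (H x) = 0" for x
    proof (rule ccontr)
      assume "\<not> ?thesis"
      then have "fourier h (x + L *\<^sub>R ivec r - \<eta>) \<noteq> 0" "fourier h (x - \<eta>) \<noteq> 0" by (auto simp: H_def)
      then have "x + L *\<^sub>R ivec r - \<eta> \<in> cbox A B" "x - \<eta> \<in> cbox A B" using supp by auto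
      then have "A $ j \<le> (x + L *\<^sub>R ivec r - \<eta>) $ j" "(x + L *\<^sub>R ivec r - \<eta>) $ j \<le> B $ j" "A $ j \<le> (x - \<eta>) $ j" "(x - \<eta>) $ j \<le> B $ j"
        unfolding mem_box_cart by blast+
      then have "\<bar>L * of_int (r j)\<bar> \<le> B $ j - A $ j" by (simp add: ivec_def)
      also have "\<dots> \<le> 1 / \<alpha>" by (rule width)
      finally have "L * \<bar>of_int (r j)\<bar> \<le> 1 / \<alpha>" using L by (simp add: abs_mult)
      moreover have "L * 1 \<le> L * \<bar>of_int (r j)\<bar>" using j L by (intro mult_left_mono) linarith+
      ultimately have "2 * pi / \<alpha> \<le> 1 / \<alpha>" by (simp add: L_def)
      \<comment> \<open>A common point of two translates would force the period 2 pi / \<alpha> to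
        be at most the width bound 1 / \<alpha>.\<close>
      then have "2 * pi \<le> 1" using al by (simp add: divide_le_cancel)
      then show False using pi_ge_two by simp
    qed
    then show ?thesis unfolding autocorr_def by (simp only: Bochner_Integration.integral_zero)
  qed
  have "((\<lambda>r. autocorr H (L *\<^sub>R ivec r)) has_sum autocorr H (L *\<^sub>R ivec (\<lambda>_. 0))) UNIV"
    by (rule has_sum_single) (rule z)
  then have R: "(\<Sum>\<^sub>\<infinity>r. autocorr H (L *\<^sub>R ivec r)) = of_real (L2_normsq H)" using infsumI by (simp add: autocorr_0)
  have "complex_of_real (\<Sum>\<^sub>\<infinity>l. ?N l) = of_real (L ^ CARD('n)) * (\<Sum>\<^sub>\<infinity>r. autocorr H (L *\<^sub>R ivec r))"
    using autocorr_poisson[OF L H] hs unfolding L\<alpha> by (auto simp: summable_on_def)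
  also have "\<dots> = of_real (L ^ CARD('n) * L2_normsq H)" unfolding R by simp
  finally have "(\<Sum>\<^sub>\<infinity>l. ?N l) = L ^ CARD('n) * L2_normsq H" by (simp only: of_real_eq_iff)
  then have "?P\<^sup>2 * (\<Sum>\<^sub>\<infinity>n. (norm (L2_inner f (tfshift (\<alpha> *\<^sub>R ivec n, \<eta>) h)))\<^sup>2) = L ^ CARD('n) * L2_normsq H"
    using infsumI[OF hs] by simp
  also have "L ^ CARD('n) = ?P / \<alpha> ^ CARD('n)" by (simp add: L_def power_divide)
  finally have "?P * (?P * (\<Sum>\<^sub>\<infinity>n. (norm (L2_inner f (tfshift (\<alpha> *\<^sub>R ivec n, \<eta>) h)))\<^sup>2)) = ?P * (L2_normsq H / \<alpha> ^ CARD('n))"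
    by (simp add: power2_eq_square)
  then have "?P * (\<Sum>\<^sub>\<infinity>n. (norm (L2_inner f (tfshift (\<alpha> *\<^sub>R ivec n, \<eta>) h)))\<^sup>2) = L2_normsq H / \<alpha> ^ CARD('n)"
    using P by (metis mult_cancel_left less_irrefl)
  also have "\<dots> = (\<integral>\<xi>. (norm (H \<xi>))\<^sup>2 / \<alpha> ^ CARD('n) \<partial>lborel)" unfolding L2_normsq_def by simp
  finally show ?thesis by (simp add: H_def norm_mult power_mult_distrib)
qed

text \<open>Adding the rows over m gives the integral of the squared Fourier transform of f against
  the multiplier \<open>\<Phi>\<close>, which is exactly the sum assumed to lie between c and C.
  Plancherel turns this into the frame bounds.\<close>

lemma painless_frame:
  fixes h f :: "('n::finite) fn"
  assumes h: "h \<in> S" and f: "f \<in> S" and al: "\<And>m. \<alpha> m > 0"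
    and supp: "\<And>\<xi>. fourier h \<xi> \<noteq> 0 \<Longrightarrow> \<xi> \<in> cbox A B" and width: "\<And>m j. B $ j - A $ j \<le> 1 / \<alpha> m"
    and low: "\<And>\<xi>. c \<le> (\<Sum>\<^sub>\<infinity>m. (norm (fourier h (\<xi> - \<beta> *\<^sub>R ivec m)))\<^sup>2 / \<alpha> m ^ CARD('n))"
    and up: "\<And>\<xi>. (\<lambda>m. (norm (fourier h (\<xi> - \<beta> *\<^sub>R ivec m)))\<^sup>2 / \<alpha> m ^ CARD('n)) summable_on UNIV"
      "\<And>\<xi>. (\<Sum>\<^sub>\<infinity>m. (norm (fourier h (\<xi> - \<beta> *\<^sub>R ivec m)))\<^sup>2 / \<alpha> m ^ CARD('n)) \<le> C"
    and sm: "(\<lambda>p. (norm (L2_inner f (tfshift (tfpoint \<alpha> \<beta> p) h)))\<^sup>2) summable_on UNIV"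
  shows "c * L2_normsq f \<le> (\<Sum>\<^sub>\<infinity>p. (norm (L2_inner f (tfshift (tfpoint \<alpha> \<beta> p) h)))\<^sup>2)"
    and "(\<Sum>\<^sub>\<infinity>p. (norm (L2_inner f (tfshift (tfpoint \<alpha> \<beta> p) h)))\<^sup>2) \<le> C * L2_normsq f"
proof -
  let ?P = "(2 * pi) ^ CARD('n)"
  have P: "?P > 0" by simp
  define T where "T = (\<Sum>\<^sub>\<infinity>p. (norm (L2_inner f (tfshift (tfpoint \<alpha> \<beta> p) h)))\<^sup>2)"
  define k where "k m \<xi> = (norm (fourier h (\<xi> - \<beta> *\<^sub>R ivec m)))\<^sup>2 / \<alpha> m ^ CARD('n)" for m \<xi>
  have k0: "k m \<xi> \<ge> 0" for m \<xi> using al[of m] by (simp add: k_def less_imp_le)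
  note rows = infsum_pair_rows[OF sm]
  have row: "?P * (\<Sum>\<^sub>\<infinity>n. (norm (L2_inner f (tfshift (tfpoint \<alpha> \<beta> (m, n)) h)))\<^sup>2) = (\<integral>\<xi>. (norm (fourier f \<xi>))\<^sup>2 * k m \<xi> \<partial>lborel)" for m
    using painless_row[OF h f al supp width, of m "\<beta> *\<^sub>R ivec m"] rows(2)[of m] unfolding k_def by (simp add: tfpoint_def)
  have If: "integrable lborel (\<lambda>\<xi>. (norm (fourier f \<xi>))\<^sup>2)" by (rule integrable_normsq[OF S_rapid(2)[OF f]])
  have kc: "sum (\<lambda>m. k m \<xi>) F \<le> C" if "finite F" for F \<xi>
  proof -
    have "sum (\<lambda>m. k m \<xi>) F \<le> (\<Sum>\<^sub>\<infinity>m. k m \<xi>)"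
      using up(1)[of \<xi>] k0 that by (intro finite_sum_le_infsum) (auto simp: k_def[abs_def])
    also have "\<dots> \<le> C" using up(2)[of \<xi>] by (simp add: k_def)
    finally show ?thesis .
  qed
  have ik: "integrable lborel (\<lambda>\<xi>. (norm (fourier f \<xi>))\<^sup>2 * k m \<xi>)" for m
  proof -
    have rh: "rapid (\<lambda>\<xi>. fourier h (\<xi> - \<beta> *\<^sub>R ivec m))" using rapid_shift[OF S_rapid(2)[OF h], of "- (\<beta> *\<^sub>R ivec m)"] by simp
    have "integrable lborel (\<lambda>\<xi>. (norm (fourier f \<xi> * fourier h (\<xi> - \<beta> *\<^sub>R ivec m)))\<^sup>2 / \<alpha> m ^ CARD('n))"
      by (intro integrable_divide integrable_normsq rapid_prod rh S_rapid f)
    then show ?thesis by (simp add: k_def norm_mult power_mult_distrib)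
  qed
  have psm: "(\<lambda>m. norm ((norm (fourier f \<xi>))\<^sup>2 * k m \<xi>)) summable_on UNIV" for \<xi>
  proof -
    have "(\<lambda>m. (norm (fourier f \<xi>))\<^sup>2 * k m \<xi>) summable_on UNIV"
      using up(1)[of \<xi>] by (intro summable_on_cmult_right) (simp add: k_def)
    then show ?thesis using k0 by (simp add: abs_mult)
  qed
  have ism: "(\<lambda>m. \<integral>\<xi>. norm ((norm (fourier f \<xi>))\<^sup>2 * k m \<xi>) \<partial>lborel) summable_on UNIV"
  proof -
    have "(\<lambda>m. ?P * (\<Sum>\<^sub>\<infinity>n. (norm (L2_inner f (tfshift (tfpoint \<alpha> \<beta> (m, n)) h)))\<^sup>2)) summable_on UNIV"
      by (intro summable_on_cmult_right rows(3))
    then show ?thesis unfolding row using k0 by (simp add: abs_mult)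
  qed
  define \<Phi> where "\<Phi> \<xi> = (\<Sum>\<^sub>\<infinity>m. k m \<xi>)" for \<xi>
  have \<Phi>: "c \<le> \<Phi> \<xi>" "\<Phi> \<xi> \<le> C" for \<xi> using low[of \<xi>] up(2)[of \<xi>] by (auto simp: \<Phi>_def k_def)
  have eq: "(\<lambda>\<xi>. \<Sum>\<^sub>\<infinity>m. (norm (fourier f \<xi>))\<^sup>2 * k m \<xi>) = (\<lambda>\<xi>. (norm (fourier f \<xi>))\<^sup>2 * \<Phi> \<xi>)"
    unfolding \<Phi>_def by (simp add: infsum_cmult_right')
  note hs = has_sum_integral[OF ik psm ism, unfolded eq]
  have "?P * T = (\<Sum>\<^sub>\<infinity>m. ?P * (\<Sum>\<^sub>\<infinity>n. (norm (L2_inner f (tfshift (tfpoint \<alpha> \<beta> (m, n)) h)))\<^sup>2))"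
    unfolding T_def rows(1) by (simp add: infsum_cmult_right')
  also have "\<dots> = (\<integral>\<xi>. (norm (fourier f \<xi>))\<^sup>2 * \<Phi> \<xi> \<partial>lborel)" unfolding row by (rule infsumI[OF hs(1)])
  finally have PT: "?P * T = (\<integral>\<xi>. (norm (fourier f \<xi>))\<^sup>2 * \<Phi> \<xi> \<partial>lborel)" .
  have pl: "(\<integral>\<xi>. (norm (fourier f \<xi>))\<^sup>2 * d \<partial>lborel) = ?P * (d * L2_normsq f)" for d
    using plancherel[OF f] by (simp add: L2_normsq_def mult_ac)
  have "?P * (c * L2_normsq f) \<le> ?P * T" unfolding PT pl[symmetric]
    by (intro integral_mono hs(2) integrable_mult_left If mult_left_mono \<Phi>) auto
  then show "c * L2_normsq f \<le> (\<Sum>\<^sub>\<infinity>p. (norm (L2_inner f (tfshift (tfpoint \<alpha> \<beta> p) h)))\<^sup>2)"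
    unfolding T_def[symmetric] using P by (rule mult_left_le_imp_le)
  have "?P * T \<le> ?P * (C * L2_normsq f)" unfolding PT pl[symmetric]
    by (intro integral_mono hs(2) integrable_mult_left If mult_left_mono \<Phi>) auto
  then show "(\<Sum>\<^sub>\<infinity>p. (norm (L2_inner f (tfshift (tfpoint \<alpha> \<beta> p) h)))\<^sup>2) \<le> C * L2_normsq f"
    unfolding T_def[symmetric] using P by (rule mult_left_le_imp_le)
qed

end

section \<open>Gabor frames on fine lattices\<close>

lemma has_sum_sum_family:
  fixes f :: "'k \<Rightarrow> 'i \<Rightarrow> 'a::topological_comm_monoid_add"
  assumes "\<And>k. k \<in> F \<Longrightarrow> (f k has_sum s k) A"
  shows "((\<lambda>i. \<Sum>k\<in>F. f k i) has_sum (\<Sum>k\<in>F. s k)) A"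
  using assms by (induction F rule: infinite_finite_induct) (auto intro: has_sum_add)

context weight_fun
begin

text \<open>By continuity \<psi> is at least half its value at x0 on a ball of radius r. With a = r
  / (2d) every point can be moved by a lattice vector to within r / 2 of x0.\<close>

lemma lattice_cover:
  fixes \<psi> :: "('n::finite) fn"
  assumes psi: "rapid \<psi>" "\<psi> \<noteq> (\<lambda>_. 0)"
  shows "\<exists>a>0. \<exists>c>0. \<forall>x. \<exists>k. c \<le> (norm (\<psi> (x - a *\<^sub>R ivec k)))\<^sup>2"
proof -
  from psi(2) obtain x0 where x0: "\<psi> x0 \<noteq> 0" by auto
  have "isCont \<psi> x0" using rapid_cont[OF psi(1)] by (simp add: continuous_on_eq_continuous_at)
  then obtain r where r: "r > 0" "\<And>x. dist x x0 < r \<Longrightarrow> dist (\<psi> x) (\<psi> x0) < norm (\<psi> x0) / 2"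
    using x0 unfolding continuous_at_eps_delta by (meson half_gt_zero zero_less_norm_iff)
  define a where "a = r / (2 * real CARD('n))"
  have a: "a > 0" using r by (simp add: a_def)
  define c where "c = (norm (\<psi> x0) / 2)\<^sup>2"
  have c: "c > 0" using x0 by (simp add: c_def)
  have "c \<le> (norm (\<psi> (x - a *\<^sub>R ivec (\<lambda>j. \<lfloor>(x - x0) $ j / a\<rfloor>))))\<^sup>2" for x
  proof -
    let ?y = "x - a *\<^sub>R ivec (\<lambda>j. \<lfloor>(x - x0) $ j / a\<rfloor>)"
    have "norm (?y - x0) \<le> (\<Sum>j\<in>UNIV. \<bar>(?y - x0) $ j\<bar>)" by (rule norm_le_l1_cart)
    also have "\<dots> \<le> (\<Sum>j\<in>(UNIV :: 'n set). a)"
    proof (intro sum_mono)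
      fix j
      let ?t = "(x - x0) $ j / a"
      have eq: "(?y - x0) $ j = a * (?t - of_int \<lfloor>?t\<rfloor>)" using a by (simp add: ivec_def field_simps)
      have "\<bar>?t - of_int \<lfloor>?t\<rfloor>\<bar> \<le> 1" by linarith
      then have "a * \<bar>?t - of_int \<lfloor>?t\<rfloor>\<bar> \<le> a * 1" using a by (intro mult_left_mono) auto
      then show "\<bar>(?y - x0) $ j\<bar> \<le> a" unfolding eq using a by (simp add: abs_mult)
    qed
    also have "\<dots> = r / 2" by (simp add: a_def)
    finally have "dist ?y x0 < r" using r(1) by (simp add: dist_norm)
    then have "dist (\<psi> ?y) (\<psi> x0) < norm (\<psi> x0) / 2" by (rule r(2))
    then have "norm (\<psi> x0) / 2 \<le> norm (\<psi> ?y)" using norm_triangle_sub[of "\<psi> x0" "\<psi> ?y"] by (simp add: dist_norm norm_minus_commute)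
    then show ?thesis unfolding c_def by (intro power_mono) auto
  qed
  then show ?thesis using a c by blast
qed

lemma Re_infsum_minus_single:
  fixes R :: "'i \<Rightarrow> complex"
  assumes "(\<lambda>r. norm (R r)) summable_on UNIV"
  shows "\<bar>Re (\<Sum>\<^sub>\<infinity>r. R r) - Re (R r0)\<bar> \<le> (\<Sum>\<^sub>\<infinity>r\<in>-{r0}. norm (R r))"
proof -
  have s: "R summable_on UNIV" by (rule abs_summable_summable[OF assms])
  have "(\<Sum>\<^sub>\<infinity>r. R r) = (\<Sum>\<^sub>\<infinity>r\<in>{r0}. R r) + (\<Sum>\<^sub>\<infinity>r\<in>-{r0}. R r)"
    using infsum_Un_disjoint[of R "{r0}" "- {r0}"] summable_on_subset_banach[OF s] by simp
  then have "Re (\<Sum>\<^sub>\<infinity>r. R r) - Re (R r0) = Re (\<Sum>\<^sub>\<infinity>r\<in>-{r0}. R r)" by simp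
  also have "\<bar>\<dots>\<bar> \<le> norm (\<Sum>\<^sub>\<infinity>r\<in>-{r0}. R r)" by (rule abs_Re_le_cmod)
  also have "\<dots> \<le> (\<Sum>\<^sub>\<infinity>r\<in>-{r0}. norm (R r))"
    by (rule norm_infsum_bound) (rule summable_on_subset_banach[OF assms], simp)
  finally show ?thesis .
qed

text \<open>For a fixed translation the inner products are Fourier samples of f times the conjugated
  window. In the Poisson sum of the autocorrelation the term at 0 is the main part; the others form
  the error.\<close>

lemma fine_gabor_row:
  fixes \<psi> f :: "('n::finite) fn"
  assumes psi: "\<psi> \<in> S" and f: "f \<in> S" and L: "L > 0"
    and sm: "(\<lambda>l. (norm (L2_inner f (tfshift (x0, (2 * pi / L) *\<^sub>R ivec l) \<psi>)))\<^sup>2) summable_on UNIV"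
  defines "Gk \<equiv> \<lambda>t. f t * cnj (\<psi> (t - x0))"
  shows "\<bar>(\<Sum>\<^sub>\<infinity>l. (norm (L2_inner f (tfshift (x0, (2 * pi / L) *\<^sub>R ivec l) \<psi>)))\<^sup>2) - L ^ CARD('n) * L2_normsq Gk\<bar>
     \<le> L ^ CARD('n) * (\<Sum>\<^sub>\<infinity>r\<in>-{\<lambda>_. 0}. norm (autocorr Gk (L *\<^sub>R ivec r)))"
proof -
  have rp: "rapid (\<lambda>t. \<psi> (t - x0))" using rapid_shift[OF S_rapid(1)[OF psi], of "- x0"] by simp
  have G: "rapid Gk" unfolding Gk_def by (intro rapid_prod rapid_cnj rp S_rapid f)
  let ?D = "L ^ CARD('n)"
  have D: "?D > 0" using L by simp
  have ip: "L2_inner f (tfshift (x0, \<xi>) \<psi>) = fourier Gk \<xi>" for \<xi>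
  proof -
    have "L2_inner f (tfshift (x0, \<xi>) \<psi>) = (\<integral>t. Gk t * cis (- (t \<bullet> \<xi>)) \<partial>lborel)"
      unfolding L2_inner_def
      by (intro Bochner_Integration.integral_cong refl) (simp add: Gk_def tfshift_def cis_cnj mult_ac)
    then show ?thesis unfolding fourier_lebesgue[OF G] .
  qed
  have asm: "(\<lambda>r. norm (autocorr Gk (L *\<^sub>R ivec r))) summable_on UNIV"
    using rapid_summable[OF rapid_autocorr[OF G] L, of 0] by simp
  let ?N = "\<Sum>\<^sub>\<infinity>l. (norm (fourier Gk ((2 * pi / L) *\<^sub>R ivec l)))\<^sup>2"
  have "complex_of_real ?N = of_real ?D * (\<Sum>\<^sub>\<infinity>r. autocorr Gk (L *\<^sub>R ivec r))"
    by (rule autocorr_poisson[OF L G]) (use sm in \<open>simp add: ip\<close>)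
  then have "?N = Re (of_real ?D * (\<Sum>\<^sub>\<infinity>r. autocorr Gk (L *\<^sub>R ivec r)))" by (metis Re_complex_of_real)
  also have "\<dots> = ?D * Re (\<Sum>\<^sub>\<infinity>r. autocorr Gk (L *\<^sub>R ivec r))"
    using scaleR_complex.simps(1)[of ?D] by (simp only: scaleR_conv_of_real[symmetric])
  finally have "?N - ?D * L2_normsq Gk = ?D * (Re (\<Sum>\<^sub>\<infinity>r. autocorr Gk (L *\<^sub>R ivec r)) - Re (autocorr Gk (L *\<^sub>R ivec (\<lambda>_. 0))))"
    by (simp add: autocorr_0 algebra_simps)
  then have "\<bar>?N - ?D * L2_normsq Gk\<bar> = ?D * \<bar>Re (\<Sum>\<^sub>\<infinity>r. autocorr Gk (L *\<^sub>R ivec r)) - Re (autocorr Gk (L *\<^sub>R ivec (\<lambda>_. 0)))\<bar>"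
    using D by (simp add: abs_mult)
  also have "\<dots> \<le> ?D * (\<Sum>\<^sub>\<infinity>r\<in>-{\<lambda>_. 0}. norm (autocorr Gk (L *\<^sub>R ivec r)))"
    using D by (intro mult_left_mono Re_infsum_minus_single[OF asm]) auto
  finally show ?thesis by (simp add: ip)
qed

text \<open>Walnut's argument: summed over the translations, the terms with \<open>r \<noteq> 0\<close> are \<open>O(1/L)\<close> because the window decays.\<close>

lemma walnut_offdiagonal:
  fixes \<psi> :: "('n::finite) fn"
  assumes psi: "\<psi> \<in> S" and a: "a > 0"
  shows "\<exists>K\<ge>0. \<forall>L\<ge>1. \<forall>f\<in>S. \<forall>F. finite F \<longrightarrow>
     (\<Sum>k\<in>F. \<Sum>\<^sub>\<infinity>r\<in>-{\<lambda>_. 0}. norm (autocorr (\<lambda>t. f t * cnj (\<psi> (t - a *\<^sub>R ivec k))) (L *\<^sub>R ivec r))) \<le> K / L * L2_normsq f"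
proof -
  \<comment> \<open>The power 2d is spent on summability over r, the remaining one on the factor 1 /
    L.\<close>
  let ?N = "2 * CARD('n) + 1"
  obtain C1 where C1: "C1 > 0" "\<And>x. (1 + norm x) ^ ?N * norm (\<psi> x) \<le> C1" using rapid_bound[OF S_rapid(1)[OF psi], of ?N] by blast
  obtain C2 where C2: "C2 > 0" "\<And>x. (1 + norm x) ^ ?N * norm (\<psi> x) \<le> C2 * decay x" using rapid_decay_bound[OF S_rapid(1)[OF psi], of ?N] by blast
  obtain C3 where C3: "C3 > 0" "\<And>L (x :: real^'n) F. L \<ge> a \<Longrightarrow> finite F \<Longrightarrow> (\<Sum>n\<in>F. decay (x - L *\<^sub>R ivec n)) \<le> C3"
    using lattice_sum_bound[OF a, where 'n='n] by blast
  obtain C4 where C4: "C4 > 0" "\<And>L (x :: real^'n) F. L \<ge> 1 \<Longrightarrow> finite F \<Longrightarrow> (\<Sum>n\<in>F. decay (x - L *\<^sub>R ivec n)) \<le> C4"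
    using lattice_sum_bound[OF zero_less_one, where 'n='n] by blast
  have pp: "norm (\<psi> (s + y)) * norm (\<psi> s) \<le> C1 * C2 / (1 + norm y) ^ ?N * decay s" for s y
  proof -
    have "(1 + norm y) ^ ?N \<le> ((1 + norm (s + y)) * (1 + norm s)) ^ ?N"
      using peetre[of y "s + y"] by (intro power_mono) auto
    then have "(1 + norm y) ^ ?N * (norm (\<psi> (s + y)) * norm (\<psi> s)) \<le> ((1 + norm (s + y)) * (1 + norm s)) ^ ?N * (norm (\<psi> (s + y)) * norm (\<psi> s))"
      by (intro mult_right_mono) auto
    also have "\<dots> = ((1 + norm (s + y)) ^ ?N * norm (\<psi> (s + y))) * ((1 + norm s) ^ ?N * norm (\<psi> s))"
      unfolding power_mult_distrib by (simp only: mult_ac)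
    also have "\<dots> \<le> C1 * (C2 * decay s)" by (intro mult_mono C1 C2) (use C1 in auto)
    finally have "norm (\<psi> (s + y)) * norm (\<psi> s) \<le> C1 * (C2 * decay s) / (1 + norm y) ^ ?N"
      by (subst pos_le_divide_eq) (auto simp: mult.commute)
    then show ?thesis by (simp only: times_divide_eq_left mult.assoc)
  qed
  define K where "K = C1 * C2 * C3 * C4"
  have "(\<Sum>k\<in>F. \<Sum>\<^sub>\<infinity>r\<in>-{\<lambda>_. 0}. norm (autocorr (\<lambda>t. f t * cnj (\<psi> (t - a *\<^sub>R ivec k))) (L *\<^sub>R ivec r))) \<le> K / L * L2_normsq f"
    if L: "L \<ge> 1" and f: "f \<in> S" and F: "finite F" for L f F
  proof -
    have L0: "L > 0" using L by simp
    define Gk where "Gk k = (\<lambda>t. f t * cnj (\<psi> (t - a *\<^sub>R ivec k)))" for k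
    have rp: "rapid (\<lambda>t. \<psi> (t - a *\<^sub>R ivec k))" for k using rapid_shift[OF S_rapid(1)[OF psi], of "- (a *\<^sub>R ivec k)"] by simp
    have G: "rapid (Gk k)" for k unfolding Gk_def by (intro rapid_prod rapid_cnj rp S_rapid f)
    have asm: "(\<lambda>r. norm (autocorr (Gk k) (L *\<^sub>R ivec r))) summable_on UNIV" for k
      using rapid_summable[OF rapid_autocorr[OF G] L0, of k 0] by simp
    have iff: "integrable lborel (\<lambda>x. norm (f (x + y)) * norm (f x))" for y
    proof -
      have "integrable lborel (\<lambda>x. norm (f (x + y) * f x))" by (intro integrable_norm rapid_integrable rapid_prod rapid_shift S_rapid f)
      then show ?thesis by (simp add: norm_mult)
    qed
    \<comment> \<open>Half the sum of squares bounds the product, and translation invariance makes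
      both halves equal.\<close>
    have ffb: "(\<integral>x. norm (f (x + y)) * norm (f x) \<partial>lborel) \<le> L2_normsq f" for y
    proof -
      have i1: "integrable lborel (\<lambda>x. (norm (f x))\<^sup>2)" by (rule integrable_normsq[OF S_rapid(1)[OF f]])
      have i2: "integrable lborel (\<lambda>x. (norm (f (x + y)))\<^sup>2)" by (rule integrable_normsq[OF rapid_shift[OF S_rapid(1)[OF f]]])
      have "(\<integral>x. norm (f (x + y)) * norm (f x) \<partial>lborel) \<le> (\<integral>x. ((norm (f (x + y)))\<^sup>2 + (norm (f x))\<^sup>2) / 2 \<partial>lborel)"
      proof (rule integral_mono[OF iff])
        show "norm (f (x + y)) * norm (f x) \<le> ((norm (f (x + y)))\<^sup>2 + (norm (f x))\<^sup>2) / 2" for x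
          using sum_squares_bound[of "norm (f (x + y))" "norm (f x)"] by simp
      qed (use i1 i2 in auto)
      also have "\<dots> = ((\<integral>x. (norm (f (x + y)))\<^sup>2 \<partial>lborel) + L2_normsq f) / 2"
        using i1 i2 by (simp add: L2_normsq_def)
      also have "(\<integral>x. (norm (f (x + y)))\<^sup>2 \<partial>lborel) = L2_normsq f"
        unfolding L2_normsq_def by (rule integral_translate[of "\<lambda>x. (norm (f x))\<^sup>2"])
      finally show ?thesis by simp
    qed
    have col: "(\<Sum>k\<in>F. norm (autocorr (Gk k) y)) \<le> C1 * C2 / (1 + norm y) ^ ?N * (C3 * L2_normsq f)" for y
    proof -
      let ?M = "C1 * C2 / (1 + norm y) ^ ?N"
      have M: "?M \<ge> 0" using C1 C2 by simp
      have ig: "integrable lborel (\<lambda>x. norm (Gk k (x + y) * cnj (Gk k x)))" for k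
        by (intro integrable_norm rapid_integrable rapid_prod rapid_cnj rapid_shift G)
      have "(\<Sum>k\<in>F. norm (autocorr (Gk k) y)) \<le> (\<Sum>k\<in>F. \<integral>x. norm (Gk k (x + y) * cnj (Gk k x)) \<partial>lborel)"
        unfolding autocorr_def by (intro sum_mono integral_norm_bound)
      also have "\<dots> = (\<integral>x. (\<Sum>k\<in>F. norm (Gk k (x + y) * cnj (Gk k x))) \<partial>lborel)"
        by (rule Bochner_Integration.integral_sum[symmetric]) (rule ig)
      also have "\<dots> \<le> (\<integral>x. ?M * C3 * (norm (f (x + y)) * norm (f x)) \<partial>lborel)"
      proof (intro integral_mono Bochner_Integration.integrable_sum ig integrable_mult_right iff)
        fix x
        let ?ff = "norm (f (x + y)) * norm (f x)"
        have "(\<Sum>k\<in>F. norm (Gk k (x + y) * cnj (Gk k x))) = (\<Sum>k\<in>F. ?ff * (norm (\<psi> ((x - a *\<^sub>R ivec k) + y)) * norm (\<psi> (x - a *\<^sub>R ivec k))))"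
          by (intro sum.cong refl) (simp add: Gk_def norm_mult mult_ac diff_add_eq)
        also have "\<dots> \<le> (\<Sum>k\<in>F. ?ff * (?M * decay (x - a *\<^sub>R ivec k)))"
          by (intro sum_mono mult_left_mono pp) auto
        also have "\<dots> = ?ff * ?M * (\<Sum>k\<in>F. decay (x - a *\<^sub>R ivec k))" by (simp add: sum_distrib_left mult.assoc)
        also have "\<dots> \<le> ?ff * ?M * C3" by (intro mult_left_mono mult_nonneg_nonneg M C3 F norm_ge_zero) auto
        finally show "(\<Sum>k\<in>F. norm (Gk k (x + y) * cnj (Gk k x))) \<le> ?M * C3 * ?ff" by (simp only: mult_ac)
      qed
      also have "\<dots> = ?M * C3 * (\<integral>x. norm (f (x + y)) * norm (f x) \<partial>lborel)" by simp
      also have "\<dots> \<le> ?M * C3 * L2_normsq f" by (intro mult_left_mono ffb mult_nonneg_nonneg M less_imp_le[OF C3(1)])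
      finally show ?thesis by (simp only: mult.assoc)
    qed
    have "(\<Sum>k\<in>F. \<Sum>\<^sub>\<infinity>r\<in>-{\<lambda>_. 0}. norm (autocorr (Gk k) (L *\<^sub>R ivec r))) = (\<Sum>\<^sub>\<infinity>r\<in>-{\<lambda>_. 0}. \<Sum>k\<in>F. norm (autocorr (Gk k) (L *\<^sub>R ivec r)))"
      by (rule infsumI[symmetric], rule has_sum_sum_family) (intro has_sum_infsum summable_on_subset_banach[OF asm], auto simp: F)
    also have "\<dots> \<le> K / L * L2_normsq f"
    proof (rule nonneg_summable_onI(2))
      fix R :: "('n \<Rightarrow> int) set" assume R: "finite R" "R \<subseteq> - {\<lambda>_. 0}"
      have "(\<Sum>r\<in>R. \<Sum>k\<in>F. norm (autocorr (Gk k) (L *\<^sub>R ivec r))) \<le> (\<Sum>r\<in>R. C1 * C2 * (1 / L * decay (0 - L *\<^sub>R ivec r :: real^'n)) * (C3 * L2_normsq f))"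
      proof (rule sum_mono)
        fix r assume "r \<in> R"
        then have "r \<noteq> (\<lambda>_. 0)" using R by blast
        then obtain j where j: "r j \<noteq> 0" by auto
        let ?y = "L *\<^sub>R ivec r :: real^'n"
        have "L * 1 \<le> L * \<bar>of_int (r j)\<bar>" using j L by (intro mult_left_mono) linarith+
        also have "\<dots> = \<bar>?y $ j\<bar>" using L by (simp add: ivec_def abs_mult)
        also have "\<dots> \<le> norm ?y" by (rule component_le_norm_cart)
        finally have "L \<le> 1 + norm ?y" by simp
        have "1 / (1 + norm ?y) ^ ?N = 1 / (1 + norm ?y) * decay ?y" by (simp add: decay_def)
        also have "\<dots> \<le> 1 / L * decay ?y" using \<open>L \<le> 1 + norm ?y\<close> L by (intro mult_right_mono divide_left_mono) auto
        finally have le: "1 / (1 + norm ?y) ^ ?N \<le> 1 / L * decay ?y" .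
        have "(\<Sum>k\<in>F. norm (autocorr (Gk k) ?y)) \<le> C1 * C2 * (1 / (1 + norm ?y) ^ ?N) * (C3 * L2_normsq f)" using col[of ?y] by simp
        also have "\<dots> \<le> C1 * C2 * (1 / L * decay ?y) * (C3 * L2_normsq f)"
          using C1(1) C2(1) C3(1) by (intro mult_right_mono mult_left_mono le mult_nonneg_nonneg L2_normsq_nonneg) auto
        finally show "(\<Sum>k\<in>F. norm (autocorr (Gk k) ?y)) \<le> C1 * C2 * (1 / L * decay (0 - ?y)) * (C3 * L2_normsq f)" by simp
      qed
      also have "\<dots> = C1 * C2 * (1 / L * (\<Sum>r\<in>R. decay (0 - L *\<^sub>R ivec r :: real^'n))) * (C3 * L2_normsq f)"
        by (simp only: sum_distrib_left sum_distrib_right)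
      also have "\<dots> \<le> C1 * C2 * (1 / L * C4) * (C3 * L2_normsq f)"
        using C1(1) C2(1) C3(1) L by (intro mult_right_mono mult_left_mono C4 R mult_nonneg_nonneg L2_normsq_nonneg) auto
      also have "\<dots> = K / L * L2_normsq f" by (simp add: K_def)
      finally show "(\<Sum>r\<in>R. \<Sum>k\<in>F. norm (autocorr (Gk k) (L *\<^sub>R ivec r))) \<le> K / L * L2_normsq f" .
    qed (auto intro: sum_nonneg)
    finally show ?thesis unfolding Gk_def .
  qed
  moreover have "K \<ge> 0" using C1 C2 C3 C4 by (simp add: K_def)
  ultimately show ?thesis by blast
qed

text \<open>The translation step a is fixed by \<open>lattice_cover\<close>, which keeps the
  diagonal part at least c times the squared norm. Only afterwards is the modulation step refined,
  until the off-diagonal part is at most half of that.\<close>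

lemma fine_gabor_frame:
  fixes \<psi> :: "('n::finite) fn"
  assumes psi: "\<psi> \<in> S" "\<psi> \<noteq> (\<lambda>_. 0)"
  shows "\<exists>a>0. \<exists>b>0. \<exists>A>0. \<exists>B. \<forall>f\<in>S. A * L2_normsq f \<le> (\<Sum>\<^sub>\<infinity>p. (norm (L2_inner f (tfshift (tfpoint (\<lambda>_. a) b p) \<psi>)))\<^sup>2) \<and>
     (\<Sum>\<^sub>\<infinity>p. (norm (L2_inner f (tfshift (tfpoint (\<lambda>_. a) b p) \<psi>)))\<^sup>2) \<le> B * L2_normsq f"
proof -
  have rpsi: "rapid \<psi>" by (rule S_rapid(1)[OF psi(1)])
  obtain a c where a: "a > 0" and c: "c > 0" "\<And>x. \<exists>k. c \<le> (norm (\<psi> (x - a *\<^sub>R ivec k)))\<^sup>2"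
    using lattice_cover[OF rpsi psi(2)] by blast
  obtain K where K: "K \<ge> 0" "\<And>L f F. L \<ge> 1 \<Longrightarrow> f \<in> S \<Longrightarrow> finite F \<Longrightarrow>
     (\<Sum>k\<in>F. \<Sum>\<^sub>\<infinity>r\<in>-{\<lambda>_. 0}. norm (autocorr (\<lambda>t. f t * cnj (\<psi> (t - a *\<^sub>R ivec k))) (L *\<^sub>R ivec r))) \<le> K / L * L2_normsq f"
    using walnut_offdiagonal[OF psi(1) a] by blast
  \<comment> \<open>Makes K / L \<le> c / 2, so that half of the diagonal lower bound
    survives.\<close>
  define L where "L = max 1 (2 * K / c)"
  have L: "L \<ge> 1" "L > 0" "2 * K / c \<le> L" by (auto simp: L_def)
  have KL: "K / L \<le> c / 2" using L c by (simp add: field_simps)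
  define b where "b = 2 * pi / L"
  have b: "b > 0" using L by (simp add: b_def)
  let ?D = "L ^ CARD('n)"
  have D: "?D > 0" using L by simp
  obtain C0 where C0: "C0 > 0" "\<And>x. norm (\<psi> x) \<le> C0" using rapid_bound[OF rpsi, of 0] by auto
  obtain C1 where C1: "C1 > 0" "\<And>x. norm (\<psi> x) \<le> C1 * decay x" using rapid_le_decay[OF rpsi] by auto
  obtain C3 where C3: "C3 > 0" "\<And>L (x :: real^'n) F. L \<ge> a \<Longrightarrow> finite F \<Longrightarrow> (\<Sum>n\<in>F. decay (x - L *\<^sub>R ivec n)) \<le> C3"
    using lattice_sum_bound[OF a, where 'n='n] by blast
  define Q where "Q = C0 * C1 * C3"
  have Q: "(\<Sum>k\<in>F. (norm (\<psi> (x - a *\<^sub>R ivec k)))\<^sup>2) \<le> Q" if "finite F" for F x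
  proof -
    have "(\<Sum>k\<in>F. (norm (\<psi> (x - a *\<^sub>R ivec k)))\<^sup>2) \<le> (\<Sum>k\<in>F. C0 * (C1 * decay (x - a *\<^sub>R ivec k)))"
      unfolding power2_eq_square using C0(1) by (intro sum_mono mult_mono C0 C1) auto
    also have "\<dots> = C0 * C1 * (\<Sum>k\<in>F. decay (x - a *\<^sub>R ivec k))" by (simp add: sum_distrib_left mult.assoc)
    also have "\<dots> \<le> Q" unfolding Q_def using C0(1) C1(1) by (intro mult_left_mono C3 that) auto
    finally show ?thesis .
  qed
  note Qs = nonneg_summable_onI[where A=UNIV and f="\<lambda>k. (norm (\<psi> (x - a *\<^sub>R ivec k)))\<^sup>2" and C=Q for x]
  have Qsum: "(\<lambda>k. (norm (\<psi> (x - a *\<^sub>R ivec k)))\<^sup>2) summable_on UNIV" for x by (rule Qs(1)) (auto intro: Q)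
  have "?D * (c / 2) * L2_normsq f \<le> (\<Sum>\<^sub>\<infinity>p. (norm (L2_inner f (tfshift (tfpoint (\<lambda>_. a) b p) \<psi>)))\<^sup>2) \<and>
     (\<Sum>\<^sub>\<infinity>p. (norm (L2_inner f (tfshift (tfpoint (\<lambda>_. a) b p) \<psi>)))\<^sup>2) \<le> ?D * (Q + c / 2) * L2_normsq f"
    if f: "f \<in> S" for f
  proof -
    have sm: "(\<lambda>p. (norm (L2_inner f (tfshift (tfpoint (\<lambda>_. a) b p) \<psi>)))\<^sup>2) summable_on UNIV"
      by (rule family_summable[OF psi(1) f]) (use tfpoint_separated[OF a, of "\<lambda>_. a" b] b in auto)
    note rows = infsum_pair_rows[OF sm]
    define T where "T = (\<Sum>\<^sub>\<infinity>p. (norm (L2_inner f (tfshift (tfpoint (\<lambda>_. a) b p) \<psi>)))\<^sup>2)"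
    define R where "R k = (\<Sum>\<^sub>\<infinity>l. (norm (L2_inner f (tfshift (tfpoint (\<lambda>_. a) b (l, k)) \<psi>)))\<^sup>2)" for k
    have Rs: "R summable_on UNIV" "T = infsum R UNIV" using rows(4,6) by (simp_all add: R_def[abs_def] T_def)
    have R0: "R k \<ge> 0" for k unfolding R_def by (intro infsum_nonneg) auto
    define Gk where "Gk k = (\<lambda>t. f t * cnj (\<psi> (t - a *\<^sub>R ivec k)))" for k
    define Ek where "Ek k = (\<Sum>\<^sub>\<infinity>r\<in>-{\<lambda>_. 0}. norm (autocorr (Gk k) (L *\<^sub>R ivec r)))" for k
    have row: "\<bar>R k - ?D * L2_normsq (Gk k)\<bar> \<le> ?D * Ek k" for k
      using fine_gabor_row[OF psi(1) f L(2), of "a *\<^sub>R ivec k"] rows(5)[of k]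
      by (simp add: R_def Gk_def Ek_def tfpoint_def b_def)
    have EkF: "(\<Sum>k\<in>F. Ek k) \<le> c / 2 * L2_normsq f" if "finite F" for F
    proof -
      have "(\<Sum>k\<in>F. Ek k) \<le> K / L * L2_normsq f" unfolding Ek_def Gk_def by (rule K(2)[OF L(1) f that])
      also have "\<dots> \<le> c / 2 * L2_normsq f" by (intro mult_right_mono KL L2_normsq_nonneg)
      finally show ?thesis .
    qed
    have rp: "rapid (\<lambda>t. \<psi> (t - a *\<^sub>R ivec k))" for k using rapid_shift[OF rpsi, of "- (a *\<^sub>R ivec k)"] by simp
    have G: "rapid (Gk k)" for k unfolding Gk_def by (intro rapid_prod rapid_cnj rp S_rapid f)
    let ?h = "\<lambda>k x. (norm (f x))\<^sup>2 * (norm (\<psi> (x - a *\<^sub>R ivec k)))\<^sup>2"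
    have Gh: "L2_normsq (Gk k) = (\<integral>x. ?h k x \<partial>lborel)" for k
      unfolding L2_normsq_def Gk_def by (simp add: norm_mult power_mult_distrib)
    have ih: "integrable lborel (?h k)" for k
      using integrable_normsq[OF G, of k] by (simp add: Gk_def norm_mult power_mult_distrib)
    have i1: "integrable lborel (\<lambda>x. (norm (f x))\<^sup>2)" by (rule integrable_normsq[OF S_rapid(1)[OF f]])
    have GF: "(\<Sum>k\<in>F. L2_normsq (Gk k)) \<le> Q * L2_normsq f" if F: "finite F" for F
    proof -
      have "(\<Sum>k\<in>F. L2_normsq (Gk k)) = (\<integral>x. (\<Sum>k\<in>F. ?h k x) \<partial>lborel)"
        unfolding Gh by (rule Bochner_Integration.integral_sum[symmetric]) (rule ih)
      also have "\<dots> \<le> (\<integral>x. (norm (f x))\<^sup>2 * Q \<partial>lborel)"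
        by (intro integral_mono Bochner_Integration.integrable_sum ih integrable_mult_left i1)
           (auto simp: sum_distrib_left[symmetric] intro!: mult_left_mono Q F)
      finally show ?thesis by (simp add: L2_normsq_def mult.commute)
    qed
    note Gs = nonneg_summable_onI[where A=UNIV and f="\<lambda>k. L2_normsq (Gk k)", OF L2_normsq_nonneg GF]
    have hs: "((\<lambda>k. \<integral>x. ?h k x \<partial>lborel) has_sum (\<integral>x. (\<Sum>\<^sub>\<infinity>k. ?h k x) \<partial>lborel)) UNIV" "integrable lborel (\<lambda>x. \<Sum>\<^sub>\<infinity>k. ?h k x)"
    proof -
      have p: "(\<lambda>k. norm (?h k x)) summable_on UNIV" for x
        using summable_on_cmult_right[OF Qsum[of x], of "(norm (f x))\<^sup>2"] by (simp add: abs_mult)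
      have q: "(\<lambda>k. \<integral>x. norm (?h k x) \<partial>lborel) summable_on UNIV" using Gs(1) unfolding Gh by (simp add: abs_mult)
      show "((\<lambda>k. \<integral>x. ?h k x \<partial>lborel) has_sum (\<integral>x. (\<Sum>\<^sub>\<infinity>k. ?h k x) \<partial>lborel)) UNIV" "integrable lborel (\<lambda>x. \<Sum>\<^sub>\<infinity>k. ?h k x)"
        by (rule has_sum_integral[OF ih p q])+
    qed
    have "c * L2_normsq f \<le> (\<integral>x. (\<Sum>\<^sub>\<infinity>k. ?h k x) \<partial>lborel)"
    proof -
      have "c * L2_normsq f = (\<integral>x. (norm (f x))\<^sup>2 * c \<partial>lborel)" by (simp add: L2_normsq_def mult.commute)
      also have "\<dots> \<le> (\<integral>x. (\<Sum>\<^sub>\<infinity>k. ?h k x) \<partial>lborel)"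
      proof (intro integral_mono integrable_mult_left i1 hs)
        fix x
        obtain k where k: "c \<le> (norm (\<psi> (x - a *\<^sub>R ivec k)))\<^sup>2" using c(2) by blast
        also have "\<dots> = (\<Sum>k\<in>{k}. (norm (\<psi> (x - a *\<^sub>R ivec k)))\<^sup>2)" by simp
        also have "\<dots> \<le> (\<Sum>\<^sub>\<infinity>k. (norm (\<psi> (x - a *\<^sub>R ivec k)))\<^sup>2)" by (intro finite_sum_le_infsum Qsum) auto
        finally have "(norm (f x))\<^sup>2 * c \<le> (norm (f x))\<^sup>2 * (\<Sum>\<^sub>\<infinity>k. (norm (\<psi> (x - a *\<^sub>R ivec k)))\<^sup>2)" by (intro mult_left_mono) auto
        then show "(norm (f x))\<^sup>2 * c \<le> (\<Sum>\<^sub>\<infinity>k. ?h k x)" by (simp add: infsum_cmult_right')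
      qed
      finally show ?thesis .
    qed
    also have "\<dots> = (\<Sum>\<^sub>\<infinity>k. L2_normsq (Gk k))" unfolding Gh by (rule infsumI[OF hs(1), symmetric])
    also have "\<dots> \<le> T / ?D + c / 2 * L2_normsq f"
    proof (rule infsum_le_finite_sums[OF Gs(1)])
      fix F :: "('n \<Rightarrow> int) set" assume F: "finite F"
      have "?D * L2_normsq (Gk k) \<le> R k + ?D * Ek k" for k using row[of k] by linarith
      then have "L2_normsq (Gk k) \<le> (R k + ?D * Ek k) / ?D" for k using D by (simp add: pos_le_divide_eq mult.commute)
      moreover have "(R k + ?D * Ek k) / ?D = R k / ?D + Ek k" for k using L(2) by (simp add: add_divide_distrib)
      ultimately have "L2_normsq (Gk k) \<le> R k / ?D + Ek k" for k by metis
      then have "(\<Sum>k\<in>F. L2_normsq (Gk k)) \<le> (\<Sum>k\<in>F. R k / ?D + Ek k)" by (rule sum_mono)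
      also have "\<dots> = (\<Sum>k\<in>F. R k) / ?D + (\<Sum>k\<in>F. Ek k)" by (simp add: sum.distrib sum_divide_distrib)
      also have "\<dots> \<le> T / ?D + c / 2 * L2_normsq f"
        using D unfolding Rs(2) by (intro add_mono divide_right_mono EkF F finite_sum_le_infsum Rs R0) auto
      finally show "(\<Sum>k\<in>F. L2_normsq (Gk k)) \<le> T / ?D + c / 2 * L2_normsq f" .
    qed
    finally have "c / 2 * L2_normsq f \<le> T / ?D" by linarith
    then have 1: "?D * (c / 2) * L2_normsq f \<le> T" using D by (simp add: field_simps)
    have "T \<le> ?D * (Q + c / 2) * L2_normsq f" unfolding Rs(2)
    proof (rule infsum_le_finite_sums[OF Rs(1)])
      fix F :: "('n \<Rightarrow> int) set" assume F: "finite F"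
      have "R k \<le> ?D * (L2_normsq (Gk k) + Ek k)" for k using row[of k] by (simp add: distrib_left abs_le_iff)
      then have "(\<Sum>k\<in>F. R k) \<le> (\<Sum>k\<in>F. ?D * (L2_normsq (Gk k) + Ek k))" by (rule sum_mono)
      also have "\<dots> = ?D * ((\<Sum>k\<in>F. L2_normsq (Gk k)) + (\<Sum>k\<in>F. Ek k))" by (simp only: sum_distrib_left[symmetric] sum.distrib)
      also have "\<dots> \<le> ?D * (Q * L2_normsq f + c / 2 * L2_normsq f)"
        using D by (intro mult_left_mono add_mono GF EkF F) auto
      finally show "(\<Sum>k\<in>F. R k) \<le> ?D * (Q + c / 2) * L2_normsq f" by (simp add: algebra_simps)
    qed
    with 1 show ?thesis by (simp add: T_def)
  qed
  moreover have "?D * (c / 2) > 0" using D c by simp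
  ultimately show ?thesis using a b by blast
qed

end

section \<open>The wave front sets\<close>

lemma infinite_int_functions: "infinite (UNIV :: ('n::finite \<Rightarrow> int) set)"
proof
  assume "finite (UNIV :: ('n \<Rightarrow> int) set)"
  then have "finite (range (\<lambda>f :: 'n \<Rightarrow> int. f undefined))" by (rule finite_imageI)
  moreover have "range (\<lambda>f :: 'n \<Rightarrow> int. f undefined) = UNIV"
    by (auto simp: image_def intro!: exI[of _ "\<lambda>_. _"])
  ultimately show False by simp
qed

theorem theorem4p8:
  fixes \<omega> :: "real \<Rightarrow> real"
    and h \<psi> \<phi> :: "real ^ 'n::finite \<Rightarrow> complex"
    and A B :: "real ^ 'n"
    and \<beta> a b :: real
    and \<alpha> :: "('n \<Rightarrow> int) \<Rightarrow> real"
    and u :: "(real ^ 'n \<Rightarrow> complex) \<Rightarrow> complex"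
  assumes "weight_function \<omega>"
    and "h \<in> S_omega \<omega>" and "h \<noteq> (\<lambda>_. 0)"
    and "closure {\<xi>. fourier h \<xi> \<noteq> 0} \<subseteq> cbox A B"
    and "\<beta> > 0"
    and "\<forall>m. \<alpha> m > 0"
    and "\<forall>m. \<forall>j. B $ j - A $ j \<le> 1 / \<alpha> m"
    and "\<exists>c>0. \<forall>\<xi>. c \<le> (\<Sum>\<^sub>\<infinity>m. (norm (fourier h (\<xi> - \<beta> *\<^sub>R ivec m)))\<^sup>2 / \<alpha> m ^ CARD('n))"
    and "\<exists>C. \<forall>\<xi>. (\<lambda>m. (norm (fourier h (\<xi> - \<beta> *\<^sub>R ivec m)))\<^sup>2 / \<alpha> m ^ CARD('n)) summable_on UNIV
              \<and> (\<Sum>\<^sub>\<infinity>m. (norm (fourier h (\<xi> - \<beta> *\<^sub>R ivec m)))\<^sup>2 / \<alpha> m ^ CARD('n)) \<le> C"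
    and "\<psi> \<in> S_omega \<omega>" and "\<psi> \<noteq> (\<lambda>_. 0)"
    and "\<phi> \<in> S_omega \<omega>" and "\<phi> \<noteq> (\<lambda>_. 0)"
    and "a > 0" and "b > 0" and "gabor_frame \<phi> a b"
    and "u \<in> S'_omega \<omega>"
  shows "WF' \<omega> \<psi> u = WF_G \<omega> \<phi> a b u \<and> WF_G \<omega> \<phi> a b u = WF_h \<omega> h \<alpha> \<beta> u"
proof -
  interpret weight_fun \<omega> by unfold_locales (rule assms(1))
  note hS = assms(2) and psiS = assms(10) and phiS = assms(12) and u = assms(17)
  \<comment> \<open>\<open>good\<close> and \<open>goodf\<close> describe the complements of the
    wave front sets, with decay tested on a full cone or only at the points of a family in it. All
    three sets are then compared with \<open>good \<psi>\<close>.\<close>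
  define good where "good \<theta> z0 \<longleftrightarrow> (\<exists>\<Gamma>. open_conic \<Gamma> \<and> z0 \<in> \<Gamma> \<and>
      (\<forall>lam>0. \<exists>C. \<forall>z\<in>\<Gamma>. exp (lam * \<omega> (norm z)) * norm (u (tfshift z \<theta>)) \<le> C))" for \<theta> z0
  define goodf where "goodf I Z g z0 \<longleftrightarrow> (\<exists>\<Gamma>. open_conic \<Gamma> \<and> z0 \<in> \<Gamma> \<and>
      (\<forall>lam>0. \<exists>C. \<forall>i\<in>I. Z i \<in> \<Gamma> \<longrightarrow> exp (lam * \<omega> (norm (Z i))) * norm (u (tfshift (Z i) g)) \<le> C))"
    for I :: "(('n \<Rightarrow> int) \<times> ('n \<Rightarrow> int)) set" and Z g z0
  have restrict: "goodf I Z g z0" if "good g z0" for I Z g z0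
    using that unfolding good_def goodf_def by meson
  have extend: "good \<theta> z0"
    if *: "goodf UNIV (tfpoint \<alpha>' \<beta>') g z0" "g \<in> S" "\<theta> \<in> S" "\<alpha>0 > 0" "\<And>m. \<alpha>0 \<le> \<alpha>' m" "\<beta>' > 0" "A' > 0"
      "\<And>f. f \<in> S \<Longrightarrow> A' * L2_normsq f \<le> (\<Sum>\<^sub>\<infinity>p. (norm (L2_inner f (tfshift (tfpoint \<alpha>' \<beta>' p) g)))\<^sup>2)"
      "\<And>f. f \<in> S \<Longrightarrow> (\<Sum>\<^sub>\<infinity>p. (norm (L2_inner f (tfshift (tfpoint \<alpha>' \<beta>' p) g)))\<^sup>2) \<le> B' * L2_normsq f"
    for g \<theta> z0 \<alpha>' \<beta>' \<alpha>0 A' B'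
  proof -
    obtain \<Gamma> where G: "open_conic \<Gamma>" "z0 \<in> \<Gamma>" and dec: "\<forall>lam>0. \<exists>C. \<forall>i\<in>UNIV. tfpoint \<alpha>' \<beta>' i \<in> \<Gamma> \<longrightarrow>
        exp (lam * \<omega> (norm (tfpoint \<alpha>' \<beta>' i))) * norm (u (tfshift (tfpoint \<alpha>' \<beta>' i) g)) \<le> C"
      using *(1) unfolding goodf_def by blast
    have sep: "\<exists>C. \<forall>w. \<forall>F. finite F \<longrightarrow> F \<subseteq> UNIV \<longrightarrow> (\<Sum>p\<in>F. 1 / (1 + norm (w - tfpoint \<alpha>' \<beta>' p)) ^ (4 * CARD('n))) \<le> C"
      using tfpoint_separated[OF that(4,5,6)] by simp
    show ?thesis unfolding good_def
      by (rule family_decay_imp_stft_decay[OF that(2) _ _ sep that(7,8,9) u that(3) G dec]) (auto simp: finite_prod infinite_int_functions)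
  qed
  \<comment> \<open>Change of window: decay on the cone is restricted to a fine lattice on which g
    generates a frame, and from there extended to the window \<theta>.\<close>
  have window: "good \<theta> z0" if *: "good g z0" "g \<in> S" "g \<noteq> (\<lambda>_. 0)" "\<theta> \<in> S" for g \<theta> z0
  proof -
    obtain a' b' A' B' where "a' > 0" "b' > 0" "A' > 0"
      "\<And>f. f \<in> S \<Longrightarrow> A' * L2_normsq f \<le> (\<Sum>\<^sub>\<infinity>p. (norm (L2_inner f (tfshift (tfpoint (\<lambda>_. a') b' p) g)))\<^sup>2)"
      "\<And>f. f \<in> S \<Longrightarrow> (\<Sum>\<^sub>\<infinity>p. (norm (L2_inner f (tfshift (tfpoint (\<lambda>_. a') b' p) g)))\<^sup>2) \<le> B' * L2_normsq f"
      using fine_gabor_frame[OF *(2,3)] by blast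
    then show ?thesis using extend[OF restrict[OF that(1)] that(2,4), of a' "\<lambda>_. a'" b' A' B'] by simp
  qed
  have lat: "gabor_lattice a b = range (tfpoint (\<lambda>_. a) b)"
    by (auto simp: gabor_lattice_def tfpoint_def image_def)
  obtain A1 B1 where AB1: "A1 > 0" "\<And>f. f \<in> L2 \<Longrightarrow> A1 * L2_normsq f \<le> (\<Sum>\<^sub>\<infinity>\<sigma>\<in>gabor_lattice a b. (norm (L2_inner f (tfshift \<sigma> \<phi>)))\<^sup>2)"
     "\<And>f. f \<in> L2 \<Longrightarrow> (\<Sum>\<^sub>\<infinity>\<sigma>\<in>gabor_lattice a b. (norm (L2_inner f (tfshift \<sigma> \<phi>)))\<^sup>2) \<le> B1 * L2_normsq f"
    using assms(16) unfolding gabor_frame_def by blast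
  have SL2: "f \<in> L2" if "f \<in> S" for f :: "'n fn"
    unfolding L2_def mem_Collect_eq
    by (intro conjI borel_measurable_cont_lborel[OF S_cont(1)[OF that]] integrable_normsq[OF S_rapid(1)[OF that]])
  have latsum: "(\<Sum>\<^sub>\<infinity>\<sigma>\<in>gabor_lattice a b. (norm (L2_inner f (tfshift \<sigma> \<phi>)))\<^sup>2) = (\<Sum>\<^sub>\<infinity>p. (norm (L2_inner f (tfshift (tfpoint (\<lambda>_. a) b p) \<phi>)))\<^sup>2)" for f
    unfolding lat by (subst infsum_reindex) (auto intro!: inj_tfpoint assms simp: o_def)
  have goodG: "goodf UNIV (tfpoint (\<lambda>_. a) b) \<phi> z0 \<longleftrightarrow> good \<psi> z0" for z0
  proof
    assume "goodf UNIV (tfpoint (\<lambda>_. a) b) \<phi> z0"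
    then show "good \<psi> z0"
      by (rule extend[OF _ phiS psiS, of _ _ _ a A1 B1]) (use assms(14,15) AB1 SL2 in \<open>auto simp: latsum\<close>)
  next
    assume "good \<psi> z0"
    then show "goodf UNIV (tfpoint (\<lambda>_. a) b) \<phi> z0" by (intro restrict window[OF _ psiS assms(11) phiS])
  qed
  have supp: "\<xi> \<in> cbox A B" if "fourier h \<xi> \<noteq> 0" for \<xi>
    by (rule subsetD[OF assms(4)], rule subsetD[OF closure_subset]) (simp add: that)
  obtain c where c: "c > 0" "\<And>\<xi>. c \<le> (\<Sum>\<^sub>\<infinity>m. (norm (fourier h (\<xi> - \<beta> *\<^sub>R ivec m)))\<^sup>2 / \<alpha> m ^ CARD('n))" using assms(8) by blast
  obtain C where C: "\<And>\<xi>. (\<lambda>m. (norm (fourier h (\<xi> - \<beta> *\<^sub>R ivec m)))\<^sup>2 / \<alpha> m ^ CARD('n)) summable_on UNIV"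
    "\<And>\<xi>. (\<Sum>\<^sub>\<infinity>m. (norm (fourier h (\<xi> - \<beta> *\<^sub>R ivec m)))\<^sup>2 / \<alpha> m ^ CARD('n)) \<le> C" using assms(9) by blast
  \<comment> \<open>At the frequency \<xi>0 + \<beta> m the m-th term of the bounded sum equals e /
    \<alpha>(m)^d with e independent of m, so \<alpha>(m) cannot approach 0.\<close>
  obtain \<alpha>0 where al0: "\<alpha>0 > 0" "\<And>m. \<alpha>0 \<le> \<alpha> m"
  proof -
    have "\<exists>\<xi>0. fourier h \<xi>0 \<noteq> 0"
    proof (rule ccontr)
      assume "\<not> ?thesis"
      then have "h x = 0" for x using fourier_inversion[OF S_rapid[OF hS], of x] by simp
      then show False using assms(3) by auto
    qed
    then obtain \<xi>0 where xi0: "fourier h \<xi>0 \<noteq> 0" by blast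
    define e where "e = (norm (fourier h \<xi>0))\<^sup>2"
    have e: "e > 0" using xi0 by (simp add: e_def)
    have eC: "e / \<alpha> m ^ CARD('n) \<le> C" for m
    proof -
      let ?k = "\<lambda>l. (norm (fourier h ((\<xi>0 + \<beta> *\<^sub>R ivec m) - \<beta> *\<^sub>R ivec l)))\<^sup>2 / \<alpha> l ^ CARD('n)"
      have "e / \<alpha> m ^ CARD('n) = (\<Sum>l\<in>{m}. ?k l)" by (simp add: e_def)
      also have "\<dots> \<le> (\<Sum>\<^sub>\<infinity>l. ?k l)" using assms(6) by (intro finite_sum_le_infsum C(1)) (auto simp: less_imp_le)
      also have "\<dots> \<le> C" by (rule C(2))
      finally show ?thesis .
    qed
    have Cp: "C > 0"
    proof -
      have "e / \<alpha> (\<lambda>_. 0) ^ CARD('n) > 0" using e assms(6) by simp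
      then show ?thesis using eC[of "\<lambda>_. 0"] by linarith
    qed
    \<comment> \<open>The minimum with 1 avoids a d-th root: if \<alpha>(m) is below 1, its d-th
      power is at most \<alpha>(m) itself.\<close>
    have "min 1 (e / C) \<le> \<alpha> m" for m
    proof (cases "\<alpha> m \<ge> 1")
      case False
      have p: "\<alpha> m > 0" using assms(6) by blast
      have "\<alpha> m ^ CARD('n) \<le> \<alpha> m ^ 1" using False p by (intro power_decreasing) (auto simp: Suc_le_eq)
      moreover have "e / C \<le> \<alpha> m ^ CARD('n)" using eC[of m] p Cp by (simp add: field_simps)
      ultimately show ?thesis by simp
    qed auto
    moreover have "min 1 (e / C) > 0" using e Cp by simp
    ultimately show ?thesis using that by blast
  qed
  have hsum: "(\<lambda>p. (norm (L2_inner f (tfshift (tfpoint \<alpha> \<beta> p) h)))\<^sup>2) summable_on UNIV" if "f \<in> S" for f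
    by (rule family_summable[OF hS that]) (use tfpoint_separated[OF al0 assms(5)] in auto)
  have goodh: "goodf UNIV (tfpoint \<alpha> \<beta>) h z0 \<longleftrightarrow> good \<psi> z0" for z0
  proof
    assume "goodf UNIV (tfpoint \<alpha> \<beta>) h z0"
    then show "good \<psi> z0"
    proof (rule extend[OF _ hS psiS al0 assms(5) c(1)])
      fix f :: "'n fn" assume f: "f \<in> S"
      note pf = painless_frame[OF hS f assms(6)[rule_format] supp assms(7)[rule_format] c(2) C hsum[OF f]]
      show "c * L2_normsq f \<le> (\<Sum>\<^sub>\<infinity>p. (norm (L2_inner f (tfshift (tfpoint \<alpha> \<beta> p) h)))\<^sup>2)" by (rule pf(1))
      show "(\<Sum>\<^sub>\<infinity>p. (norm (L2_inner f (tfshift (tfpoint \<alpha> \<beta> p) h)))\<^sup>2) \<le> C * L2_normsq f" by (rule pf(2))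
    qed
  next
    assume "good \<psi> z0"
    then show "goodf UNIV (tfpoint \<alpha> \<beta>) h z0" by (intro restrict window[OF _ psiS assms(11) hS])
  qed
  \<comment> \<open>Modulating before translating differs from the opposite order by a unimodular
    constant, which conjugate-linearity of u takes out.\<close>
  have uh: "norm (u (hmn h \<alpha> \<beta> m n)) = norm (u (tfshift (tfpoint \<alpha> \<beta> (m, n)) h))" for m n
  proof -
    have "hmn h \<alpha> \<beta> m n = (\<lambda>t. cis (- (\<beta> * (ivec m \<bullet> (\<alpha> m *\<^sub>R ivec n)))) * tfshift (tfpoint \<alpha> \<beta> (m, n)) h t)"
    proof
      fix t
      have "cis (\<beta> * (ivec m \<bullet> (t - \<alpha> m *\<^sub>R ivec n))) = cis (- (\<beta> * (ivec m \<bullet> (\<alpha> m *\<^sub>R ivec n)))) * cis (t \<bullet> (\<beta> *\<^sub>R ivec m))"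
        by (simp add: cis_mult inner_diff_right inner_commute algebra_simps)
      then show "hmn h \<alpha> \<beta> m n t = cis (- (\<beta> * (ivec m \<bullet> (\<alpha> m *\<^sub>R ivec n)))) * tfshift (tfpoint \<alpha> \<beta> (m, n)) h t"
        by (simp add: hmn_def tfshift_def tfpoint_def)
    qed
    then show ?thesis using dual_scale[OF u tfshift_S(1)[OF hS]] by (simp add: norm_mult)
  qed
  have 1: "WF' \<omega> \<psi> u = {z0. z0 \<noteq> 0 \<and> \<not> good \<psi> z0}" by (simp add: WF'_def good_def)
  have 2: "WF_G \<omega> \<phi> a b u = {z0. z0 \<noteq> 0 \<and> \<not> goodf UNIV (tfpoint (\<lambda>_. a) b) \<phi> z0}"
  proof -
    have "(\<forall>\<sigma>\<in>range Z \<inter> \<Gamma>. Q \<sigma>) \<longleftrightarrow> (\<forall>i\<in>UNIV. Z i \<in> \<Gamma> \<longrightarrow> Q (Z i))"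
      for Z :: "('n \<Rightarrow> int) \<times> ('n \<Rightarrow> int) \<Rightarrow> (real^'n) \<times> (real^'n)" and \<Gamma> Q by auto
    then show ?thesis unfolding WF_G_def goodf_def lat by presburger
  qed
  have 3: "WF_h \<omega> h \<alpha> \<beta> u = {z0. z0 \<noteq> 0 \<and> \<not> goodf UNIV (tfpoint \<alpha> \<beta>) h z0}"
    unfolding WF_h_def goodf_def uh by (simp add: tfpoint_def split_paired_all)
  show ?thesis unfolding 1 2 3 goodG goodh by simp
qed

end
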